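(* Let $\alpha\in(\tfrac12,1)$, let $u_0\in H^1(\mathbb R^2;\mathbb R^2)\cap\dot W^{1,p}(\mathbb R^2;\mathbb R^2)$ for some $p\in(2,\infty]$ with $\nabla\cdot u_0=0$, and let $\theta_0=\mathbf 1_{D_0}$ be the indicator function of a bounded simply connected set $D_0\subset\mathbb R^2$ with $\partial D_0\in C^{2\alpha'}$ for some $\alpha'\in[0,\alpha)$. Let $(u,\theta)$ be the unique global solution (in the sense described in the context) with initial data $(u_0,\theta_0)$ of $$u_t+u\cdot\nabla u+\Lambda^{2\alpha}u=\nabla p+\theta e_2,\quad \nabla\cdot u=0,\quad \theta_t+u\cdot\nabla\theta=0$$ on $\mathbb R_+\times\mathbb R^2$ (where in the equation $p=p(t,x)$ denotes the pressure). Then $\theta$ remains an indicator function: for all $t\ge0$, $\theta(t)=\mathbf 1_{D(t)}$ for some set $D(t)\subset\mathbb R^2$, and $\partial D\in L^\infty(0,t;C^{2\alpha'})$ for all $t\ge0$.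
   Context: $\Lambda^{2\alpha}=(-\Delta)^\alpha$ is the Fourier multiplier $\widehat{\Lambda^{2\alpha}f}(\xi)=|2\pi\xi|^{2\alpha}\hat f(\xi)$ on $\mathbb R^2$, and $e_2=(0,1)^T$. Weak solution: a global solution with initial data $(u_0,\theta_0)$ is a pair $(u,\theta)\in L^2_{\mathrm{loc}}([0,\infty)\times\mathbb R^2;\mathbb R^2)\times L^2_{\mathrm{loc}}([0,\infty)\times\mathbb R^2)$ with $\nabla\cdot u=0$ such that for every divergence-free $\phi\in C_c^\infty([0,\infty)\times\mathbb R^2;\mathbb R^2)$ and every $\psi\in C_c^\infty([0,\infty)\times\mathbb R^2)$, $$\int_0^\infty\!\!\int_{\mathbb R^2}\big(u\cdot\phi_t+u\otimes u:\nabla\phi-u\cdot\Lambda^{2\alpha}\phi+\theta\,\phi\cdot e_2\big)\,dx\,dt+\int_{\mathbb R^2}u_0\cdot\phi(0,x)\,dx=0,$$ $$\int_0^\infty\!\!\int_{\mathbb R^2}\big(\theta\psi_t+\theta u\cdot\nabla\psi\big)\,dx\,dt+\int_{\mathbb R^2}\theta_0\,\psi(0,x)\,dx=0.$$ The global solution: set $q=p$ if $p<\infty$, and let $q\in(2,\infty)$ be any finite exponent if $p=\infty$ (then $u_0\in H^1\cap\dot W^{1,q}$ as well). The global solution is the unique weak solution such that for every $t>0$, $\rho\in[1,\min(2,q/2))$ and $\beta\in[0,\alpha)$: $u\in L^\infty(0,t;W^{1,q})\cap L^\rho(0,t;C^{2\beta})$ and $\theta\in L^\infty(0,t;L^1\cap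 L^\infty)$, where $C^s=B^s_{\infty,\infty}(\mathbb R^2)$. The function $\theta(t)$ is understood through its (weakly continuous in time) representative, as an equality almost everywhere in $x$. Boundary regularity: $\partial D_0\in C^{2\alpha'}$ means that $\partial D_0$ is parameterised by a simple closed curve $\gamma_0\in C^{2\alpha'}([0,1];\mathbb R^2)$ (with $\gamma_0'\neq0$ when $2\alpha'\ge1$), where $C^{2\alpha'}$ is the usual Hölder class. $\partial D\in L^\infty(0,t;C^{2\alpha'})$ means that for each $\tau\in[0,t]$ the boundary $\partial D(\tau)$ is parameterised in the same sense by a curve $\gamma(\tau,\cdot)\in C^{2\alpha'}([0,1];\mathbb R^2)$ with $\sup_{\tau\in[0,t]}\|\gamma(\tau,\cdot)\|_{C^{2\alpha'}}<\infty$. *)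

theory Defs
  imports "HOL-Analysis.Analysis" "HOL-Probability.Essential_Supremum"
begin

type_synonym plane = "real^2"

section \<open>Smooth functions and test functions\<close>

primrec C_k :: "nat \<Rightarrow> ('a::real_normed_vector \<Rightarrow> 'b::real_normed_vector) \<Rightarrow> bool" where
  "C_k 0 f \<longleftrightarrow> continuous_on UNIV f"
| "C_k (Suc k) f \<longleftrightarrow>
     (\<forall>x. f differentiable (at x)) \<and> (\<forall>v. C_k k (\<lambda>x. frechet_derivative f (at x) v))"

definition smooth_map :: "('a::real_normed_vector \<Rightarrow> 'b::real_normed_vector) \<Rightarrow> bool" where
  "smooth_map f \<longleftrightarrow> (\<forall>k. C_k k f)"

text \<open>For \<open>'a = real \<times> plane\<close> these functions serve as
  \<open>C\<^sub>c\<^sup>\<infinity>([0,\<infinity>) \<times> \<real>\<^sup>2)\<close>: an element of that space is the restriction to times \<open>t \<ge> 0\<close>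
  of a function in \<open>C\<^sub>c\<^sup>\<infinity>(\<real> \<times> \<real>\<^sup>2)\<close>.  In particular the test function need not vanish at
  \<open>t = 0\<close>, and every condition and integral below only involves times \<open>t \<ge> 0\<close>.\<close>

definition test_fun :: "('a::euclidean_space \<Rightarrow> 'b::euclidean_space) \<Rightarrow> bool" where
  "test_fun f \<longleftrightarrow> smooth_map f \<and> compact (closure {x. f x \<noteq> 0})"

definition dt :: "(real \<times> plane \<Rightarrow> 'b::real_normed_vector) \<Rightarrow> real \<times> plane \<Rightarrow> 'b" where
  "dt \<phi> z = frechet_derivative \<phi> (at z) (1, 0)"

definition dx :: "2 \<Rightarrow> (real \<times> plane \<Rightarrow> 'b::real_normed_vector) \<Rightarrow> real \<times> plane \<Rightarrow> 'b" where
  "dx i \<phi> z = frechet_derivative \<phi> (at z) (0, axis i 1)"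

definition pd :: "2 \<Rightarrow> (plane \<Rightarrow> 'b::real_normed_vector) \<Rightarrow> plane \<Rightarrow> 'b" where
  "pd i \<psi> x = frechet_derivative \<psi> (at x) (axis i 1)"


section \<open>The Fourier multiplier \<open>\<Lambda>\<^sup>2\<^sup>\<alpha>\<close>\<close>

definition fourier :: "(plane \<Rightarrow> complex) \<Rightarrow> plane \<Rightarrow> complex" where
  "fourier f \<xi> = (LINT x|lebesgue. cis (- (2 * pi * (x \<bullet> \<xi>))) * f x)"

definition inv_fourier :: "(plane \<Rightarrow> complex) \<Rightarrow> plane \<Rightarrow> complex" where
  "inv_fourier g x = (LINT \<xi>|lebesgue. cis (2 * pi * (x \<bullet> \<xi>)) * g \<xi>)"

text \<open>Only applied to \<open>f\<close> in \<open>C\<^sub>c\<^sup>\<infinity>\<close>, where both integrals converge absolutely.  The symbol is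
  even and \<open>f\<close> is real, so the inverse transform is real and \<open>Re\<close> only changes the type.\<close>

definition Lambda_pow :: "real \<Rightarrow> (plane \<Rightarrow> real) \<Rightarrow> plane \<Rightarrow> real" where
  "Lambda_pow s f x =
     Re (inv_fourier (\<lambda>\<xi>. of_real (norm ((2 * pi) *\<^sub>R \<xi>) powr s)
                            * fourier (\<lambda>y. of_real (f y)) \<xi>) x)"

definition Lambda_pow_vec :: "real \<Rightarrow> (plane \<Rightarrow> plane) \<Rightarrow> plane \<Rightarrow> plane" where
  "Lambda_pow_vec s f x = (\<chi> i. Lambda_pow s (\<lambda>y. f y $ i) x)"


section \<open>Function spaces, given by extended norms\<close>

text \<open>Each norm takes values in \<open>[0,\<infinity>]\<close>, and the space consists of the functions of finite norm.\<close>

definition ennpowr :: "ennreal \<Rightarrow> real \<Rightarrow> ennreal" where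
  "ennpowr x a = (if x = \<infinity> then \<infinity> else ennreal (enn2real x powr a))"

definition Lp_ennorm :: "'a measure \<Rightarrow> ennreal \<Rightarrow> ('a \<Rightarrow> ennreal) \<Rightarrow> ennreal" where
  "Lp_ennorm M p g =
     (if g \<notin> borel_measurable M then \<infinity>
      else if p = \<infinity> then esssup M g
      else ennpowr (\<integral>\<^sup>+ x. ennpowr (g x) (enn2real p) \<partial>M) (1 / enn2real p))"

definition Lp_norm :: "ennreal \<Rightarrow> (plane \<Rightarrow> 'b::euclidean_space) \<Rightarrow> ennreal" where
  "Lp_norm p f =
     (if f \<in> borel_measurable lebesgue then Lp_ennorm lebesgue p (\<lambda>x. ennreal (norm (f x)))
      else \<infinity>)"

definition locally_integrable :: "(plane \<Rightarrow> 'b::euclidean_space) \<Rightarrow> bool" where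
  "locally_integrable f \<longleftrightarrow> (\<forall>K. compact K \<longrightarrow> set_integrable lebesgue K f)"

definition weak_gradient ::
    "(plane \<Rightarrow> 'b::euclidean_space) \<Rightarrow> (2 \<Rightarrow> plane \<Rightarrow> 'b) \<Rightarrow> bool" where
  "weak_gradient f g \<longleftrightarrow>
     locally_integrable f \<and> (\<forall>i. locally_integrable (g i)) \<and>
     (\<forall>\<psi>::plane \<Rightarrow> real. test_fun \<psi> \<longrightarrow>
        (\<forall>i. (LINT x|lebesgue. pd i \<psi> x *\<^sub>R f x) = - (LINT x|lebesgue. \<psi> x *\<^sub>R g i x)))"

text \<open>Weak gradients are unique almost everywhere, so the infimum is over a single value, or is
  \<open>\<infinity>\<close> when there is no weak gradient.\<close>

definition W1_seminorm :: "ennreal \<Rightarrow> (plane \<Rightarrow> 'b::euclidean_space) \<Rightarrow> ennreal" where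
  "W1_seminorm p f = (INF g\<in>{g. weak_gradient f g}. \<Sum>i\<in>UNIV. Lp_norm p (g i))"

definition W1_norm :: "ennreal \<Rightarrow> (plane \<Rightarrow> 'b::euclidean_space) \<Rightarrow> ennreal" where
  "W1_norm p f = Lp_norm p f + W1_seminorm p f"

definition div_free :: "(plane \<Rightarrow> plane) \<Rightarrow> bool" where
  "div_free f \<longleftrightarrow> (\<forall>\<psi>::plane \<Rightarrow> real. test_fun \<psi> \<longrightarrow>
     (LINT x|lebesgue. (\<Sum>i\<in>UNIV. f x $ i * pd i \<psi> x)) = 0)"

text \<open>The Besov space \<open>B\<^sup>s\<^sub>\<infinity>\<^sub>,\<^sub>\<infinity>\<close> via Littlewood-Paley blocks, for one concrete dyadic
  partition of unity (the space does not depend on this choice): \<open>lp_cutoff\<close> is smooth and radial,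
  \<open>1\<close> on the unit ball and \<open>0\<close> outside the ball of radius 2.  The symbol with index \<open>0\<close> is
  the low-frequency one (usually numbered \<open>-1\<close>), the one with index \<open>n \<ge> 1\<close> is supported in
  \<open>2\<^sup>n\<^sup>-\<^sup>1 \<le> |\<xi>| \<le> 2\<^sup>n\<^sup>+\<^sup>1\<close>, and all of them add up to \<open>1\<close>.\<close>

definition flat_exp :: "real \<Rightarrow> real" where
  "flat_exp r = (if r > 0 then exp (- 1 / r) else 0)"

definition lp_cutoff :: "plane \<Rightarrow> real" where
  "lp_cutoff \<xi> =
     flat_exp (2 - norm \<xi>) / (flat_exp (2 - norm \<xi>) + flat_exp (norm \<xi> - 1))"

primrec lp_symbol :: "nat \<Rightarrow> plane \<Rightarrow> real" where
  "lp_symbol 0 \<xi> = lp_cutoff \<xi>"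
| "lp_symbol (Suc n) \<xi> = lp_cutoff (\<xi> /\<^sub>R 2 ^ Suc n) - lp_cutoff (\<xi> /\<^sub>R 2 ^ n)"

definition lp_kernel :: "nat \<Rightarrow> plane \<Rightarrow> real" where
  "lp_kernel n x = Re (inv_fourier (\<lambda>\<xi>. of_real (lp_symbol n \<xi>)) x)"

definition lp_block :: "nat \<Rightarrow> (plane \<Rightarrow> 'b::euclidean_space) \<Rightarrow> plane \<Rightarrow> 'b" where
  "lp_block n f x = (LINT y|lebesgue. lp_kernel n (x - y) *\<^sub>R f y)"

text \<open>The integrability condition holds for every \<open>f\<close> in some \<open>L\<^sup>p\<close>; it keeps the value \<open>0\<close> of a
  divergent integral from being read as a norm.\<close>

definition Besov_norm :: "real \<Rightarrow> (plane \<Rightarrow> 'b::euclidean_space) \<Rightarrow> ennreal" where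
  "Besov_norm s f =
     (if \<forall>n x. integrable lebesgue (\<lambda>y. lp_kernel n (x - y) *\<^sub>R f y)
      then SUP n. ennreal (2 powr (s * (real n - 1))) * Lp_norm \<infinity> (lp_block n f)
      else \<infinity>)"

text \<open>\<open>L\<^sup>r(0,t;X)\<close> for the space \<open>X\<close> with extended norm \<open>N\<close>.  It asks for measurability of the
  norm in time, not for strong measurability into \<open>X\<close>: the indicator functions of a moving set are
  in general not strongly measurable as a map into \<open>L\<^sup>\<infinity>\<close>.  Joint measurability in
  space-time is part of \<open>L2_loc\<close> below.\<close>

definition in_Lr_time ::
    "ennreal \<Rightarrow> real \<Rightarrow> ((plane \<Rightarrow> 'b) \<Rightarrow> ennreal) \<Rightarrow> (real \<Rightarrow> plane \<Rightarrow> 'b) \<Rightarrow> bool" where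
  "in_Lr_time r t N f \<longleftrightarrow> Lp_ennorm (lebesgue_on {0<..<t}) r (\<lambda>\<tau>. N (f \<tau>)) < \<infinity>"

abbreviation spacetime :: "(real \<times> plane) set" where
  "spacetime \<equiv> {0..} \<times> UNIV"

definition L2_loc :: "(real \<Rightarrow> plane \<Rightarrow> 'b::euclidean_space) \<Rightarrow> bool" where
  "L2_loc f \<longleftrightarrow>
     (\<lambda>(t, x). f t x) \<in> borel_measurable (lebesgue_on spacetime) \<and>
     (\<forall>K. compact K \<and> K \<subseteq> spacetime \<longrightarrow>
        set_integrable lebesgue K (\<lambda>(t, x). (norm (f t x))\<^sup>2))"


section \<open>Weak solutions\<close>

definition e2 :: "plane" where
  "e2 = vector [0, 1]"

definition momentum_integrand ::
    "real \<Rightarrow> (real \<Rightarrow> plane \<Rightarrow> plane) \<Rightarrow> (real \<Rightarrow> plane \<Rightarrow> real) \<Rightarrow>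
     (real \<times> plane \<Rightarrow> plane) \<Rightarrow> real \<times> plane \<Rightarrow> real" where
  "momentum_integrand \<alpha> u \<theta> \<phi> = (\<lambda>(t, x).
     u t x \<bullet> dt \<phi> (t, x)
     + (\<Sum>i\<in>UNIV. \<Sum>j\<in>UNIV. u t x $ i * u t x $ j * (dx i \<phi> (t, x) $ j))
     - u t x \<bullet> Lambda_pow_vec (2 * \<alpha>) (\<lambda>y. \<phi> (t, y)) x
     + \<theta> t x * (\<phi> (t, x) \<bullet> e2))"

definition transport_integrand ::
    "(real \<Rightarrow> plane \<Rightarrow> plane) \<Rightarrow> (real \<Rightarrow> plane \<Rightarrow> real) \<Rightarrow>
     (real \<times> plane \<Rightarrow> real) \<Rightarrow> real \<times> plane \<Rightarrow> real" where
  "transport_integrand u \<theta> \<psi> = (\<lambda>(t, x).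
     \<theta> t x * dt \<psi> (t, x) + \<theta> t x * (\<Sum>i\<in>UNIV. u t x $ i * dx i \<psi> (t, x)))"

text \<open>Integrability of the momentum integrand is required explicitly because
  \<open>\<Lambda>\<^sup>2\<^sup>\<alpha>\<phi>\<close> is not compactly supported.  All other integrands are integrable
  because of the local integrability of \<open>u\<close>, \<open>\<theta>\<close>, \<open>u0\<close> and \<open>\<theta>0\<close>.\<close>

definition weak_solution ::
    "real \<Rightarrow> (plane \<Rightarrow> plane) \<Rightarrow> (plane \<Rightarrow> real) \<Rightarrow>
     (real \<Rightarrow> plane \<Rightarrow> plane) \<Rightarrow> (real \<Rightarrow> plane \<Rightarrow> real) \<Rightarrow> bool" where
  "weak_solution \<alpha> u0 \<theta>0 u \<theta> \<longleftrightarrow>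
     locally_integrable u0 \<and> locally_integrable \<theta>0 \<and> L2_loc u \<and> L2_loc \<theta> \<and>
     (\<forall>\<psi>::real \<times> plane \<Rightarrow> real. test_fun \<psi> \<longrightarrow>
        (LINT z:spacetime|lebesgue. (\<lambda>(t, x). \<Sum>i\<in>UNIV. u t x $ i * dx i \<psi> (t, x)) z) = 0) \<and>
     (\<forall>\<phi>::real \<times> plane \<Rightarrow> plane.
        test_fun \<phi> \<and> (\<forall>t\<ge>0. \<forall>x. (\<Sum>i\<in>UNIV. dx i \<phi> (t, x) $ i) = 0) \<longrightarrow>
        set_integrable lebesgue spacetime (momentum_integrand \<alpha> u \<theta> \<phi>) \<and>
        (LINT z:spacetime|lebesgue. momentum_integrand \<alpha> u \<theta> \<phi> z)
          + (LINT x|lebesgue. u0 x \<bullet> \<phi> (0, x)) = 0) \<and>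
     (\<forall>\<psi>::real \<times> plane \<Rightarrow> real. test_fun \<psi> \<longrightarrow>
        (LINT z:spacetime|lebesgue. transport_integrand u \<theta> \<psi> z)
          + (LINT x|lebesgue. \<theta>0 x * \<psi> (0, x)) = 0)"

text \<open>Weak solutions in this class are unique (a theorem about the system, not part of the
  definition), so the predicate describes the global solution.\<close>

definition global_solution ::
    "real \<Rightarrow> real \<Rightarrow> (plane \<Rightarrow> plane) \<Rightarrow> (plane \<Rightarrow> real) \<Rightarrow>
     (real \<Rightarrow> plane \<Rightarrow> plane) \<Rightarrow> (real \<Rightarrow> plane \<Rightarrow> real) \<Rightarrow> bool" where
  "global_solution \<alpha> q u0 \<theta>0 u \<theta> \<longleftrightarrow>
     weak_solution \<alpha> u0 \<theta>0 u \<theta> \<and>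
     (\<forall>t>0. \<forall>\<rho>\<in>{1..<min 2 (q / 2)}. \<forall>\<beta>\<in>{0..<\<alpha>}.
        in_Lr_time \<infinity> t (W1_norm (ennreal q)) u \<and>
        in_Lr_time (ennreal \<rho>) t (Besov_norm (2 * \<beta>)) u \<and>
        in_Lr_time \<infinity> t (\<lambda>f. Lp_norm 1 f + Lp_norm \<infinity> f) \<theta>)"

text \<open>Weak continuity is taken in \<open>L\<^sup>2\<close>, which contains \<open>L\<^sup>1 \<inter> L\<^sup>\<infinity>\<close>.  For each \<open>t\<close> the
  representative is determined up to a null set.\<close>

definition weakly_continuous_rep ::
    "(real \<Rightarrow> plane \<Rightarrow> real) \<Rightarrow> (real \<Rightarrow> plane \<Rightarrow> real) \<Rightarrow> bool" where
  "weakly_continuous_rep \<theta> \<theta>' \<longleftrightarrow>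
     (AE t in lebesgue_on {0..}. AE x in lebesgue. \<theta>' t x = \<theta> t x) \<and>
     (\<forall>t\<ge>0. Lp_norm 2 (\<theta>' t) < \<infinity>) \<and>
     (\<forall>g::plane \<Rightarrow> real. Lp_norm 2 g < \<infinity> \<longrightarrow>
        continuous_on {0..} (\<lambda>t. LINT x|lebesgue. \<theta>' t x * g x))"


section \<open>Boundary regularity\<close>

definition curve_deriv :: "(real \<Rightarrow> plane) \<Rightarrow> real \<Rightarrow> plane" where
  "curve_deriv \<gamma> x = vector_derivative \<gamma> (at x within {0..1})"

text \<open>One-sided derivatives at the endpoints \<open>0\<close> and \<open>1\<close>.  For a closed curve they are not
  required to match: the class is \<open>C\<^sup>s([0,1])\<close>, not \<open>C\<^sup>s\<close> of the circle.

  The Hoelder class \<open>C\<^sup>s([0,1]) = C\<^sup>k\<^sup>,\<^sup>s\<^sup>-\<^sup>k\<close> with \<open>k = \<lfloor>s\<rfloor>\<close>, \<open>s \<ge> 0\<close>; for integer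
  \<open>s\<close> this is the classical \<open>C\<^sup>k\<close>.\<close>

definition Holder_norm :: "real \<Rightarrow> (real \<Rightarrow> plane) \<Rightarrow> ennreal" where
  "Holder_norm s \<gamma> = (let k = nat \<lfloor>s\<rfloor> in
     if (\<forall>j<k. (curve_deriv ^^ j) \<gamma> differentiable_on {0..1}) \<and>
        continuous_on {0..1} ((curve_deriv ^^ k) \<gamma>)
     then (\<Sum>j\<le>k. SUP x\<in>{0..1}. ennreal (norm ((curve_deriv ^^ j) \<gamma> x)))
          + (SUP (x, y)\<in>{(x, y). x \<in> {0..1} \<and> y \<in> {0..1} \<and> x \<noteq> y}.
               ennreal (norm ((curve_deriv ^^ k) \<gamma> x - (curve_deriv ^^ k) \<gamma> y)
                        / \<bar>x - y\<bar> powr (s - real k)))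
     else \<infinity>)"

definition boundary_param :: "real \<Rightarrow> plane set \<Rightarrow> (real \<Rightarrow> plane) \<Rightarrow> bool" where
  "boundary_param s A \<gamma> \<longleftrightarrow>
     simple_path \<gamma> \<and> pathfinish \<gamma> = pathstart \<gamma> \<and> path_image \<gamma> = frontier A \<and>
     Holder_norm s \<gamma> < \<infinity> \<and> (s \<ge> 1 \<longrightarrow> (\<forall>x\<in>{0..1}. curve_deriv \<gamma> x \<noteq> 0))"

definition boundary_bounded_in_time :: "real \<Rightarrow> real \<Rightarrow> (real \<Rightarrow> plane set) \<Rightarrow> bool" where
  "boundary_bounded_in_time s t D \<longleftrightarrow>
     (\<exists>\<gamma>. (\<forall>\<tau>\<in>{0..t}. boundary_param s (D \<tau>) (\<gamma> \<tau>)) \<and>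
          (SUP \<tau>\<in>{0..t}. Holder_norm s (\<gamma> \<tau>)) < \<infinity>)"

end

theory Submission
  imports Defs "HOL-Real_Asymp.Real_Asymp" "HOL-Probability.Probability"
begin

text \<open>The Besov bound with exponent \<open>s > 1\<close> makes the velocity, at almost every time, a bounded Lipschitz
  field with Hoelder continuous derivative, with a bound that is integrable in time.  It therefore has a flow
  of diffeomorphisms of class \<open>1 + a\<close>, with bounds that are uniform on compact time intervals, and \<open>a\<close> can be
  chosen with \<open>2 \<alpha>' <= 1 + a\<close>.  Testing the weak transport equation with \<open>g \<circ> flow t 0\<close>, cut off in time
  (which is admissible by mollification), shows that the time average of \<open>\<theta> (t, x) * g (flow t 0 x)\<close>, integrated
  over the plane, equals the integral of \<open>\<theta>0 * g\<close>.  Since the velocity is divergence free, the same holds with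
  \<open>1\<close> in place of \<open>\<theta>\<close>, so the flow preserves area, and then \<open>\<theta> (t, x) = \<theta>0 (flow t 0 x)\<close>.  Hence the patch is
  carried by the flow, and so is its boundary curve, whose Hoelder norm the bounds on the flow control.\<close>

text \<open>Control of the velocity is only \<open>L^1\<close> in time, so trajectories and
  transported test functions are merely absolutely continuous in time. Time derivatives are
  therefore replaced by identities between increments and integrals, obtained by comparing
  increments over short intervals with the integral of a majorant (\<open>null_increment\<close>).
  As a weak solution has no time slices to begin with, testing yields time averages first.

  The other obstacle is null sets. A flow needs a field that is regular at every time and point,
  while the solution is given almost everywhere; limits of Littlewood-Paley sums supply a version
  that is also jointly measurable. Area preservation comes from the weak equation for the constant 1
  and avoids Jacobian determinants.

  The exponents fit because \<open>2 * \<alpha>'\<close> and 1 both lie below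
  \<open>2 * \<alpha>\<close>: this leaves room for \<open>1 + a < s < 2 * \<alpha>\<close>, and the
  gap between \<open>1 + a\<close> and \<open>s\<close> makes the dyadic series of Taylor remainders
  geometric.\<close>

abbreviation borel_fun :: "('a::topological_space => 'b::topological_space) => bool" where
  "borel_fun f \<equiv> f \<in> borel_measurable borel"

lemmas bochner_bound = Bochner_Integration.integrable_bound
lemmas continuous_borel = borel_measurable_continuous_onI

section \<open>Smooth functions\<close>

text \<open>The predicate \<open>C_k\<close> relative to a set, for real values. Restricting to open
  sets admits \<open>norm\<close> and \<open>powr\<close>, which are smooth only off the origin;
  \<open>Ckon_Un\<close> glues the pieces.\<close>

primrec Ckon :: "nat => 'a set => ('a::real_normed_vector => real) => bool" where
  "Ckon 0 S f \<longleftrightarrow> continuous_on S f"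
| "Ckon (Suc k) S f \<longleftrightarrow>
     (\<forall>x\<in>S. f differentiable (at x)) \<and> (\<forall>v. Ckon k S (\<lambda>x. frechet_derivative f (at x) v))"

lemma C_k_iff_Ckon: "C_k k f \<longleftrightarrow> Ckon k UNIV f"
  by (induction k arbitrary: f) auto

lemma smooth_map_iff_Ckon: "smooth_map f \<longleftrightarrow> (\<forall>k. Ckon k UNIV f)"
  by (simp add: smooth_map_def C_k_iff_Ckon)

lemma Ckon_cong:
  assumes "open S" "\<And>x. x \<in> S ==> f x = g x" "Ckon k S f"
  shows "Ckon k S g"
  using assms(2,3)
proof (induction k arbitrary: f g)
  case 0
  then show ?case by (simp cong: continuous_on_cong)
next
  case (Suc k)
  have D: "(g has_derivative frechet_derivative f (at x)) (at x)" if "x \<in> S" for x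
    using has_derivative_transform_within_open[of f "frechet_derivative f (at x)" x UNIV S g]
      Suc.prems that assms(1) by (simp add: frechet_derivative_works)
  then have "frechet_derivative g (at x) = frechet_derivative f (at x)" if "x \<in> S" for x
    using frechet_derivative_at that by metis
  then have "Ckon k S (\<lambda>x. frechet_derivative g (at x) v)" for v
    using Suc.IH[of "\<lambda>x. frechet_derivative f (at x) v" "\<lambda>x. frechet_derivative g (at x) v"]
      Suc.prems by simp
  then show ?case using D by (auto simp: differentiable_def)
qed

lemma Ckon_SucI:
  assumes "open S" "\<And>x. x \<in> S ==> (f has_derivative D x) (at x)" "\<And>v. Ckon k S (\<lambda>x. D x v)"
  shows "Ckon (Suc k) S f"
proof -
  have "frechet_derivative f (at x) = D x" if "x \<in> S" for x
    using frechet_derivative_at[OF assms(2)[OF that]] by simp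
  then have "Ckon k S (\<lambda>x. frechet_derivative f (at x) v)" for v
    using Ckon_cong[OF assms(1) _ assms(3)[of v], of "\<lambda>x. frechet_derivative f (at x) v"] by simp
  then show ?thesis using assms(2) by (auto simp: differentiable_def)
qed

lemma Ckon_has_derivative:
  "Ckon (Suc k) S f ==> x \<in> S ==> (f has_derivative frechet_derivative f (at x)) (at x)"
  by (simp add: frechet_derivative_works)

lemma Ckon_continuous: "Ckon k S f ==> continuous_on S f"
  by (cases k) (auto intro!: continuous_at_imp_continuous_on differentiable_imp_continuous_within)

lemma Ckon_Suc: "Ckon (Suc k) S f ==> Ckon k S f"
proof (induction k arbitrary: f)
  case 0
  then show ?case using Ckon_continuous[OF 0] by simp
next
  case (Suc k)
  from Suc.prems[unfolded Ckon.simps(2)[of "Suc k"]] show ?case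
    unfolding Ckon.simps(2)[of k S f] using Suc.IH by blast
qed

lemma Ckon_Un:
  "open S ==> open T ==> Ckon k S f ==> Ckon k T f ==> Ckon k (S \<union> T) f"
  by (induction k arbitrary: f) (auto intro: continuous_on_open_Un)

lemma Ckon_subset: "T \<subseteq> S ==> Ckon k S f ==> Ckon k T f"
  by (induction k arbitrary: f) (auto intro: continuous_on_subset)

lemma Ckon_const: "open S ==> Ckon k S (\<lambda>x. c)"
proof (induction k arbitrary: c)
  case (Suc k)
  show ?case by (rule Ckon_SucI[where D="\<lambda>x v. 0"]) (use Suc in auto)
qed simp

lemma Ckon_linear:
  assumes "bounded_linear f" "open S" shows "Ckon k S f"
proof (cases k)
  case 0
  then show ?thesis using assms linear_continuous_on by auto
next
  case (Suc j)
  show ?thesis unfolding Suc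
    by (rule Ckon_SucI[where D="\<lambda>x. f"])
      (use assms bounded_linear_imp_has_derivative Ckon_const in auto)
qed

lemma Ckon_add: "open S ==> Ckon k S f ==> Ckon k S g ==> Ckon k S (\<lambda>x. f x + g x)"
proof (induction k arbitrary: f g)
  case (Suc k)
  note D = Ckon_has_derivative[OF Suc.prems(2)] Ckon_has_derivative[OF Suc.prems(3)]
  have 1: "Ckon k S (\<lambda>x. frechet_derivative f (at x) v)" "Ckon k S (\<lambda>x. frechet_derivative g (at x) v)" for v
    using Suc.prems by simp_all
  show ?case
    by (rule Ckon_SucI[OF Suc.prems(1) has_derivative_add[OF D]]) (auto intro!: Suc.IH 1 Suc.prems)
qed (auto intro: continuous_intros)

lemma Ckon_mult: "open S ==> Ckon k S f ==> Ckon k S g ==> Ckon k S (\<lambda>x. f x * g x)"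
proof (induction k arbitrary: f g)
  case (Suc k)
  note D = Ckon_has_derivative[OF Suc.prems(2)] Ckon_has_derivative[OF Suc.prems(3)]
  have 1: "Ckon k S (\<lambda>x. frechet_derivative f (at x) v)" "Ckon k S (\<lambda>x. frechet_derivative g (at x) v)" for v
    using Suc.prems by simp_all
  show ?case
    by (rule Ckon_SucI[OF Suc.prems(1) has_derivative_mult[OF D]])
      (auto intro!: Ckon_add Suc.IH 1 Suc.prems Ckon_Suc[OF Suc.prems(2)] Ckon_Suc[OF Suc.prems(3)] simp del: Ckon.simps)
qed (auto intro: continuous_intros)

lemma Ckon_cmult: "open S ==> Ckon k S f ==> Ckon k S (\<lambda>x. c * f x)"
  using Ckon_mult[OF _ Ckon_const] .

lemma Ckon_diff: "open S ==> Ckon k S f ==> Ckon k S g ==> Ckon k S (\<lambda>x. f x - g x)"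
  using Ckon_add[of S k f "\<lambda>x. -1 * g x"] Ckon_cmult[of S k g "-1"] by simp

lemma Ckon_sum:
  "open S ==> (\<And>i. i \<in> A ==> Ckon k S (f i)) ==> Ckon k S (\<lambda>x. \<Sum>i\<in>A. f i x)"
  by (induction A rule: infinite_finite_induct) (auto intro: Ckon_const Ckon_add)

lemma Ckon_prod:
  "open S ==> (\<And>i. i \<in> A ==> Ckon k S (f i)) ==> Ckon k S (\<lambda>x. \<Prod>i\<in>A. f i x)"
  by (induction A rule: infinite_finite_induct) (auto intro: Ckon_const Ckon_mult)

text \<open>For a function of one real variable the derivative is multiplication by its value at 1.
  The chain rule then gives a product of two functions of class \<open>k\<close>; the second one is
  again a composition, so the induction runs over \<open>g\<close>.\<close>

lemma Ckon_compose:
  fixes g :: "real => real"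
  assumes S: "open S" and T: "open T" and f: "f ` S \<subseteq> T"
  shows "Ckon k S f ==> Ckon k T g ==> Ckon k S (\<lambda>x. g (f x))"
  using f
proof (induction k arbitrary: g)
  case 0
  then show ?case by (auto intro: continuous_on_compose2)
next
  case (Suc k)
  have D: "((\<lambda>x. g (f x)) has_derivative
      (\<lambda>v. frechet_derivative f (at x) v * frechet_derivative g (at (f x)) 1)) (at x)" if "x \<in> S" for x
  proof -
    have fx: "f x \<in> T" using Suc.prems that by auto
    have "linear (frechet_derivative g (at (f x)))"
      using Ckon_has_derivative[OF Suc.prems(2) fx] has_derivative_linear by blast
    then have "frechet_derivative g (at (f x)) r = r * frechet_derivative g (at (f x)) 1" for r
      using linear_cmul[of _ r 1] by fastforce
    then have "(\<lambda>v. frechet_derivative g (at (f x)) (frechet_derivative f (at x) v)) =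
        (\<lambda>v. frechet_derivative f (at x) v * frechet_derivative g (at (f x)) 1)" by blast
    with has_derivative_compose[OF Ckon_has_derivative[OF Suc.prems(1) that]
          Ckon_has_derivative[OF Suc.prems(2) fx]] show ?thesis by (simp only:)
  qed
  have "Ckon k S (\<lambda>x. frechet_derivative g (at (f x)) 1)"
    using Suc.IH[OF Ckon_Suc[OF Suc.prems(1)] _ Suc.prems(3), of "\<lambda>y. frechet_derivative g (at y) 1"]
      Suc.prems(2) by simp
  then have "Ckon k S (\<lambda>x. frechet_derivative f (at x) v * frechet_derivative g (at (f x)) 1)" for v
    using Ckon_mult[OF S] Suc.prems(1) by simp
  then show ?case using D by (intro Ckon_SucI[OF S, where
     D="\<lambda>x v. frechet_derivative f (at x) v * frechet_derivative g (at (f x)) 1"])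
qed

lemma Ckon_powr: "Ckon k {0<..} (\<lambda>r::real. r powr p)"
proof (induction k arbitrary: p)
  case 0
  show ?case by (auto intro!: continuous_intros)
next
  case (Suc k)
  have D: "((\<lambda>r::real. r powr p) has_derivative (\<lambda>v. v * (p * r powr (p - 1)))) (at r)" if "r > 0" for r
    using has_real_derivative_powr[of r p] that
    by (simp add: has_field_derivative_def mult.commute[of _ "p * r powr (p-1)"])
  show ?case
    by (rule Ckon_SucI[where D="\<lambda>r v. v * (p * r powr (p - 1))"])
      (use D Suc in \<open>auto intro!: Ckon_cmult\<close>)
qed

section \<open>Flat functions and smooth cutoffs\<close>

text \<open>Differentiation stays within the family \<open>r powr p * exp (- 1 / r)\<close>: it
  yields the members with \<open>p - 1\<close> and \<open>p - 2\<close>. All real \<open>p\<close>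
  are therefore treated together; the case \<open>p = 0\<close> is \<open>flat_exp\<close>.\<close>

lemma Ckon_powr_exp:
  "Ckon k UNIV (\<lambda>r::real. if r > 0 then r powr p * exp (- 1 / r) else 0)"
proof (induction k arbitrary: p)
  case 0
  let ?f = "\<lambda>r::real. if r > 0 then r powr p * exp (- 1 / r) else 0"
  have "((\<lambda>r::real. r powr p * exp (- 1 / r)) \<longlongrightarrow> 0) (at_right 0)" by real_asymp
  then have R: "(?f \<longlongrightarrow> 0) (at_right 0)"
    by (rule Lim_transform_eventually) (auto simp: eventually_at_right_less eventually_at_filter)
  have "(?f \<longlongrightarrow> 0) (at_left 0)"
    by (rule Lim_transform_eventually[OF tendsto_const]) (auto simp: eventually_at_filter)
  with R have "isCont ?f 0" by (simp add: isCont_def filterlim_at_split)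
  moreover have "isCont ?f r" if "r \<noteq> 0" for r
  proof (cases "r > 0")
    case True
    have "continuous_on {0<..} ?f"
      by (subst continuous_on_cong[OF refl, of _ _ "\<lambda>r. r powr p * exp (- 1 / r)"])
        (auto intro!: continuous_intros)
    then show ?thesis using True by (simp add: continuous_on_eq_continuous_at)
  next
    case False
    have "continuous_on {..<0} ?f"
      by (subst continuous_on_cong[OF refl, of _ _ "\<lambda>r. 0"]) auto
    then show ?thesis using False that by (simp add: continuous_on_eq_continuous_at)
  qed
  ultimately show ?case
    unfolding Ckon.simps(1) by (intro continuous_at_imp_continuous_on ballI) (metis (lifting))
next
  case (Suc k)
  let ?f = "\<lambda>p r::real. if r > 0 then r powr p * exp (- 1 / r) else 0"
  have D: "(?f p has_derivative (\<lambda>v. v * (p * ?f (p - 1) r + ?f (p - 2) r))) (at r)" for r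
  proof -
    consider "r > 0" | "r < 0" | "r = 0" by linarith
    then show ?thesis
    proof cases
      case 1
      have *: "((\<lambda>r::real. r powr p * exp (- 1 / r)) has_field_derivative
          (p * (r powr (p - 1) * exp (- 1 / r)) + r powr (p - 2) * exp (- 1 / r))) (at r)"
        using 1 by (auto intro!: derivative_eq_intros simp: powr_diff field_simps power2_eq_square)
      show ?thesis
        by (rule has_derivative_transform_within_open[of "\<lambda>r. r powr p * exp (- 1 / r)" _ _ UNIV "{0<..}"])
          (use 1 * in \<open>auto simp: has_field_derivative_def mult_commute_abs\<close>)
    next
      case 2
      show ?thesis
        by (rule has_derivative_transform_within_open[of "\<lambda>r. 0" _ _ UNIV "{..<0}"])
          (use 2 in auto)
    next
      case 3
      have "((\<lambda>r::real. r powr p * exp (- 1 / r) / r) \<longlongrightarrow> 0) (at_right 0)" by real_asymp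
      then have R: "((\<lambda>r. ?f p r / r) \<longlongrightarrow> 0) (at_right 0)"
        by (rule Lim_transform_eventually) (auto simp: eventually_at_filter)
      have "((\<lambda>r. ?f p r / r) \<longlongrightarrow> 0) (at_left 0)"
        by (rule Lim_transform_eventually[OF tendsto_const]) (auto simp: eventually_at_filter)
      with R have "((\<lambda>r. ?f p r / r) \<longlongrightarrow> 0) (at 0)" by (simp add: filterlim_at_split)
      then have "(?f p has_field_derivative 0) (at 0)"
        by (simp add: has_field_derivative_iff)
      then show ?thesis using 3 by (simp add: has_field_derivative_def lambda_zero)
    qed
  qed
  show ?case
    by (rule Ckon_SucI[where D="\<lambda>r v. v * (p * ?f (p - 1) r + ?f (p - 2) r)"])
      (use D Suc in \<open>auto intro!: Ckon_cmult Ckon_add\<close>)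
qed

lemma Ckon_flat_exp: "Ckon k UNIV flat_exp"
proof -
  have "flat_exp = (\<lambda>r. if r > 0 then r powr 0 * exp (- 1 / r) else 0)"
    by (auto simp: flat_exp_def)
  then show ?thesis using Ckon_powr_exp[of k 0] by simp
qed

lemma flat_exp_pos: "r > 0 ==> flat_exp r > 0"
  and flat_exp_0: "r <= 0 ==> flat_exp r = 0"
  and flat_exp_nonneg: "flat_exp r >= 0"
  by (auto simp: flat_exp_def)

text \<open>The one-dimensional profile of \<open>lp_cutoff\<close>, rising from 0 on the negative
  axis to 1 beyond 1.\<close>

definition smooth_step :: "real => real" where
  "smooth_step r = flat_exp r / (flat_exp r + flat_exp (1 - r))"

lemma smooth_step_denom: "flat_exp r + flat_exp (1 - r) > 0"
  using flat_exp_pos[of r] flat_exp_pos[of "1 - r"] flat_exp_nonneg[of r] flat_exp_nonneg[of "1 - r"]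
  by (cases "r > 0") auto

lemma Ckon_smooth_step: "Ckon k UNIV smooth_step"
proof -
  have 1: "Ckon k UNIV (\<lambda>r::real. 1 - r)"
    by (intro Ckon_diff Ckon_const Ckon_linear bounded_linear_ident) auto
  have 2: "Ckon k UNIV (\<lambda>r. flat_exp r + flat_exp (1 - r))"
    using Ckon_compose[OF open_UNIV open_UNIV _ 1 Ckon_flat_exp] by (intro Ckon_add Ckon_flat_exp) auto
  \<comment> \<open>The reciprocal is taken as the power with exponent -1, so that
    \<open>Ckon_powr\<close> gives smoothness; the denominator is positive everywhere.\<close>
  have 3: "Ckon k UNIV (\<lambda>r. (flat_exp r + flat_exp (1 - r)) powr (-1))"
    by (rule Ckon_compose[OF open_UNIV _ _ 2 Ckon_powr]) (use smooth_step_denom in auto)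
  have "smooth_step = (\<lambda>r. flat_exp r * (flat_exp r + flat_exp (1 - r)) powr (-1))"
    using smooth_step_denom by (auto simp: smooth_step_def powr_minus_divide less_imp_le abs_of_pos)
  then show ?thesis using Ckon_mult[OF open_UNIV Ckon_flat_exp 3] by simp
qed

lemma smooth_step_0: "r <= 0 ==> smooth_step r = 0"
  and smooth_step_1: "r >= 1 ==> smooth_step r = 1"
  and smooth_step_nonneg: "0 <= smooth_step r"
  and smooth_step_le1: "smooth_step r <= 1"
  using smooth_step_denom[of r] flat_exp_nonneg[of r] flat_exp_nonneg[of "1-r"]
  by (auto simp: smooth_step_def flat_exp_0)

lemma lp_cutoff_eq_step: "lp_cutoff \<xi> = smooth_step (2 - norm \<xi>)"
  by (simp add: lp_cutoff_def smooth_step_def)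

lemma Ckon_norm: "Ckon k (- {0}) (norm :: 'a::euclidean_space => real)"
proof -
  have "Ckon k UNIV (\<lambda>x::'a. \<Sum>b\<in>Basis. (x \<bullet> b) * (x \<bullet> b))"
    by (intro Ckon_sum Ckon_mult Ckon_linear bounded_linear_inner_left open_UNIV)
  then have 1: "Ckon k UNIV (\<lambda>x::'a. x \<bullet> x)"
    by (subst euclidean_inner) 
  have "Ckon k (- {0}) (\<lambda>x::'a. (x \<bullet> x) powr (1/2))"
    by (rule Ckon_compose[OF _ _ _ Ckon_subset[OF _ 1] Ckon_powr]) auto
  then show ?thesis
    by (rule Ckon_cong[rotated 2]) (auto simp: norm_eq_sqrt_inner powr_half_sqrt)
qed

text \<open>The norm is not smooth at the origin, but the cutoff is constant on the unit ball; this
  ball and the punctured plane cover everything.\<close>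

lemma Ckon_lp_cutoff: "Ckon k UNIV lp_cutoff"
proof -
  have 1: "Ckon k (- {0}) (\<lambda>\<xi>::plane. 2 - norm \<xi>)"
    by (intro Ckon_diff Ckon_const Ckon_norm) auto
  have 2: "Ckon k (- {0}) lp_cutoff"
    using Ckon_compose[OF _ open_UNIV _ 1 Ckon_smooth_step]
    by (simp add: lp_cutoff_eq_step[abs_def] open_Compl)
  have 3: "Ckon k (ball 0 1) lp_cutoff"
    by (rule Ckon_cong[OF _ _ Ckon_const[of _ _ 1]]) (auto simp: lp_cutoff_eq_step smooth_step_1)
  have "UNIV = - {0} \<union> ball (0::plane) 1" by auto
  then show ?thesis using Ckon_Un[OF _ _ 2 3] by (simp add: open_Compl)
qed

lemma compact_closure_support:
  fixes f :: "'a::euclidean_space => 'b::real_vector"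
  assumes "\<And>x. x \<notin> cbox a b ==> f x = 0"
  shows "compact (closure {x. f x \<noteq> 0})"
proof -
  have "{x. f x \<noteq> 0} \<subseteq> cbox a b" using assms by auto
  then show ?thesis using bounded_subset[OF bounded_cbox] by (simp add: compact_closure)
qed

text \<open>Differentiation under the integral sign puts every derivative on \<eta>, so
  \<open>f\<close> enters only through its continuity, whatever \<open>k\<close> is.\<close>

lemma Ckon_convolution:
  fixes f \<eta> :: "'a::euclidean_space => real"
  assumes f: "continuous_on UNIV f"
  shows "Ckon k UNIV \<eta> ==> Ckon k UNIV (\<lambda>x. integral (cbox a b) (\<lambda>y. f y * \<eta> (x - y)))"
proof (induction k arbitrary: \<eta>)
  case 0
  have c: "continuous_on UNIV \<eta>" using 0 by simp
  have "continuous_on (UNIV \<times> cbox a b) (\<lambda>(x, y). f y * \<eta> (x - y))"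
    unfolding split_beta
    by (intro continuous_intros continuous_on_compose2[OF f] continuous_on_compose2[OF c]) auto
  then show ?case using integral_continuous_on_param[of UNIV a b "\<lambda>x y. f y * \<eta> (x - y)"] by simp
next
  case (Suc k)
  let ?D = "\<lambda>x. frechet_derivative \<eta> (at x)"
  have c: "continuous_on UNIV \<eta>" using Suc.prems Ckon_continuous by blast
  have bl: "bounded_linear (?D x)" for x
    using Ckon_has_derivative[OF Suc.prems] has_derivative_bounded_linear by auto
  \<comment> \<open>The Leibniz rule expects the derivative as a continuous family of bounded linear
    maps, hence the passage through \<open>Blinfun\<close>; continuity is checked direction by
    direction.\<close>
  define fx where "fx = (\<lambda>x y. f y *\<^sub>R Blinfun (?D (x - y)))"
  have fx: "blinfun_apply (fx x y) = (\<lambda>v. f y * ?D (x - y) v)" for x y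
    by (auto simp: fx_def blinfun.scaleR_left bounded_linear_Blinfun_apply[OF bl])
  have cD: "continuous_on UNIV (\<lambda>x. ?D x v)" for v
    using Suc.prems Ckon_continuous[of k UNIV "\<lambda>x. ?D x v"] by simp
  have "((\<lambda>x. integral (cbox a b) (\<lambda>y. f y * \<eta> (x - y))) has_derivative
      integral (cbox a b) (fx x)) (at x)" for x
  proof (rule leibniz_rule[of UNIV])
    fix x y
    have "((\<lambda>x. \<eta> (x - y)) has_derivative ?D (x - y)) (at x)"
      by (rule has_derivative_compose[of "\<lambda>x. x - y" "\<lambda>h. h", OF _ Ckon_has_derivative[OF Suc.prems]])
        (auto intro!: derivative_eq_intros)
    then show "((\<lambda>x. f y * \<eta> (x - y)) has_derivative blinfun_apply (fx x y)) (at x within UNIV)"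
      unfolding fx by (auto intro!: derivative_eq_intros)
  next
    show "(\<lambda>y. f y * \<eta> (x - y)) integrable_on cbox a b" for x
      by (intro integrable_continuous continuous_intros continuous_on_compose2[OF f]
           continuous_on_compose2[OF c]) auto
    show "continuous_on (UNIV \<times> cbox a b) (\<lambda>(x, t). fx x t)"
      unfolding split_beta
      by (intro continuous_on_blinfun_componentwise)
       (auto simp: fx intro!: continuous_intros continuous_on_compose2[OF f] continuous_on_compose2[OF cD])
  qed auto
  moreover have "blinfun_apply (integral (cbox a b) (fx x)) v
      = integral (cbox a b) (\<lambda>y. f y * ?D (x - y) v)" for x v
  proof -
    have "continuous_on (cbox a b) (fx x)"
      by (intro continuous_on_blinfun_componentwise)
       (auto simp: fx intro!: continuous_intros continuous_on_compose2[OF f] continuous_on_compose2[OF cD])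
    then have "fx x integrable_on cbox a b" by (rule integrable_continuous)
    from integral_linear[OF this blinfun.bounded_linear_left, of v]
    show ?thesis by (simp add: o_def fx)
  qed
  ultimately have D: "((\<lambda>x. integral (cbox a b) (\<lambda>y. f y * \<eta> (x - y))) has_derivative
      (\<lambda>v. integral (cbox a b) (\<lambda>y. f y * ?D (x - y) v))) (at x)" for x
    by (metis (no_types, lifting) ext)
  show ?case
    by (rule Ckon_SucI[where D="\<lambda>x v. integral (cbox a b) (\<lambda>y. f y * ?D (x - y) v)"])
      (use D Suc in auto)
qed

section \<open>Approximate identities\<close>

lemma lborel_integral_shift:
  fixes f :: "'a::euclidean_space => 'b::{banach, second_countable_topology}"
  assumes [measurable]: "borel_fun f"
  shows "integral\<^sup>L lborel (\<lambda>x. f (c + x)) = integral\<^sup>L lborel f"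
    and "integrable lborel (\<lambda>x. f (c + x)) \<longleftrightarrow> integrable lborel f"
  by (subst (2) lborel_distr_plus[of c, symmetric], simp add: integral_distr)
    (subst (2) lborel_distr_plus[of c, symmetric], simp add: integrable_distr_eq)

lemma lborel_affine_integrable_iff:
  fixes f :: "'a::euclidean_space => 'b::{banach, second_countable_topology}"
  assumes [measurable]: "borel_fun f" and c: "c \<noteq> 0"
  shows "integrable lborel (\<lambda>x. f (t + c *\<^sub>R x)) \<longleftrightarrow> integrable lborel f"
  by (subst (2) lborel_affine[OF c, of t]) (use c integrable_scaleR_right[of "\<bar>c\<bar> ^ DIM('a)" lborel] integrable_scaleR_right[of "inverse (\<bar>c\<bar> ^ DIM('a))" lborel "\<lambda>x. \<bar>c\<bar> ^ DIM('a) *\<^sub>R f (t + c *\<^sub>R x)"] in \<open>auto simp: integrable_density integrable_distr_eq\<close>)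

lemma lborel_affine_integral:
  fixes f :: "'a::euclidean_space => 'b::{banach, second_countable_topology}"
  assumes [measurable]: "borel_fun f" and c: "c \<noteq> 0"
  shows "integral\<^sup>L lborel (\<lambda>x. f (t + c *\<^sub>R x)) = integral\<^sup>L lborel f /\<^sub>R \<bar>c\<bar> ^ DIM('a)"
  by (subst (2) lborel_affine[OF c, of t]) (simp add: integral_density integral_distr c)

lemma lborel_integral_reflect:
  fixes f :: "'a::euclidean_space => 'b::{banach, second_countable_topology}"
  assumes [measurable]: "borel_fun f"
  shows "integral\<^sup>L lborel (\<lambda>x. f (c - x)) = integral\<^sup>L lborel f"
    and "integrable lborel (\<lambda>x. f (c - x)) \<longleftrightarrow> integrable lborel f"
  using lborel_affine_integral[of f "-1" c] lborel_affine_integrable_iff[of f "-1" c] by auto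

lemma integrable_indicator_cbox [simp, intro]:
  "integrable lborel (indicat_real (cbox (a::'a::euclidean_space) b))"
  by (rule integrable_real_indicator) (auto simp: emeasure_lborel_cbox_eq)

lemma integrable_on_compact_support:
  fixes f :: "'a::euclidean_space => real"
  assumes [measurable]: "borel_fun f" and "\<And>x. x \<notin> cbox a b ==> f x = 0" "\<And>x. \<bar>f x\<bar> <= M"
  shows "integrable lborel f"
proof (rule bochner_bound)
  show "integrable lborel (\<lambda>x. M * indicator (cbox a b) x)" by simp
  show "AE x in lborel. norm (f x) <= norm (M * indicator (cbox a b) x)"
    using assms(2) order_trans[OF assms(3) abs_ge_self] by (auto simp: indicator_def)
qed simp

lemma integrable_continuous_cbox_support:
  fixes f :: "'a::euclidean_space => real"
  assumes "continuous_on UNIV f" and s: "\<And>x. x \<notin> cbox a b ==> f x = 0"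
  shows "integrable lborel f"
proof -
  have "compact (f ` cbox a b)"
    using assms(1) by (intro compact_continuous_image compact_cbox) (auto intro: continuous_on_subset)
  then obtain M where M: "\<And>x. x \<in> cbox a b ==> \<bar>f x\<bar> <= M"
    by (metis compact_imp_bounded bounded_iff image_eqI real_norm_def)
  have "\<bar>f x\<bar> <= max M 0" for x
    using M[of x] s[of x] by (cases "x \<in> cbox a b") auto
  then show ?thesis
    using assms by (intro integrable_on_compact_support[of f a b "max M 0"]) (auto intro: continuous_borel)
qed

lemma integrable_bounded_support:
  fixes f :: "'a::euclidean_space => real"
  assumes f: "borel_fun f" and s: "\<And>x. norm x > S ==> f x = 0" and b: "\<And>x. \<bar>f x\<bar> <= M"
  shows "integrable lborel f"
proof (rule integrable_on_compact_support[OF f _ b])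
  fix x :: 'a assume x: "x \<notin> cbox (- S *\<^sub>R One) (S *\<^sub>R One)"
  show "f x = 0"
  proof (rule s, rule ccontr)
    assume "\<not> S < norm x"
    then have "\<bar>x \<bullet> b\<bar> <= S" if "b \<in> Basis" for b using Basis_le_norm[OF that, of x] by simp
    then have "x \<in> cbox (- S *\<^sub>R One) (S *\<^sub>R One)" by (simp add: mem_box abs_le_iff minus_le_iff)
    then show False using x by simp
  qed
qed

lemma bounded_continuous_support:
  fixes f :: "'a::euclidean_space => real"
  assumes "continuous_on UNIV f" "\<And>z. norm z > S ==> f z = 0"
  obtains B where "0 <= B" "\<And>z. \<bar>f z\<bar> <= B"
proof -
  have "compact (f ` cball 0 S)" by (intro compact_continuous_image continuous_on_subset[OF assms(1)]) auto
  then obtain B where B: "\<And>z. z \<in> cball 0 S ==> norm (f z) <= B" by (metis compact_imp_bounded bounded_iff image_eqI)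
  show thesis
  proof (rule that[of "max 0 B"])
    show "\<bar>f z\<bar> <= max 0 B" for z using B[of z] assms(2)[of z] by (cases "norm z <= S") auto
  qed simp
qed

lemma integrable_continuous_support:
  fixes f :: "'a::euclidean_space => real"
  assumes "continuous_on UNIV f" "\<And>z. norm z > S ==> f z = 0"
  shows "integrable lborel f"
  by (rule bounded_continuous_support[OF assms], assumption,
      rule integrable_bounded_support[OF continuous_borel[OF assms(1)] assms(2)])

lemma integrable_indicator_cball [simp, intro]:
  "integrable lborel (indicat_real (cball (x::'a::euclidean_space) r))"
  by (rule integrable_real_indicator[OF _ emeasure_lborel_cball_finite]) simp

lemma measurable_vec_nth [measurable (raw)]:
  "f \<in> borel_measurable M ==> (\<lambda>x. (f x :: real ^ 'n) $ i) \<in> borel_measurable M"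
  by (erule measurable_compose) (intro continuous_borel continuous_intros)

text \<open>The continuous functions provided by \<open>measurable_on\<close> converge only
  pointwise. Truncation in height by \<open>cl\<close> and in space by the continuous cutoff
  \<kappa> makes them uniformly bounded with a common compact support, and dominated convergence
  turns pointwise into \<open>L^1\<close> convergence.\<close>

lemma L1_dense_continuous:
  fixes f :: "'a::euclidean_space => real"
  assumes f: "integrable lborel f" and e: "e > 0"
  obtains g a b where "continuous_on UNIV g" "\<And>x. x \<notin> cbox a b ==> g x = 0"
    "integrable lborel g" "(LBINT x. \<bar>f x - g x\<bar>) < e"
proof -
  note [measurable] = borel_measurable_integrable[OF f, simplified]
  define cl where "cl = (\<lambda>(M::real) r. max (- M) (min M r))"
  define \<kappa> where "\<kappa> = (\<lambda>M (x::'a). max 0 (min 1 (M + 1 - norm x)))"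
  have cl: "\<bar>cl M r\<bar> <= M" "\<bar>cl M r\<bar> <= \<bar>r\<bar>" if "M >= 0" for M r
    using that by (auto simp: cl_def)
  have \<kappa>: "0 <= \<kappa> M x" "\<kappa> M x <= 1" "M + 1 <= norm x ==> \<kappa> M x = 0" for M x
    by (auto simp: \<kappa>_def)
  have \<kappa>c: "continuous_on UNIV (\<kappa> M)" for M
    unfolding \<kappa>_def by (intro continuous_intros)
  note [measurable] = continuous_borel[OF \<kappa>c]
  have [measurable]: "borel_fun (cl M)" for M unfolding cl_def by simp
  have "(\<lambda>n::nat. LBINT x. \<bar>f x - cl n (f x) * \<kappa> n x\<bar>) \<longlonglongrightarrow> (\<integral>x. 0 \<partial>(lborel::'a measure))"
  proof (rule integral_dominated_convergence[where w="\<lambda>x. 2 * \<bar>f x\<bar>"])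
    have "(\<lambda>n::nat. \<bar>f x - cl n (f x) * \<kappa> n x\<bar>) \<longlonglongrightarrow> 0" for x
    proof (rule tendsto_eventually, rule eventually_sequentiallyI)
      fix n assume n: "nat \<lceil>max \<bar>f x\<bar> (norm x)\<rceil> <= n"
      then have "\<bar>f x\<bar> <= n" "norm x <= n" by linarith+
      then show "\<bar>f x - cl n (f x) * \<kappa> n x\<bar> = 0" by (auto simp: cl_def \<kappa>_def)
    qed
    then show "AE x in lborel. (\<lambda>n::nat. \<bar>f x - cl n (f x) * \<kappa> n x\<bar>) \<longlonglongrightarrow> 0" by simp
    have "\<bar>f x - cl n (f x) * \<kappa> n x\<bar> <= 2 * \<bar>f x\<bar>" for n :: nat and x
    proof -
      have "\<bar>cl n (f x) * \<kappa> n x\<bar> <= \<bar>f x\<bar> * 1"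
        unfolding abs_mult using cl(2)[of n "f x"] \<kappa>(1,2)[of n x] by (intro mult_mono) auto
      then show ?thesis by linarith
    qed
    then show "AE x in lborel. norm \<bar>f x - cl n (f x) * \<kappa> n x\<bar> <= 2 * \<bar>f x\<bar>" for n :: nat by simp
  qed (use f in auto)
  then have "\<forall>\<^sub>F n::nat in sequentially. (LBINT x. \<bar>f x - cl n (f x) * \<kappa> n x\<bar>) < e / 2"
    using e by (intro order_tendstoD) auto
  then obtain m :: nat where m: "(LBINT x. \<bar>f x - cl m (f x) * \<kappa> m x\<bar>) < e / 2"
    by (auto simp: eventually_sequentially)
  have "f measurable_on UNIV"
    by (rule lebesgue_measurable_imp_measurable_on) (auto simp: measurable_completion)
  then obtain N g where N: "negligible N" and gc: "\<And>n. continuous_on UNIV (g n)"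
    and g: "\<And>x. x \<notin> N ==> (\<lambda>n. g n x) \<longlonglongrightarrow> f x"
    unfolding measurable_on_def by auto
  note [measurable] = continuous_borel[OF gc]
  have aeN: "AE x in lborel. x \<notin> N"
    using AE_not_in[of N lebesgue] N by (simp add: negligible_iff_null_sets AE_completion_iff)
  obtain a where a: "cball (0::'a) (m + 1) \<subseteq> cbox (- a) a"
    using bounded_subset_cbox_symmetric[OF bounded_cball] by blast
  define h where "h = (\<lambda>n x. cl m (g n x) * \<kappa> m x)"
  have hc: "continuous_on UNIV (h n)" for n
    unfolding h_def cl_def by (intro continuous_intros gc \<kappa>c)
  have h0: "h n x = 0" if "x \<notin> cbox (- a) a" for n x
    using that a \<kappa>(3)[of m x] by (force simp: h_def)
  have hi: "integrable lborel (h n)" for n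
    by (rule integrable_continuous_cbox_support[OF hc h0])
  have b0: "\<bar>cl m r * \<kappa> m x\<bar> <= real m * indicat_real (cbox (- a) a) x" for r x
  proof (cases "x \<in> cbox (- a) a")
    case True
    have "\<bar>cl m r * \<kappa> m x\<bar> <= real m * 1"
      unfolding abs_mult using cl(1)[of m r] \<kappa>(1,2)[of m x] by (intro mult_mono) auto
    then show ?thesis using True by simp
  next
    case False
    then show ?thesis using a \<kappa>(3)[of m x] by force
  qed
  have "(\<lambda>n. LBINT x. \<bar>cl m (f x) * \<kappa> m x - h n x\<bar>) \<longlonglongrightarrow> (\<integral>x. 0 \<partial>(lborel::'a measure))"
  proof (rule integral_dominated_convergence[where w="\<lambda>x. 2 * (real m * indicat_real (cbox (- a) a) x)"])
    show "AE x in lborel. (\<lambda>n. \<bar>cl m (f x) * \<kappa> m x - h n x\<bar>) \<longlonglongrightarrow> 0"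
      using aeN
    proof eventually_elim
      case (elim x)
      have "(\<lambda>n. \<bar>cl m (f x) * \<kappa> m x - h n x\<bar>) \<longlonglongrightarrow> \<bar>cl m (f x) * \<kappa> m x - cl m (f x) * \<kappa> m x\<bar>"
        unfolding h_def cl_def by (intro tendsto_intros tendsto_max tendsto_min g elim)
      then show ?case by simp
    qed
    show "AE x in lborel. norm \<bar>cl m (f x) * \<kappa> m x - h n x\<bar> <= 2 * (real m * indicat_real (cbox (- a) a) x)" for n
    proof (rule AE_I2)
      fix x show "norm \<bar>cl m (f x) * \<kappa> m x - h n x\<bar> <= 2 * (real m * indicat_real (cbox (- a) a) x)"
        using b0[of "f x" x] b0[of "g n x" x] unfolding h_def by simp
    qed
  qed (auto simp: h_def)
  then have lim2: "(\<lambda>n. LBINT x. \<bar>cl m (f x) * \<kappa> m x - h n x\<bar>) \<longlonglongrightarrow> 0" by simp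
  have "\<forall>\<^sub>F n in sequentially. (LBINT x. \<bar>cl m (f x) * \<kappa> m x - h n x\<bar>) < e / 2"
    using e by (intro order_tendstoD(2)[OF lim2]) auto
  then obtain n where n: "(LBINT x. \<bar>cl m (f x) * \<kappa> m x - h n x\<bar>) < e / 2"
    by (auto simp: eventually_sequentially)
  have i2: "integrable lborel (\<lambda>x. cl m (f x) * \<kappa> m x)"
    by (rule bochner_bound[of _ "\<lambda>x. real m * indicat_real (cbox (- a) a) x"])
      (use b0 in \<open>auto intro: order_trans[OF b0]\<close>)
  have "(LBINT x. \<bar>f x - h n x\<bar>)
      <= (LBINT x. \<bar>f x - cl m (f x) * \<kappa> m x\<bar> + \<bar>cl m (f x) * \<kappa> m x - h n x\<bar>)"
    by (rule integral_mono) (use f hi i2 in auto)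
  also have "\<dots> < e"
    using m n f hi i2 by (subst Bochner_Integration.integral_add) auto
  finally show thesis using that[OF hc h0 hi] by blast
qed

text \<open>Reduction to a continuous \<open>g\<close> with compact support, for which uniform
  continuity on a common box is enough; the shifted and the unshifted approximation errors have the
  same integral.\<close>

lemma L1_translation_continuous:
  fixes f :: "'a::euclidean_space => real"
  assumes f: "integrable lborel f"
  shows "((\<lambda>h. LBINT x. \<bar>f (x - h) - f x\<bar>) \<longlongrightarrow> 0) (at 0)"
proof (rule tendstoI)
  fix e :: real assume e: "e > 0"
  obtain g a b where g: "continuous_on UNIV g" "\<And>x. x \<notin> cbox a b ==> g x = 0"
    "integrable lborel g" "(LBINT x. \<bar>f x - g x\<bar>) < e / 4"
    using L1_dense_continuous[OF f, of "e/4"] e by auto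
  note [measurable] = borel_measurable_integrable[OF f, simplified] borel_measurable_integrable[OF g(3), simplified]
  obtain R where R: "\<And>x. x \<in> cbox a b ==> norm x <= R"
    using bounded_cbox[of a b] unfolding bounded_iff by blast
  obtain c where c: "cball (0::'a) (R + 1) \<subseteq> cbox (- c) c"
    using bounded_subset_cbox_symmetric[OF bounded_cball] by blast
  define V where "V = measure lborel (cbox (- c) c) + 1"
  have V: "V > 0" unfolding V_def by (smt (verit) measure_nonneg)
  have "uniformly_continuous_on (cbox (- c) c) g"
    using g(1) by (intro compact_uniformly_continuous compact_cbox) (auto intro: continuous_on_subset)
  have "uniformly_continuous_on (cball 0 1 \<times> cbox (-c) c) (\<lambda>(h, x). g (x - h))"
    unfolding split_beta
    by (intro compact_uniformly_continuous compact_Times compact_cbox compact_cball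
        continuous_on_compose2[OF g(1)] continuous_intros) auto
  then obtain d where d: "d > 0" and dd: "\<And>p q. p \<in> cball 0 1 \<times> cbox (-c) c ==>
     q \<in> cball 0 1 \<times> cbox (-c) c ==> dist p q < d ==>
     \<bar>g (snd p - fst p) - g (snd q - fst q)\<bar> < e / (4 * V)"
    unfolding uniformly_continuous_on_def split_beta dist_real_def
    using divide_pos_pos[OF e, of "4 * V"] V by (metis (no_types, lifting) zero_less_mult_iff zero_less_numeral)
  have sh: "(LBINT x. \<bar>f (x - h) - g (x - h)\<bar>) = (LBINT x. \<bar>f x - g x\<bar>)" 
    "integrable lborel (\<lambda>x. f (x - h))" "integrable lborel (\<lambda>x. g (x - h))" for h
    using lborel_integral_shift[of "\<lambda>x. \<bar>f x - g x\<bar>" "-h"] lborel_integral_shift[of f "-h"]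
      lborel_integral_shift[of g "-h"] f g(3) by auto
  have "(LBINT x. \<bar>f (x - h) - f x\<bar>) < e" if h: "norm h < min d 1" for h
  proof -
    have pt: "\<bar>g (x - h) - g x\<bar> <= e / (4 * V) * indicator (cbox (-c) c) x" for x
    proof (cases "x \<in> cbox (-c) c")
      case True
      then show ?thesis using dd[of "(h, x)" "(0, x)"] h by (auto simp: dist_Pair_Pair)
    next
      case False
      have "x \<notin> cbox a b" using False subsetD[OF c, of x] R[of x] by auto
      moreover have "x - h \<notin> cbox a b"
        using False subsetD[OF c, of x] R[of "x - h"] norm_triangle_sub[of x h] h norm_triangle_ineq[of "x - h" h]
        by auto
      ultimately have "x \<notin> cbox a b" "x - h \<notin> cbox a b" by auto
      then show ?thesis using g(2) False by simp
    qed
    have "(LBINT x. \<bar>g (x - h) - g x\<bar>) <= (LBINT x. e / (4 * V) * indicator (cbox (-c) c) x)"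
      by (rule integral_mono) (use pt sh g(3) in auto)
    also have "\<dots> = e / (4 * V) * (V - 1)" by (simp add: V_def)
    also have "\<dots> <= e / 4" using V e by (simp add: field_simps)
    finally have 1: "(LBINT x. \<bar>g (x - h) - g x\<bar>) <= e / 4" .
    have "(LBINT x. \<bar>f (x - h) - f x\<bar>) <=
      (LBINT x. \<bar>f (x - h) - g (x - h)\<bar> + \<bar>g (x - h) - g x\<bar> + \<bar>f x - g x\<bar>)"
      by (rule integral_mono) (use sh f g(3) in auto)
    also have "\<dots> = (LBINT x. \<bar>f x - g x\<bar>) + (LBINT x. \<bar>g (x - h) - g x\<bar>) + (LBINT x. \<bar>f x - g x\<bar>)"
      using sh f g(3) by simp
    finally show ?thesis using 1 g(4) e by linarith
  qed
  moreover have "0 <= (LBINT x. \<bar>f (x - h) - f x\<bar>)" for h by simp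
  ultimately show "\<forall>\<^sub>F h in at 0. dist (LBINT x. \<bar>f (x - h) - f x\<bar>) 0 < e"
    unfolding eventually_at using d by (intro exI[of _ "min d 1"]) (auto simp: dist_real_def)
qed

text \<open>Stated on a set \<open>B\<close> because it is also applied to functions in
  \<open>L^q\<close>, which are integrable only locally. By Fubini the error is at most the integral
  of \<open>\<bar>k z\<bar> * \<omega> (\<epsilon> n *\<^sub>R z)\<close>, where \<omega> is the
  \<open>L^1\<close> modulus of continuity on \<open>B\<close>. The uniform bound \<open>C\<close>
  gives the majorant, and continuity of \<omega> at 0 the limit.\<close>

lemma approx_identity_L1:
  fixes f k :: "'a::euclidean_space => real"
  assumes f[measurable]: "borel_fun f" and B[measurable]: "B \<in> sets borel"
    and k: "integrable lborel k" "(LBINT z. k z) = 1"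
    and fi: "\<And>z. integrable lborel (\<lambda>x. indicator B x * f (x - z))"
    and C: "\<And>z. (LBINT x. indicator B x * \<bar>f (x - z)\<bar>) <= C"
    and B': "B' \<in> sets borel" "\<And>x z. x \<in> B ==> norm z <= 1 ==> x - z \<in> B'"
    and fB': "integrable lborel (\<lambda>x. indicator B' x * f x)"
    and \<epsilon>: "\<epsilon> \<longlonglongrightarrow> 0"
  shows "(\<lambda>n::nat. LBINT x. indicator B x * \<bar>(LBINT z. k z * f (x - \<epsilon> n *\<^sub>R z)) - f x\<bar>) \<longlonglongrightarrow> 0"
proof -
  note [measurable] = borel_measurable_integrable[OF k(1), simplified]
  define \<omega> where "\<omega> = (\<lambda>h. LBINT x. indicator B x * \<bar>f (x - h) - f x\<bar>)"
  have fi': "integrable lborel (\<lambda>x. indicator B x * \<bar>f (x - z)\<bar>)" for z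
    using integrable_abs[OF fi[of z]] by (simp add: abs_mult)
  have di: "integrable lborel (\<lambda>x. indicator B x * \<bar>f (x - z) - f x\<bar>)" for z
    using integrable_abs[OF Bochner_Integration.integrable_diff[OF fi[of z] fi[of 0]]]
    by (simp add: abs_mult flip: right_diff_distrib)
  have \<omega>0: "0 <= \<omega> h" for h by (simp add: \<omega>_def)
  have \<omega>C: "\<omega> h <= 2 * C" for h
  proof -
    have "\<omega> h <= (LBINT x. indicator B x * \<bar>f (x - h)\<bar> + indicator B x * \<bar>f (x - 0)\<bar>)"
      unfolding \<omega>_def using di fi'[of h] fi'[of 0] by (intro integral_mono) (auto simp: indicator_def)
    then show ?thesis using C[of h] C[of 0] fi'[of h] fi'[of 0] by simp
  qed
  have [measurable]: "borel_fun \<omega>" unfolding \<omega>_def by measurable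
  \<comment> \<open>For shifts of length at most 1 nothing changes on \<open>B\<close> if
    \<open>f\<close> is cut off outside \<open>B'\<close>. The function that is cut off is
    integrable, so continuity of translations applies to it.\<close>
  define F where "F = (\<lambda>x. indicator B' x * f x)"
  have Flim: "((\<lambda>h. LBINT x. \<bar>F (x - h) - F x\<bar>) \<longlongrightarrow> 0) (at 0)"
    using L1_translation_continuous fB' unfolding F_def by blast
  have \<omega>F: "\<omega> h <= (LBINT x. \<bar>F (x - h) - F x\<bar>)" if "norm h <= 1" for h
  proof -
    have [measurable]: "borel_fun F" unfolding F_def using B'(1) by measurable
    have "integrable lborel (\<lambda>x. F (x - h))"
      using lborel_integral_shift(2)[of F "- h"] fB' unfolding F_def[symmetric] by simp
    then show ?thesis
      unfolding \<omega>_def using di fB' that B'(2)[of _ h] B'(2)[of _ 0]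
      by (intro integral_mono) (auto simp: indicator_def F_def)
  qed
  have "\<forall>\<^sub>F h in at 0. \<omega> h <= (LBINT x. \<bar>F (x - h) - F x\<bar>)"
    unfolding eventually_at using \<omega>F by (intro exI[of _ 1]) auto
  then have \<omega>lim: "(\<omega> \<longlongrightarrow> 0) (at 0)"
    using tendsto_sandwich[of "\<lambda>_. 0" \<omega>, OF _ _ tendsto_const Flim] \<omega>0 by simp
  have \<omega>00: "\<omega> 0 = 0" by (simp add: \<omega>_def)
  have bound: "(LBINT x. indicator B x * \<bar>(LBINT z. k z * f (x - e *\<^sub>R z)) - f x\<bar>)
      <= (LBINT z. \<bar>k z\<bar> * \<omega> (e *\<^sub>R z))" for e
  proof -
    define H where "H = (\<lambda>(z, x). indicator B x * (k z * (f (x - e *\<^sub>R z) - f x)))"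
    have in1: "(LBINT x. \<bar>H (z, x)\<bar>) = \<bar>k z\<bar> * \<omega> (e *\<^sub>R z)" for z
    proof -
      have "(\<lambda>x. \<bar>H (z, x)\<bar>) = (\<lambda>x. \<bar>k z\<bar> * (indicator B x * \<bar>f (x - e *\<^sub>R z) - f x\<bar>))"
        by (auto simp: H_def abs_mult)
      then show ?thesis by (simp add: \<omega>_def)
    qed
    have ik\<omega>: "integrable lborel (\<lambda>z. \<bar>k z\<bar> * \<omega> (e *\<^sub>R z))"
      by (rule bochner_bound[of _ "\<lambda>z. 2 * C * \<bar>k z\<bar>"])
        (use k(1) \<omega>0 order_trans[OF \<omega>C abs_ge_self] in \<open>auto simp: abs_mult mult.commute[of "\<bar>k _\<bar>"] intro!: mult_right_mono\<close>)
    have Hi: "integrable (lborel \<Otimes>\<^sub>M lborel) H"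
    proof (rule lborel_pair.Fubini_integrable)
      show "H \<in> borel_measurable (lborel \<Otimes>\<^sub>M lborel)" unfolding H_def by measurable
      show "integrable lborel (\<lambda>z. LBINT x. norm (H (z, x)))" unfolding real_norm_def in1 by (rule ik\<omega>)
      have "integrable lborel (\<lambda>x. k z * (indicator B x * f (x - e *\<^sub>R z) - indicator B x * f (x - 0)))" for z
        by (intro integrable_mult_right Bochner_Integration.integrable_diff fi)
      then show "AE z in lborel. integrable lborel (\<lambda>x. H (z, x))"
        by (auto simp: H_def algebra_simps)
    qed
    then have Hi'': "integrable (lborel \<Otimes>\<^sub>M lborel) (case_prod (\<lambda>z x. \<bar>H (z, x)\<bar>))"
      using integrable_abs[OF Hi] by (simp add: case_prod_beta')
    from Hi have Hi': "integrable (lborel \<Otimes>\<^sub>M lborel) (case_prod (\<lambda>z x. H (z, x)))" by simp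
    have "AE x in lborel. indicator B x * \<bar>(LBINT z. k z * f (x - e *\<^sub>R z)) - f x\<bar> <= (LBINT z. \<bar>H (z, x)\<bar>)"
      using lborel_pair.AE_integrable_snd[OF Hi']
    proof eventually_elim
      case (elim x)
      show ?case
      proof (cases "x \<in> B")
        case True
        have 1: "integrable lborel (\<lambda>z. k z * (f (x - e *\<^sub>R z) - f x))"
          using elim True by (simp add: H_def)
        have "integrable lborel (\<lambda>z. k z * (f (x - e *\<^sub>R z) - f x) + k z * f x)"
          using 1 k(1) by auto
        then have 2: "integrable lborel (\<lambda>z. k z * f (x - e *\<^sub>R z))" by (simp add: algebra_simps)
        have "(LBINT z. k z * (f (x - e *\<^sub>R z) - f x)) = (LBINT z. k z * f (x - e *\<^sub>R z)) - (LBINT z. k z * f x)"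
          unfolding right_diff_distrib using 2 k(1) by (intro Bochner_Integration.integral_diff) auto
        also have "(LBINT z. k z * f x) = f x" using k by simp
        finally show ?thesis
          using True integral_abs_bound[of lborel "\<lambda>z. k z * (f (x - e *\<^sub>R z) - f x)"] by (simp add: H_def)
      qed simp
    qed
    then have "(LBINT x. indicator B x * \<bar>(LBINT z. k z * f (x - e *\<^sub>R z)) - f x\<bar>)
        <= (LBINT x. (LBINT z. \<bar>H (z, x)\<bar>))"
      using lborel_pair.integrable_snd[OF Hi''] by (intro integral_mono_AE') auto
    also have "\<dots> = (LBINT z. (LBINT x. \<bar>H (z, x)\<bar>))"
      by (rule lborel_pair.Fubini_integral[OF Hi''])
    finally show ?thesis by (simp add: in1)
  qed
  have "(\<lambda>n. LBINT z. \<bar>k z\<bar> * \<omega> (\<epsilon> n *\<^sub>R z)) \<longlonglongrightarrow> (\<integral>z. 0 \<partial>(lborel :: 'a measure))"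
  proof (rule integral_dominated_convergence[where w="\<lambda>z. \<bar>k z\<bar> * (2 * C)"])
    have "(\<lambda>n. \<bar>k z\<bar> * \<omega> (\<epsilon> n *\<^sub>R z)) \<longlonglongrightarrow> 0" for z
    proof -
      have "isCont \<omega> 0" using \<omega>lim \<omega>00 by (simp add: isCont_def)
      moreover have "(\<lambda>n. \<epsilon> n *\<^sub>R z) \<longlonglongrightarrow> 0" using tendsto_scaleR[OF \<epsilon> tendsto_const[of z]] by simp
      ultimately have "(\<lambda>n. \<omega> (\<epsilon> n *\<^sub>R z)) \<longlonglongrightarrow> 0"
        using isCont_tendsto_compose \<omega>00 by metis
      then show ?thesis using tendsto_mult_right_zero by blast
    qed
    then show "AE z in lborel. (\<lambda>n. \<bar>k z\<bar> * \<omega> (\<epsilon> n *\<^sub>R z)) \<longlonglongrightarrow> 0" by simp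
    show "AE z in lborel. norm (\<bar>k z\<bar> * \<omega> (\<epsilon> n *\<^sub>R z)) <= \<bar>k z\<bar> * (2 * C)" for n
      using \<omega>0 \<omega>C by (auto simp: abs_mult intro!: mult_left_mono)
  qed (use k(1) in auto)
  then have *: "(\<lambda>n. LBINT z. \<bar>k z\<bar> * \<omega> (\<epsilon> n *\<^sub>R z)) \<longlonglongrightarrow> 0" by simp
  show ?thesis
    by (rule tendsto_sandwich[OF _ _ tendsto_const *]) (auto simp: bound)
qed

lemma approx_identity_L1_UNIV:
  fixes f k :: "'a::euclidean_space => real"
  assumes f: "integrable lborel f" and k: "integrable lborel k" "(LBINT z. k z) = 1" and \<epsilon>: "\<epsilon> \<longlonglongrightarrow> 0"
  shows "(\<lambda>n::nat. LBINT x. \<bar>(LBINT z. k z * f (x - \<epsilon> n *\<^sub>R z)) - f x\<bar>) \<longlonglongrightarrow> 0"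
proof -
  note [measurable] = borel_measurable_integrable[OF f, simplified]
  show ?thesis
    using approx_identity_L1[of f UNIV k "LBINT x. \<bar>f x\<bar>" UNIV \<epsilon>]
      lborel_integral_shift[of f] lborel_integral_shift[of "\<lambda>x. \<bar>f x\<bar>" "- _"] f k \<epsilon>
      lborel_integral_shift(2)[of f "- _"]
    by auto
qed

section \<open>Littlewood-Paley kernels\<close>

lemma integral_eq_integral_cbox:
  fixes f :: "'a::euclidean_space => real"
  assumes "continuous_on UNIV f" and s: "\<And>x. x \<notin> cbox a b ==> f x = 0"
  shows "integral\<^sup>L lborel f = integral (cbox a b) f"
proof -
  have i: "integrable lborel f" by (rule integrable_continuous_cbox_support[OF assms])
  have "integral (cbox a b) f = integral UNIV f"
  proof -
    have "(\<lambda>x. if x \<in> cbox a b then f x else 0) = f" using s by auto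
    then show ?thesis using integral_restrict_UNIV[of "cbox a b" f] by simp
  qed
  then show ?thesis using integral_lborel[OF i] by simp
qed

lemma abs_diff_le_of_deriv:
  fixes f :: "real => real"
  assumes "a <= b" "\<And>t. a <= t ==> t <= b ==> (f has_real_derivative f' t) (at t)"
    and "\<And>t. a <= t ==> t <= b ==> \<bar>f' t\<bar> <= K"
  shows "\<bar>f b - f a\<bar> <= K * (b - a)"
proof (cases "a = b")
  case False
  then have "a < b" using assms(1) by simp
  from MVT2[OF this, of f f'] assms(2) obtain z where z: "a < z" "z < b" "f b - f a = (b - a) * f' z"
    by auto
  then show ?thesis using assms(3)[of z] \<open>a < b\<close> by (simp add: abs_mult mult.commute)
qed simp

lemma has_real_derivative_line:
  fixes f :: "'a::real_normed_vector => real"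
  assumes "(f has_derivative f') (at (x + t *\<^sub>R h))"
  shows "((\<lambda>t. f (x + t *\<^sub>R h)) has_real_derivative f' h) (at t)"
proof -
  have "((\<lambda>t. f (x + t *\<^sub>R h)) has_derivative (\<lambda>s. f' (s *\<^sub>R h))) (at t)"
    by (rule has_derivative_compose[of "\<lambda>t. x + t *\<^sub>R h" "\<lambda>s. s *\<^sub>R h", OF _ assms])
      (auto intro!: derivative_eq_intros)
  moreover have "(\<lambda>s. f' (s *\<^sub>R h)) = (*) (f' h)"
    using linear_cmul[OF has_derivative_linear[OF assms]] by (auto simp: mult.commute)
  ultimately show ?thesis by (simp add: has_field_derivative_def)
qed

lemma derivative_support:
  fixes f :: "'a::euclidean_space => real"
  assumes "(f has_derivative f') (at x)" "\<And>x. x \<notin> cbox a b ==> f x = 0" "x \<notin> cbox a b"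
  shows "f' h = 0"
proof -
  have "(f has_derivative (\<lambda>h. 0)) (at x)"
    by (rule has_derivative_transform_within_open[of "\<lambda>x. 0" _ _ UNIV "- cbox a b"])
      (use assms in \<open>auto simp: open_Compl\<close>)
  then show ?thesis using has_derivative_unique[OF assms(1)] by metis
qed

text \<open>Translation invariance makes all difference quotients integrate to zero; they are
  bounded on a common box and converge to the derivative.\<close>

lemma integral_directional_derivative_eq_0:
  fixes f :: "'a::euclidean_space => real"
  assumes D: "\<And>x. (f has_derivative f' x) (at x)" and c: "continuous_on UNIV (\<lambda>x. f' x h)"
    and s: "\<And>x. x \<notin> cbox a b ==> f x = 0"
  shows "(LBINT x. f' x h) = 0"
proof -
  have s': "f' x h = 0" if "x \<notin> cbox a b" for x by (rule derivative_support[OF D s that])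
  have fc: "continuous_on UNIV f"
    by (rule continuous_at_imp_continuous_on) (use D has_derivative_continuous in blast)
  note [measurable] = continuous_borel[OF fc] continuous_borel[OF c]
  have "compact ((\<lambda>x. f' x h) ` cbox a b)"
    using c by (intro compact_continuous_image compact_cbox) (auto intro: continuous_on_subset)
  then obtain M0 where M0: "\<And>x. x \<in> cbox a b ==> \<bar>f' x h\<bar> <= M0"
    by (metis compact_imp_bounded bounded_iff image_eqI real_norm_def)
  define M where "M = max M0 0"
  have M: "\<bar>f' x h\<bar> <= M" for x using M0[of x] s'[of x] by (cases "x \<in> cbox a b") (auto simp: M_def)
  obtain R where R: "\<And>x. x \<in> cbox a b ==> norm x <= R"
    using bounded_cbox[of a b] unfolding bounded_iff by blast
  obtain d where d: "cball (0::'a) (R + norm h) \<subseteq> cbox (- d) d"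
    using bounded_subset_cbox_symmetric[OF bounded_cball] by blast
  \<comment> \<open>The steps \<open>1 / Suc n\<close> are at most 1, so every quotient is supported
    within distance \<open>norm h\<close> of the box; the box given by \<open>d\<close> is chosen
    for that.\<close>
  define q where "q = (\<lambda>n x. (f (x + (1 / Suc n) *\<^sub>R h) - f x) * Suc n)"
  have fi: "integrable lborel f" by (rule integrable_continuous_cbox_support[OF fc s])
  have fi': "integrable lborel (\<lambda>x. f (x + c))" "(LBINT x. f (x + c)) = (LBINT x. f x)" for c
    using lborel_integral_shift[of f c] fi by (simp_all add: add.commute)
  have "(\<lambda>n. LBINT x. q n x) \<longlonglongrightarrow> (LBINT x. f' x h)"
  proof (rule integral_dominated_convergence[where w="\<lambda>x. M * indicat_real (cbox (- d) d) x"])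
    have "(\<lambda>n. q n x) \<longlonglongrightarrow> f' x h" for x
    proof -
      have "((\<lambda>t. f (x + t *\<^sub>R h)) has_real_derivative f' x h) (at 0)"
        using has_real_derivative_line[of f "f' x" x 0 h] D by simp
      then have "((\<lambda>t. (f (x + t *\<^sub>R h) - f x) / t) \<longlongrightarrow> f' x h) (at 0)"
        by (simp add: has_field_derivative_iff)
      moreover have "filterlim (\<lambda>n. 1 / real (Suc n)) (at 0) sequentially"
        unfolding filterlim_at using LIMSEQ_inverse_real_of_nat by (auto simp: inverse_eq_divide)
      ultimately have "(\<lambda>n. (f (x + (1 / real (Suc n)) *\<^sub>R h) - f x) / (1 / real (Suc n))) \<longlonglongrightarrow> f' x h"
        by (rule filterlim_compose)
      then show ?thesis by (simp add: q_def)
    qed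
    then show "AE x in lborel. (\<lambda>n. q n x) \<longlonglongrightarrow> f' x h" by simp
    have "\<bar>q n x\<bar> <= M * indicat_real (cbox (- d) d) x" for n x
    proof (cases "x \<in> cbox (- d) d")
      case True
      have "\<bar>f (x + (1 / Suc n) *\<^sub>R h) - f (x + 0 *\<^sub>R h)\<bar> <= M * (1 / Suc n - 0)"
        by (rule abs_diff_le_of_deriv[where f'="\<lambda>t. f' (x + t *\<^sub>R h) h"])
          (auto intro: has_real_derivative_line D M)
      then have "\<bar>f (x + (1 / Suc n) *\<^sub>R h) - f x\<bar> * Suc n <= M" by (simp add: field_simps)
      then show ?thesis using True by (simp add: q_def abs_mult)
    next
      case False
      then have "norm x > R + norm h" using d by (meson mem_cball_0 not_le subsetD)
      moreover have "norm ((1 / Suc n) *\<^sub>R h) <= norm h"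
        using mult_left_le_one_le[of "norm h" "1 / Suc n"] by simp
      ultimately have "x \<notin> cbox a b" "x + (1 / Suc n) *\<^sub>R h \<notin> cbox a b"
        using R[of x] R[of "x + (1 / Suc n) *\<^sub>R h"] norm_triangle_ineq4[of "x + (1 / Suc n) *\<^sub>R h" "(1 / Suc n) *\<^sub>R h"]
          norm_ge_zero[of h] by auto
      then show ?thesis using False s by (simp add: q_def)
    qed
    then show "AE x in lborel. norm (q n x) <= M * indicat_real (cbox (- d) d) x" for n by simp
  qed (auto simp: q_def)
  moreover have "(LBINT x. q n x) = 0" for n
    unfolding q_def using fi' fi by simp
  ultimately show ?thesis by (simp add: LIMSEQ_const_iff)
qed

lemma vec2_measurable: "(\<lambda>p::real\<times>real. vector [fst p, snd p] :: plane) \<in> borel \<rightarrow>\<^sub>M borel"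
proof (rule continuous_borel)
  have "continuous_on UNIV (\<lambda>p::real\<times>real. (\<chi> i. if i = 1 then fst p else snd p) :: plane)"
  proof (rule continuous_on_vec_lambda)
    show "continuous_on UNIV (\<lambda>p::real\<times>real. if i = 1 then fst p else snd p)" for i :: 2
      by (cases "i = 1") (auto intro!: continuous_intros)
  qed
  moreover have "(\<lambda>p::real\<times>real. vector [fst p, snd p] :: plane) = (\<lambda>p. (\<chi> i. if i = 1 then fst p else snd p))"
    by (auto simp: vec_eq_iff forall_2)
  ultimately show "continuous_on UNIV (\<lambda>p::real\<times>real. vector [fst p, snd p] :: plane)" by (simp only:)
qed

text \<open>The two measures agree on boxes. This identifies the plane with a product of two lines,
  so that integrals of products split.\<close>

lemma lborel_vec2:
  "(lborel :: plane measure) = distr (lborel \<Otimes>\<^sub>M lborel) borel (\<lambda>p. vector [fst p, snd p])"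
proof (rule lborel_eqI)
  note [measurable] = vec2_measurable
  fix l u :: plane assume le: "\<And>b. b \<in> Basis ==> l \<bullet> b <= u \<bullet> b"
  have le': "l $ i <= u $ i" for i using le[of "axis i 1"] by (simp add: inner_axis axis_in_Basis_iff)
  have pre: "(\<lambda>p::real\<times>real. vector [fst p, snd p] :: plane) -` box l u = {l$1<..<u$1} \<times> {l$2<..<u$2}"
    by (auto simp: mem_box_cart forall_2)
  have "emeasure (distr (lborel \<Otimes>\<^sub>M lborel) borel (\<lambda>p. vector [fst p, snd p] :: plane)) (box l u)
      = emeasure (lborel \<Otimes>\<^sub>M lborel) ({l$1<..<u$1} \<times> {l$2<..<u$2})"
    by (subst emeasure_distr) (simp_all add: pre space_pair_measure lborel_prod)
  also have "\<dots> = ennreal (u$1 - l$1) * ennreal (u$2 - l$2)"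
    using le' by (subst lborel.emeasure_pair_measure_Times) auto
  also have "\<dots> = ennreal (\<Prod>b\<in>Basis. (u - l) \<bullet> b)"
  proof -
    have B: "(Basis :: plane set) = {axis 1 1, axis 2 1}"
      unfolding Basis_vec_def by (auto simp: UNIV_2)
    have "axis 1 1 \<noteq> (axis 2 1 :: plane)" by (simp add: axis_eq_axis)
    then show ?thesis unfolding B using le'
      by (simp add: inner_axis ennreal_mult' vector_minus_component)
  qed
  finally show "emeasure (distr (lborel \<Otimes>\<^sub>M lborel) borel (\<lambda>p. vector [fst p, snd p] :: plane)) (box l u)
      = ennreal (\<Prod>b\<in>Basis. (u - l) \<bullet> b)" .
qed simp

lemma plane_integral_prod:
  fixes f g :: "real => real"
  assumes f: "integrable lborel f" and g: "integrable lborel g"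
  shows "integrable lborel (\<lambda>x::plane. f (x $ 1) * g (x $ 2))"
    and "(\<integral>x. f (x $ 1) * g (x $ 2) \<partial>(lborel :: plane measure)) = (LBINT x. f x) * (LBINT x. g x)"
proof -
  note [measurable] = borel_measurable_integrable[OF f, simplified] borel_measurable_integrable[OF g, simplified]
  note [measurable] = vec2_measurable
  have i: "integrable (lborel \<Otimes>\<^sub>M lborel) (\<lambda>p. f (fst p) * g (snd p))"
    by (rule lborel_pair.Fubini_integrable) (use f g in \<open>auto simp: abs_mult\<close>)
  show "integrable lborel (\<lambda>x::plane. f (x $ 1) * g (x $ 2))"
    by (subst lborel_vec2, subst integrable_distr_eq) (use i in \<open>auto simp: lborel_prod\<close>)
  have "(\<integral>x. f (x $ 1) * g (x $ 2) \<partial>(lborel :: plane measure)) = (\<integral>p. f (fst p) * g (snd p) \<partial>(lborel \<Otimes>\<^sub>M lborel))"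
    by (subst lborel_vec2, subst integral_distr) (auto simp: lborel_prod)
  also have "\<dots> = (LBINT x. LBINT y. f x * g y)"
    using lborel_pair.integral_fst[of "\<lambda>x y. f x * g y"] i by (simp add: case_prod_beta')
  finally show "(\<integral>x. f (x $ 1) * g (x $ 2) \<partial>(lborel :: plane measure)) = (LBINT x. f x) * (LBINT x. g x)"
    by simp
qed

text \<open>A product weight, so that integrability is a one-dimensional fact; two integrations by
  parts in each coordinate bound a transform by it.\<close>

definition decay :: "plane => real" where
  "decay x = 1 / (1 + (x $ 1)\<^sup>2) * (1 / (1 + (x $ 2)\<^sup>2))"

lemma integrable_decay: "integrable lborel decay"
proof -
  have "integrable lborel (\<lambda>x::real. 1 / (1 + x\<^sup>2))"
    using integrable_inverse_1_plus_square by (simp add: set_integrable_def inverse_eq_divide)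
  from plane_integral_prod(1)[OF this this] show ?thesis by (simp add: decay_def[abs_def])
qed

lemma decay_pos: "decay x > 0"
  by (auto simp: decay_def intro!: mult_pos_pos divide_pos_pos add_pos_nonneg)

lemma decay_shift:
  assumes "norm h <= 1" shows "decay (x + h) <= 9 * decay x"
proof -
  have *: "1 / (1 + (r + s)\<^sup>2) <= 3 * (1 / (1 + r\<^sup>2))" if "\<bar>s\<bar> <= 1" for r s :: real
  proof -
    have "s\<^sup>2 <= 1" using that by (simp add: abs_square_le_1)
    \<comment> \<open>The difference of the two sides of the next inequality is the sum of these
      squares and \<open>2 * (1 - s\<^sup>2)\<close>.\<close>
    moreover have "0 <= (r + 2 * s)\<^sup>2" "0 <= (r + s)\<^sup>2" by simp_all
    ultimately have "1 + r\<^sup>2 <= 3 * (1 + (r + s)\<^sup>2)" by (simp add: power2_eq_square algebra_simps)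
    moreover have "1 + r\<^sup>2 > 0" "1 + (r + s)\<^sup>2 > 0" by (simp_all add: add_pos_nonneg)
    ultimately show ?thesis by (simp add: divide_simps)
  qed
  have "\<bar>h $ i\<bar> <= 1" for i using component_le_norm_cart[of h i] assms by linarith
  then have "decay (x + h) <= (3 * (1 / (1 + (x $ 1)\<^sup>2))) * (3 * (1 / (1 + (x $ 2)\<^sup>2)))"
    unfolding decay_def vector_add_component by (intro mult_mono *) auto
  then show ?thesis by (simp add: decay_def)
qed

section \<open>Trigonometric transforms of smooth symbols with compact support\<close>

definition nice :: "(plane => real) => bool" where
  "nice m \<longleftrightarrow> (\<forall>k. Ckon k UNIV m) \<and> (\<exists>a b. \<forall>x. x \<notin> cbox a b --> m x = 0)"

lemma nice_continuous: "nice m ==> continuous_on UNIV m"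
  using Ckon_continuous by (auto simp: nice_def)

lemma nice_integrable: "nice m ==> integrable lborel m"
  using integrable_continuous_cbox_support nice_continuous by (metis nice_def)

lemma nice_has_derivative: "nice m ==> (m has_derivative frechet_derivative m (at x)) (at x)"
  using Ckon_has_derivative[of 0 UNIV m x] by (auto simp: nice_def simp del: Ckon.simps)

lemma nice_derivative: "nice m ==> nice (\<lambda>x. frechet_derivative m (at x) h)"
  using derivative_support[OF nice_has_derivative]
  unfolding nice_def by (metis Ckon.simps(2))

lemma nice_linear_mult: "nice m ==> bounded_linear l ==> nice (\<lambda>x. l x * m x)"
  using Ckon_mult[OF open_UNIV Ckon_linear[OF _ open_UNIV], of l _ m] unfolding nice_def
  by (metis mult_zero_right)

text \<open>The phase covers the cosine and the sine transform at once, and differentiation shifts it by \<open>pi / 2\<close>.\<close>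

definition trig :: "real => (plane => real) => plane => real" where
  "trig \<theta> m x = (LBINT \<xi>. cos (2 * pi * (x \<bullet> \<xi>) + \<theta>) * m \<xi>)"

lemma trig_integrable:
  assumes m: "integrable lborel m" shows "integrable lborel (\<lambda>\<xi>. cos (2 * pi * (x \<bullet> \<xi>) + \<theta>) * m \<xi>)"
proof -
  note [measurable] = borel_measurable_integrable[OF m, simplified]
  show ?thesis
    by (rule bochner_bound[OF m])
      (auto simp: abs_mult intro!: mult_left_le_one_le abs_cos_le_one)
qed

lemma trig_bound: "integrable lborel m ==> \<bar>trig \<theta> m x\<bar> <= (LBINT \<xi>. \<bar>m \<xi>\<bar>)"
  unfolding trig_def using trig_integrable[of m x \<theta>]
  by (intro order_trans[OF integral_abs_bound] integral_mono integrable_abs)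
    (auto simp: abs_mult mult_left_le_one_le)

lemma trig_cmult: "trig \<theta> (\<lambda>\<xi>. c * m \<xi>) x = c * trig \<theta> m x"
  by (simp add: trig_def mult.left_commute)

lemma trig_add:
  "integrable lborel m ==> integrable lborel m' ==> trig \<theta> (\<lambda>\<xi>. m \<xi> + m' \<xi>) x = trig \<theta> m x + trig \<theta> m' x"
  by (simp add: trig_def ring_distribs trig_integrable)

text \<open>The directional derivative of
  \<open>sin (2 * pi * (x \<bullet> \<xi>) + \<theta>) * m \<xi>\<close> has integral zero, and the
  sine is minus the cosine with its phase advanced by \<open>pi / 2\<close>.\<close>

lemma trig_by_parts:
  assumes m: "nice m"
  shows "2 * pi * (x \<bullet> h) * trig \<theta> m x = trig (\<theta> + pi / 2) (\<lambda>\<xi>. frechet_derivative m (at \<xi>) h) x"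
proof -
  let ?D = "\<lambda>\<xi>. frechet_derivative m (at \<xi>)"
  obtain a b where s: "\<And>x. x \<notin> cbox a b ==> m x = 0" using m by (auto simp: nice_def)
  have "(LBINT \<xi>. (2 * pi * (x \<bullet> h)) * (cos (2 * pi * (x \<bullet> \<xi>) + \<theta>) * m \<xi>) + sin (2 * pi * (x \<bullet> \<xi>) + \<theta>) * ?D \<xi> h) = 0"
  proof (rule integral_directional_derivative_eq_0[where f="\<lambda>\<xi>. sin (2 * pi * (x \<bullet> \<xi>) + \<theta>) * m \<xi>"
    and f'="\<lambda>\<xi> h. (2 * pi * (x \<bullet> h)) * (cos (2 * pi * (x \<bullet> \<xi>) + \<theta>) * m \<xi>) + sin (2 * pi * (x \<bullet> \<xi>) + \<theta>) * ?D \<xi> h"])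
    fix \<xi>
    show "((\<lambda>\<xi>. sin (2 * pi * (x \<bullet> \<xi>) + \<theta>) * m \<xi>) has_derivative
      (\<lambda>h. (2 * pi * (x \<bullet> h)) * (cos (2 * pi * (x \<bullet> \<xi>) + \<theta>) * m \<xi>) + sin (2 * pi * (x \<bullet> \<xi>) + \<theta>) * ?D \<xi> h)) (at \<xi>)"
      by (rule derivative_eq_intros nice_has_derivative[OF m] refl | simp add: algebra_simps)+
  next
    show "continuous_on UNIV (\<lambda>\<xi>. (2 * pi * (x \<bullet> h)) * (cos (2 * pi * (x \<bullet> \<xi>) + \<theta>) * m \<xi>) + sin (2 * pi * (x \<bullet> \<xi>) + \<theta>) * ?D \<xi> h)"
      by (intro continuous_intros nice_continuous m nice_derivative)
  qed (use s in auto)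
  moreover have "integrable lborel (\<lambda>\<xi>. (2 * pi * (x \<bullet> h)) * (cos (2 * pi * (x \<bullet> \<xi>) + \<theta>) * m \<xi>))"
    by (intro integrable_mult_right trig_integrable nice_integrable m)
  moreover have "sin (2 * pi * (x \<bullet> \<xi>) + \<theta>) = - cos (2 * pi * (x \<bullet> \<xi>) + (\<theta> + pi / 2))" for \<xi>
    by (simp add: cos_add sin_add)
  moreover have "integrable lborel (\<lambda>\<xi>. - cos (2 * pi * (x \<bullet> \<xi>) + (\<theta> + pi / 2)) * ?D \<xi> h)"
    using integrable_minus[OF trig_integrable[OF nice_integrable[OF nice_derivative[OF m]]]] by simp
  ultimately show ?thesis by (simp add: trig_def)
qed

text \<open>Each factor \<open>(2 * pi * x $ i)\<^sup>2\<close> is exchanged for two derivatives of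
  the symbol. Expanding \<open>(1 + ?a) * (1 + ?b)\<close> leaves four transforms, each bounded by
  the \<open>L^1\<close> norm of its symbol, which depends neither on the phase nor on the
  point.\<close>

lemma trig_decay:
  assumes m: "nice m"
  obtains C where "C >= 0" "\<And>\<theta> x. \<bar>trig \<theta> m x\<bar> <= C * decay x"
proof -
  define D where "D = (\<lambda>i (m :: plane => real) \<xi>. frechet_derivative m (at \<xi>) (axis (i::2) (1::real)))"
  have nD: "nice (D i m)" if "nice m" for i m unfolding D_def by (rule nice_derivative[OF that])
  have D2: "(2 * pi * x $ i)\<^sup>2 * trig \<theta> m x = trig (\<theta> + pi / 2 + pi / 2) (D i (D i m)) x" if "nice m" for i m \<theta> x
  proof -
    have 1: "2 * pi * x $ i * trig \<theta> m x = trig (\<theta> + pi / 2) (D i m) x" if "nice m" for m \<theta>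
      using trig_by_parts[OF that, of x "axis i 1" \<theta>] by (simp add: D_def inner_axis)
    show ?thesis
      unfolding power2_eq_square by (simp only: mult.assoc[of "2 * pi * x $ i"] 1[OF that] 1[OF nD[OF that]])
  qed
  define I where "I = (\<lambda>m :: plane => real. LBINT \<xi>. \<bar>m \<xi>\<bar>)"
  have I: "\<bar>trig \<theta> m x\<bar> <= I m" if "nice m" for m \<theta> x
    using trig_bound[OF nice_integrable[OF that]] by (simp add: I_def)
  define C where "C = I m + I (D 1 (D 1 m)) + I (D 2 (D 2 m)) + I (D 2 (D 2 (D 1 (D 1 m))))"
  have "\<bar>trig \<theta> m x\<bar> <= C * decay x" for \<theta> x
  proof -
    let ?a = "(2 * pi * x $ 1)\<^sup>2" and ?b = "(2 * pi * x $ 2)\<^sup>2" and ?g = "trig \<theta> m x"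
    have 1: "\<bar>?g\<bar> <= I m" by (rule I[OF m])
    have 2: "\<bar>?a * ?g\<bar> <= I (D 1 (D 1 m))" unfolding D2[OF m] by (intro I nD m)
    have 3: "\<bar>?b * ?g\<bar> <= I (D 2 (D 2 m))" unfolding D2[OF m] by (intro I nD m)
    have "?b * (?a * ?g) = trig (\<theta> + pi / 2 + pi / 2 + pi / 2 + pi / 2) (D 2 (D 2 (D 1 (D 1 m)))) x"
      unfolding D2[OF m] by (intro D2 nD m)
    then have 4: "\<bar>?b * (?a * ?g)\<bar> <= I (D 2 (D 2 (D 1 (D 1 m))))" by (metis I nD m)
    have ab: "(x $ 1)\<^sup>2 <= ?a" "(x $ 2)\<^sup>2 <= ?b"
    proof -
      have p: "1 <= (2 * pi)\<^sup>2" using pi_ge_two by (intro one_le_power) auto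
      show "(x $ 1)\<^sup>2 <= ?a" "(x $ 2)\<^sup>2 <= ?b"
        using mult_right_mono[OF p, of "(x $ 1)\<^sup>2"] mult_right_mono[OF p, of "(x $ 2)\<^sup>2"]
        by (simp_all add: power_mult_distrib)
    qed
    have "(1 + (x $ 1)\<^sup>2) * (1 + (x $ 2)\<^sup>2) * \<bar>?g\<bar> <= (1 + ?a) * (1 + ?b) * \<bar>?g\<bar>"
      using ab by (intro mult_mono) auto
    also have "\<dots> = \<bar>?g\<bar> + \<bar>?a * ?g\<bar> + \<bar>?b * ?g\<bar> + \<bar>?b * (?a * ?g)\<bar>"
      by (simp add: abs_mult algebra_simps)
    also have "\<dots> <= C" using 1 2 3 4 by (simp add: C_def)
    finally show ?thesis
      unfolding decay_def by (simp add: field_simps add_pos_nonneg)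
  qed
  moreover have "C >= 0" unfolding C_def I_def by simp
  ultimately show thesis using that by blast
qed

lemma trig_has_real_derivative:
  assumes m: "nice m"
  shows "((\<lambda>t. trig \<theta> m (x + t *\<^sub>R h)) has_real_derivative
    trig (\<theta> + pi / 2) (\<lambda>\<xi>. 2 * pi * (h \<bullet> \<xi>) * m \<xi>) (x + t *\<^sub>R h)) (at t)"
proof -
  obtain a b where s: "\<And>x. x \<notin> cbox a b ==> m x = 0" using m by (auto simp: nice_def)
  have eq: "trig \<theta> m x = integral (cbox a b) (\<lambda>\<xi>. cos (2 * pi * (x \<bullet> \<xi>) + \<theta>) * m \<xi>)"
    if "continuous_on UNIV m" "\<And>x. x \<notin> cbox a b ==> m x = 0" for \<theta> m x
    unfolding trig_def using that
    by (intro integral_eq_integral_cbox continuous_intros) auto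
  have mc: "continuous_on UNIV m" by (rule nice_continuous[OF m])
  have "((\<lambda>t. integral (cbox a b) (\<lambda>\<xi>. cos (2 * pi * ((x + t *\<^sub>R h) \<bullet> \<xi>) + \<theta>) * m \<xi>)) has_real_derivative
     integral (cbox a b) (\<lambda>\<xi>. cos (2 * pi * ((x + t *\<^sub>R h) \<bullet> \<xi>) + (\<theta> + pi / 2)) * (2 * pi * (h \<bullet> \<xi>) * m \<xi>))) (at t)"
  proof (rule leibniz_rule_field_derivative[of UNIV])
    fix t \<xi>
    have "((\<lambda>t. cos (2 * pi * ((x + t *\<^sub>R h) \<bullet> \<xi>) + \<theta>) * m \<xi>) has_real_derivative
        - sin (2 * pi * ((x + t *\<^sub>R h) \<bullet> \<xi>) + \<theta>) * (2 * pi * (h \<bullet> \<xi>)) * m \<xi>) (at t)"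
      by (auto intro!: derivative_eq_intros simp: inner_add_left)
    then show "((\<lambda>t. cos (2 * pi * ((x + t *\<^sub>R h) \<bullet> \<xi>) + \<theta>) * m \<xi>) has_real_derivative
        cos (2 * pi * ((x + t *\<^sub>R h) \<bullet> \<xi>) + (\<theta> + pi / 2)) * (2 * pi * (h \<bullet> \<xi>) * m \<xi>)) (at t)"
      by (simp add: cos_add sin_add algebra_simps)
  next
    show "(\<lambda>\<xi>. cos (2 * pi * ((x + t *\<^sub>R h) \<bullet> \<xi>) + \<theta>) * m \<xi>) integrable_on cbox a b" for t
      by (intro integrable_continuous continuous_intros continuous_on_subset[OF mc]) auto
    show "continuous_on (UNIV \<times> cbox a b) (\<lambda>(t, \<xi>). cos (2 * pi * ((x + t *\<^sub>R h) \<bullet> \<xi>) + (\<theta> + pi / 2)) * (2 * pi * (h \<bullet> \<xi>) * m \<xi>))"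
      unfolding split_beta by (intro continuous_intros continuous_on_compose2[OF mc]) auto
  qed auto
  moreover have "continuous_on UNIV (\<lambda>\<xi>. 2 * pi * (h \<bullet> \<xi>) * m \<xi>)"
    by (intro continuous_intros mc)
  ultimately show ?thesis
    using eq[OF mc s] eq[of "\<lambda>\<xi>. 2 * pi * (h \<bullet> \<xi>) * m \<xi>"] s by simp
qed


lemma trig_measurable [measurable]:
  assumes [measurable]: "borel_fun m"
  shows "borel_fun (trig \<theta> m)"
  unfolding trig_def[abs_def] by measurable

lemma trig_even: "a \<in> borel_measurable borel ==> trig 0 a (- x) = trig 0 a x"
  by (simp add: trig_def)

lemma trig_inner_expand:
  assumes "nice m"
  shows "trig \<theta> (\<lambda>\<xi>. 2 * pi * (h \<bullet> \<xi>) * m \<xi>) x =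
    h $ 1 * trig \<theta> (\<lambda>\<xi>. (2 * pi * \<xi> $ 1) * m \<xi>) x + h $ 2 * trig \<theta> (\<lambda>\<xi>. (2 * pi * \<xi> $ 2) * m \<xi>) x"
proof -
  have n: "nice (\<lambda>\<xi>. (2 * pi * \<xi> $ i) * m \<xi>)" for i
    by (intro nice_linear_mult assms bounded_linear_const_mult bounded_linear_vec_nth)
  have "(\<lambda>\<xi>. 2 * pi * (h \<bullet> \<xi>) * m \<xi>) =
      (\<lambda>\<xi>. h $ 1 * ((2 * pi * \<xi> $ 1) * m \<xi>) + h $ 2 * ((2 * pi * \<xi> $ 2) * m \<xi>))"
    by (auto simp: inner_vec_def sum_2 algebra_simps)
  then show ?thesis
    using trig_add[OF integrable_mult_right[OF nice_integrable[OF n], of "h$1" 1] integrable_mult_right[OF nice_integrable[OF n], of "h$2" 2], of \<theta> x]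
    by (simp add: trig_cmult)
qed

text \<open>Splitting \<open>h\<close> into coordinates reduces to two fixed symbols; this makes the
  constant uniform in \<open>h\<close> and the growth in \<open>h\<close> linear.\<close>

lemma trig_inner_decay:
  assumes m: "nice m"
  obtains C where "C >= 0" "\<And>\<theta> h x. \<bar>trig \<theta> (\<lambda>\<xi>. 2 * pi * (h \<bullet> \<xi>) * m \<xi>) x\<bar> <= C * norm h * decay x"
proof -
  have n: "nice (\<lambda>\<xi>. (2 * pi * \<xi> $ i) * m \<xi>)" for i
    by (intro nice_linear_mult m bounded_linear_const_mult bounded_linear_vec_nth)
  obtain C1 where C1: "C1 >= 0" "\<And>\<theta> x. \<bar>trig \<theta> (\<lambda>\<xi>. (2 * pi * \<xi> $ 1) * m \<xi>) x\<bar> <= C1 * decay x"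
    using trig_decay[OF n[of 1]] by metis
  obtain C2 where C2: "C2 >= 0" "\<And>\<theta> x. \<bar>trig \<theta> (\<lambda>\<xi>. (2 * pi * \<xi> $ 2) * m \<xi>) x\<bar> <= C2 * decay x"
    using trig_decay[OF n[of 2]] by metis
  have "\<bar>trig \<theta> (\<lambda>\<xi>. 2 * pi * (h \<bullet> \<xi>) * m \<xi>) x\<bar> <= (C1 + C2) * norm h * decay x" for \<theta> h x
  proof -
    have "\<bar>trig \<theta> (\<lambda>\<xi>. 2 * pi * (h \<bullet> \<xi>) * m \<xi>) x\<bar> <= \<bar>h $ 1\<bar> * (C1 * decay x) + \<bar>h $ 2\<bar> * (C2 * decay x)"
      unfolding trig_inner_expand[OF m] using C1(2)[of \<theta> x] C2(2)[of \<theta> x]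
      by (intro order_trans[OF abs_triangle_ineq] add_mono) (auto simp: abs_mult intro!: mult_left_mono)
    also have "\<dots> <= norm h * (C1 * decay x) + norm h * (C2 * decay x)"
      using C1(1) C2(1) decay_pos[of x] by (intro add_mono mult_right_mono component_le_norm_cart) auto
    finally show ?thesis by (simp add: algebra_simps)
  qed
  then show thesis using that[of "C1 + C2"] C1(1) C2(1) by simp
qed

lemma trig_inner_inner_decay:
  assumes m: "nice m"
  obtains C where "C >= 0"
    "\<And>\<theta> h x. \<bar>trig \<theta> (\<lambda>\<xi>. 2 * pi * (h \<bullet> \<xi>) * (2 * pi * (h \<bullet> \<xi>) * m \<xi>)) x\<bar> <= C * (norm h)\<^sup>2 * decay x"
proof -
  have n: "nice (\<lambda>\<xi>. (2 * pi * \<xi> $ i) * m \<xi>)" for i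
    by (intro nice_linear_mult m bounded_linear_const_mult bounded_linear_vec_nth)
  have n': "nice (\<lambda>\<xi>. (2 * pi * (h \<bullet> \<xi>)) * m \<xi>)" for h
    by (intro nice_linear_mult m bounded_linear_const_mult bounded_linear_inner_right)
  obtain C1 where C1: "C1 >= 0" "\<And>\<theta> h x. \<bar>trig \<theta> (\<lambda>\<xi>. 2 * pi * (h \<bullet> \<xi>) * ((2 * pi * \<xi> $ 1) * m \<xi>)) x\<bar> <= C1 * norm h * decay x"
    by (rule trig_inner_decay[OF n[of 1]]) (rule that)
  obtain C2 where C2: "C2 >= 0" "\<And>\<theta> h x. \<bar>trig \<theta> (\<lambda>\<xi>. 2 * pi * (h \<bullet> \<xi>) * ((2 * pi * \<xi> $ 2) * m \<xi>)) x\<bar> <= C2 * norm h * decay x"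
    by (rule trig_inner_decay[OF n[of 2]]) (rule that)
  have "\<bar>trig \<theta> (\<lambda>\<xi>. 2 * pi * (h \<bullet> \<xi>) * (2 * pi * (h \<bullet> \<xi>) * m \<xi>)) x\<bar> <= (C1 + C2) * (norm h)\<^sup>2 * decay x" for \<theta> h x
  proof -
    have eq: "trig \<theta> (\<lambda>\<xi>. 2 * pi * (h \<bullet> \<xi>) * (2 * pi * (h \<bullet> \<xi>) * m \<xi>)) x =
       h $ 1 * trig \<theta> (\<lambda>\<xi>. 2 * pi * (h \<bullet> \<xi>) * ((2 * pi * \<xi> $ 1) * m \<xi>)) x
       + h $ 2 * trig \<theta> (\<lambda>\<xi>. 2 * pi * (h \<bullet> \<xi>) * ((2 * pi * \<xi> $ 2) * m \<xi>)) x"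
      using trig_inner_expand[OF n'[of h], of \<theta> h x] by (simp add: mult_ac)
    have "\<bar>trig \<theta> (\<lambda>\<xi>. 2 * pi * (h \<bullet> \<xi>) * (2 * pi * (h \<bullet> \<xi>) * m \<xi>)) x\<bar>
      <= \<bar>h $ 1\<bar> * (C1 * norm h * decay x) + \<bar>h $ 2\<bar> * (C2 * norm h * decay x)"
      unfolding eq using C1(2)[of \<theta> h x] C2(2)[of \<theta> h x]
      by (intro order_trans[OF abs_triangle_ineq] add_mono) (auto simp: abs_mult intro!: mult_left_mono)
    also have "\<dots> <= norm h * (C1 * norm h * decay x) + norm h * (C2 * norm h * decay x)"
      using C1(1) C2(1) decay_pos[of x] by (intro add_mono mult_right_mono component_le_norm_cart) auto
    finally show ?thesis by (simp add: algebra_simps power2_eq_square)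
  qed
  then show thesis using that[of "C1 + C2"] C1(1) C2(1) by simp
qed

lemma integrable_decay_bound:
  assumes [measurable]: "borel_fun f" and b: "\<And>x. \<bar>f x\<bar> <= C * decay x"
  shows "integrable lborel f" "(LBINT x. \<bar>f x\<bar>) <= C * (LBINT x. decay x)"
proof -
  have i: "integrable lborel (\<lambda>x. C * decay x)" using integrable_decay by simp
  show 1: "integrable lborel f"
    by (rule bochner_bound[OF i]) (auto intro: order_trans[OF b abs_ge_self])
  have "(LBINT x. \<bar>f x\<bar>) <= (LBINT x. C * decay x)"
    by (rule integral_mono) (use 1 i b in auto)
  then show "(LBINT x. \<bar>f x\<bar>) <= C * (LBINT x. decay x)" by simp
qed

section \<open>The kernel of the frequency cutoff\<close>

lemma nice_lp_cutoff: "nice lp_cutoff"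
proof -
  obtain a where a: "cball (0::plane) 2 \<subseteq> cbox (- a) a"
    using bounded_subset_cbox_symmetric[OF bounded_cball] by blast
  have "lp_cutoff x = 0" if "x \<notin> cbox (- a) a" for x
    using that a smooth_step_0[of "2 - norm x"] by (force simp: lp_cutoff_eq_step)
  then show ?thesis unfolding nice_def using Ckon_lp_cutoff by blast
qed

definition cutoff_kernel :: "plane => real" where
  "cutoff_kernel = trig 0 lp_cutoff"

definition cutoff_kernel_deriv :: "plane => plane => real" where
  "cutoff_kernel_deriv h = trig (pi / 2) (\<lambda>\<xi>. 2 * pi * (h \<bullet> \<xi>) * lp_cutoff \<xi>)"

lemma cutoff_measurable [measurable]:
  "borel_fun lp_cutoff" "borel_fun cutoff_kernel"
  "borel_fun (cutoff_kernel_deriv h)"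
proof -
  show [measurable]: "borel_fun lp_cutoff"
    by (rule continuous_borel[OF nice_continuous[OF nice_lp_cutoff]])
  show "borel_fun cutoff_kernel" "borel_fun (cutoff_kernel_deriv h)"
    unfolding cutoff_kernel_def cutoff_kernel_deriv_def by measurable
qed

lemma cutoff_kernel_even: "cutoff_kernel (- x) = cutoff_kernel x"
  by (simp add: cutoff_kernel_def trig_even)

lemma cutoff_kernel_deriv_linear: "linear (\<lambda>h. cutoff_kernel_deriv h x)"
  unfolding cutoff_kernel_deriv_def trig_inner_expand[OF nice_lp_cutoff]
  by (intro linearI) (auto simp: algebra_simps)

text \<open>These are Bernstein estimates at unit frequency. In the last one, Taylor's formula gives
  order \<open>(norm h)\<^sup>2\<close> for small \<open>h\<close> and the triangle inequality order
  \<open>norm h\<close> for large \<open>h\<close>; both are at most a multiple of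
  \<open>norm h powr (1 + a)\<close> because \<open>a\<close> lies between 0 and 1.\<close>

lemma cutoff_kernel_bounds:
  obtains A where "A >= 0" "integrable lborel cutoff_kernel" "(LBINT z. \<bar>cutoff_kernel z\<bar>) <= A"
    "\<And>z. \<bar>cutoff_kernel z\<bar> <= A"
    "\<And>h. integrable lborel (cutoff_kernel_deriv h)"
    "\<And>h. (LBINT z. \<bar>cutoff_kernel_deriv h z\<bar>) <= A * norm h"
    "\<And>h a. 0 <= a ==> a <= 1 ==>
       (LBINT z. \<bar>cutoff_kernel (z + h) - cutoff_kernel z - cutoff_kernel_deriv h z\<bar>) <= A * norm h powr (1 + a)"
proof -
  note m = nice_lp_cutoff
  obtain C0 where C0: "C0 >= 0" "\<And>x. \<bar>cutoff_kernel x\<bar> <= C0 * decay x"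
    using trig_decay[OF m] unfolding cutoff_kernel_def by metis
  obtain C1 where C1: "C1 >= 0" "\<And>h x. \<bar>cutoff_kernel_deriv h x\<bar> <= C1 * norm h * decay x"
    using trig_inner_decay[OF m] unfolding cutoff_kernel_deriv_def by metis
  obtain C2 where C2: "C2 >= 0" 
    "\<And>\<theta> h x. \<bar>trig \<theta> (\<lambda>\<xi>. 2 * pi * (h \<bullet> \<xi>) * (2 * pi * (h \<bullet> \<xi>) * lp_cutoff \<xi>)) x\<bar> <= C2 * (norm h)\<^sup>2 * decay x"
    by (rule trig_inner_inner_decay[OF m]) (rule that)
  define I where "I = (LBINT x. decay x)"
  have I: "I >= 0" unfolding I_def using decay_pos by (simp add: less_imp_le)
  have d1: "decay x <= 1" for x unfolding decay_def by (intro mult_le_one) (auto simp: divide_le_eq add_pos_nonneg)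
  have K0: "integrable lborel cutoff_kernel" "(LBINT z. \<bar>cutoff_kernel z\<bar>) <= C0 * I"
    using integrable_decay_bound[OF _ C0(2)] by (auto simp: I_def)
  have K1: "integrable lborel (cutoff_kernel_deriv h)" "(LBINT z. \<bar>cutoff_kernel_deriv h z\<bar>) <= C1 * norm h * I" for h
    using integrable_decay_bound[OF _ C1(2)] by (auto simp: I_def)
  define Q where "Q = (\<lambda>h z. cutoff_kernel (z + h) - cutoff_kernel z - cutoff_kernel_deriv h z)"
  \<comment> \<open>Two mean value estimates along the segment from \<open>x\<close> to
    \<open>x + h\<close> bound the remainder by the second derivative; \<open>decay_shift\<close>
    moves the weight back to \<open>x\<close> at the cost of the factor 9.\<close>
  have Q1: "(LBINT z. \<bar>Q h z\<bar>) <= 9 * C2 * (norm h)\<^sup>2 * I" if h: "norm h <= 1" for h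
  proof -
    have "\<bar>Q h x\<bar> <= 9 * C2 * (norm h)\<^sup>2 * decay x" for x
    proof -
      let ?K = "9 * C2 * (norm h)\<^sup>2 * decay x"
      have D1: "((\<lambda>t. cutoff_kernel (x + t *\<^sub>R h)) has_real_derivative cutoff_kernel_deriv h (x + t *\<^sub>R h)) (at t)" for t
        using trig_has_real_derivative[OF m, of 0 x h t] by (simp add: cutoff_kernel_def cutoff_kernel_deriv_def)
      have n': "nice (\<lambda>\<xi>. (2 * pi * (h \<bullet> \<xi>)) * lp_cutoff \<xi>)"
        by (intro nice_linear_mult m bounded_linear_const_mult bounded_linear_inner_right)
      have D2: "((\<lambda>t. cutoff_kernel_deriv h (x + t *\<^sub>R h)) has_real_derivative 
          trig (pi / 2 + pi / 2) (\<lambda>\<xi>. 2 * pi * (h \<bullet> \<xi>) * (2 * pi * (h \<bullet> \<xi>) * lp_cutoff \<xi>)) (x + t *\<^sub>R h)) (at t)" for t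
        using trig_has_real_derivative[OF n', of "pi / 2" x h t] by (simp add: cutoff_kernel_deriv_def)
      have B2: "\<bar>trig (pi / 2 + pi / 2) (\<lambda>\<xi>. 2 * pi * (h \<bullet> \<xi>) * (2 * pi * (h \<bullet> \<xi>) * lp_cutoff \<xi>)) (x + t *\<^sub>R h)\<bar> <= ?K"
        if t: "0 <= t" "t <= 1" for t
      proof -
        have "norm (t *\<^sub>R h) <= 1" using t h mult_le_one[of t "norm h"] by simp
        then have "C2 * (norm h)\<^sup>2 * decay (x + t *\<^sub>R h) <= C2 * (norm h)\<^sup>2 * (9 * decay x)"
          using C2(1) by (intro mult_left_mono decay_shift) auto
        then show ?thesis using C2(2)[of "pi/2+pi/2" h "x + t *\<^sub>R h"] by simp
      qed
      have K0: "?K >= 0" using C2(1) decay_pos[of x] by simp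
      have B1: "\<bar>cutoff_kernel_deriv h (x + t *\<^sub>R h) - cutoff_kernel_deriv h x\<bar> <= ?K" if t: "0 <= t" "t <= 1" for t
      proof -
        have "\<bar>cutoff_kernel_deriv h (x + t *\<^sub>R h) - cutoff_kernel_deriv h (x + 0 *\<^sub>R h)\<bar> <= ?K * (t - 0)"
          by (rule abs_diff_le_of_deriv[OF t(1) D2]) (use B2 t in auto)
        also have "\<dots> <= ?K" using K0 t by (simp add: mult_left_le)
        finally show ?thesis by simp
      qed
      have "\<bar>(cutoff_kernel (x + 1 *\<^sub>R h) - 1 * cutoff_kernel_deriv h x) - (cutoff_kernel (x + 0 *\<^sub>R h) - 0 * cutoff_kernel_deriv h x)\<bar> <= ?K * (1 - 0)"
        by (rule abs_diff_le_of_deriv[where f'="\<lambda>t. cutoff_kernel_deriv h (x + t *\<^sub>R h) - cutoff_kernel_deriv h x"])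
          (auto intro!: derivative_eq_intros D1 B1)
      then show ?thesis by (simp add: Q_def algebra_simps)
    qed
    then show ?thesis using integrable_decay_bound(2)[of "Q h" "9 * C2 * (norm h)\<^sup>2"] by (simp add: I_def Q_def)
  qed
  have Q2: "(LBINT z. \<bar>Q h z\<bar>) <= 2 * (C0 * I) + C1 * norm h * I" for h
  proof -
    have sh: "integrable lborel (\<lambda>z. cutoff_kernel (z + h))" "(LBINT z. \<bar>cutoff_kernel (z + h)\<bar>) = (LBINT z. \<bar>cutoff_kernel z\<bar>)"
      using lborel_integral_shift(2)[of cutoff_kernel h] lborel_integral_shift(1)[of "\<lambda>z. \<bar>cutoff_kernel z\<bar>" h] K0(1)
      by (simp_all add: add.commute)
    have "(LBINT z. \<bar>Q h z\<bar>) <= (LBINT z. \<bar>cutoff_kernel (z + h)\<bar> + \<bar>cutoff_kernel z\<bar> + \<bar>cutoff_kernel_deriv h z\<bar>)"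
      unfolding Q_def using sh K0 K1 by (intro integral_mono) auto
    also have "\<dots> = (LBINT z. \<bar>cutoff_kernel z\<bar>) + (LBINT z. \<bar>cutoff_kernel z\<bar>) + (LBINT z. \<bar>cutoff_kernel_deriv h z\<bar>)"
      using sh K0 K1 by simp
    finally show ?thesis using K0(2) K1(2)[of h] by simp
  qed
  \<comment> \<open>\<open>C0\<close> is for the pointwise bound,
    \<open>2 * (C0 * I) + C1 * I\<close> for large increments and \<open>9 * C2 * I\<close> for
    small ones.\<close>
  define A where "A = C0 + 2 * (C0 * I) + C1 * I + 9 * C2 * I"
  have nn: "C0 * I >= 0" "C1 * I >= 0" "C2 * I >= 0" using C0(1) C1(1) C2(1) I by auto
  show thesis
  proof (rule that[of A])
    show "A >= 0" unfolding A_def using nn C0(1) by linarith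
    show "integrable lborel cutoff_kernel" "integrable lborel (cutoff_kernel_deriv h)" for h by fact+
    show "(LBINT z. \<bar>cutoff_kernel z\<bar>) <= A" unfolding A_def using nn C0(1) K0(2) by linarith
    have "C0 * decay z <= C0" for z using d1[of z] C0(1) by (simp add: mult_left_le)
    from this C0(2) have "\<bar>cutoff_kernel z\<bar> <= C0" for z by (rule order_trans[rotated])
    then show "\<bar>cutoff_kernel z\<bar> <= A" for z
      by (rule order_trans) (use nn C0(1) in \<open>simp add: A_def\<close>)
    have "C1 * I * norm h <= A * norm h" for h :: plane
      unfolding A_def using nn C0(1) by (intro mult_right_mono) auto
    then show "(LBINT z. \<bar>cutoff_kernel_deriv h z\<bar>) <= A * norm h" for h
      using K1(2)[of h] by (smt (verit) mult.assoc mult.commute)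
    fix h :: plane and a :: real assume a: "0 <= a" "a <= 1"
    have "(LBINT z. \<bar>Q h z\<bar>) <= A * norm h powr (1 + a)"
    proof (cases "norm h <= 1")
      case True
      have "(norm h)\<^sup>2 <= norm h powr (1 + a)"
      proof (cases "h = 0")
        case False
        have "norm h powr 2 <= norm h powr (1 + a)" using True False a by (intro powr_mono') auto
        then show ?thesis using False by simp
      qed simp
      then have "9 * (C2 * I) * (norm h)\<^sup>2 <= A * norm h powr (1 + a)"
        using nn C0(1) by (intro mult_mono) (auto simp: A_def)
      then show ?thesis using Q1[OF True] by (simp add: mult_ac)
    next
      case False
      have h1: "norm h powr 1 <= norm h powr (1 + a)" "1 <= norm h"
        using powr_mono[of 1 "1 + a" "norm h"] False a by auto
      have "2 * (C0 * I) + C1 * I * norm h <= (2 * (C0 * I)) * norm h + C1 * I * norm h"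
        using nn h1 mult_left_mono[of 1 "norm h" "2 * (C0 * I)"] by simp
      also have "\<dots> = (2 * (C0 * I) + C1 * I) * norm h" by (simp add: algebra_simps)
      also have "\<dots> <= A * norm h powr (1 + a)"
        using nn C0(1) h1 by (intro mult_mono) (auto simp: A_def)
      finally show ?thesis using Q2[of h] by (simp add: mult_ac)
    qed
    then show "(LBINT z. \<bar>cutoff_kernel (z + h) - cutoff_kernel z - cutoff_kernel_deriv h z\<bar>) <= A * norm h powr (1 + a)"
      by (simp add: Q_def)
  qed
qed


section \<open>Fourier inversion by Gaussian summation\<close>

text \<open>Real and imaginary part of the characteristic function of the standard normal law at
  frequency \<open>2 * pi * t\<close>, with the normalising factor removed. The result is again a
  normal density, of standard deviation \<open>1 / (2 * pi)\<close>.\<close>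

lemma gauss_trig_1:
  fixes t :: real
  defines "nd \<equiv> normal_density 0 (1 / (2 * pi))"
  shows "integrable lborel (\<lambda>x. cos (2 * pi * (x * t)) * exp (- x\<^sup>2 / 2))"
    and "(LBINT x. cos (2 * pi * (x * t)) * exp (- x\<^sup>2 / 2)) = nd t"
    and "integrable lborel (\<lambda>x. sin (2 * pi * (x * t)) * exp (- x\<^sup>2 / 2))"
    and "(LBINT x. sin (2 * pi * (x * t)) * exp (- x\<^sup>2 / 2)) = 0"
proof -
  define r where "r = 2 * pi * t"
  let ?f = "\<lambda>x. std_normal_density x *\<^sub>R iexp (r * x)"
  have sd: "std_normal_density x * sqrt (2 * pi) = exp (- x\<^sup>2 / 2)" for x
    by (simp add: std_normal_density_def)
  have i: "integrable lborel ?f"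
    by (rule bochner_bound[OF integrable_normal_density[of 1 0, OF zero_less_one]])
      (auto simp: norm_exp_i_times)
  have "char std_normal_distribution r = (LBINT x. ?f x)"
    unfolding char_def by (subst integral_density) (auto simp: normal_density_nonneg)
  then have ch: "(LBINT x. ?f x) = of_real (exp (- r\<^sup>2 / 2))"
    by (simp add: char_std_normal_distribution)
  have c: "Re (?f x) * sqrt (2 * pi) = cos (2 * pi * (x * t)) * exp (- x\<^sup>2 / 2)"
    and s: "Im (?f x) * sqrt (2 * pi) = sin (2 * pi * (x * t)) * exp (- x\<^sup>2 / 2)" for x
    unfolding sd[symmetric] by (simp_all add: r_def Re_exp Im_exp mult_ac)
  show "integrable lborel (\<lambda>x. cos (2 * pi * (x * t)) * exp (- x\<^sup>2 / 2))"
    "integrable lborel (\<lambda>x. sin (2 * pi * (x * t)) * exp (- x\<^sup>2 / 2))"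
    unfolding c[symmetric] s[symmetric] by (intro integrable_mult_left integrable_Re integrable_Im i)+
  have "(LBINT x. cos (2 * pi * (x * t)) * exp (- x\<^sup>2 / 2)) = exp (- r\<^sup>2 / 2) * sqrt (2 * pi)"
    unfolding c[symmetric] using i ch by (simp add: integral_Re del: scaleR_complex.simps)
  also have "\<dots> = nd t"
  proof -
    have "sqrt (2 * pi * (1 / (2 * pi))\<^sup>2) = 1 / sqrt (2 * pi)"
      by (simp add: real_sqrt_divide power2_eq_square real_sqrt_mult field_simps)
    moreover have "- r\<^sup>2 / 2 = - (t - 0)\<^sup>2 / (2 * (1 / (2 * pi))\<^sup>2)"
      by (simp add: r_def field_simps power2_eq_square)
    ultimately show ?thesis unfolding nd_def normal_density_def by simp
  qed
  finally show "(LBINT x. cos (2 * pi * (x * t)) * exp (- x\<^sup>2 / 2)) = nd t" .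
  show "(LBINT x. sin (2 * pi * (x * t)) * exp (- x\<^sup>2 / 2)) = 0"
    unfolding s[symmetric] using i ch by (simp add: integral_Im del: scaleR_complex.simps)
qed

text \<open>Normalised by its value 1 at the origin; it is the transform \<open>gauss_hat\<close>
  that has integral 1.\<close>

definition gauss :: "plane => real" where
  "gauss x = exp (- (x $ 1)\<^sup>2 / 2) * exp (- (x $ 2)\<^sup>2 / 2)"

definition gauss_hat :: "plane => real" where
  "gauss_hat t = normal_density 0 (1 / (2 * pi)) (t $ 1) * normal_density 0 (1 / (2 * pi)) (t $ 2)"

lemma gauss_measurable [measurable]: "borel_fun gauss" "borel_fun gauss_hat"
  unfolding gauss_def[abs_def] gauss_hat_def[abs_def] normal_density_def
  by (intro continuous_borel continuous_intros; simp)+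

lemma gauss_integrable: "integrable lborel gauss"
  using plane_integral_prod(1)[OF gauss_trig_1(1)[of 0] gauss_trig_1(1)[of 0]] by (simp add: gauss_def[abs_def])

lemma gauss_bounds: "0 <= gauss x" "gauss x <= 1" "gauss 0 = 1"
  by (auto simp: gauss_def intro!: mult_le_one)

lemma isCont_gauss: "isCont gauss x"
  unfolding gauss_def by (intro continuous_intros) simp_all

lemma gauss_hat_integral: "integrable lborel gauss_hat" "(LBINT t. gauss_hat t) = 1"
  using plane_integral_prod[of "normal_density 0 (1 / (2 * pi))" "normal_density 0 (1 / (2 * pi))"]
    integral_normal_density[of "1 / (2 * pi)" 0] integrable_normal_density[of "1 / (2 * pi)" 0]
  by (simp_all add: gauss_hat_def[abs_def])

lemma gauss_hat_even: "gauss_hat (- t) = gauss_hat t"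
  by (simp add: gauss_hat_def normal_density_def)

lemma gauss_trig: "(LBINT x. cos (2 * pi * (x \<bullet> t)) * gauss x) = gauss_hat t"
proof -
  have "(\<lambda>x. cos (2 * pi * (x \<bullet> t)) * gauss x) = (\<lambda>x.
     (cos (2 * pi * (x $ 1 * t $ 1)) * exp (- (x $ 1)\<^sup>2 / 2)) * (cos (2 * pi * (x $ 2 * t $ 2)) * exp (- (x $ 2)\<^sup>2 / 2))
     - (sin (2 * pi * (x $ 1 * t $ 1)) * exp (- (x $ 1)\<^sup>2 / 2)) * (sin (2 * pi * (x $ 2 * t $ 2)) * exp (- (x $ 2)\<^sup>2 / 2)))"
    by (auto simp: gauss_def inner_vec_def sum_2 cos_add ring_distribs mult_ac)
  then show ?thesis
    by (simp only: gauss_hat_def gauss_trig_1(2,4) mult_zero_left diff_0_right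
      Bochner_Integration.integral_diff[OF plane_integral_prod(1)[OF gauss_trig_1(1)[of "t$1"] gauss_trig_1(1)[of "t$2"]]
        plane_integral_prod(1)[OF gauss_trig_1(3)[of "t$1"] gauss_trig_1(3)[of "t$2"]]]
      plane_integral_prod(2)[OF gauss_trig_1(1)[of "t$1"] gauss_trig_1(1)[of "t$2"]]
      plane_integral_prod(2)[OF gauss_trig_1(3)[of "t$1"] gauss_trig_1(3)[of "t$2"]])
qed

lemma gauss_trig_scaled:
  assumes \<delta>: "\<delta> > 0"
  shows "(LBINT x. cos (2 * pi * (x \<bullet> t)) * gauss (\<delta> *\<^sub>R x)) = gauss_hat (t /\<^sub>R \<delta>) / \<delta>\<^sup>2"
    "integrable lborel (\<lambda>x. gauss (\<delta> *\<^sub>R x))"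
proof -
  have "(0 + \<delta> *\<^sub>R x) \<bullet> (t /\<^sub>R \<delta>) = x \<bullet> t" for x using \<delta> by (simp add: field_simps)
  then have "(LBINT x. cos (2 * pi * (x \<bullet> t)) * gauss (\<delta> *\<^sub>R x))
     = (LBINT x. cos (2 * pi * ((0 + \<delta> *\<^sub>R x) \<bullet> (t /\<^sub>R \<delta>))) * gauss (0 + \<delta> *\<^sub>R x))"
    by (simp only: add_0)
  also have "\<dots> = (LBINT x. cos (2 * pi * (x \<bullet> (t /\<^sub>R \<delta>))) * gauss x) /\<^sub>R \<bar>\<delta>\<bar> ^ DIM(plane)"
    using \<delta> by (intro lborel_affine_integral) auto
  also have "\<dots> = gauss_hat (t /\<^sub>R \<delta>) / \<delta>\<^sup>2"
    unfolding gauss_trig by (simp add: divide_inverse mult.commute)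
  finally show "(LBINT x. cos (2 * pi * (x \<bullet> t)) * gauss (\<delta> *\<^sub>R x)) = gauss_hat (t /\<^sub>R \<delta>) / \<delta>\<^sup>2" .
  show "integrable lborel (\<lambda>x. gauss (\<delta> *\<^sub>R x))"
    using lborel_affine_integrable_iff[of gauss \<delta> 0] \<delta> gauss_integrable by simp
qed

text \<open>With the factor \<open>gauss (\<delta> n *\<^sub>R z)\<close> the double integral
  converges absolutely, and exchanging the order turns it into an average of \<open>a\<close>
  against \<open>gauss_hat\<close> at scale \<open>\<delta> n\<close>. As the scale tends to 0, both
  expressions converge, to the two sides of the claim.\<close>

lemma trig_inversion:
  assumes a: "continuous_on UNIV a" "integrable lborel a" "\<And>\<xi>. \<bar>a \<xi>\<bar> <= A" "\<And>\<xi>. a (- \<xi>) = a \<xi>"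
    and \<kappa>: "integrable lborel (trig 0 a)"
  shows "(LBINT z. trig 0 a z * cos (2 * pi * (z \<bullet> \<xi>))) = a \<xi>"
proof (rule LIMSEQ_unique)
  note [measurable] = continuous_borel[OF a(1)]
  define \<delta> where "\<delta> = (\<lambda>n. 1 / real (Suc n))"
  have \<delta>: "\<delta> n > 0" for n by (simp add: \<delta>_def)
  have \<delta>0: "\<delta> \<longlonglongrightarrow> 0" unfolding \<delta>_def using LIMSEQ_inverse_real_of_nat by (simp add: inverse_eq_divide)
  have sc: "(\<lambda>n. \<delta> n *\<^sub>R z) \<longlonglongrightarrow> 0" for z :: plane using tendsto_scaleR[OF \<delta>0 tendsto_const[of z]] by simp
  define I where "I = (\<lambda>n. LBINT z. trig 0 a z * cos (2 * pi * (z \<bullet> \<xi>)) * gauss (\<delta> n *\<^sub>R z))"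
  show "I \<longlonglongrightarrow> (LBINT z. trig 0 a z * cos (2 * pi * (z \<bullet> \<xi>)))"
    unfolding I_def
  proof (rule integral_dominated_convergence[where w="\<lambda>z. \<bar>trig 0 a z\<bar>"])
    have "(\<lambda>n. gauss (\<delta> n *\<^sub>R z)) \<longlonglongrightarrow> 1" for z
      using isCont_tendsto_compose[OF isCont_gauss sc] gauss_bounds(3) by metis
    from tendsto_mult[OF tendsto_const this]
    show "AE z in lborel. (\<lambda>n. trig 0 a z * cos (2 * pi * (z \<bullet> \<xi>)) * gauss (\<delta> n *\<^sub>R z)) \<longlonglongrightarrow> trig 0 a z * cos (2 * pi * (z \<bullet> \<xi>))"
      by simp
    show "AE z in lborel. norm (trig 0 a z * cos (2 * pi * (z \<bullet> \<xi>)) * gauss (\<delta> n *\<^sub>R z)) <= \<bar>trig 0 a z\<bar>" for n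
      using gauss_bounds abs_cos_le_one
      by (auto simp: abs_mult mult.assoc intro!: mult_left_le mult_le_one)
  qed (use \<kappa> in auto)
  have I: "I n = (LBINT s. a (\<xi> + \<delta> n *\<^sub>R s) * gauss_hat s)" for n
  proof -
    let ?d = "\<delta> n"
    let ?G = "\<lambda>t. gauss_hat (t /\<^sub>R ?d) / ?d\<^sup>2"
    have int: "integrable (lborel \<Otimes>\<^sub>M lborel) (\<lambda>(z, \<eta>). cos (2 * pi * (z \<bullet> \<eta>)) * a \<eta> * cos (2 * pi * (z \<bullet> \<xi>)) * gauss (?d *\<^sub>R z))"
    proof (rule bochner_bound)
      show "integrable (lborel \<Otimes>\<^sub>M lborel) (\<lambda>p. gauss (?d *\<^sub>R (fst p :: plane)) * a (snd p))"
        by (rule lborel_pair.Fubini_integrable)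
          (use a(2) gauss_trig_scaled(2)[OF \<delta>[of n]] in \<open>auto simp: abs_mult\<close>)
      show "AE p in lborel \<Otimes>\<^sub>M lborel. norm (case p of (z, \<eta>) => cos (2 * pi * (z \<bullet> \<eta>)) * a \<eta> * cos (2 * pi * (z \<bullet> \<xi>)) * gauss (?d *\<^sub>R z))
          <= norm (gauss (?d *\<^sub>R (fst p :: plane)) * a (snd p))"
      proof (rule AE_I2, safe)
        fix z \<eta> :: plane
        have "\<bar>cos (2 * pi * (z \<bullet> \<eta>))\<bar> * \<bar>cos (2 * pi * (z \<bullet> \<xi>))\<bar> * \<bar>gauss (?d *\<^sub>R z) * a \<eta>\<bar> <= 1 * \<bar>gauss (?d *\<^sub>R z) * a \<eta>\<bar>"
          by (intro mult_right_mono mult_le_one) auto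
        then show "norm (cos (2 * pi * (z \<bullet> \<eta>)) * a \<eta> * cos (2 * pi * (z \<bullet> \<xi>)) * gauss (?d *\<^sub>R z)) <= norm (gauss (?d *\<^sub>R fst (z, \<eta>)) * a (snd (z, \<eta>)))"
          by (simp add: abs_mult mult_ac)
      qed
    qed measurable
    have "I n = (LBINT z. LBINT \<eta>. cos (2 * pi * (z \<bullet> \<eta>)) * a \<eta> * cos (2 * pi * (z \<bullet> \<xi>)) * gauss (?d *\<^sub>R z))"
      unfolding I_def trig_def by simp
    also have "\<dots> = (LBINT \<eta>. LBINT z. cos (2 * pi * (z \<bullet> \<eta>)) * a \<eta> * cos (2 * pi * (z \<bullet> \<xi>)) * gauss (?d *\<^sub>R z))"
      using lborel_pair.Fubini_integral[OF int] by simp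
    also have "\<dots> = (LBINT \<eta>. (a \<eta> * ?G (\<eta> - \<xi>)) / 2 + (a \<eta> * ?G (\<eta> + \<xi>)) / 2)"
    proof (rule Bochner_Integration.integral_cong[OF refl])
      fix \<eta>
      have gi: "integrable lborel (\<lambda>z. cos (2 * pi * (z \<bullet> t)) * gauss (?d *\<^sub>R z))" for t
        by (rule bochner_bound[OF gauss_trig_scaled(2)[OF \<delta>[of n]]])
          (auto simp: abs_mult intro!: mult_left_le_one_le)
      \<comment> \<open>The product of cosines as a sum: two Gaussians appear, centred at \<xi> and
        at \<open>- \<xi>\<close>, and they contribute equally since \<open>a\<close> is
        even.\<close>
      have "cos (2 * pi * (z \<bullet> \<eta>)) * a \<eta> * cos (2 * pi * (z \<bullet> \<xi>)) * gauss (?d *\<^sub>R z) =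
        (a \<eta> / 2) * (cos (2 * pi * (z \<bullet> (\<eta> - \<xi>))) * gauss (?d *\<^sub>R z) + cos (2 * pi * (z \<bullet> (\<eta> + \<xi>))) * gauss (?d *\<^sub>R z))" for z
        by (simp add: inner_diff_right inner_add_right cos_add cos_diff ring_distribs)
      then show "(LBINT z. cos (2 * pi * (z \<bullet> \<eta>)) * a \<eta> * cos (2 * pi * (z \<bullet> \<xi>)) * gauss (?d *\<^sub>R z)) =
          (a \<eta> * ?G (\<eta> - \<xi>)) / 2 + (a \<eta> * ?G (\<eta> + \<xi>)) / 2"
        using gi by (simp add: gauss_trig_scaled(1)[OF \<delta>] ring_distribs)
    qed
    also have "\<dots> = (LBINT \<eta>. a \<eta> * ?G (\<eta> - \<xi>))"
    proof -
      have Gi: "integrable lborel (\<lambda>\<eta>. a \<eta> * ?G (\<eta> - \<xi>))"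
      proof (rule bochner_bound)
        have "integrable lborel (\<lambda>\<eta>. ?G (\<eta> - \<xi>))"
          using lborel_affine_integrable_iff[of "\<lambda>\<eta>. ?G (\<eta> - \<xi>)" "?d" \<xi>] \<delta>[of n] gauss_hat_integral(1)
          by simp
        then show "integrable lborel (\<lambda>\<eta>. A * ?G (\<eta> - \<xi>))" by (rule integrable_mult_right)
        show "AE \<eta> in lborel. norm (a \<eta> * ?G (\<eta> - \<xi>)) <= norm (A * ?G (\<eta> - \<xi>))"
          using order_trans[OF a(3) abs_ge_self] by (auto simp: abs_mult intro!: mult_right_mono divide_right_mono)
      qed simp
      have eq: "(LBINT \<eta>. a \<eta> * ?G (\<eta> + \<xi>)) = (LBINT \<eta>. a \<eta> * ?G (\<eta> - \<xi>))"
        "integrable lborel (\<lambda>\<eta>. a \<eta> * ?G (\<eta> + \<xi>)) \<longleftrightarrow> integrable lborel (\<lambda>\<eta>. a \<eta> * ?G (\<eta> - \<xi>))"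
      proof -
        have "a (0 - \<eta>) * ?G (0 - \<eta> - \<xi>) = a \<eta> * ?G (\<eta> + \<xi>)" for \<eta>
          using gauss_hat_even[of "(\<eta> + \<xi>) /\<^sub>R ?d"] a(4)[of \<eta>] by (simp flip: scaleR_minus_right)
        then have e: "(\<lambda>\<eta>. a \<eta> * ?G (\<eta> + \<xi>)) = (\<lambda>\<eta>. a (0 - \<eta>) * ?G (0 - \<eta> - \<xi>))" by (simp only:)
        show "(LBINT \<eta>. a \<eta> * ?G (\<eta> + \<xi>)) = (LBINT \<eta>. a \<eta> * ?G (\<eta> - \<xi>))"
          "integrable lborel (\<lambda>\<eta>. a \<eta> * ?G (\<eta> + \<xi>)) \<longleftrightarrow> integrable lborel (\<lambda>\<eta>. a \<eta> * ?G (\<eta> - \<xi>))"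
          unfolding e by (intro lborel_integral_reflect[of "\<lambda>\<eta>. a \<eta> * ?G (\<eta> - \<xi>)" 0]; measurable)+
      qed
      show ?thesis using Gi eq by (subst Bochner_Integration.integral_add) (auto simp del: times_divide_eq_right)
    qed
    also have "\<dots> = (LBINT s. a (\<xi> + ?d *\<^sub>R s) * gauss_hat s)"
    proof -
      have e: "a (\<xi> + ?d *\<^sub>R s) * ?G (\<xi> + ?d *\<^sub>R s - \<xi>) = (a (\<xi> + ?d *\<^sub>R s) * gauss_hat s) / ?d\<^sup>2" for s
        using \<delta>[of n] by simp
      have "(LBINT s. a (\<xi> + ?d *\<^sub>R s) * ?G (\<xi> + ?d *\<^sub>R s - \<xi>)) = (LBINT \<eta>. a \<eta> * ?G (\<eta> - \<xi>)) /\<^sub>R \<bar>?d\<bar> ^ DIM(plane)"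
        using \<delta>[of n] by (intro lborel_affine_integral[of "\<lambda>\<eta>. a \<eta> * ?G (\<eta> - \<xi>)" "?d" \<xi>]) auto
      then have "(LBINT s. a (\<xi> + ?d *\<^sub>R s) * gauss_hat s) / ?d\<^sup>2 = (LBINT \<eta>. a \<eta> * ?G (\<eta> - \<xi>)) / ?d\<^sup>2"
        unfolding e by (simp add: divide_inverse mult.commute[of _ "inverse (?d\<^sup>2)"])
      then show ?thesis using \<delta>[of n] by (simp only: divide_cancel_right) auto
    qed
    finally show ?thesis .
  qed
  have "I \<longlonglongrightarrow> (LBINT s. a \<xi> * gauss_hat s)"
    unfolding I
  proof (rule integral_dominated_convergence[where w="\<lambda>s. A * \<bar>gauss_hat s\<bar>"])
    have "isCont a \<xi>" using a(1) by (simp add: continuous_on_eq_continuous_at)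
    have "(\<lambda>n. \<xi> + \<delta> n *\<^sub>R s) \<longlonglongrightarrow> \<xi>" for s using tendsto_add[OF tendsto_const sc] by simp
    then have "(\<lambda>n. a (\<xi> + \<delta> n *\<^sub>R s)) \<longlonglongrightarrow> a \<xi>" for s using isCont_tendsto_compose[OF \<open>isCont a \<xi>\<close>] by blast
    then show "AE s in lborel. (\<lambda>n. a (\<xi> + \<delta> n *\<^sub>R s) * gauss_hat s) \<longlonglongrightarrow> a \<xi> * gauss_hat s"
      by (auto intro!: tendsto_intros)
    show "AE s in lborel. norm (a (\<xi> + \<delta> n *\<^sub>R s) * gauss_hat s) <= A * \<bar>gauss_hat s\<bar>" for n
      using a(3) by (auto simp: abs_mult intro!: mult_right_mono)
  qed (use gauss_hat_integral in auto)
  then show "I \<longlonglongrightarrow> a \<xi>" using gauss_hat_integral by simp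
qed

text \<open>Convolution with \<kappa> multiplies the symbol \<open>b\<close> by the transform
  \<open>a\<close>, which acts as the identity on \<open>b\<close>. The sine part drops out because
  \<kappa> is even.\<close>

lemma trig_reproducing:
  assumes \<kappa>: "integrable lborel \<kappa>" "\<And>z. \<kappa> (- z) = \<kappa> z" "\<And>\<xi>. (LBINT z. \<kappa> z * cos (2 * pi * (z \<bullet> \<xi>))) = a \<xi>"
    and b: "integrable lborel b" "\<And>\<xi>. a \<xi> * b \<xi> = b \<xi>"
  shows "(LBINT z. \<kappa> z * trig 0 b (x - z)) = trig 0 b x"
proof -
  note [measurable] = borel_measurable_integrable[OF \<kappa>(1), simplified] borel_measurable_integrable[OF b(1), simplified]
  have int: "integrable (lborel \<Otimes>\<^sub>M lborel) (\<lambda>(z, \<xi>). \<kappa> z * (cos (2 * pi * ((x - z) \<bullet> \<xi>)) * b \<xi>))"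
  proof (rule bochner_bound)
    show "integrable (lborel \<Otimes>\<^sub>M lborel) (\<lambda>p. \<kappa> (fst p) * b (snd p))"
      by (rule lborel_pair.Fubini_integrable) (use b \<kappa> in \<open>auto simp: abs_mult\<close>)
    show "AE p in lborel \<Otimes>\<^sub>M lborel. norm (case p of (z, \<xi>) => \<kappa> z * (cos (2 * pi * ((x - z) \<bullet> \<xi>)) * b \<xi>)) <= norm (\<kappa> (fst p) * b (snd p))"
      by (rule AE_I2) (auto simp: abs_mult intro!: mult_left_mono mult_left_le_one_le)
  qed measurable
  have tri: "integrable lborel (\<lambda>z. \<kappa> z * cos (2 * pi * (z \<bullet> \<xi>)))" "integrable lborel (\<lambda>z. \<kappa> z * sin (2 * pi * (z \<bullet> \<xi>)))" for \<xi>
    by (rule bochner_bound[OF \<kappa>(1)], auto simp: abs_mult intro!: mult_left_le)+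
  have sin0: "(LBINT z. \<kappa> z * sin (2 * pi * (z \<bullet> \<xi>))) = 0" for \<xi>
    using lborel_integral_reflect(1)[of "\<lambda>z. \<kappa> z * sin (2 * pi * (z \<bullet> \<xi>))" 0] \<kappa>(2) by simp
  have "(LBINT z. \<kappa> z * trig 0 b (x - z)) = (LBINT z. LBINT \<xi>. \<kappa> z * (cos (2 * pi * ((x - z) \<bullet> \<xi>)) * b \<xi>))"
    by (simp add: trig_def)
  also have "\<dots> = (LBINT \<xi>. LBINT z. \<kappa> z * (cos (2 * pi * ((x - z) \<bullet> \<xi>)) * b \<xi>))"
    using lborel_pair.Fubini_integral[OF int] by simp
  also have "\<dots> = (LBINT \<xi>. cos (2 * pi * (x \<bullet> \<xi>)) * b \<xi>)"
  proof (rule Bochner_Integration.integral_cong[OF refl])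
    fix \<xi>
    have "\<kappa> z * (cos (2 * pi * ((x - z) \<bullet> \<xi>)) * b \<xi>) =
        (cos (2 * pi * (x \<bullet> \<xi>)) * b \<xi>) * (\<kappa> z * cos (2 * pi * (z \<bullet> \<xi>))) + (sin (2 * pi * (x \<bullet> \<xi>)) * b \<xi>) * (\<kappa> z * sin (2 * pi * (z \<bullet> \<xi>)))" for z
      by (simp add: inner_diff_left right_diff_distrib cos_diff ring_distribs mult_ac)
    then have "(LBINT z. \<kappa> z * (cos (2 * pi * ((x - z) \<bullet> \<xi>)) * b \<xi>)) =
        (cos (2 * pi * (x \<bullet> \<xi>)) * b \<xi>) * a \<xi> + (sin (2 * pi * (x \<bullet> \<xi>)) * b \<xi>) * 0"
      by (simp only: Bochner_Integration.integral_add[OF integrable_mult_right[OF tri(1)] integrable_mult_right[OF tri(2)]]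
        integral_mult_right_zero \<kappa>(3) sin0)
    also have "\<dots> = cos (2 * pi * (x \<bullet> \<xi>)) * (a \<xi> * b \<xi>)" by simp
    finally show "(LBINT z. \<kappa> z * (cos (2 * pi * ((x - z) \<bullet> \<xi>)) * b \<xi>)) = cos (2 * pi * (x \<bullet> \<xi>)) * b \<xi>"
      unfolding b(2) .
  qed
  finally show ?thesis by (simp add: trig_def)
qed

section \<open>Dyadic kernels\<close>

lemma trig_scale:
  assumes [measurable]: "borel_fun a" and r: "r > 0"
  shows "trig 0 (\<lambda>\<xi>. a (\<xi> /\<^sub>R r)) x = r\<^sup>2 * trig 0 a (r *\<^sub>R x)"
  using lborel_affine_integral[of "\<lambda>w. cos (2 * pi * ((r *\<^sub>R x) \<bullet> w)) * a w" "1 / r" 0] r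
  by (simp add: trig_def field_simps inverse_eq_divide power2_eq_square)

text \<open>The kernel of the frequency cutoff at scale \<open>r\<close>; the factor is the Jacobian
  of the dilation in the plane.\<close>

definition scaled_kernel :: "real => plane => real" where
  "scaled_kernel r x = r\<^sup>2 * cutoff_kernel (r *\<^sub>R x)"

lemma scaled_kernel_measurable [measurable]: "borel_fun (scaled_kernel r)"
  unfolding scaled_kernel_def[abs_def] by measurable

lemma scaled_kernel_eq: "r > 0 ==> scaled_kernel r = trig 0 (\<lambda>\<xi>. lp_cutoff (\<xi> /\<^sub>R r))"
  by (simp add: scaled_kernel_def[abs_def] trig_scale cutoff_kernel_def fun_eq_iff)

lemma cutoff_kernel_integrable: "integrable lborel cutoff_kernel"
  by (rule cutoff_kernel_bounds)

lemma scaled_kernel_integrable: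
  assumes "r > 0" shows "integrable lborel (scaled_kernel r)"
proof -
  have "integrable lborel (\<lambda>x. cutoff_kernel (0 + r *\<^sub>R x))"
    using lborel_affine_integrable_iff[of cutoff_kernel r 0] cutoff_kernel_integrable assms by auto
  then show ?thesis by (simp add: scaled_kernel_def[abs_def])
qed

lemma cutoff_kernel_transform:
  "(LBINT z. cutoff_kernel z * cos (2 * pi * (z \<bullet> \<xi>))) = lp_cutoff \<xi>"
  unfolding cutoff_kernel_def
proof (rule trig_inversion)
  show "\<bar>lp_cutoff \<xi>\<bar> <= 1" "lp_cutoff (- \<xi>) = lp_cutoff \<xi>" for \<xi>
    using smooth_step_nonneg smooth_step_le1 by (simp_all add: lp_cutoff_eq_step abs_of_nonneg)
  show "integrable lborel (trig 0 lp_cutoff)"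
    using cutoff_kernel_integrable by (simp add: cutoff_kernel_def)
qed (rule nice_continuous nice_integrable, rule nice_lp_cutoff)+

lemma scaled_kernel_transform:
  assumes r: "r > 0"
  shows "(LBINT z. scaled_kernel r z * cos (2 * pi * (z \<bullet> \<xi>))) = lp_cutoff (\<xi> /\<^sub>R r)"
proof -
  have e: "(0 + r *\<^sub>R z) \<bullet> (\<xi> /\<^sub>R r) = z \<bullet> \<xi>" for z using r by (simp add: field_simps)
  have "(LBINT z. cutoff_kernel (0 + r *\<^sub>R z) * cos (2 * pi * ((0 + r *\<^sub>R z) \<bullet> (\<xi> /\<^sub>R r)))) =
    (LBINT z. cutoff_kernel z * cos (2 * pi * (z \<bullet> (\<xi> /\<^sub>R r)))) /\<^sub>R \<bar>r\<bar> ^ DIM(plane)"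
    using r by (intro lborel_affine_integral) auto
  then have "(LBINT z. cutoff_kernel (r *\<^sub>R z) * cos (2 * pi * (z \<bullet> \<xi>))) = lp_cutoff (\<xi> /\<^sub>R r) / r\<^sup>2"
    unfolding e cutoff_kernel_transform by (simp add: divide_inverse)
  then show ?thesis using r by (simp add: scaled_kernel_def mult.assoc)
qed

lemma nice_lp_symbol: "nice (lp_symbol n)"
proof -
  have sc: "nice (\<lambda>\<xi>. lp_cutoff (\<xi> /\<^sub>R r))" if r: "r >= 1" for r
  proof -
    have 1: "Ckon k (- {0}) (\<lambda>\<xi>::plane. 2 - norm (\<xi> /\<^sub>R r))" for k
      using r Ckon_diff[OF _ Ckon_const[of "- {0}" k 2] Ckon_cmult[OF _ Ckon_norm[of k], of "1 / r"]]
      by (simp add: open_Compl divide_inverse mult.commute)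
    have 2: "Ckon k (- {0}) (\<lambda>\<xi>. lp_cutoff (\<xi> /\<^sub>R r))" for k
      using Ckon_compose[OF _ open_UNIV _ 1 Ckon_smooth_step]
      by (simp add: lp_cutoff_eq_step[abs_def] open_Compl)
    have 3: "Ckon k (ball 0 1) (\<lambda>\<xi>. lp_cutoff (\<xi> /\<^sub>R r))" for k
    proof (rule Ckon_cong[OF _ _ Ckon_const[of _ _ 1]])
      fix \<xi> :: plane assume "\<xi> \<in> ball 0 1"
      then have "norm (\<xi> /\<^sub>R r) <= 1" using r by (simp add: field_simps)
      then show "1 = lp_cutoff (\<xi> /\<^sub>R r)" by (simp add: lp_cutoff_eq_step smooth_step_1)
    qed auto
    have U: "UNIV = - {0} \<union> ball (0::plane) 1" by auto
    obtain a where a: "cball (0::plane) (2 * r) \<subseteq> cbox (- a) a"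
      using bounded_subset_cbox_symmetric[OF bounded_cball] by blast
    have "lp_cutoff (x /\<^sub>R r) = 0" if "x \<notin> cbox (- a) a" for x
    proof -
      have "norm x > 2 * r" using that a by force
      then have "2 - norm (x /\<^sub>R r) <= 0" using r by (simp add: field_simps)
      then show ?thesis by (simp only: lp_cutoff_eq_step smooth_step_0)
    qed
    moreover have "Ckon k UNIV (\<lambda>\<xi>. lp_cutoff (\<xi> /\<^sub>R r))" for k
      unfolding U by (rule Ckon_Un[OF _ _ 2 3]) (auto simp: open_Compl)
    ultimately show ?thesis unfolding nice_def by blast
  qed
  have d: "nice (\<lambda>\<xi>. f \<xi> - g \<xi>)" if nf: "nice f" and ng: "nice g" for f g :: "plane => real"
  proof -
    obtain a b where f: "\<And>x. x \<notin> cbox a b ==> f x = 0" using nf by (auto simp: nice_def)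
    obtain c d where g: "\<And>x. x \<notin> cbox c d ==> g x = 0" using ng by (auto simp: nice_def)
    obtain e where "cbox a b \<union> cbox c d \<subseteq> cbox (- e) e"
      using bounded_subset_cbox_symmetric[OF bounded_Un[THEN iffD2, OF conjI[OF bounded_cbox bounded_cbox]]] by blast
    then have "f x - g x = 0" if "x \<notin> cbox (- e) e" for x using f g that by (metis Un_iff diff_self subsetD)
    moreover have "Ckon k UNIV (\<lambda>\<xi>. f \<xi> - g \<xi>)" for k
      using nf ng by (intro Ckon_diff) (simp_all add: nice_def)
    ultimately show ?thesis unfolding nice_def by blast
  qed
  show ?thesis
  proof (cases n)
    case 0
    have "lp_symbol 0 = lp_cutoff" by (rule ext) simp
    then show ?thesis using nice_lp_cutoff 0 by simp
  next
    case (Suc j)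
    have "lp_symbol n = (\<lambda>\<xi>. lp_cutoff (\<xi> /\<^sub>R 2 ^ Suc j) - lp_cutoff (\<xi> /\<^sub>R 2 ^ j))"
      unfolding Suc by (rule ext) simp
    then show ?thesis using d[OF sc[of "2 ^ Suc j"] sc[of "2 ^ j"]] by (simp del: power_Suc)
  qed
qed

lemma lp_kernel_eq_trig: "lp_kernel n = trig 0 (lp_symbol n)"
proof
  fix x
  have i: "integrable lborel (lp_symbol n)" by (rule nice_integrable[OF nice_lp_symbol])
  note [measurable] = borel_measurable_integrable[OF i, simplified]
  have c: "integrable lborel (\<lambda>\<xi>. cis (2 * pi * (x \<bullet> \<xi>)) * of_real (lp_symbol n \<xi>))"
    by (rule bochner_bound[OF i]) (auto simp: norm_mult cis_conv_exp)
  have "inv_fourier (\<lambda>\<xi>. of_real (lp_symbol n \<xi>)) x = (LBINT \<xi>. cis (2 * pi * (x \<bullet> \<xi>)) * of_real (lp_symbol n \<xi>))"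
    unfolding inv_fourier_def by (rule integral_completion) (simp add: cis_conv_exp)
  then show "lp_kernel n x = trig 0 (lp_symbol n) x"
    using integral_Re[OF c] by (simp add: lp_kernel_def trig_def)
qed

text \<open>The dyadic symbols telescope to one dilated cutoff.\<close>

lemma sum_lp_kernel: "(\<Sum>k\<le>n. lp_kernel k x) = scaled_kernel (2 ^ n) x"
proof -
  have "(\<Sum>k\<le>n. lp_symbol k \<xi>) = lp_cutoff (\<xi> /\<^sub>R 2 ^ n)" for \<xi>
    by (induction n) (auto simp del: power_Suc)
  moreover have "(\<Sum>k\<le>n. trig 0 (lp_symbol k) x) = trig 0 (\<lambda>\<xi>. \<Sum>k\<le>n. lp_symbol k \<xi>) x" for n
    unfolding trig_def sum_distrib_left
    by (rule Bochner_Integration.integral_sum[symmetric]) (intro trig_integrable nice_integrable nice_lp_symbol)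
  ultimately show ?thesis by (simp add: lp_kernel_eq_trig scaled_kernel_eq)
qed

text \<open>The cutoff at scale \<open>2 ^ Suc n\<close> equals 1 on the ball of that radius, and
  the symbol with index \<open>n\<close> vanishes outside it.\<close>

lemma lp_kernel_reproducing:
  "(LBINT z. scaled_kernel (2 ^ Suc n) z * lp_kernel n (x - z)) = lp_kernel n x"
  unfolding lp_kernel_eq_trig
proof (rule trig_reproducing[where a="\<lambda>\<xi>. lp_cutoff (\<xi> /\<^sub>R 2 ^ Suc n)"])
  fix \<xi>
  show "lp_cutoff (\<xi> /\<^sub>R 2 ^ Suc n) * lp_symbol n \<xi> = lp_symbol n \<xi>"
  proof (cases "norm \<xi> <= 2 ^ Suc n")
    case True
    then have "norm (\<xi> /\<^sub>R 2 ^ Suc n) <= 1" by (simp add: field_simps)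
    then show ?thesis by (simp add: lp_cutoff_eq_step smooth_step_1 del: power_Suc)
  next
    case False
    have z: "lp_cutoff (\<xi> /\<^sub>R 2 ^ k) = 0" if "k <= n" for k
    proof -
      have "(2::real) ^ k <= 2 ^ n" using that by simp
      then have "2 * 2 ^ k <= norm \<xi>" using False unfolding power_Suc by linarith
      then have "2 - norm (\<xi> /\<^sub>R 2 ^ k) <= 0" by (simp add: field_simps)
      then show ?thesis by (simp only: lp_cutoff_eq_step smooth_step_0)
    qed
    have "lp_symbol n \<xi> = 0"
      using z[of n] z[of "n - 1"] by (cases n) (auto simp del: power_Suc)
    then show ?thesis by simp
  qed
  show "integrable lborel (scaled_kernel (2 ^ Suc n))" by (rule scaled_kernel_integrable) simp
  show "(LBINT z. scaled_kernel (2 ^ Suc n) z * cos (2 * pi * (z \<bullet> \<xi>))) = lp_cutoff (\<xi> /\<^sub>R 2 ^ Suc n)"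
    by (rule scaled_kernel_transform) simp
  show "scaled_kernel (2 ^ Suc n) (- \<xi>) = scaled_kernel (2 ^ Suc n) \<xi>"
    by (simp add: scaled_kernel_def cutoff_kernel_even)
qed (rule nice_integrable[OF nice_lp_symbol])

lemma lp_kernel_bounds:
  obtains C where "C >= 0" "integrable lborel (lp_kernel n)" "\<And>x. \<bar>lp_kernel n x\<bar> <= C" "borel_fun (lp_kernel n)"
proof -
  note m = nice_lp_symbol[of n]
  note [measurable] = continuous_borel[OF nice_continuous[OF m]]
  obtain C where C: "C >= 0" "\<And>x. \<bar>lp_kernel n x\<bar> <= C * decay x"
    using trig_decay[OF m] unfolding lp_kernel_eq_trig by metis
  have "decay x <= 1" for x unfolding decay_def by (intro mult_le_one) (auto simp: divide_le_eq add_pos_nonneg)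
  then have "\<bar>lp_kernel n x\<bar> <= C" for x using C(1) order_trans[OF C(2)[of x] mult_left_le[of "decay x" C]] by blast
  moreover have b: "borel_fun (lp_kernel n)" unfolding lp_kernel_eq_trig by measurable
  ultimately show thesis using that[of C] C(1) integrable_decay_bound(1)[OF b C(2)] by blast
qed

section \<open>Pointwise regularity of Besov functions\<close>

text \<open>Stands in for Hoelder's inequality: against an integrable and bounded kernel, the
  summand 1 is paired with integrability and the power with boundedness.\<close>

lemma abs_le_1_plus_powr: "1 <= q ==> \<bar>y::real\<bar> <= 1 + \<bar>y\<bar> powr q"
proof (cases "\<bar>y\<bar> <= 1")
  case False
  assume "1 <= q"
  then show ?thesis using False powr_mono[of 1 q "\<bar>y\<bar>"] by auto
qed (simp add: add_increasing2)

definition lq :: "real => (plane => real) => bool" where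
  "lq q g \<longleftrightarrow> g \<in> borel_measurable borel \<and> integrable lborel (\<lambda>x. \<bar>g x\<bar> powr q)"

lemma lq_measurable: "lq q g ==> borel_fun g"
  by (simp add: lq_def)

lemma lq_kernel_integrable:
  assumes g: "lq q g" "1 <= q" and K: "integrable lborel K" "\<And>x. \<bar>K x\<bar> <= C" "borel_fun K"
  shows "integrable lborel (\<lambda>y. K (x - y) * g y)"
    and "(LBINT y. \<bar>K (x - y) * g y\<bar>) <= (LBINT y. \<bar>K y\<bar>) + C * (LBINT y. \<bar>g y\<bar> powr q)"
proof -
  note [measurable] = lq_measurable[OF g(1)] K(3)
  have gq: "integrable lborel (\<lambda>x. \<bar>g x\<bar> powr q)" using g(1) by (simp add: lq_def)
  have Ki: "integrable lborel (\<lambda>y. K (x - y))" "(LBINT y. \<bar>K (x - y)\<bar>) = (LBINT y. \<bar>K y\<bar>)"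
    using lborel_integral_reflect[of K x] lborel_integral_reflect[of "\<lambda>y. \<bar>K y\<bar>" x] K by auto
  have i: "integrable lborel (\<lambda>y. \<bar>K (x - y)\<bar> + C * \<bar>g y\<bar> powr q)" using Ki gq by auto
  have b: "\<bar>K (x - y) * g y\<bar> <= \<bar>K (x - y)\<bar> + C * \<bar>g y\<bar> powr q" for y
  proof -
    have "\<bar>K (x - y) * g y\<bar> <= \<bar>K (x - y)\<bar> * (1 + \<bar>g y\<bar> powr q)"
      unfolding abs_mult using abs_le_1_plus_powr[OF g(2)] by (intro mult_left_mono) auto
    also have "\<dots> <= \<bar>K (x - y)\<bar> + C * \<bar>g y\<bar> powr q"
      using mult_right_mono[OF K(2)[of "x - y"], of "\<bar>g y\<bar> powr q"] by (simp add: ring_distribs)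
    finally show ?thesis .
  qed
  show 1: "integrable lborel (\<lambda>y. K (x - y) * g y)"
    by (rule bochner_bound[OF i]) (auto intro: order_trans[OF b abs_ge_self])
  have "(LBINT y. \<bar>K (x - y) * g y\<bar>) <= (LBINT y. \<bar>K (x - y)\<bar> + C * \<bar>g y\<bar> powr q)"
    by (rule integral_mono) (use 1 i b in auto)
  then show "(LBINT y. \<bar>K (x - y) * g y\<bar>) <= (LBINT y. \<bar>K y\<bar>) + C * (LBINT y. \<bar>g y\<bar> powr q)"
    using Ki gq by simp
qed

definition block :: "nat => (plane => real) => plane => real" where
  "block n g x = (LBINT y. lp_kernel n (x - y) * g y)"

definition partial_sum :: "nat => (plane => real) => plane => real" where
  "partial_sum n g x = (LBINT y. scaled_kernel (2 ^ n) (x - y) * g y)"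

text \<open>A pointwise limit is chosen as representative because it inherits joint measurability
  when \<open>g\<close> depends measurably on time.\<close>

definition besov_rep :: "(plane => real) => plane => real" where
  "besov_rep g x = lim (\<lambda>n. partial_sum n g x)"

lemma lp_kernel_measurable [measurable]: "borel_fun (lp_kernel n)"
  by (rule lp_kernel_bounds)

lemma lp_kernel_integrable: "integrable lborel (lp_kernel n)"
  by (rule lp_kernel_bounds)

lemma block_integrable:
  assumes "lq q g" "1 <= q"
  shows "integrable lborel (\<lambda>y. lp_kernel n (x - y) * g y)"
proof -
  obtain C where "\<And>x. \<bar>lp_kernel n x\<bar> <= C" by (rule lp_kernel_bounds[of n]) (rule that)
  then show ?thesis using lq_kernel_integrable(1)[OF assms lp_kernel_integrable _ lp_kernel_measurable] by blast
qed

lemma sum_block: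
  assumes "lq q g" "1 <= q"
  shows "(\<Sum>k\<le>n. block k g x) = partial_sum n g x"
proof -
  have "(\<Sum>k\<le>n. block k g x) = (LBINT y. (\<Sum>k\<le>n. lp_kernel k (x - y) * g y))"
    unfolding block_def by (rule Bochner_Integration.integral_sum[symmetric]) (rule block_integrable[OF assms])
  then show ?thesis by (simp add: partial_sum_def sum_lp_kernel flip: sum_distrib_right)
qed

lemma block_measurable:
  assumes "lq q g" shows "borel_fun (block n g)"
proof -
  note [measurable] = lq_measurable[OF assms]
  show ?thesis unfolding block_def[abs_def] by measurable
qed

text \<open>A block written as convolution of itself with a kernel at its own scale lets a bare sup
  bound control its derivatives, as in Bernstein's inequality.\<close>

lemma block_reproducing:
  assumes g: "lq q g" "1 <= q"
  shows "block n g x = (LBINT y. scaled_kernel (2 ^ Suc n) (x - y) * block n g y)"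
proof -
  note [measurable] = lq_measurable[OF g(1)] block_measurable[OF g(1)]
  let ?P = "scaled_kernel (2 ^ Suc n)" and ?K = "lp_kernel n"
  have P: "integrable lborel ?P" by (rule scaled_kernel_integrable) simp
  obtain C where C: "\<And>x. \<bar>?K x\<bar> <= C" by (rule lp_kernel_bounds[of n]) (rule that)
  note Kg = lq_kernel_integrable[OF g lp_kernel_integrable C lp_kernel_measurable]
  define B where "B = (LBINT y. \<bar>?K y\<bar>) + C * (LBINT y. \<bar>g y\<bar> powr q)"
  have int: "integrable (lborel \<Otimes>\<^sub>M lborel) (\<lambda>(z, y). ?P z * (?K (x - z - y) * g y))"
  proof (rule lborel_pair.Fubini_integrable)
    have nn: "(LBINT y. norm (case (z, y) of (z, y) => ?P z * (?K (x - z - y) * g y)))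
        = \<bar>?P z\<bar> * (LBINT y. \<bar>?K (x - z - y) * g y\<bar>)" for z by (simp add: abs_mult)
    show "integrable lborel (\<lambda>z. LBINT y. norm (case (z, y) of (z, y) => ?P z * (?K (x - z - y) * g y)))"
      unfolding nn
    proof (rule bochner_bound)
      show "integrable lborel (\<lambda>z. B * ?P z)" using P by simp
      have "\<bar>LBINT y. \<bar>?K (x - z - y) * g y\<bar>\<bar> <= \<bar>B\<bar>" for z
        using Kg(2)[of "x - z"] unfolding B_def[symmetric] by (auto simp: abs_of_nonneg)
      then have "\<bar>?P z\<bar> * \<bar>LBINT y. \<bar>?K (x - z - y) * g y\<bar>\<bar> <= \<bar>?P z\<bar> * \<bar>B\<bar>" for z
        by (intro mult_left_mono) auto
      then show "AE z in lborel. norm (\<bar>?P z\<bar> * (LBINT y. \<bar>?K (x - z - y) * g y\<bar>)) <= norm (B * ?P z)"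
        by (intro AE_I2) (simp only: real_norm_def abs_mult abs_idempotent mult.commute[of "\<bar>B\<bar>"])
    qed measurable
    show "AE z in lborel. integrable lborel (\<lambda>y. case (z, y) of (z, y) => ?P z * (?K (x - z - y) * g y))"
      using Kg(1) by auto
  qed measurable
  have "(LBINT y. ?P (x - y) * block n g y) = (LBINT z. ?P z * block n g (x - z))"
    using lborel_integral_reflect(1)[of "\<lambda>z. ?P z * block n g (x - z)" x] by simp
  also have "\<dots> = (LBINT z. LBINT y. ?P z * (?K (x - z - y) * g y))"
    by (simp add: block_def)
  also have "\<dots> = (LBINT y. LBINT z. ?P z * (?K (x - z - y) * g y))"
    using lborel_pair.Fubini_integral[OF int] by simp
  also have "\<dots> = (LBINT y. ?K (x - y) * g y)"
  proof (rule Bochner_Integration.integral_cong[OF refl])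
    fix y
    have "?P z * (?K (x - z - y) * g y) = (?P z * ?K (x - y - z)) * g y" for z
      by (simp only: mult.assoc cancel_ab_semigroup_add_class.diff_right_commute[of x z y])
    then have "(LBINT z. ?P z * (?K (x - z - y) * g y)) = (LBINT z. ?P z * ?K (x - y - z)) * g y"
      by (simp only: integral_mult_left_zero)
    then show "(LBINT z. ?P z * (?K (x - z - y) * g y)) = ?K (x - y) * g y"
      by (simp only: lp_kernel_reproducing)
  qed
  finally show ?thesis by (simp add: block_def)
qed

text \<open>After the substitution of \<open>x - y /\<^sub>R r\<close> for \<open>y\<close> the
  kernel stands at unit scale and the increment becomes \<open>r *\<^sub>R h\<close>; every estimate
  is then an \<open>L^1\<close> bound on a kernel times the essential bound on
  \<open>F\<close>.\<close>

lemma scaled_kernel_convolution_regular: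
  assumes F[measurable]: "borel_fun F" and A: "AE x in lborel. \<bar>F x\<bar> <= A" "A >= 0" and r: "r > 0"
    and A0: "A0 >= 0" "(LBINT z. \<bar>cutoff_kernel z\<bar>) <= A0"
      "\<And>h. integrable lborel (cutoff_kernel_deriv h)"
      "\<And>h. (LBINT z. \<bar>cutoff_kernel_deriv h z\<bar>) <= A0 * norm h"
      "\<And>h. (LBINT z. \<bar>cutoff_kernel (z + h) - cutoff_kernel z - cutoff_kernel_deriv h z\<bar>) <= A0 * norm h powr (1 + a)"
  defines "G \<equiv> \<lambda>x. LBINT y. scaled_kernel r (x - y) * F y"
  defines "L \<equiv> \<lambda>x h. LBINT y. cutoff_kernel_deriv (r *\<^sub>R h) y * F (x - y /\<^sub>R r)"
  shows "\<bar>G x\<bar> <= A0 * A" "linear (L x)" "\<bar>L x h\<bar> <= A0 * A * (r * norm h)"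
    "\<bar>G (x + h) - G x - L x h\<bar> <= A0 * A * (r * norm h) powr (1 + a)"
proof -
  have K: "integrable lborel cutoff_kernel" by (rule cutoff_kernel_integrable)
  have KF: "integrable lborel (\<lambda>y. k y * F (x - y /\<^sub>R r))" "\<bar>LBINT y. k y * F (x - y /\<^sub>R r)\<bar> <= A * (LBINT y. \<bar>k y\<bar>)"
    if k: "integrable lborel k" for k :: "plane => real" and x
  proof -
    note [measurable] = borel_measurable_integrable[OF k, simplified]
    \<comment> \<open>Affine maps preserve null sets, so the essential bound survives the
      substitution.\<close>
    have AE: "AE y in lborel. \<bar>F (x - y /\<^sub>R r)\<bar> <= A"
    proof -
      have c: "- inverse r \<noteq> 0" using r by simp
      from A(1) have "AE y in density (distr lborel borel (\<lambda>y. x + (- inverse r) *\<^sub>R y)) (\<lambda>_. \<bar>- inverse r\<bar> ^ DIM(plane)). \<bar>F y\<bar> <= A"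
        unfolding lborel_affine[OF c, of x, symmetric] .
      then show ?thesis using r by (simp add: AE_density AE_distr_iff)
    qed
    have b: "AE y in lborel. \<bar>k y * F (x - y /\<^sub>R r)\<bar> <= A * \<bar>k y\<bar>"
      using AE by eventually_elim (auto simp: abs_mult mult.commute[of A] intro!: mult_left_mono)
    have i: "integrable lborel (\<lambda>y. A * \<bar>k y\<bar>)" using k by simp
    show 1: "integrable lborel (\<lambda>y. k y * F (x - y /\<^sub>R r))"
      by (rule bochner_bound[OF i]) (use b A(2) in auto)
    have "\<bar>LBINT y. k y * F (x - y /\<^sub>R r)\<bar> <= (LBINT y. \<bar>k y * F (x - y /\<^sub>R r)\<bar>)"
      by (rule integral_abs_bound)
    also have "\<dots> <= (LBINT y. A * \<bar>k y\<bar>)"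
      by (rule integral_mono_AE) (use 1 i b in auto)
    finally show "\<bar>LBINT y. k y * F (x - y /\<^sub>R r)\<bar> <= A * (LBINT y. \<bar>k y\<bar>)" by simp
  qed
  have G: "G (x + h) = (LBINT y. cutoff_kernel (y + r *\<^sub>R h) * F (x - y /\<^sub>R r))" for x h
  proof -
    have A: "(LBINT y. scaled_kernel r (x + h - (x + (- inverse r) *\<^sub>R y)) * F (x + (- inverse r) *\<^sub>R y))
      = (LBINT y. scaled_kernel r (x + h - y) * F y) /\<^sub>R \<bar>- inverse r\<bar> ^ DIM(plane)"
      using r by (intro lborel_affine_integral[of "\<lambda>y. scaled_kernel r (x + h - y) * F y"]) auto
    have e: "scaled_kernel r (x + h - (x + (- inverse r) *\<^sub>R y)) * F (x + (- inverse r) *\<^sub>R y)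
       = r\<^sup>2 * (cutoff_kernel (y + r *\<^sub>R h) * F (x - y /\<^sub>R r))" for y
      using r by (simp add: scaled_kernel_def algebra_simps)
    let ?I = "LBINT y. cutoff_kernel (y + r *\<^sub>R h) * F (x - y /\<^sub>R r)"
    have "r\<^sup>2 * ?I = G (x + h) /\<^sub>R \<bar>- inverse r\<bar> ^ DIM(plane)"
      using A unfolding e integral_mult_right_zero G_def .
    also have "\<dots> = r\<^sup>2 * G (x + h)" by (simp add: power_inverse)
    finally show ?thesis using r by simp
  qed
  have G0: "G x = (LBINT y. cutoff_kernel y * F (x - y /\<^sub>R r))" for x using G[of x 0] by simp
  show "\<bar>G x\<bar> <= A0 * A"
    unfolding G0 using order_trans[OF KF(2)[OF K] mult_left_mono[OF A0(2) A(2)]] by (simp add: mult.commute)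
  show "linear (L x)"
  proof (rule linearI)
    show "L x (h + k) = L x h + L x k" for h k
      using linear_add[OF cutoff_kernel_deriv_linear, of "r *\<^sub>R h" "r *\<^sub>R k"] KF(1)[OF A0(3)]
      by (simp add: L_def scaleR_add_right ring_distribs)
    show "L x (c *\<^sub>R h) = c *\<^sub>R L x h" for c h
      using linear_cmul[OF cutoff_kernel_deriv_linear, of c "r *\<^sub>R h"]
      by (simp add: L_def mult.assoc mult.commute[of r c])
  qed
  have "\<bar>L x h\<bar> <= A * (A0 * norm (r *\<^sub>R h))"
    unfolding L_def using order_trans[OF KF(2)[OF A0(3)] mult_left_mono[OF A0(4) A(2)]] .
  then show "\<bar>L x h\<bar> <= A0 * A * (r * norm h)" using r by (simp add: mult_ac)
  have sh: "integrable lborel (\<lambda>y. cutoff_kernel (y + r *\<^sub>R h))"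
    using lborel_integral_shift(2)[of cutoff_kernel "r *\<^sub>R h"] K by (simp add: add.commute)
  have "G (x + h) - G x - L x h = (LBINT y. (cutoff_kernel (y + r *\<^sub>R h) - cutoff_kernel y - cutoff_kernel_deriv (r *\<^sub>R h) y) * F (x - y /\<^sub>R r))"
    unfolding G[of x h] G0[of x] L_def left_diff_distrib
    using KF(1)[OF sh] KF(1)[OF K] KF(1)[OF A0(3)] by simp
  also have "\<bar>\<dots>\<bar> <= A * (A0 * norm (r *\<^sub>R h) powr (1 + a))"
    using sh K A0(3) by (intro order_trans[OF KF(2) mult_left_mono[OF A0(5) A(2)]]) auto
  finally show "\<bar>G (x + h) - G x - L x h\<bar> <= A0 * A * (r * norm h) powr (1 + a)" using r by (simp add: mult_ac)
qed

text \<open>The kernels \<open>scaled_kernel (2 ^ n)\<close> form an approximate identity at scale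
  \<open>1 / 2 ^ n\<close>, since the integral of \<open>cutoff_kernel\<close> is
  \<open>lp_cutoff 0 = 1\<close>. Convergence is on balls because \<open>g\<close> is only in
  \<open>L^q\<close>.\<close>

lemma partial_sum_tendsto_L1:
  assumes g: "lq q g" "1 <= q"
  shows "(\<lambda>n. LBINT x. indicator (ball 0 R) x * \<bar>partial_sum n g x - g x\<bar>) \<longlonglongrightarrow> 0"
proof -
  note [measurable] = lq_measurable[OF g(1)]
  have gq: "integrable lborel (\<lambda>x. \<bar>g x\<bar> powr q)" using g(1) by (simp add: lq_def)
  have [measurable]: "ball (0::plane) R \<in> sets borel" for R by simp
  have ib: "integrable lborel (indicat_real (ball (0::plane) R))" for R
    by (rule integrable_real_indicator[OF _ emeasure_lborel_ball_finite]) simp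
  have b: "\<bar>indicat_real (ball 0 R) x * y\<bar> <= indicat_real (ball 0 R) x + \<bar>y\<bar> powr q" for x :: plane and y R
    using abs_le_1_plus_powr[OF g(2), of y] by (auto simp: indicator_def)
  have sh: "integrable lborel (\<lambda>x. \<bar>g (x - z)\<bar> powr q)" "(LBINT x. \<bar>g (x - z)\<bar> powr q) = (LBINT x. \<bar>g x\<bar> powr q)" for z
    using lborel_integral_shift[of "\<lambda>x. \<bar>g x\<bar> powr q" "- z"] gq by simp_all
  have fi: "integrable lborel (\<lambda>x. indicat_real (ball 0 R) x * g (x - z))" for z R
  proof (rule bochner_bound[OF Bochner_Integration.integrable_add[OF ib[of R] sh(1)[of z]]])
    show "AE x in lborel. norm (indicat_real (ball 0 R) x * g (x - z)) <= norm (indicat_real (ball 0 R) x + \<bar>g (x - z)\<bar> powr q)"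
      using order_trans[OF b abs_ge_self] by simp
  qed simp
  have fi': "integrable lborel (\<lambda>x. indicat_real (ball 0 R) x * \<bar>g (x - z)\<bar>)" for z
    using integrable_abs[OF fi[of R z]] by (simp add: abs_mult)
  have C: "(LBINT x. indicat_real (ball 0 R) x * \<bar>g (x - z)\<bar>) <= (LBINT x. indicat_real (ball (0::plane) R) x) + (LBINT x. \<bar>g x\<bar> powr q)" for z
  proof -
    have "(LBINT x. indicat_real (ball 0 R) x * \<bar>g (x - z)\<bar>) <= (LBINT x. indicat_real (ball 0 R) x + \<bar>g (x - z)\<bar> powr q)"
      by (intro integral_mono fi' Bochner_Integration.integrable_add ib sh)
        (use b[of R _ "g (_ - z)"] in \<open>auto simp: abs_mult\<close>)
    also have "\<dots> = (LBINT x. indicat_real (ball (0::plane) R) x) + (LBINT x. \<bar>g x\<bar> powr q)"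
      by (simp only: Bochner_Integration.integral_add[OF ib sh(1)] sh(2))
    finally show ?thesis .
  qed
  have cut0: "(LBINT z. cutoff_kernel z) = 1"
    using cutoff_kernel_transform[of 0] by (simp add: lp_cutoff_eq_step smooth_step_1)
  have "(\<lambda>n. (1/2::real) ^ n) \<longlonglongrightarrow> 0" by (rule LIMSEQ_power_zero) simp
  then have eps: "(\<lambda>n. 1 / 2 ^ n :: real) \<longlonglongrightarrow> 0" by (simp add: power_one_over)
  have "(\<lambda>n. LBINT x. indicator (ball 0 R) x * \<bar>(LBINT z. cutoff_kernel z * g (x - (1 / 2 ^ n) *\<^sub>R z)) - g x\<bar>) \<longlonglongrightarrow> 0"
  proof (rule approx_identity_L1[OF _ _ cutoff_kernel_integrable cut0 fi C _ _ _ eps])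
    show "x - z \<in> ball 0 (R + 1)" if "x \<in> ball 0 R" "norm z <= 1" for x z :: plane
      using that norm_triangle_ineq4[of x z] by simp
    show "integrable lborel (\<lambda>x. indicat_real (ball 0 (R + 1)) x * g x)" using fi[of "R + 1" 0] by simp
  qed auto
  moreover have "(LBINT z. cutoff_kernel z * g (x - (1 / 2 ^ n) *\<^sub>R z)) = partial_sum n g x" for n x
  proof -
    let ?r = "(2::real) ^ n"
    have "(LBINT z. scaled_kernel ?r (x - (x + (- inverse ?r) *\<^sub>R z)) * g (x + (- inverse ?r) *\<^sub>R z))
      = (LBINT y. scaled_kernel ?r (x - y) * g y) /\<^sub>R \<bar>- inverse ?r\<bar> ^ DIM(plane)"
      by (intro lborel_affine_integral[of "\<lambda>y. scaled_kernel ?r (x - y) * g y"]) auto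
    moreover have "scaled_kernel ?r (x - (x + (- inverse ?r) *\<^sub>R z)) * g (x + (- inverse ?r) *\<^sub>R z)
       = ?r\<^sup>2 * (cutoff_kernel z * g (x - (1 / ?r) *\<^sub>R z))" for z
      by (simp add: scaled_kernel_def inverse_eq_divide)
    ultimately show ?thesis by (simp add: partial_sum_def power_inverse)
  qed
  ultimately show ?thesis by simp
qed

text \<open>Up to constants, block \<open>n\<close> has size \<open>2 powr (- s * n)\<close>; its
  derivative costs a factor \<open>2 ^ n\<close>, its Taylor remainder the same factor to the power
  \<open>1 + a\<close>. Since \<open>1 + a < s\<close>, all three series are dominated by a
  geometric one, and the sum inherits a first-order expansion.\<close>

theorem besov_rep_regular:
  assumes a: "0 < a" "a <= 1" "1 + a < s"
  obtains C where "C >= 0"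
    "\<And>q g M. lq q g ==> 1 <= q ==> M >= 0 ==> (\<And>n. AE x in lborel. \<bar>block n g x\<bar> <= M * 2 powr (- s * (real n - 1))) ==>
      (AE x in lborel. besov_rep g x = g x) \<and> (\<forall>x. \<bar>besov_rep g x\<bar> <= C * M) \<and>
      (\<exists>L. \<forall>x. linear (L x) \<and> (\<forall>h. \<bar>L x h\<bar> <= C * M * norm h) \<and>
        (\<forall>h. \<bar>besov_rep g (x + h) - besov_rep g x - L x h\<bar> <= C * M * norm h powr (1 + a)))"
proof -
  obtain A0 where A0: "A0 >= 0" "(LBINT z. \<bar>cutoff_kernel z\<bar>) <= A0"
      "\<And>h. integrable lborel (cutoff_kernel_deriv h)"
      "\<And>h. (LBINT z. \<bar>cutoff_kernel_deriv h z\<bar>) <= A0 * norm h"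
      "\<And>h. (LBINT z. \<bar>cutoff_kernel (z + h) - cutoff_kernel z - cutoff_kernel_deriv h z\<bar>) <= A0 * norm h powr (1 + a)"
  proof (rule cutoff_kernel_bounds)
    fix A :: real
    assume 1: "\<And>A0. \<lbrakk>A0 >= 0; (LBINT z. \<bar>cutoff_kernel z\<bar>) <= A0;
      \<And>h. integrable lborel (cutoff_kernel_deriv h);
      \<And>h. (LBINT z. \<bar>cutoff_kernel_deriv h z\<bar>) <= A0 * norm h;
      \<And>h. (LBINT z. \<bar>cutoff_kernel (z + h) - cutoff_kernel z - cutoff_kernel_deriv h z\<bar>) <= A0 * norm h powr (1 + a)\<rbrakk> \<Longrightarrow> thesis"
     and 2: "0 <= A" "integrable lborel cutoff_kernel" "(LBINT z. \<bar>cutoff_kernel z\<bar>) <= A" "\<And>h. integrable lborel (cutoff_kernel_deriv h)"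
      "\<And>h. (LBINT z. \<bar>cutoff_kernel_deriv h z\<bar>) <= A * norm h" and 3: "\<And>h a. 0 <= a ==> a <= 1 ==>
       (LBINT z. \<bar>cutoff_kernel (z + h) - cutoff_kernel z - cutoff_kernel_deriv h z\<bar>) <= A * norm h powr (1 + a)"
    show thesis by (rule 1[OF 2(1,3,4,5) 3]) (use a in auto)
  qed
  \<comment> \<open>Common majorant of the three series, with ratio
    \<open>2 powr (1 + a - s) < 1\<close>; it dominates the first two because
    \<open>2 ^ Suc n >= 1\<close>.\<close>
  define c where "c = (\<lambda>n. 2 powr (- s * (real n - 1)) * (2 ^ Suc n) powr (1 + a))"
  have c_eq: "c n = 2 powr (s + 1 + a) * (2 powr (1 + a - s)) ^ n" for n
  proof -
    have "(2 ^ Suc n) powr (1 + a) = 2 powr (real (Suc n) * (1 + a))"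
      by (simp only: powr_realpow[symmetric] powr_powr zero_less_numeral)
    moreover have "(2 powr (1 + a - s)) ^ n = 2 powr ((1 + a - s) * real n)"
      by (simp add: powr_power mult.commute)
    ultimately show ?thesis unfolding c_def by (simp add: powr_add[symmetric] algebra_simps)
  qed
  have csum: "summable c"
  proof -
    have "2 powr (1 + a - s) < 2 powr (0::real)" using a by (intro powr_less_mono) auto
    then have "norm (2 powr (1 + a - s)) < 1" by simp
    from summable_mult[OF summable_geometric[OF this]] show ?thesis unfolding c_eq[abs_def] .
  qed
  have c0: "c n >= 0" for n by (simp add: c_def)
  have r1: "(1::real) <= 2 ^ Suc n" for n by (rule one_le_power) simp
  have cle1: "2 powr (- s * (real n - 1)) <= c n" for n
    unfolding c_def using ge_one_powr_ge_zero[OF r1, of "1 + a" n] a by (intro mult_right_mono[of 1, simplified] | simp)+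
  have cle2: "2 powr (- s * (real n - 1)) * 2 ^ Suc n <= c n" for n
    unfolding c_def using powr_mono[of 1 "1 + a" "2 ^ Suc n", OF _ r1] a r1[of n] by (intro mult_left_mono) (simp_all del: power_Suc)
  define C where "C = A0 * (\<Sum>n. c n)"
  have C0: "C >= 0" unfolding C_def using A0(1) csum c0 by (intro mult_nonneg_nonneg suminf_nonneg) auto
  show thesis
  proof (rule that[OF C0], goal_cases)
    case (1 q g M)
    note g = 1(1,2) and M = 1(3) and bl = 1(4)
    note [measurable] = lq_measurable[OF g(1)] block_measurable[OF g(1)]
    define A where "A = (\<lambda>n. M * 2 powr (- s * (real n - 1)))"
    have An: "A n >= 0" for n using M by (simp add: A_def)
    define L where "L = (\<lambda>n x h. LBINT y. cutoff_kernel_deriv (2 ^ Suc n *\<^sub>R h) y * block n g (x - y /\<^sub>R 2 ^ Suc n))"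
    have Ac: "A0 * A n <= A0 * M * c n" "A0 * A n * 2 ^ Suc n <= A0 * M * c n"
      "A0 * A n * (2 ^ Suc n) powr (1 + a) = A0 * M * c n" for n
    proof -
      show "A0 * A n <= A0 * M * c n"
        using mult_left_mono[OF cle1, of "A0 * M" n] A0(1) M by (simp add: A_def mult.assoc)
      show "A0 * A n * 2 ^ Suc n <= A0 * M * c n"
        using mult_left_mono[OF cle2, of "A0 * M" n] A0(1) M by (simp add: A_def mult.assoc)
      show "A0 * A n * (2 ^ Suc n) powr (1 + a) = A0 * M * c n" by (simp add: A_def c_def mult.assoc)
    qed
    have r0: "(2::real) ^ Suc n > 0" for n by simp
    have bl': "AE x in lborel. \<bar>block n g x\<bar> <= A n" for n using bl by (simp add: A_def)
    have reg: "\<bar>block n g x\<bar> <= A0 * A n" "linear (L n x)" "\<bar>L n x h\<bar> <= A0 * A n * (2 ^ Suc n * norm h)"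
      "\<bar>block n g (x + h) - block n g x - L n x h\<bar> <= A0 * A n * (2 ^ Suc n * norm h) powr (1 + a)" for n x h
    proof -
      have Le: "L n x h = (LBINT y. cutoff_kernel_deriv (2 ^ Suc n *\<^sub>R h) y * block n g (x - y /\<^sub>R 2 ^ Suc n))" for x h
        by (simp add: L_def)
      note R = scaled_kernel_convolution_regular[OF block_measurable[OF g(1)] bl'[of n] An[of n] r0[of n] A0,
          folded block_reproducing[OF g, of n] Le]
      show "\<bar>block n g x\<bar> <= A0 * A n" "linear (L n x)" "\<bar>L n x h\<bar> <= A0 * A n * (2 ^ Suc n * norm h)"
        "\<bar>block n g (x + h) - block n g x - L n x h\<bar> <= A0 * A n * (2 ^ Suc n * norm h) powr (1 + a)"
        by (rule R)+
    qed
    have D1: "\<bar>block n g x\<bar> <= A0 * M * c n" for n x by (rule order_trans[OF reg(1) Ac(1)])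
    have D2: "\<bar>L n x h\<bar> <= A0 * M * c n * norm h" for n x h
      using order_trans[OF reg(3)[where n=n and x=x and h=h]] mult_right_mono[OF Ac(2)[of n], of "norm h"] by (simp add: mult.assoc)
    have D3: "\<bar>block n g (x + h) - block n g x - L n x h\<bar> <= A0 * M * c n * norm h powr (1 + a)" for n x h
      using reg(4)[where n=n and x=x and h=h] Ac(3)[of n] by (simp add: powr_mult mult.assoc[symmetric] del: power_Suc)
    have cs: "summable (\<lambda>n. A0 * M * c n * k)" "(\<Sum>n. A0 * M * c n * k) = C * M * k" for k
      using csum by (auto intro!: summable_mult summable_mult2 simp: suminf_mult suminf_mult2[symmetric] C_def mult_ac)
    have S1: "summable (\<lambda>n. block n g x)" for x
      by (rule summable_comparison_test'[OF cs(1)[of 1], of 0]) (use D1 in simp)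
    have S2: "summable (\<lambda>n. L n x h)" for x h
      by (rule summable_comparison_test'[OF cs(1)[of "norm h"], of 0]) (use D2 in simp)
    have w: "(\<lambda>n. partial_sum n g x) \<longlonglongrightarrow> (\<Sum>n. block n g x)" for x
      using summable_LIMSEQ'[OF S1[of x]] by (simp add: sum_block[OF g])
    then have rep: "besov_rep g x = (\<Sum>n. block n g x)" for x unfolding besov_rep_def by (rule limI)
    have sb: "\<bar>\<Sum>n. f n\<bar> <= C * M * k" if "\<And>n. \<bar>f n\<bar> <= A0 * M * c n * k" for f :: "nat => real" and k
    proof -
      have "norm (\<Sum>n. f n) <= (\<Sum>n. A0 * M * c n * k)"
        by (rule norm_suminf_le[OF _ cs(1)]) (use that in simp)
      then show ?thesis by (simp add: cs(2))
    qed
    have B1: "\<bar>besov_rep g x\<bar> <= C * M" for x unfolding rep using sb[of "\<lambda>n. block n g x" 1] D1 by simp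
    have "linear (\<lambda>h. \<Sum>n. L n x h)" for x
      by (intro linearI) (simp_all add: linear_add[OF reg(2)] linear_cmul[OF reg(2)] suminf_add[OF S2 S2] suminf_mult[OF S2])
    moreover have "\<bar>\<Sum>n. L n x h\<bar> <= C * M * norm h" for x h by (rule sb) (rule D2)
    moreover have "\<bar>besov_rep g (x + h) - besov_rep g x - (\<Sum>n. L n x h)\<bar> <= C * M * norm h powr (1 + a)" for x h
      unfolding rep suminf_diff[OF S1 S1] suminf_diff[OF summable_diff[OF S1 S1] S2] by (rule sb) (rule D3)
    \<comment> \<open>The partial sums converge to \<open>besov_rep g\<close> pointwise with a
      uniform bound, and to \<open>g\<close> in \<open>L^1\<close> on balls, so the two limits agree
      almost everywhere on each ball.\<close>
    moreover have "AE x in lborel. besov_rep g x = g x"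
    proof -
      have [measurable]: "borel_fun (besov_rep g)"
        unfolding besov_rep_def[abs_def] partial_sum_def by measurable
      have pm[measurable]: "borel_fun (partial_sum n g)" for n
        unfolding partial_sum_def[abs_def] by measurable
      have [measurable]: "ball (0::plane) R \<in> sets borel" for R by simp
      have ib: "integrable lborel (indicat_real (ball (0::plane) R))" for R
        by (rule integrable_real_indicator[OF _ emeasure_lborel_ball_finite]) simp
      have gi: "integrable lborel (\<lambda>x. indicat_real (ball 0 R) x * g x)" for R
      proof (rule bochner_bound)
        show "integrable lborel (\<lambda>x. indicat_real (ball 0 R) x + \<bar>g x\<bar> powr q)"
          using ib g(1) by (auto simp: lq_def)
        show "AE x in lborel. norm (indicat_real (ball 0 R) x * g x) <= norm (indicat_real (ball 0 R) x + \<bar>g x\<bar> powr q)"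
          using abs_le_1_plus_powr[OF g(2)] by (auto simp: indicator_def)
      qed simp
      have pb: "\<bar>partial_sum n g x\<bar> <= C * M" for n x
      proof -
        have "\<bar>partial_sum n g x\<bar> <= (\<Sum>k\<le>n. A0 * M * c k * 1)"
          unfolding sum_block[OF g, symmetric] by (rule order_trans[OF sum_abs sum_mono]) (use D1 in simp)
        also have "\<dots> <= (\<Sum>k. A0 * M * c k * 1)"
          using cs(1)[of 1] A0(1) M c0 by (intro sum_le_suminf) auto
        finally show ?thesis unfolding cs(2) by simp
      qed
      have "AE x in lborel. indicat_real (ball 0 R) x * \<bar>besov_rep g x - g x\<bar> = 0" for R :: real
      proof -
        have bi: "integrable lborel (\<lambda>x. indicat_real (ball 0 R) x * f x)" if [measurable]: "borel_fun f" and "\<And>x. \<bar>f x\<bar> <= C * M"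
          for f :: "plane => real"
        proof (rule bochner_bound[OF integrable_mult_right[OF ib[of R], of "C * M"]])
          show "AE x in lborel. norm (indicat_real (ball 0 R) x * f x) <= norm (C * M * indicat_real (ball 0 R) x)"
            using order_trans[OF that(2) abs_ge_self] by (intro AE_I2) (auto simp: indicator_def simp del: abs_mult)
        qed simp
        have "(\<lambda>n. LBINT x. indicat_real (ball 0 R) x * \<bar>besov_rep g x - partial_sum n g x\<bar>) \<longlonglongrightarrow> (\<integral>x. 0 \<partial>(lborel :: plane measure))"
        proof (rule integral_dominated_convergence[where w="\<lambda>x. 2 * (C * M) * indicat_real (ball 0 R) x"])
          have "(\<lambda>n. indicat_real (ball 0 R) x * \<bar>besov_rep g x - partial_sum n g x\<bar>) \<longlonglongrightarrow> indicat_real (ball 0 R) x * \<bar>besov_rep g x - besov_rep g x\<bar>" for x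
            by (intro tendsto_intros) (use w rep in simp)
          then show "AE x in lborel. (\<lambda>n. indicat_real (ball 0 R) x * \<bar>besov_rep g x - partial_sum n g x\<bar>) \<longlonglongrightarrow> 0" by simp
          have "\<bar>besov_rep g x - partial_sum n g x\<bar> <= 2 * (C * M)" for n x using B1[of x] pb[of n x] by linarith
          then show "AE x in lborel. norm (indicat_real (ball 0 R) x * \<bar>besov_rep g x - partial_sum n g x\<bar>) <= 2 * (C * M) * indicat_real (ball 0 R) x" for n
            by (auto simp: indicator_def)
        qed (use ib in auto)
        from tendsto_add[OF this partial_sum_tendsto_L1[OF g, of R]]
        have lim: "(\<lambda>n. (LBINT x. indicat_real (ball 0 R) x * \<bar>besov_rep g x - partial_sum n g x\<bar>) + 
          (LBINT x. indicat_real (ball 0 R) x * \<bar>partial_sum n g x - g x\<bar>)) \<longlonglongrightarrow> 0" by simp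
        have i: "integrable lborel (\<lambda>x. indicat_real (ball 0 R) x * \<bar>besov_rep g x - g x\<bar>)"
          "integrable lborel (\<lambda>x. indicat_real (ball 0 R) x * \<bar>besov_rep g x - partial_sum n g x\<bar>)"
          "integrable lborel (\<lambda>x. indicat_real (ball 0 R) x * \<bar>partial_sum n g x - g x\<bar>)" for n
          using integrable_abs[OF Bochner_Integration.integrable_diff[OF bi[of "besov_rep g"] gi[of R]]]
            integrable_abs[OF Bochner_Integration.integrable_diff[OF bi[of "besov_rep g"] bi[of "partial_sum n g"]]]
            integrable_abs[OF Bochner_Integration.integrable_diff[OF bi[of "partial_sum n g"] gi[of R]]] B1 pb
          by (simp_all add: abs_mult flip: right_diff_distrib)
        have "(LBINT x. indicat_real (ball 0 R) x * \<bar>besov_rep g x - g x\<bar>) <=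
          (LBINT x. indicat_real (ball 0 R) x * \<bar>besov_rep g x - partial_sum n g x\<bar>) + 
          (LBINT x. indicat_real (ball 0 R) x * \<bar>partial_sum n g x - g x\<bar>)" for n
          by (subst Bochner_Integration.integral_add[symmetric, OF i(2,3)], rule integral_mono)
            (use i in \<open>auto simp: indicator_def\<close>)
        then have "(LBINT x. indicat_real (ball 0 R) x * \<bar>besov_rep g x - g x\<bar>) <= 0"
          by (intro LIMSEQ_le_const[OF lim]) blast
        moreover have "0 <= (LBINT x. indicat_real (ball 0 R) x * \<bar>besov_rep g x - g x\<bar>)" by simp
        ultimately have "(LBINT x. indicat_real (ball 0 R) x * \<bar>besov_rep g x - g x\<bar>) = 0" by linarith
        moreover have "AE x in lborel. 0 <= indicat_real (ball 0 R) x * \<bar>besov_rep g x - g x\<bar>" by simp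
        ultimately show ?thesis using integral_nonneg_eq_0_iff_AE[OF i(1)] by blast
      qed
      then have "AE x in lborel. \<forall>n::nat. indicat_real (ball 0 (real n)) x * \<bar>besov_rep g x - g x\<bar> = 0"
        unfolding AE_all_countable by blast
      then show ?thesis
      proof eventually_elim
        case (elim x)
        obtain n :: nat where "norm x < real n" using reals_Archimedean2[of "norm x"] by auto
        then show ?case using elim[rule_format, of n] by (simp add: indicator_def)
      qed
    qed
    ultimately show ?case
      by (intro conjI allI exI[of _ "\<lambda>x h. \<Sum>n. L n x h"] B1) simp_all
  qed
qed

section \<open>Flows of Lipschitz fields with integrable Lipschitz constant\<close>

definition loc_int :: "(real => 'a::euclidean_space) => bool" where
  "loc_int f \<longleftrightarrow> f \<in> borel_measurable borel \<and> (\<forall>a b. set_integrable lborel {a..b} f)"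

definition itg :: "(real => 'a::euclidean_space) => real => real => 'a" where
  "itg f a b = (LBINT r:{a..b}. f r)"

text \<open>The summand with the empty or degenerate range of integration vanishes, so these are the
  oriented and the unoriented integral between two times in any order.\<close>

definition oint :: "(real => 'a::euclidean_space) => real => real => 'a" where
  "oint f s t = itg f s t - itg f t s"

definition aint :: "(real => real) => real => real => real" where
  "aint f s t = itg f s t + itg f t s"

lemma loc_int_measurable: "loc_int f ==> borel_fun f"
  by (simp add: loc_int_def)

lemma itg_HK: "loc_int f ==> f integrable_on {a..b} \<and> itg f a b = integral {a..b} f"
  unfolding itg_def loc_int_def using set_borel_integral_eq_integral[of "{a..b}" f] by blast

lemma itg_le: "b <= a ==> loc_int f ==> itg f a b = 0"
  using itg_HK[of f a b] by (cases "a = b") auto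

lemma itg_combine: "loc_int f ==> a <= b ==> b <= c ==> itg f a b + itg f b c = itg f a c"
  using itg_HK[of f a b] itg_HK[of f b c] itg_HK[of f a c] Henstock_Kurzweil_Integration.integral_combine[of a b c f]
  by simp

lemma loc_int_bound:
  assumes "loc_int g" "borel_fun f" "\<And>r. norm (f r) <= g r"
  shows "loc_int f"
  unfolding loc_int_def set_integrable_def
proof safe
  fix a b :: real
  have i: "integrable lborel (\<lambda>r. indicator {a..b} r *\<^sub>R g r)" using assms(1) by (simp add: loc_int_def set_integrable_def)
  show "integrable lborel (\<lambda>r. indicator {a..b} r *\<^sub>R f r)"
  proof (rule bochner_bound[OF i])
    show "(\<lambda>r. indicator {a..b} r *\<^sub>R f r) \<in> borel_measurable lborel" using assms(2) by measurable
    show "AE r in lborel. norm (indicator {a..b} r *\<^sub>R f r) <= norm (indicator {a..b} r *\<^sub>R g r)"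
      using order_trans[OF assms(3) abs_ge_self] by (auto simp: indicator_def)
  qed
qed (use assms in simp)

lemma loc_int_bound_on:
  assumes "loc_int g" "borel_fun f" "\<And>a b. \<exists>K. \<forall>r\<in>{a..b}. norm (f r) <= K * g r"
  shows "loc_int f"
  unfolding loc_int_def set_integrable_def
proof safe
  fix a b :: real
  obtain K where K: "\<And>r. r \<in> {a..b} ==> norm (f r) <= K * g r" using assms(3) by blast
  have i: "integrable lborel (\<lambda>r. K * (indicator {a..b} r *\<^sub>R g r))"
    using assms(1) by (intro integrable_mult_right) (simp add: loc_int_def set_integrable_def)
  show "integrable lborel (\<lambda>r. indicator {a..b} r *\<^sub>R f r)"
  proof (rule bochner_bound[OF i])
    show "(\<lambda>r. indicator {a..b} r *\<^sub>R f r) \<in> borel_measurable lborel" using assms(2) by measurable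
    show "AE r in lborel. norm (indicator {a..b} r *\<^sub>R f r) <= norm (K * (indicator {a..b} r *\<^sub>R g r))"
      using order_trans[OF K abs_ge_self] by (intro AE_I2) (auto simp: indicator_def simp del: abs_mult)
  qed
qed (use assms in simp)

lemma itg_norm_le:
  assumes "loc_int f" "loc_int g" "\<And>r. a <= r ==> r <= b ==> norm (f r) <= g r"
  shows "norm (itg f a b) <= itg g a b"
  using itg_HK[OF assms(1), of a b] itg_HK[OF assms(2), of a b] assms(3)
    integral_norm_bound_integral[of f "{a..b}" g] by auto

lemma itg_mono:
  assumes "loc_int f" "loc_int g" "\<And>r. a <= r ==> r <= b ==> f r <= (g r :: real)"
  shows "itg f a b <= itg g a b"
  using itg_HK[OF assms(1), of a b] itg_HK[OF assms(2), of a b] assms(3) integral_le[of f "{a..b}" g] by auto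

lemma loc_int_add: "loc_int f ==> loc_int g ==> loc_int (\<lambda>r. f r + g r)"
  by (auto simp: loc_int_def intro: set_integral_add)

lemma loc_int_diff: "loc_int f ==> loc_int g ==> loc_int (\<lambda>r. f r - g r)"
  by (auto simp: loc_int_def intro: set_integral_diff)

lemma loc_int_scaleR: "loc_int f ==> loc_int (\<lambda>r. c *\<^sub>R f r)"
  by (auto simp: loc_int_def)

lemma loc_int_cmult: "loc_int f ==> loc_int (\<lambda>r. c * f r :: real)"
  using loc_int_scaleR[of f c] by simp

lemma loc_int_continuous:
  assumes "continuous_on UNIV f" shows "loc_int f"
  unfolding loc_int_def
  by (auto intro!: continuous_borel[OF assms] borel_integrable_atLeastAtMost' continuous_on_subset[OF assms])

lemma itg_diff: "loc_int f ==> loc_int g ==> itg (\<lambda>r. f r - g r) a b = itg f a b - itg g a b"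
  by (simp add: itg_def loc_int_def set_integral_diff)

lemma itg_add: "loc_int f ==> loc_int g ==> itg (\<lambda>r. f r + g r) a b = itg f a b + itg g a b"
  by (simp add: itg_def loc_int_def set_integral_add)

lemma itg_scaleR: "itg (\<lambda>r. c *\<^sub>R f r) a b = c *\<^sub>R itg f a b"
  by (simp add: itg_def)

lemma itg_cmult: "itg (\<lambda>r. c * f r :: real) a b = c * itg f a b"
  using itg_scaleR[of c f a b] by simp

lemma oint_simps:
  "loc_int f ==> s <= t ==> oint f s t = itg f s t" "loc_int f ==> t <= s ==> oint f s t = - itg f t s"
  by (simp_all add: oint_def itg_le)

lemma aint_simps:
  "loc_int f ==> s <= t ==> aint f s t = itg f s t" "loc_int f ==> t <= s ==> aint f s t = itg f t s"
  by (simp_all add: aint_def itg_le)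

lemma oint_refl [simp]: "oint f s s = 0" by (simp add: oint_def)

lemma oint_combine: "loc_int f ==> oint f a b + oint f b c = oint f a c"
proof -
  assume f: "loc_int f"
  consider "a <= b" "b <= c" | "a <= c" "c <= b" | "b <= a" "a <= c" | "b <= c" "c <= a" | "c <= a" "a <= b" | "c <= b" "b <= a"
    by linarith
  then show ?thesis
  proof cases
    case 1 then show ?thesis using itg_combine[OF f, of a b c] by (simp add: oint_simps[OF f])
  next
    case 2 then show ?thesis using itg_combine[OF f, of a c b, symmetric] by (simp add: oint_simps[OF f])
  next
    case 3 then show ?thesis using itg_combine[OF f, of b a c, symmetric] by (simp add: oint_simps[OF f])
  next
    case 4 then show ?thesis using itg_combine[OF f, of b c a, symmetric] by (simp add: oint_simps[OF f])
  next
    case 5 then show ?thesis using itg_combine[OF f, of c a b, symmetric] by (simp add: oint_simps[OF f])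
  next
    case 6 then show ?thesis using itg_combine[OF f, of c b a, symmetric] by (simp add: oint_simps[OF f])
  qed
qed

lemma oint_add: "loc_int f ==> loc_int g ==> oint (\<lambda>r. f r + g r) s t = oint f s t + oint g s t"
  and oint_diff: "loc_int f ==> loc_int g ==> oint (\<lambda>r. f r - g r) s t = oint f s t - oint g s t"
  and oint_scaleR: "oint (\<lambda>r. c *\<^sub>R f r) s t = c *\<^sub>R oint f s t"
  by (simp_all add: oint_def itg_add itg_diff itg_scaleR scaleR_diff_right)

lemma aint_cmult: "aint (\<lambda>r. c * f r) s t = c * aint f s t"
  by (simp add: aint_def itg_cmult ring_distribs)

lemma aint_commute: "aint f s t = aint f t s"
  by (simp add: aint_def)

lemma aint_add: "loc_int f ==> loc_int g ==> aint (\<lambda>r. f r + g r) s t = aint f s t + aint g s t"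
  by (simp add: aint_def itg_add)

lemma norm_oint_le:
  assumes "loc_int f" "loc_int g" "\<And>r. r \<in> closed_segment s t ==> norm (f r) <= g r"
  shows "norm (oint f s t) <= aint g s t"
proof (cases "s <= t")
  case True
  then show ?thesis using assms itg_norm_le[of f g s t] by (simp add: oint_simps aint_simps closed_segment_eq_real_ivl)
next
  case False
  then show ?thesis using assms itg_norm_le[of f g t s] by (simp add: oint_simps aint_simps closed_segment_eq_real_ivl)
qed

lemma aint_mono:
  assumes "loc_int f" "loc_int g" "\<And>r. r \<in> closed_segment s t ==> f r <= g r"
  shows "aint f s t <= aint g s t"
proof (cases "s <= t")
  case True
  then show ?thesis using assms itg_mono[of f g s t] by (simp add: aint_simps closed_segment_eq_real_ivl)
next
  case False
  then show ?thesis using assms itg_mono[of f g t s] by (simp add: aint_simps closed_segment_eq_real_ivl)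
qed

lemma itg_nonneg: "(\<And>r. 0 <= (f r :: real)) ==> 0 <= itg f a b"
  unfolding itg_def set_lebesgue_integral_def by (rule Bochner_Integration.integral_nonneg) auto

lemma itg_mono_set:
  fixes f :: "real => real"
  assumes "loc_int f" "\<And>r. 0 <= f r" "a' <= a" "b <= b'" shows "itg f a b <= itg f a' b'"
proof (cases "a <= b")
  case True
  then have "itg f a' b' = itg f a' a + itg f a b + itg f b b'"
    using assms itg_combine[of f a' a b] itg_combine[of f a' b b'] by simp
  then show ?thesis using itg_nonneg[of f a' a] itg_nonneg[of f b b'] assms(2) by simp
qed (use assms itg_le[of b a f] itg_nonneg[of f a' b'] in simp)

lemma aint_nonneg: "(\<And>r. 0 <= f r) ==> 0 <= aint f s t"
  by (simp add: aint_def itg_nonneg)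

lemma aint_le_itg:
  assumes "loc_int f" "\<And>r. 0 <= f r" "s \<in> {a..b}" "t \<in> {a..b}" shows "aint f s t <= itg f a b"
  using assms itg_mono_set[OF assms(1,2)] by (cases "s <= t") (auto simp: aint_simps)

lemma aint_sub:
  assumes "loc_int f" "\<And>r. 0 <= f r" "r \<in> closed_segment s t" shows "aint f s r <= aint f s t"
  using assms itg_mono_set[OF assms(1,2)]
  by (cases "s <= t") (auto simp: aint_simps closed_segment_eq_real_ivl)

lemma continuous_on_oint: "loc_int f ==> continuous_on UNIV (\<lambda>t. oint f s t)"
proof -
  assume f: "loc_int f"
  have "isCont (\<lambda>t. oint f s t) t" for t
  proof -
    have "continuous_on {t - 1..t + 1} (\<lambda>u. itg f (t - 1) u)"
      using itg_HK[OF f] indefinite_integral_continuous_1[of f "t - 1" "t + 1"] by simp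
    then have "continuous_on {t - 1..t + 1} (\<lambda>u. oint f s (t - 1) + itg f (t - 1) u)"
      by (intro continuous_intros)
    then have "continuous_on {t - 1<..<t + 1} (\<lambda>u. oint f s (t - 1) + itg f (t - 1) u)"
      by (rule continuous_on_subset) auto
    then have "continuous_on {t - 1<..<t + 1} (\<lambda>u. oint f s u)"
      by (rule continuous_on_eq) (use oint_combine[OF f] oint_simps[OF f] in \<open>metis greaterThanLessThan_iff less_imp_le\<close>)
    then show ?thesis by (simp add: continuous_on_eq_continuous_at)
  qed
  then show ?thesis by (simp add: continuous_on_eq_continuous_at)
qed

lemma aint_abs_oint: "loc_int f ==> (\<And>r. 0 <= f r) ==> aint f s t = \<bar>oint f s t\<bar>"
  by (cases "s <= t") (simp_all add: aint_simps oint_simps itg_nonneg)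

text \<open>Takes the place of the fundamental theorem for absolutely continuous functions: summing
  over a fine subdivision gives \<open>\<bar>G b - G a\<bar> <= e * itg m a b\<close> for every
  \<open>e\<close>. To show that two functions have the same increments it is applied to their
  difference.\<close>

lemma null_increment:
  fixes G :: "real => real"
  assumes m: "loc_int m" and ab: "a <= b"
    and inc: "\<And>e. e > 0 ==> \<exists>d>0. \<forall>s t. a <= s \<and> s <= t \<and> t <= b \<and> t - s < d --> \<bar>G t - G s\<bar> <= e * itg m s t"
  shows "G b = G a"
proof -
  have le: "\<bar>G b - G a\<bar> <= e * itg m a b" if e: "e > 0" for e
  proof -
    obtain d where d: "d > 0" "\<And>s t. a <= s ==> s <= t ==> t <= b ==> t - s < d ==> \<bar>G t - G s\<bar> <= e * itg m s t"
      using inc[OF e] by blast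
    obtain N :: nat where N: "(b - a) / d < N" using reals_Archimedean2 by blast
    have N0: "N > 0" using N d(1) ab by (auto intro!: gr0I simp: divide_less_0_iff)
    define h where "h = (b - a) / N"
    have h: "0 <= h" "h < d" using N N0 d(1) ab by (auto simp: h_def field_simps)
    have hk: "a + h * k <= b" if "k <= N" for k :: nat
    proof -
      have "h * k <= h * N" using that h by (intro mult_left_mono) auto
      then show ?thesis using N0 by (simp add: h_def)
    qed
    have "\<bar>G (a + h * k) - G a\<bar> <= e * itg m a (a + h * k)" if "k <= N" for k :: nat
      using that
    proof (induction k)
      case 0
      then show ?case using itg_le[of a a m] m by simp
    next
      case (Suc k)
      have s: "a <= a + h * k" "a + h * k <= a + h * Suc k" using h(1) by (auto simp: algebra_simps)
      have 1: "\<bar>G (a + h * Suc k) - G (a + h * k)\<bar> <= e * itg m (a + h * k) (a + h * Suc k)"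
        by (rule d(2)[OF s hk[OF Suc.prems]]) (use h in \<open>simp add: algebra_simps\<close>)
      have 2: "\<bar>G (a + h * k) - G a\<bar> <= e * itg m a (a + h * k)" using Suc by simp
      show ?case unfolding itg_combine[OF m s, symmetric] distrib_left using 1 2 by linarith
    qed
    from this[of N] show ?thesis using N0 by (simp add: h_def)
  qed
  have "\<bar>G b - G a\<bar> <= 0"
  proof (rule field_le_epsilon)
    fix \<epsilon> :: real assume "\<epsilon> > 0"
    then have "\<bar>G b - G a\<bar> <= \<epsilon> / (\<bar>itg m a b\<bar> + 1) * itg m a b" by (intro le) (simp add: add_nonneg_pos)
    also have "\<dots> <= \<epsilon> / (\<bar>itg m a b\<bar> + 1) * (\<bar>itg m a b\<bar> + 1)"
      using \<open>\<epsilon> > 0\<close> by (intro mult_left_mono) (auto simp: add_nonneg_pos)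
    also have "\<dots> = \<epsilon>" by (simp add: add_nonneg_pos add_nonneg_eq_0_iff)
    finally show "\<bar>G b - G a\<bar> <= 0 + \<epsilon>" by simp
  qed
  then show ?thesis by simp
qed

text \<open>\<open>M\<close> is only absolutely continuous, so a pointwise chain rule is not at
  hand. Over a short interval the mean value theorem for \<open>exp\<close>, at an intermediate
  value of \<open>M\<close>, gives the increment up to a small multiple of the integral of
  \<open>m\<close>, and \<open>null_increment\<close> concludes.\<close>

lemma itg_exp_primitive:
  fixes s a b c :: real
  assumes m: "loc_int m" "\<And>r. 0 <= m r" and ab: "a <= b" and c: "c \<noteq> 0"
  defines "M \<equiv> \<lambda>r. oint m s r"
  shows "itg (\<lambda>r. m r * exp (c * M r)) a b = (exp (c * M b) - exp (c * M a)) / c"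
proof -
  have Mc: "continuous_on UNIV M" unfolding M_def by (rule continuous_on_oint[OF m(1)])
  have Md: "M t - M u = itg m u t" if "u <= t" for u t
    unfolding M_def using oint_combine[OF m(1), of s u t] oint_simps[OF m(1) that] by simp
  define \<phi> where "\<phi> = (\<lambda>y. exp (c * y))"
  have \<phi>c: "continuous_on S \<phi>" for S unfolding \<phi>_def by (intro continuous_intros)
  have [measurable]: "borel_fun m" "borel_fun M"
    using loc_int_measurable[OF m(1)] continuous_borel[OF Mc] by auto
  have lm: "loc_int (\<lambda>r. m r * \<phi> (M r))"
  proof (rule loc_int_bound_on[OF m(1)])
    fix a b
    have "compact ((\<lambda>r. \<phi> (M r)) ` {a..b})"
      by (intro compact_continuous_image continuous_on_compose2[OF \<phi>c[of UNIV]] continuous_on_subset[OF Mc]) auto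
    then obtain K where K: "\<And>r. r \<in> {a..b} ==> \<bar>\<phi> (M r)\<bar> <= K"
      by (metis compact_imp_bounded bounded_iff image_eqI real_norm_def)
    show "\<exists>K. \<forall>r\<in>{a..b}. norm (m r * \<phi> (M r)) <= K * m r"
      using K m(2) by (intro exI[of _ K]) (auto simp: abs_mult mult.commute[of K] intro!: mult_left_mono)
  qed (simp add: \<phi>_def)
  define G where "G = (\<lambda>t. \<phi> (M t) - c * itg (\<lambda>r. m r * \<phi> (M r)) a t)"
  have "G b = G a"
  proof (rule null_increment[OF m(1) ab])
    fix e :: real assume e: "e > 0"
    have uc: "uniformly_continuous_on {M a..M b} \<phi>" by (intro compact_uniformly_continuous \<phi>c) simp
    obtain d1 where d1: "d1 > 0" "\<And>x y. x \<in> {M a..M b} ==> y \<in> {M a..M b} ==> \<bar>y - x\<bar> < d1 ==> \<bar>\<phi> y - \<phi> x\<bar> < e / \<bar>c\<bar>"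
      using uc e c unfolding uniformly_continuous_on_def dist_real_def
      by (metis divide_pos_pos zero_less_abs_iff)
    have "uniformly_continuous_on {a..b} M"
      by (intro compact_uniformly_continuous continuous_on_subset[OF Mc]) auto
    then obtain d where d: "d > 0" "\<And>x y. x \<in> {a..b} ==> y \<in> {a..b} ==> \<bar>y - x\<bar> < d ==> \<bar>M y - M x\<bar> < d1"
      using d1(1) unfolding uniformly_continuous_on_def dist_real_def by metis
    show "\<exists>d>0. \<forall>s t. a <= s \<and> s <= t \<and> t <= b \<and> t - s < d --> \<bar>G t - G s\<bar> <= e * itg m s t"
    proof (intro exI[of _ d] conjI d allI impI)
      fix u t assume ut: "a <= u \<and> u <= t \<and> t <= b \<and> t - u < d"
      have mono: "M x <= M y" if "x <= y" for x y using Md[OF that] itg_nonneg[of m x y] m(2) by simp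
      obtain z where z: "z \<in> {M u..M t}" "\<phi> (M t) - \<phi> (M u) = c * \<phi> z * (M t - M u)"
      proof (cases "M u = M t")
        case False
        then have "M u < M t" using mono[of u t] ut by simp
        moreover have "(\<phi> has_real_derivative c * \<phi> x) (at x)" for x
          unfolding \<phi>_def by (auto intro!: derivative_eq_intros)
        ultimately obtain z where "M u < z" "z < M t" "\<phi> (M t) - \<phi> (M u) = (M t - M u) * (c * \<phi> z)"
          using MVT2[of "M u" "M t" \<phi> "\<lambda>x. c * \<phi> x"] by auto
        then show ?thesis using that[of z] by (simp add: mult_ac)
      qed (use that[of "M u"] in auto)
      have "G t - G u = (\<phi> (M t) - \<phi> (M u)) - c * (itg (\<lambda>r. m r * \<phi> (M r)) a t - itg (\<lambda>r. m r * \<phi> (M r)) a u)"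
        by (simp add: G_def algebra_simps)
      also have "itg (\<lambda>r. m r * \<phi> (M r)) a t - itg (\<lambda>r. m r * \<phi> (M r)) a u = itg (\<lambda>r. m r * \<phi> (M r)) u t"
        using itg_combine[OF lm, of a u t] ut by linarith
      also have "\<phi> (M t) - \<phi> (M u) = c * \<phi> z * itg m u t" using z(2) Md[of u t] ut by simp
      also have "c * \<phi> z * itg m u t - c * itg (\<lambda>r. m r * \<phi> (M r)) u t = itg (\<lambda>r. c * (\<phi> z * m r - m r * \<phi> (M r))) u t"
        unfolding itg_cmult itg_diff[OF loc_int_cmult[OF m(1)] lm] by (simp add: algebra_simps)
      also have "\<bar>\<dots>\<bar> <= itg (\<lambda>r. e * m r) u t"
        unfolding real_norm_def[symmetric]
      proof (rule itg_norm_le)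
        fix r assume r: "u <= r" "r <= t"
        have "M t - M u < d1" using d(2)[of u t] ut by auto
        moreover have "M r \<in> {M u..M t}" "M a <= M u" "M t <= M b" using mono r ut by auto
        ultimately have "\<bar>\<phi> z - \<phi> (M r)\<bar> < e / \<bar>c\<bar>" using z(1) by (intro d1(2)) auto
        then have "\<bar>c\<bar> * \<bar>\<phi> z - \<phi> (M r)\<bar> <= e" using c by (simp add: field_simps)
        from mult_right_mono[OF this m(2)[of r]]
        moreover have "norm (c * (\<phi> z * m r - m r * \<phi> (M r))) = \<bar>c\<bar> * \<bar>\<phi> z - \<phi> (M r)\<bar> * m r"
        proof -
          have "c * (\<phi> z * m r - m r * \<phi> (M r)) = c * (\<phi> z - \<phi> (M r)) * m r" by (simp add: algebra_simps)
          then show ?thesis by (simp only: real_norm_def abs_mult abs_of_nonneg[OF m(2)])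
        qed
        ultimately show "norm (c * (\<phi> z * m r - m r * \<phi> (M r))) <= e * m r" by simp
      qed (intro loc_int_cmult loc_int_diff m lm)+
      finally show "\<bar>G t - G u\<bar> <= e * itg m u t" by (simp add: itg_cmult)
    qed
  qed
  then show ?thesis using c itg_le[OF order_refl lm, of a] by (simp add: G_def \<phi>_def field_simps)
qed

text \<open>The weight \<open>exp (2 * aint m s t)\<close> makes integration against \<open>m\<close> a contraction with factor
  \<open>1/2\<close>; this drives the Picard iteration and replaces Gronwall's lemma.\<close>

definition weight :: "(real => real) => real => real => real" where
  "weight m s t = exp (2 * aint m s t)"

lemma weight_ge_1: "(\<And>r. 0 <= m r) ==> 1 <= weight m s t"
  by (simp add: weight_def aint_nonneg)

lemma continuous_on_weight: "loc_int m ==> (\<And>r. 0 <= m r) ==> continuous_on UNIV (weight m s)"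
proof -
  assume m: "loc_int m" "\<And>r. 0 <= m r"
  have "weight m s = (\<lambda>t. exp (2 * \<bar>oint m s t\<bar>))" by (auto simp: weight_def aint_abs_oint[OF m])
  then show ?thesis by (auto intro!: continuous_intros continuous_on_oint m)
qed

lemma loc_int_mult_continuous:
  assumes m: "loc_int m" "\<And>r. 0 <= m r" and g: "continuous_on UNIV g"
  shows "loc_int (\<lambda>r. m r * (g r :: real))"
proof (rule loc_int_bound_on[OF m(1)])
  have [measurable]: "borel_fun m" "borel_fun g"
    using loc_int_measurable[OF m(1)] continuous_borel[OF g] by auto
  show "borel_fun (\<lambda>r. m r * g r)" by measurable
  fix a b
  have "compact (g ` {a..b})" by (intro compact_continuous_image continuous_on_subset[OF g]) auto
  then obtain K where K: "\<And>r. r \<in> {a..b} ==> \<bar>g r\<bar> <= K"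
    by (metis compact_imp_bounded bounded_iff image_eqI real_norm_def)
  show "\<exists>K. \<forall>r\<in>{a..b}. norm (m r * g r) <= K * m r"
    using K m(2) by (intro exI[of _ K]) (auto simp: abs_mult mult.commute[of K] intro!: mult_left_mono)
qed

text \<open>The product of \<open>m\<close> and the weight has half the weight as primitive, up to a
  sign given by the direction of time; the exact value is
  \<open>(weight m s t - 1) / 2\<close>.\<close>

lemma aint_weight_le:
  assumes m: "loc_int m" "\<And>r. 0 <= m r"
  shows "aint (\<lambda>r. m r * weight m s r) s t <= weight m s t / 2"
proof -
  have l: "loc_int (\<lambda>r. m r * weight m s r)"
    by (rule loc_int_mult_continuous[OF m continuous_on_weight[OF m]])
  have pos: "weight m s r = exp (2 * oint m s r)" if "s <= r" for r
    using that m by (simp add: weight_def aint_abs_oint oint_simps itg_nonneg)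
  have neg: "weight m s r = exp (- 2 * oint m s r)" if "r <= s" for r
    using that m by (simp add: weight_def aint_simps oint_simps)
  show ?thesis
  proof (cases "s <= t")
    case True
    have "itg (\<lambda>r. m r * weight m s r) s t = itg (\<lambda>r. m r * exp (2 * oint m s r)) s t"
      unfolding itg_def by (rule set_lebesgue_integral_cong) (auto simp: pos)
    also have "\<dots> = (weight m s t - 1) / 2"
      using itg_exp_primitive[OF m True, of 2 s] pos[OF True] by simp
    finally show ?thesis using True l by (simp add: aint_simps)
  next
    case False
    then have ts: "t <= s" by simp
    have "itg (\<lambda>r. m r * weight m s r) t s = itg (\<lambda>r. m r * exp (- 2 * oint m s r)) t s"
      unfolding itg_def by (rule set_lebesgue_integral_cong) (auto simp: neg)
    also have "\<dots> = (weight m s t - 1) / 2"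
      using itg_exp_primitive[OF m ts, of "-2" s] neg[OF ts] by (simp add: field_simps)
    finally show ?thesis using ts l by (simp add: aint_simps)
  qed
qed

text \<open>Let \<open>S\<close> be the largest quotient of \<open>d\<close> by the weight. If
  \<open>S > 0\<close>, the inequality at the point where it is attained gives
  \<open>S * w <= c + S * w / 2\<close> with \<open>w >= 1\<close> the weight there, hence
  \<open>S <= 2 * c\<close>.\<close>

lemma weighted_gronwall:
  assumes m: "loc_int m" "\<And>r. 0 <= m r" and d: "continuous_on UNIV d" and c: "0 <= c"
    and le: "\<And>r. r \<in> closed_segment s t ==> d r <= c + aint (\<lambda>r. m r * d r) s r"
  shows "d t <= 2 * c * weight m s t"
proof -
  let ?w = "weight m s"
  have w1: "1 <= ?w r" for r by (rule weight_ge_1[OF m(2)])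
  have w0: "0 < ?w r" for r using w1[of r] by linarith
  have "continuous_on (closed_segment s t) (\<lambda>r. d r / ?w r)"
    using w0 by (intro continuous_on_divide continuous_on_subset[OF d] continuous_on_subset[OF continuous_on_weight[OF m]])
      (auto simp: less_imp_neq[symmetric])
  from continuous_attains_sup[OF compact_segment _ this]
  obtain z where z: "z \<in> closed_segment s t" "\<And>r. r \<in> closed_segment s t ==> d r / ?w r <= d z / ?w z" by auto
  define S where "S = d z / ?w z"
  have dS: "d r <= S * ?w r" if "r \<in> closed_segment s t" for r
    using z(2)[OF that] w0[of r] by (simp add: S_def pos_divide_le_eq)
  have "S <= 2 * c"
  proof (cases "S <= 0")
    case False
    have sub: "closed_segment s z \<subseteq> closed_segment s t"
      using z(1) by (auto simp: closed_segment_eq_real_ivl split: if_splits)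
    have "d z <= c + aint (\<lambda>r. m r * d r) s z" by (rule le[OF z(1)])
    also have "aint (\<lambda>r. m r * d r) s z <= aint (\<lambda>r. S * (m r * ?w r)) s z"
    proof (rule aint_mono)
      show "loc_int (\<lambda>r. m r * d r)" by (rule loc_int_mult_continuous[OF m d])
      show "loc_int (\<lambda>r. S * (m r * ?w r))" by (intro loc_int_cmult loc_int_mult_continuous[OF m continuous_on_weight[OF m]])
      fix r assume "r \<in> closed_segment s z"
      then show "m r * d r <= S * (m r * ?w r)"
        using mult_left_mono[OF dS[of r] m(2)[of r]] sub by (auto simp: mult_ac)
    qed
    also have "\<dots> <= S * (?w z / 2)" unfolding aint_cmult
      using False by (intro mult_left_mono aint_weight_le[OF m]) auto
    finally have "S * ?w z <= c + S * ?w z / 2" using w0[of z] by (simp add: S_def)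
    then have "S * ?w z <= 2 * c * 1" by simp
    also have "\<dots> <= 2 * c * ?w z" using c w1[of z] by (intro mult_left_mono) auto
    finally show ?thesis using w0[of z] by simp
  qed (use c in simp)
  then have "S * ?w t <= 2 * c * ?w t" using w0[of t] by (intro mult_right_mono) auto
  then show ?thesis using dS[of t] by simp
qed

section \<open>Flows of fields that are measurable in time and Lipschitz in space\<close>

text \<open>One function \<open>m\<close> serves as Lipschitz constant and as bound at the origin,
  so that a single weight controls existence, uniqueness and dependence on the data.\<close>

locale caratheodory =
  fixes F :: "real => 'a::euclidean_space => 'a" and m :: "real => real"
  assumes F_measurable: "borel_fun (\<lambda>(t, x). F t x)"
    and m_loc_int: "loc_int m" and m_nonneg: "\<And>t. 0 <= m t"
    and F_lipschitz: "\<And>t x y. norm (F t x - F t y) <= m t * norm (x - y)"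
    and F_zero: "\<And>t. norm (F t 0) <= m t"
begin

definition sol :: "(real => 'a) => bool" where
  "sol y \<longleftrightarrow> continuous_on UNIV y \<and> (\<forall>s t. y t - y s = oint (\<lambda>r. F r (y r)) s t)"

lemma F_bound: "norm (F t x) <= m t * (1 + norm x)"
  using norm_triangle_sub[of "F t x" "F t 0"] F_zero[of t] F_lipschitz[of t x 0] by (simp add: ring_distribs)

lemma loc_int_F:
  assumes y: "borel_fun y" and b: "\<And>r. norm (y r) <= g r" "continuous_on UNIV g"
  shows "loc_int (\<lambda>r. F r (y r))"
proof (rule loc_int_bound)
  show "loc_int (\<lambda>r. m r * (1 + g r))"
    by (intro loc_int_mult_continuous m_loc_int m_nonneg continuous_intros b)
  have "borel_fun (\<lambda>r. case (r, y r) of (t, x) => F t x)"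
    by (rule measurable_compose[OF _ F_measurable]) (use y in measurable)
  then show "borel_fun (\<lambda>r. F r (y r))" by simp
  show "norm (F r (y r)) <= m r * (1 + g r)" for r
    using F_bound[of r "y r"] mult_left_mono[OF add_left_mono[OF b(1)[of r], of 1] m_nonneg[of r]] by linarith
qed

lemma loc_int_F_continuous: "continuous_on UNIV y ==> loc_int (\<lambda>r. F r (y r))"
  by (rule loc_int_F[of y "\<lambda>r. norm (y r)"]) (auto intro!: continuous_borel continuous_intros)

lemma solI:
  assumes "continuous_on UNIV y" "\<And>t. y t = y s + oint (\<lambda>r. F r (y r)) s t"
  shows "sol y"
  unfolding sol_def
proof (intro conjI allI assms(1))
  fix s' t
  show "y t - y s' = oint (\<lambda>r. F r (y r)) s' t"
    using assms(2)[of t] assms(2)[of s'] oint_combine[OF loc_int_F_continuous[OF assms(1)], of s s' t]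
    by (metis add_diff_cancel_left add_diff_cancel_left' )
qed

lemma sol_diff_bound:
  assumes "sol y" "sol z"
  shows "norm (y t - z t) <= 2 * norm (y s - z s) * weight m s t"
proof (rule weighted_gronwall[OF m_loc_int m_nonneg])
  have yc: "continuous_on UNIV y" "continuous_on UNIV z" using assms by (auto simp: sol_def)
  show dc: "continuous_on UNIV (\<lambda>t. norm (y t - z t))" by (intro continuous_intros yc)
  fix r
  have "y r - z r = (y s - z s) + ((y r - y s) - (z r - z s))" by simp
  also have "(y r - y s) - (z r - z s) = oint (\<lambda>r. F r (y r) - F r (z r)) s r"
    using assms by (simp only: sol_def oint_diff[OF loc_int_F_continuous[OF yc(1)] loc_int_F_continuous[OF yc(2)]])
  finally have "y r - z r = (y s - z s) + oint (\<lambda>r. F r (y r) - F r (z r)) s r" .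
  moreover have "norm (oint (\<lambda>r. F r (y r) - F r (z r)) s r) <= aint (\<lambda>r. m r * norm (y r - z r)) s r"
    by (intro norm_oint_le loc_int_diff loc_int_F_continuous yc loc_int_mult_continuous m_loc_int m_nonneg dc F_lipschitz)
  ultimately show "norm (y r - z r) <= norm (y s - z s) + aint (\<lambda>r. m r * norm (y r - z r)) s r"
    using norm_triangle_ineq[of "y s - z s" "oint (\<lambda>r. F r (y r) - F r (z r)) s r"] by simp
qed simp

lemma sol_unique: "sol y ==> sol z ==> y s = z s ==> y t = z t"
  using sol_diff_bound[of y z t s] by simp

primrec picard :: "real => 'a => nat => real => 'a" where
  "picard s x 0 t = x"
| "picard s x (Suc n) t = x + oint (\<lambda>r. F r (picard s x n r)) s t"

lemma picard_continuous: "continuous_on UNIV (picard s x n)"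
proof (induction n)
  case (Suc n)
  have "continuous_on UNIV (\<lambda>t. x + oint (\<lambda>r. F r (picard s x n r)) s t)"
    by (intro continuous_intros continuous_on_oint loc_int_F_continuous Suc)
  then show ?case by simp
qed simp

text \<open>Every iteration gains the factor \<open>1/2\<close> from \<open>aint_weight_le\<close>,
  on the whole time axis and in both directions of time at once.\<close>

lemma picard_step:
  "norm (picard s x (Suc n) t - picard s x n t) <= (1 + norm x) * (1 / 2) ^ n * weight m s t"
proof (induction n arbitrary: t)
  case 0
  have "norm (oint (\<lambda>r. F r x) s t) <= aint (\<lambda>r. (1 + norm x) * (m r * weight m s r)) s t"
  proof (rule norm_oint_le)
    show "loc_int (\<lambda>r. F r x)" using loc_int_F_continuous[of "\<lambda>r. x"] by simp
    show "loc_int (\<lambda>r. (1 + norm x) * (m r * weight m s r))"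
      by (intro loc_int_cmult loc_int_mult_continuous m_loc_int m_nonneg continuous_on_weight)
    show "norm (F r x) <= (1 + norm x) * (m r * weight m s r)" for r
    proof -
      have "m r * (1 + norm x) * 1 <= m r * (1 + norm x) * weight m s r"
        using m_nonneg[of r] by (intro mult_left_mono weight_ge_1 m_nonneg) auto
      then show ?thesis using F_bound[of r x] by (simp add: mult_ac)
    qed
  qed
  also have "\<dots> <= (1 + norm x) * (weight m s t / 2)"
    unfolding aint_cmult by (intro mult_left_mono aint_weight_le m_loc_int m_nonneg) auto
  also have "\<dots> <= (1 + norm x) * weight m s t"
    using weight_ge_1[of m s t, OF m_nonneg] by (intro mult_left_mono) auto
  finally show ?case by simp
next
  case (Suc n)
  let ?K = "(1 + norm x) * (1 / 2) ^ n"
  note li = loc_int_F_continuous[OF picard_continuous]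
  have "picard s x (Suc (Suc n)) t - picard s x (Suc n) t
      = oint (\<lambda>r. F r (picard s x (Suc n) r) - F r (picard s x n r)) s t"
    by (simp only: picard.simps(2)[of s x "Suc n" t] picard.simps(2)[of s x n t] oint_diff[OF li li]) simp
  also have "norm \<dots> <= aint (\<lambda>r. ?K * (m r * weight m s r)) s t"
  proof (rule norm_oint_le)
    show "norm (F r (picard s x (Suc n) r) - F r (picard s x n r)) <= ?K * (m r * weight m s r)" for r
      using order_trans[OF F_lipschitz mult_left_mono[OF Suc[of r] m_nonneg[of r]]] by (simp only: mult_ac)
  qed (intro loc_int_diff li loc_int_cmult loc_int_mult_continuous m_loc_int m_nonneg continuous_on_weight)+
  also have "\<dots> <= ?K * (weight m s t / 2)"
    unfolding aint_cmult by (intro mult_left_mono aint_weight_le m_loc_int m_nonneg) auto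
  finally show ?case by (simp only: power_Suc)
qed

text \<open>The telescoping series of Picard differences converges at every time. The tail estimate
  is a multiple of the weight, hence integrable against \<open>m\<close>, and lets the integral
  equation pass to the limit.\<close>

lemma sol_exists: "\<exists>y. sol y \<and> y s = x"
proof -
  let ?p = "picard s x" and ?w = "weight m s"
  define K where "K = 1 + norm x"
  have K: "0 <= K" by (simp add: K_def)
  have step: "norm (?p (Suc n) t - ?p n t) <= K * ?w t * (1 / 2) ^ n" for n t
    using picard_step[of s x n t] by (simp add: K_def mult_ac)
  have w0: "0 <= ?w t" for t using weight_ge_1[of m s t, OF m_nonneg] by linarith
  have gs: "summable (\<lambda>n. K * ?w t * (1 / 2) ^ n)" for t
    by (intro summable_mult summable_geometric) simp
  have sm: "summable (\<lambda>n. ?p (Suc n) t - ?p n t)" for t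
    by (rule summable_comparison_test'[OF gs[of t], of 0]) (rule step)
  define y where "y = (\<lambda>t. x + (\<Sum>n. ?p (Suc n) t - ?p n t))"
  have lim: "(\<lambda>n. ?p n t) \<longlonglongrightarrow> y t" for t
  proof -
    have "(\<lambda>n. x + (\<Sum>k<n. ?p (Suc k) t - ?p k t)) \<longlonglongrightarrow> y t"
      unfolding y_def by (intro tendsto_intros summable_LIMSEQ sm)
    moreover have "x + (\<Sum>k<n. ?p (Suc k) t - ?p k t) = ?p n t" for n
      using sum_lessThan_telescope[of "\<lambda>k. ?p k t" n] by simp
    ultimately show ?thesis by simp
  qed
  have tail: "norm (y t - ?p n t) <= 2 * K * ?w t * (1 / 2) ^ n" for n t
  proof -
    have "norm (?p (n + k) t - ?p n t) <= 2 * K * ?w t * (1 / 2) ^ n" for k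
    proof -
      have "norm (?p (n + k) t - ?p n t) <= K * ?w t * (1 / 2) ^ n * (2 - 2 * (1 / 2) ^ k)"
      proof (induction k)
        case (Suc k)
        have "norm (?p (n + Suc k) t - ?p n t) <= norm (?p (Suc (n + k)) t - ?p (n + k) t) + norm (?p (n + k) t - ?p n t)"
          using norm_triangle_ineq[of "?p (Suc (n + k)) t - ?p (n + k) t" "?p (n + k) t - ?p n t"] by simp
        also have "\<dots> <= K * ?w t * (1 / 2) ^ (n + k) + K * ?w t * (1 / 2) ^ n * (2 - 2 * (1 / 2) ^ k)"
          by (intro add_mono step Suc)
        finally show ?case by (simp add: power_add algebra_simps)
      qed simp
      also have "\<dots> <= K * ?w t * (1 / 2) ^ n * 2" using K w0[of t] by (intro mult_left_mono) auto
      finally show ?thesis by (simp add: mult_ac)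
    qed
    moreover have "(\<lambda>k. norm (?p (n + k) t - ?p n t)) \<longlonglongrightarrow> norm (y t - ?p n t)"
      using LIMSEQ_ignore_initial_segment[OF lim[of t], of n] by (intro tendsto_intros) (simp add: add.commute)
    ultimately show ?thesis by (intro LIMSEQ_le_const2) blast+
  qed
  have ym: "borel_fun y"
    by (rule borel_measurable_LIMSEQ_metric[OF _ lim]) (rule continuous_borel[OF picard_continuous])
  have yb: "norm (y t) <= norm x + 2 * K * ?w t" for t
    using tail[of t 0] norm_triangle_sub[of "y t" x] by simp
  have li: "loc_int (\<lambda>r. F r (y r))"
    by (rule loc_int_F[OF ym yb]) (intro continuous_intros continuous_on_weight m_loc_int m_nonneg)
  have eq: "y t = x + oint (\<lambda>r. F r (y r)) s t" for t
  proof (rule LIMSEQ_unique)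
    show "(\<lambda>n. ?p (Suc n) t) \<longlonglongrightarrow> y t" using lim by (rule LIMSEQ_Suc)
    have "(\<lambda>n. oint (\<lambda>r. F r (?p n r)) s t) \<longlonglongrightarrow> oint (\<lambda>r. F r (y r)) s t"
    proof (rule LIM_zero_cancel, rule Lim_null_comparison)
      show "(\<lambda>n. 2 * K * (?w t / 2) * (1 / 2) ^ n) \<longlonglongrightarrow> 0"
        by (intro tendsto_mult_right_zero LIMSEQ_power_zero) simp
      have "norm (oint (\<lambda>r. F r (?p n r)) s t - oint (\<lambda>r. F r (y r)) s t) <= 2 * K * (?w t / 2) * (1 / 2) ^ n" for n
      proof -
        note lp = loc_int_F_continuous[OF picard_continuous]
        have "norm (oint (\<lambda>r. F r (?p n r) - F r (y r)) s t) <= aint (\<lambda>r. (2 * K * (1 / 2) ^ n) * (m r * ?w r)) s t"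
        proof (rule norm_oint_le)
          show "norm (F r (?p n r) - F r (y r)) <= (2 * K * (1 / 2) ^ n) * (m r * ?w r)" for r
          proof -
            have "norm (F r (?p n r) - F r (y r)) <= m r * norm (y r - ?p n r)"
              using F_lipschitz[of r "?p n r" "y r"] by (simp add: norm_minus_commute)
            also have "\<dots> <= m r * (2 * K * ?w r * (1 / 2) ^ n)" by (intro mult_left_mono tail m_nonneg)
            finally show ?thesis by (simp add: mult_ac)
          qed
        qed (intro loc_int_diff lp li loc_int_cmult loc_int_mult_continuous m_loc_int m_nonneg continuous_on_weight)+
        also have "\<dots> <= (2 * K * (1 / 2) ^ n) * (?w t / 2)"
          unfolding aint_cmult using K by (intro mult_left_mono aint_weight_le m_loc_int m_nonneg) auto
        finally show ?thesis unfolding oint_diff[OF lp li] by (simp add: mult_ac)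
      qed
      then show "\<forall>\<^sub>F n in sequentially. norm (oint (\<lambda>r. F r (?p n r)) s t - oint (\<lambda>r. F r (y r)) s t) <= 2 * K * (?w t / 2) * (1 / 2) ^ n"
        by simp
    qed
    then show "(\<lambda>n. ?p (Suc n) t) \<longlonglongrightarrow> x + oint (\<lambda>r. F r (y r)) s t"
      by (simp add: tendsto_add)
  qed
  have "continuous_on UNIV (\<lambda>t. x + oint (\<lambda>r. F r (y r)) s t)"
    by (intro continuous_intros continuous_on_oint li)
  then have yc: "continuous_on UNIV y" by (rule continuous_on_eq) (rule eq[symmetric])
  have ys: "y s = x" using eq[of s] by (simp only: oint_refl add_0_right)
  have "sol y" by (rule solI[OF yc, of s]) (unfold ys, rule eq)
  with ys show ?thesis by blast
qed

text \<open>The first argument is the starting time, the second the time of observation;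
  \<open>sol_unique\<close> makes the choice immaterial.\<close>

definition flow :: "real => real => 'a => 'a" where
  "flow s t x = (SOME y. sol y \<and> y s = x) t"

lemma flow_sol: "sol (\<lambda>t. flow s t x)" and flow_refl [simp]: "flow s s x = x"
proof -
  have "sol (SOME y. sol y \<and> y s = x) \<and> (SOME y. sol y \<and> y s = x) s = x"
    using sol_exists by (rule someI_ex)
  then show "sol (\<lambda>t. flow s t x)" "flow s s x = x" unfolding flow_def by auto
qed

lemma flow_unique: "sol y ==> flow s t (y s) = y t"
  using sol_unique[OF flow_sol[of s "y s"], of y s t] by simp

lemma flow_comp: "flow s t (flow r s x) = flow r t x"
  using flow_unique[OF flow_sol[of r x], of s t] .

lemma flow_inverse: "flow t s (flow s t x) = x"
  by (simp add: flow_comp)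

lemma flow_lipschitz: "norm (flow s t x - flow s t y) <= 2 * norm (x - y) * weight m s t"
  using sol_diff_bound[OF flow_sol[of s x] flow_sol[of s y], of t s] by simp

lemma flow_continuous: "continuous_on UNIV (\<lambda>t. flow s t x)"
  using flow_sol by (simp add: sol_def)

lemma flow_loc_int: "loc_int (\<lambda>r. F r (flow s r x))"
  by (rule loc_int_F_continuous[OF flow_continuous])

lemma flow_eq: "flow s t x - flow s t' x = oint (\<lambda>r. F r (flow s r x)) t' t"
  using flow_sol[of s x] by (simp add: sol_def)

end

section \<open>Fields with Hoelder continuous derivative\<close>

text \<open>The value at \<open>x + k'\<close> is expanded both around \<open>x\<close> and around
  \<open>y\<close>, and the value at \<open>x\<close> around \<open>y\<close>. With
  \<open>k'\<close> rescaled to length \<open>norm (x - y)\<close> all three remainders have the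
  same order; the constant 6 is \<open>4 + 1 + 1\<close>, where 4 bounds
  \<open>2 powr (1 + a)\<close>.\<close>

lemma expansion_imp_derivative_holder:
  fixes f :: "'a::real_normed_vector => 'b::real_normed_vector"
  assumes K: "0 <= K" and a: "0 < a" "a <= 1" and J: "\<And>x. linear (J x)"
    and e: "\<And>x h. norm (f (x + h) - f x - J x h) <= K * norm h powr (1 + a)"
  shows "norm (J x k - J y k) <= 6 * K * norm (x - y) powr a * norm k"
proof (cases "x = y \<or> k = 0")
  case True
  then show ?thesis using linear_0[OF J] by auto
next
  case False
  define d where "d = norm (x - y)"
  have d: "d > 0" using False by (simp add: d_def)
  define k' where "k' = (d / norm k) *\<^sub>R k"
  have k': "norm k' = d" using False d by (simp add: k'_def)
  have lin: "J y (x - y + k') = J y (x - y) + J y k'" by (rule linear_add[OF J])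
  have 4: "(2 * d) powr (1 + a) <= 4 * d powr (1 + a)"
  proof -
    have "2 powr (1 + a) <= 2 powr (2::real)" using a by (intro powr_mono) auto
    then show ?thesis using d by (simp add: powr_mult mult_right_mono)
  qed
  have "norm (x - y + k') <= 2 * d" using norm_triangle_ineq[of "x - y" k'] k' by (simp add: d_def)
  then have "norm (x - y + k') powr (1 + a) <= (2 * d) powr (1 + a)" using a by (intro powr_mono2) auto
  then have 2: "norm (f (y + (x - y + k')) - f y - J y (x - y + k')) <= K * (4 * d powr (1 + a))"
    using e[of y "x - y + k'"] 4 K by (meson mult_left_mono order_trans)
  have 1: "norm (f (x + k') - f x - J x k') <= K * d powr (1 + a)" using e[of x k'] k' by simp
  have 3: "norm (f (y + (x - y)) - f y - J y (x - y)) <= K * d powr (1 + a)" using e[of y "x - y"] by (simp add: d_def)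
  have eq: "J x k' - J y k' = (f (y + (x - y + k')) - f y - J y (x - y + k')) - (f (y + (x - y)) - f y - J y (x - y))
      - (f (x + k') - f x - J x k')"
    unfolding lin by simp
  have "norm (J x k' - J y k') <= K * (4 * d powr (1 + a)) + K * d powr (1 + a) + K * d powr (1 + a)"
    unfolding eq by (intro order_trans[OF norm_triangle_ineq4] add_mono 1 2 3)
  also have "\<dots> = 6 * K * d powr a * d" using d by (simp add: powr_add)
  finally have *: "norm (J x k' - J y k') <= 6 * K * d powr a * d" .
  have "J x k' - J y k' = (d / norm k) *\<^sub>R (J x k - J y k)"
    unfolding k'_def linear_cmul[OF J] by (simp add: scaleR_diff_right)
  then have "norm (J x k' - J y k') = d / norm k * norm (J x k - J y k)" using d by simp
  with * have "d * norm (J x k - J y k) <= d * (6 * K * d powr a * norm k)"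
    using False by (simp add: field_simps)
  then show ?thesis using d by (simp add: d_def)
qed

lemma expansion_imp_has_derivative:
  fixes f :: "'a::euclidean_space => 'b::real_normed_vector"
  assumes a: "0 < a" and J: "linear J"
    and e: "\<And>h. norm (f (x + h) - f x - J h) <= K * norm h powr (1 + a)"
  shows "(f has_derivative J) (at x)"
  unfolding has_derivative_at
proof
  show "bounded_linear J" using J by (simp add: linear_conv_bounded_linear)
  show "(\<lambda>h. norm (f (x + h) - f x - J h) / norm h) \<midarrow>0\<rightarrow> 0"
  proof (rule tendsto_sandwich[OF _ _ tendsto_const])
    have "((\<lambda>h::'a. K * norm h powr a) \<longlongrightarrow> K * 0 powr a) (at 0)"
      using a by (intro tendsto_intros tendsto_powr2 tendsto_norm_zero) (auto simp: eventually_at_filter)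
    then show "((\<lambda>h::'a. K * norm h powr a) \<longlongrightarrow> 0) (at 0)" using a by simp
    have "norm (f (x + h) - f x - J h) / norm h <= K * norm h powr a" if "h \<noteq> 0" for h
      using e[of h] that by (simp add: powr_add field_simps)
    then show "\<forall>\<^sub>F h in at 0. norm (f (x + h) - f x - J h) / norm h <= K * norm h powr a"
      by (auto simp: eventually_at_filter)
  qed simp
qed

lemma itg_linear:
  assumes f: "loc_int f" and l: "bounded_linear l"
  shows "itg (\<lambda>r. l (f r)) a b = l (itg f a b)"
  unfolding itg_def set_lebesgue_integral_def
  using f integral_bounded_linear[OF l, of lborel "\<lambda>r. indicat_real {a..b} r *\<^sub>R f r"]
  by (simp add: loc_int_def set_integrable_def linear_simps[OF l])

text \<open>\<open>L t x\<close> is the space derivative of \<open>v t\<close> at \<open>x\<close>.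
  The expansion of order \<open>1 + a\<close> encodes its Hoelder continuity
  (\<open>expansion_imp_derivative_holder\<close>) in a form that passes to sums of series and to
  the flow.\<close>

locale c1a_field =
  fixes v :: "real => plane => plane" and L :: "real => plane => plane => plane"
    and m :: "real => real" and a :: real
  assumes a: "0 < a" "a <= 1"
    and v_measurable: "borel_fun (\<lambda>(t, x). v t x)"
    and m_loc_int: "loc_int m" and m_nonneg: "\<And>t. 0 <= m t"
    and v_bound: "\<And>t x. norm (v t x) <= m t"
    and v_lipschitz: "\<And>t x y. norm (v t x - v t y) <= m t * norm (x - y)"
    and L_linear: "\<And>t x. linear (L t x)"
    and L_bound: "\<And>t x h. norm (L t x h) <= m t * norm h"
    and v_expansion: "\<And>t x h. norm (v t (x + h) - v t x - L t x h) <= m t * norm h powr (1 + a)"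
begin

sublocale caratheodory v m
  by unfold_locales (auto intro: v_measurable m_loc_int m_nonneg v_lipschitz v_bound)

text \<open>The variational equation along a trajectory fits the same framework as the field itself.
  Measurability of its coefficient comes from difference quotients of \<open>v\<close> with step
  \<open>1 / Suc n\<close>, which converge by the expansion.\<close>

lemma linearized: "caratheodory (\<lambda>t z. L t (flow s t x) z) m"
proof
  let ?X = "\<lambda>t. flow s t x"
  have Xm[measurable]: "borel_fun ?X" by (rule continuous_borel[OF flow_continuous])
  have "(\<lambda>p. L (fst p) (?X (fst p)) (snd p)) \<in> borel_measurable (borel \<Otimes>\<^sub>M borel)"
  proof (rule borel_measurable_LIMSEQ_metric)
    fix n
    have [measurable]: "(\<lambda>p. case (fst p, f p) of (t, x) => v t x) \<in> borel_measurable (borel \<Otimes>\<^sub>M borel)"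
      if [measurable]: "f \<in> borel_measurable (borel \<Otimes>\<^sub>M borel)" for f :: "real \<times> plane => plane"
      by (rule measurable_compose[OF _ v_measurable[folded borel_prod]]) measurable
    have "(\<lambda>p. real (Suc n) *\<^sub>R ((case (fst p, ?X (fst p) + (1 / real (Suc n)) *\<^sub>R snd p) of (t, x) => v t x)
        - (case (fst p, ?X (fst p)) of (t, x) => v t x))) \<in> borel_measurable (borel \<Otimes>\<^sub>M borel)"
      by measurable
    then show "(\<lambda>p. real (Suc n) *\<^sub>R (v (fst p) (?X (fst p) + (1 / real (Suc n)) *\<^sub>R snd p) - v (fst p) (?X (fst p)))) \<in> borel_measurable (borel \<Otimes>\<^sub>M borel)"
      by (simp only: prod.case)
  next
    fix p :: "real \<times> plane"
    obtain t z where p: "p = (t, z)" by (cases p)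
    have 1: "norm (real (Suc n) *\<^sub>R (v t (?X t + (1 / real (Suc n)) *\<^sub>R z) - v t (?X t)) - L t (?X t) z) <= m t * norm z powr (1 + a) * (1 / real (Suc n)) powr a" for n
    proof -
      let ?N = "real (Suc n)"
      have "?N *\<^sub>R (v t (?X t + (1 / ?N) *\<^sub>R z) - v t (?X t)) - L t (?X t) z = ?N *\<^sub>R (v t (?X t + (1 / ?N) *\<^sub>R z) - v t (?X t) - L t (?X t) ((1 / ?N) *\<^sub>R z))"
        by (simp add: scaleR_diff_right linear_cmul[OF L_linear])
      also have "norm \<dots> <= ?N * (m t * norm ((1 / ?N) *\<^sub>R z) powr (1 + a))"
        using v_expansion[of t "?X t" "(1 / ?N) *\<^sub>R z"] by (simp del: of_nat_Suc)
      also have "norm ((1 / ?N) *\<^sub>R z) powr (1 + a) = (1 / ?N) powr (1 + a) * norm z powr (1 + a)"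
        by (simp add: powr_mult powr_divide del: of_nat_Suc)
      also have "(1 / ?N) powr (1 + a) = 1 / ?N * (1 / ?N) powr a" by (simp add: powr_add del: of_nat_Suc)
      also have "?N * (m t * (1 / ?N * (1 / ?N) powr a * norm z powr (1 + a))) = m t * norm z powr (1 + a) * (1 / ?N) powr a" by simp
      finally show ?thesis .
    qed
    have 2: "(\<lambda>n. m t * norm z powr (1 + a) * (1 / real (Suc n)) powr a) \<longlonglongrightarrow> 0"
    proof -
      have "(\<lambda>n. (1 / real (Suc n)) powr a) \<longlonglongrightarrow> 0"
        using a(1) by real_asymp
      then show ?thesis by (rule tendsto_mult_right_zero)
    qed
    show "(\<lambda>n. real (Suc n) *\<^sub>R (v (fst p) (?X (fst p) + (1 / real (Suc n)) *\<^sub>R snd p) - v (fst p) (?X (fst p)))) \<longlonglongrightarrow> L (fst p) (?X (fst p)) (snd p)"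
      unfolding p fst_conv snd_conv
      by (rule LIM_zero_cancel, rule Lim_null_comparison[OF _ 2], rule always_eventually, rule allI, rule 1)
  qed
  then show "borel_fun (\<lambda>(t, z). L t (flow s t x) z)" by (simp add: case_prod_beta' borel_prod)
  show "norm (L t (flow s t x) y - L t (flow s t x) z) <= m t * norm (y - z)" for t y z
    using L_bound[of t "flow s t x" "y - z"] linear_diff[OF L_linear] by metis
  show "norm (L t (flow s t x) 0) <= m t" for t using linear_0[OF L_linear] m_nonneg by simp
qed (rule m_loc_int m_nonneg)+

text \<open>The solution of the variational equation; \<open>flow_has_derivative\<close> identifies
  it as the space derivative of the flow.\<close>

definition dflow :: "real => real => plane => plane => plane" where
  "dflow s t x = caratheodory.flow (\<lambda>t z. L t (flow s t x) z) s t"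

lemmas lin_sol_def = caratheodory.sol_def[OF linearized]

lemma dflow_sol: "caratheodory.sol (\<lambda>t z. L t (flow s t x) z) (\<lambda>t. dflow s t x h)"
  unfolding dflow_def by (rule caratheodory.flow_sol[OF linearized])

lemma dflow_continuous: "continuous_on UNIV (\<lambda>t. dflow s t x h)"
  using dflow_sol by (simp add: lin_sol_def)

lemma dflow_refl [simp]: "dflow s s x h = h"
  unfolding dflow_def by (rule caratheodory.flow_refl[OF linearized])

lemma dflow_loc_int: "loc_int (\<lambda>r. L r (flow s r x) (dflow s r x h))"
  by (rule caratheodory.loc_int_F_continuous[OF linearized dflow_continuous])

lemma dflow_eq: "dflow s t x h = h + oint (\<lambda>r. L r (flow s r x) (dflow s r x h)) s t"
  using dflow_sol[of s x h] unfolding lin_sol_def by (metis add.commute diff_add_cancel dflow_refl)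

lemma dflow_unique:
  assumes "continuous_on UNIV y" "\<And>t. y t = y s + oint (\<lambda>r. L r (flow s r x) (y r)) s t"
  shows "dflow s t x (y s) = y t"
  unfolding dflow_def
  by (rule caratheodory.flow_unique[OF linearized caratheodory.solI[OF linearized assms]])

lemma dflow_linear: "linear (dflow s t x)"
proof (rule linearI)
  fix h k :: plane and c :: real
  have "dflow s t x (dflow s s x h + dflow s s x k) = dflow s t x h + dflow s t x k"
  proof (rule dflow_unique[of "\<lambda>t. dflow s t x h + dflow s t x k"])
    fix t
    have "dflow s t x h + dflow s t x k = (h + k) + (oint (\<lambda>r. L r (flow s r x) (dflow s r x h)) s t + oint (\<lambda>r. L r (flow s r x) (dflow s r x k)) s t)"
      by (subst (1 2) dflow_eq) simp
    then show "dflow s t x h + dflow s t x k = dflow s s x h + dflow s s x k + oint (\<lambda>r. L r (flow s r x) (dflow s r x h + dflow s r x k)) s t"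
      by (simp add: linear_add[OF L_linear] oint_add[OF dflow_loc_int dflow_loc_int])
  qed (intro continuous_intros dflow_continuous)
  then show "dflow s t x (h + k) = dflow s t x h + dflow s t x k" by simp
  have "dflow s t x (c *\<^sub>R dflow s s x h) = c *\<^sub>R dflow s t x h"
  proof (rule dflow_unique[of "\<lambda>t. c *\<^sub>R dflow s t x h"])
    fix t
    have "c *\<^sub>R dflow s t x h = c *\<^sub>R h + c *\<^sub>R oint (\<lambda>r. L r (flow s r x) (dflow s r x h)) s t"
      by (subst dflow_eq) (simp add: scaleR_add_right)
    then show "c *\<^sub>R dflow s t x h = c *\<^sub>R dflow s s x h + oint (\<lambda>r. L r (flow s r x) (c *\<^sub>R dflow s r x h)) s t"
      by (simp add: linear_cmul[OF L_linear] oint_scaleR)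
  qed (intro continuous_intros dflow_continuous)
  then show "dflow s t x (c *\<^sub>R h) = c *\<^sub>R dflow s t x h" by simp
qed

lemma dflow_bound: "norm (dflow s t x h) <= 2 * norm h * weight m s t"
  using caratheodory.flow_lipschitz[OF linearized, of s x s t h 0] linear_0[OF dflow_linear, of s t x]
  by (simp add: dflow_def)

lemma dflow_comp: "dflow s t (flow r s x) (dflow r s x h) = dflow r t x h"
  unfolding dflow_def[of s t] flow_comp unfolding dflow_def by (rule caratheodory.flow_comp[OF linearized])

lemma dflow_near_id: "norm (dflow s t x h - h) <= 2 * norm h * weight m s t * aint m s t"
proof -
  have w: "weight m s r <= weight m s t" if "r \<in> closed_segment s t" for r
    using aint_sub[OF m_loc_int m_nonneg that] by (simp add: weight_def)
  have "norm (oint (\<lambda>r. L r (flow s r x) (dflow s r x h)) s t) <= aint (\<lambda>r. (2 * norm h * weight m s t) * m r) s t"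
  proof (rule norm_oint_le[OF dflow_loc_int loc_int_cmult[OF m_loc_int]])
    fix r assume r: "r \<in> closed_segment s t"
    have "norm (dflow s r x h) <= 2 * norm h * weight m s t"
      by (rule order_trans[OF dflow_bound mult_left_mono[OF w[OF r]]]) simp
    from mult_left_mono[OF this m_nonneg[of r]] L_bound[of r "flow s r x" "dflow s r x h"]
    show "norm (L r (flow s r x) (dflow s r x h)) <= 2 * norm h * weight m s t * m r" by (simp add: mult_ac)
  qed
  then show ?thesis using dflow_eq[of s t x h] by (simp add: aint_cmult)
qed

lemma flow_displacement: "norm (flow s t x - flow s t' x) <= aint m t' t"
  unfolding flow_eq[of s t x t'] by (rule norm_oint_le[OF flow_loc_int m_loc_int v_bound])

text \<open>The error \<open>e\<close> of the linear approximation solves the linearised equation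
  with a source, the Taylor remainder of \<open>v\<close> at the distance of the two trajectories.
  That distance is controlled by \<open>flow_lipschitz\<close>, and \<open>weighted_gronwall\<close>
  absorbs the linear part.\<close>

lemma flow_expansion:
  "norm (flow s t (x + h) - flow s t x - dflow s t x h)
    <= 2 * (aint m s t * (2 * norm h * weight m s t) powr (1 + a)) * weight m s t"
proof (rule weighted_gronwall[OF m_loc_int m_nonneg])
  let ?X = "\<lambda>r. flow s r x" and ?Y = "\<lambda>r. flow s r (x + h)" and ?J = "\<lambda>r. dflow s r x h"
  define e where "e = (\<lambda>r. ?Y r - ?X r - ?J r)"
  define b where "b = (2 * norm h * weight m s t) powr (1 + a)"
  have ec: "continuous_on UNIV e" unfolding e_def by (intro continuous_intros flow_continuous dflow_continuous)
  show "continuous_on UNIV (\<lambda>r. norm (flow s r (x + h) - flow s r x - dflow s r x h))"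
    by (rule continuous_on_norm[OF ec[unfolded e_def]])
  show "0 <= aint m s t * (2 * norm h * weight m s t) powr (1 + a)" by (simp add: aint_nonneg m_nonneg)
  fix r assume r: "r \<in> closed_segment s t"
  have "e r = oint (\<lambda>r. v r (?Y r) - v r (?X r) - L r (?X r) (?J r)) s r"
    unfolding oint_diff[OF loc_int_diff[OF flow_loc_int flow_loc_int] dflow_loc_int] oint_diff[OF flow_loc_int flow_loc_int]
      flow_eq[of s r _ s, symmetric] e_def using dflow_eq[of s r x h] by (simp add: algebra_simps)
  moreover have "norm (oint (\<lambda>r. v r (?Y r) - v r (?X r) - L r (?X r) (?J r)) s r) <= aint (\<lambda>r. m r * norm (e r) + b * m r) s r"
  proof (rule norm_oint_le)
    show "loc_int (\<lambda>r. v r (?Y r) - v r (?X r) - L r (?X r) (?J r))"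
      by (intro loc_int_diff flow_loc_int dflow_loc_int)
    show "loc_int (\<lambda>r. m r * norm (e r) + b * m r)"
      by (intro loc_int_add loc_int_cmult loc_int_mult_continuous m_loc_int m_nonneg continuous_intros ec)
    fix q assume "q \<in> closed_segment s r"
    then have q: "q \<in> closed_segment s t" using r by (auto simp: closed_segment_eq_real_ivl split: if_splits)
    let ?\<Delta> = "?Y q - ?X q"
    have "weight m s q <= weight m s t" using aint_sub[OF m_loc_int m_nonneg q] by (simp add: weight_def)
    then have "norm ?\<Delta> <= 2 * norm h * weight m s t"
      using flow_lipschitz[of s q "x + h" x] mult_left_mono[of "weight m s q" "weight m s t" "2 * norm h"] by simp
    then have "norm ?\<Delta> powr (1 + a) <= b" unfolding b_def using a by (intro powr_mono2) auto
    then have 1: "norm (v q (?X q + ?\<Delta>) - v q (?X q) - L q (?X q) ?\<Delta>) <= m q * b"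
      using order_trans[OF v_expansion mult_left_mono[OF _ m_nonneg]] by blast
    have "v q (?Y q) - v q (?X q) - L q (?X q) (?J q) = (v q (?X q + ?\<Delta>) - v q (?X q) - L q (?X q) ?\<Delta>) + L q (?X q) (e q)"
      unfolding e_def linear_diff[OF L_linear] by simp
    also have "norm \<dots> <= m q * b + m q * norm (e q)"
      by (intro order_trans[OF norm_triangle_ineq] add_mono 1 L_bound)
    finally show "norm (v q (?Y q) - v q (?X q) - L q (?X q) (?J q)) <= m q * norm (e q) + b * m q" by (simp add: mult_ac)
  qed
  moreover have "aint (\<lambda>r. m r * norm (e r) + b * m r) s r = aint (\<lambda>r. m r * norm (e r)) s r + b * aint m s r"
    unfolding aint_cmult[symmetric]
    by (intro aint_add loc_int_cmult loc_int_mult_continuous m_loc_int m_nonneg continuous_intros ec)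
  moreover have "b * aint m s r <= b * aint m s t"
    by (intro mult_left_mono aint_sub m_loc_int m_nonneg r) (simp add: b_def)
  ultimately show "norm (flow s r (x + h) - flow s r x - dflow s r x h)
      <= aint m s t * (2 * norm h * weight m s t) powr (1 + a) + aint (\<lambda>r. m r * norm (flow s r (x + h) - flow s r x - dflow s r x h)) s r"
    unfolding e_def b_def by (simp add: mult.commute)
qed

text \<open>One constant for all times in \<open>{-T..T}\<close>, the source of all bounds that are
  uniform in time: \<open>exp (2 * A)\<close> bounds every weight on the interval, and
  \<open>6 * K\<close> comes from \<open>expansion_imp_derivative_holder\<close>.\<close>

lemma flow_bounds:
  obtains C where "C >= 1"
    "\<And>s t x y. s \<in> {-T..T} ==> t \<in> {-T..T} ==> norm (flow s t x - flow s t y) <= C * norm (x - y)"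
    "\<And>s t x h. s \<in> {-T..T} ==> t \<in> {-T..T} ==> norm (dflow s t x h) <= C * norm h"
    "\<And>s t x h. s \<in> {-T..T} ==> t \<in> {-T..T} ==> norm (flow s t (x + h) - flow s t x - dflow s t x h) <= C * norm h powr (1 + a)"
    "\<And>s t x y h. s \<in> {-T..T} ==> t \<in> {-T..T} ==> norm (dflow s t x h - dflow s t y h) <= C * norm (x - y) powr a * norm h"
    "\<And>s t x h. s \<in> {-T..T} ==> t \<in> {-T..T} ==> norm (dflow s t x h - h) <= C * norm h * aint m s t"
    "\<And>s t x. s \<in> {-T..T} ==> t \<in> {-T..T} ==> norm (flow s t x - x) <= C"
proof -
  define A where "A = itg m (-T) T"
  define W where "W = exp (2 * A)"
  have A: "A >= 0" unfolding A_def by (rule itg_nonneg[OF m_nonneg])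
  have W: "W >= 1" using A by (simp add: W_def)
  have aA: "aint m s t <= A" if "s \<in> {-T..T}" "t \<in> {-T..T}" for s t
    unfolding A_def by (rule aint_le_itg[OF m_loc_int m_nonneg that])
  have wW: "weight m s t <= W" if "s \<in> {-T..T}" "t \<in> {-T..T}" for s t
    using aA[OF that] by (simp add: weight_def W_def)
  have w0: "0 <= weight m s t" for s t by (simp add: weight_def)
  define K where "K = 2 * (A * (2 * W) powr (1 + a)) * W"
  have K: "K >= 0" using A W by (simp add: K_def)
  define C where "C = 2 * W + 6 * K + A"
  have C: "1 <= C" "2 * W <= C" "K <= C" "6 * K <= C" "A <= C" using A W K by (auto simp: C_def)
  have W2: "2 * norm h * weight m s t <= C * norm h" if "s \<in> {-T..T}" "t \<in> {-T..T}" for s t and h :: plane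
  proof -
    have "2 * norm h * weight m s t <= 2 * norm h * W" by (intro mult_left_mono wW that) simp
    also have "\<dots> <= C * norm h" using mult_right_mono[OF C(2), of "norm h"] by (simp add: mult_ac)
    finally show ?thesis .
  qed
  have ex: "norm (flow s t (x + h) - flow s t x - dflow s t x h) <= K * norm h powr (1 + a)"
    if st: "s \<in> {-T..T}" "t \<in> {-T..T}" for s t x h
  proof -
    have "(2 * norm h * weight m s t) powr (1 + a) <= (2 * norm h * W) powr (1 + a)"
      using a w0 by (intro powr_mono2 mult_left_mono wW st) auto
    also have "\<dots> = (2 * W) powr (1 + a) * norm h powr (1 + a)"
      using W by (simp add: powr_mult[symmetric] mult_ac)
    finally have "2 * (aint m s t * (2 * norm h * weight m s t) powr (1 + a)) * weight m s t
        <= 2 * (A * ((2 * W) powr (1 + a) * norm h powr (1 + a))) * W"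
      using A w0 by (intro mult_mono[OF mult_left_mono[OF mult_mono[OF aA[OF st]]] wW[OF st]])
        (auto simp: aint_nonneg m_nonneg)
    then show ?thesis using flow_expansion[of s t x h] by (simp add: K_def mult_ac)
  qed
  show thesis
  proof (rule that[OF C(1)])
    fix s t :: real and x y h :: plane
    assume st: "s \<in> {-T..T}" "t \<in> {-T..T}"
    show "norm (flow s t x - flow s t y) <= C * norm (x - y)" using flow_lipschitz[of s t x y] W2[OF st, of "x - y"] by simp
    show "norm (dflow s t x h) <= C * norm h" using dflow_bound[of s t x h] W2[OF st, of h] by simp
    show "norm (flow s t (x + h) - flow s t x - dflow s t x h) <= C * norm h powr (1 + a)"
      using ex[OF st, of x h] mult_right_mono[OF C(3), of "norm h powr (1 + a)"] by simp
    have "norm (dflow s t x h - dflow s t y h) <= 6 * K * norm (x - y) powr a * norm h"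
      by (rule expansion_imp_derivative_holder[OF K a dflow_linear ex[OF st]])
    also have "\<dots> <= C * norm (x - y) powr a * norm h" using C(4) by (intro mult_right_mono) auto
    finally show "norm (dflow s t x h - dflow s t y h) <= C * norm (x - y) powr a * norm h" .
    show "norm (dflow s t x h - h) <= C * norm h * aint m s t"
      using dflow_near_id[of s t x h] mult_right_mono[OF W2[OF st, of h], of "aint m s t"] by (simp add: aint_nonneg m_nonneg)
    show "norm (flow s t x - x) <= C"
      using flow_displacement[of s t x s] aA[OF st] C(5) by simp
  qed
qed

lemma flow_has_derivative: "(flow s t has_derivative dflow s t x) (at x)"
proof -
  define T where "T = max \<bar>s\<bar> \<bar>t\<bar>"
  have T: "s \<in> {-T..T}" "t \<in> {-T..T}" by (auto simp: T_def)
  obtain C where C: "C >= 1" "\<And>s t x h. s \<in> {-T..T} ==> t \<in> {-T..T} ==>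
    norm (flow s t (x + h) - flow s t x - dflow s t x h) <= C * norm h powr (1 + a)"
    by (rule flow_bounds[of T]) (rule that)
  show ?thesis by (rule expansion_imp_has_derivative[OF a(1) dflow_linear C(2)[OF T]])
qed

text \<open>Moving the starting time from \<open>s\<close> to \<open>t\<close> is a composition with \<open>flow s t\<close>, which is close to the identity.\<close>

lemma aint_tendsto: "((\<lambda>p. aint m (fst p) (fst q)) \<longlongrightarrow> 0) (at (q :: real \<times> plane))"
proof -
  have "continuous_on UNIV (\<lambda>t. \<bar>oint m (fst q) t\<bar>)" by (intro continuous_intros continuous_on_oint m_loc_int)
  then have "isCont (\<lambda>t. \<bar>oint m (fst q) t\<bar>) (fst q)" by (simp add: continuous_on_eq_continuous_at)
  then have "((\<lambda>p. \<bar>oint m (fst q) (fst p)\<bar>) \<longlongrightarrow> \<bar>oint m (fst q) (fst q)\<bar>) (at q)"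
    by (rule isCont_tendsto_compose) (intro tendsto_intros)
  moreover have "\<bar>oint m (fst q) (fst p)\<bar> = aint m (fst p) (fst q)" for p :: "real \<times> plane"
    using aint_abs_oint[OF m_loc_int m_nonneg, of "fst q" "fst p"] by (simp add: aint_commute)
  ultimately show ?thesis by simp
qed

lemma eventually_fst_in: "\<forall>\<^sub>F p in at (q :: real \<times> plane). fst p \<in> {- (\<bar>fst q\<bar> + 1)..\<bar>fst q\<bar> + 1}"
proof -
  have "((\<lambda>p. fst p) \<longlongrightarrow> fst q) (at q)" by (intro tendsto_intros)
  then have "\<forall>\<^sub>F p in at q. dist (fst p) (fst q) < 1" by (rule tendstoD) simp
  then show ?thesis by eventually_elim (auto simp: dist_real_def)
qed

lemma backward_flow_continuous: "continuous_on UNIV (\<lambda>(t, x). flow t 0 x)"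
proof (rule continuous_at_imp_continuous_on, rule ballI)
  fix q :: "real \<times> plane"
  define T where "T = \<bar>fst q\<bar> + 1"
  obtain C where C: "C >= 1" "\<And>s t x y. s \<in> {-T..T} ==> t \<in> {-T..T} ==> norm (flow s t x - flow s t y) <= C * norm (x - y)"
    by (rule flow_bounds[of T]) (rule that)
  have "((\<lambda>p. (flow (fst p) 0 (snd p) - flow (fst q) 0 (snd q))) \<longlongrightarrow> 0) (at q)"
  proof (rule Lim_null_comparison)
    show "\<forall>\<^sub>F p in at q. norm (flow (fst p) 0 (snd p) - flow (fst q) 0 (snd q)) <= C * (aint m (fst p) (fst q) + norm (snd p - snd q))"
      using eventually_fst_in[of q]
    proof eventually_elim
      case (elim p)
      have T: "fst q \<in> {-T..T}" "0 \<in> {-T..T}" by (auto simp: T_def)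
      have "flow (fst p) 0 (snd p) = flow (fst q) 0 (flow (fst p) (fst q) (snd p))" by (simp add: flow_comp)
      then have "norm (flow (fst p) 0 (snd p) - flow (fst q) 0 (snd q)) <= C * norm (flow (fst p) (fst q) (snd p) - snd q)"
        using C(2)[OF T, of "flow (fst p) (fst q) (snd p)" "snd q"] by (simp only:)
      also have "norm (flow (fst p) (fst q) (snd p) - snd q) <= norm (flow (fst p) (fst q) (snd p) - snd p) + norm (snd p - snd q)"
        using norm_triangle_ineq[of "flow (fst p) (fst q) (snd p) - snd p" "snd p - snd q"] by simp
      also have "norm (flow (fst p) (fst q) (snd p) - snd p) <= aint m (fst p) (fst q)"
        using flow_displacement[of "fst p" "fst q" "snd p" "fst p"] by simp
      finally show ?case using C(1) by simp
    qed
    have "((\<lambda>p. C * (aint m (fst p) (fst q) + norm (snd p - snd q))) \<longlongrightarrow> C * (0 + norm (snd q - snd q))) (at q)"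
      by (intro tendsto_intros aint_tendsto)
    then show "((\<lambda>p. C * (aint m (fst p) (fst q) + norm (snd p - snd q))) \<longlongrightarrow> 0) (at q)" by simp
  qed
  then show "isCont (\<lambda>(t, x). flow t 0 x) q"
    unfolding isCont_def case_prod_beta' by (rule LIM_zero_cancel)
qed

lemma backward_dflow_continuous: "continuous_on UNIV (\<lambda>(t, x). dflow t 0 x h)"
proof (rule continuous_at_imp_continuous_on, rule ballI)
  fix q :: "real \<times> plane"
  define T where "T = \<bar>fst q\<bar> + 1"
  obtain C where C: "C >= 1"
    "\<And>s t x h. s \<in> {-T..T} ==> t \<in> {-T..T} ==> norm (dflow s t x h) <= C * norm h"
    "\<And>s t x y h. s \<in> {-T..T} ==> t \<in> {-T..T} ==> norm (dflow s t x h - dflow s t y h) <= C * norm (x - y) powr a * norm h"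
    "\<And>s t x h. s \<in> {-T..T} ==> t \<in> {-T..T} ==> norm (dflow s t x h - h) <= C * norm h * aint m s t"
    by (rule flow_bounds[of T]) (rule that)
  have "((\<lambda>p. (dflow (fst p) 0 (snd p) h - dflow (fst q) 0 (snd q) h)) \<longlongrightarrow> 0) (at q)"
  proof (rule Lim_null_comparison)
    let ?b = "\<lambda>p. C * (C * norm h * aint m (fst p) (fst q)) + C * (aint m (fst p) (fst q) + norm (snd p - snd q)) powr a * norm h"
    show "\<forall>\<^sub>F p in at q. norm (dflow (fst p) 0 (snd p) h - dflow (fst q) 0 (snd q) h) <= ?b p"
      using eventually_fst_in[of q]
    proof eventually_elim
      case (elim p)
      let ?s = "fst p" and ?t = "fst q" and ?x = "snd p" and ?y = "snd q"
      let ?z = "flow ?s ?t ?x"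
      have T: "?s \<in> {-T..T}" "?t \<in> {-T..T}" "0 \<in> {-T..T}" using elim by (auto simp: T_def)
      have eq: "dflow ?s 0 ?x h = dflow ?t 0 ?z (dflow ?s ?t ?x h)" by (simp add: dflow_comp)
      \<comment> \<open>The first term changes the vector, the second the base point.\<close>
      have eq': "dflow ?s 0 ?x h - dflow ?t 0 ?y h = dflow ?t 0 ?z (dflow ?s ?t ?x h - h) + (dflow ?t 0 ?z h - dflow ?t 0 ?y h)"
        unfolding eq linear_diff[OF dflow_linear] by simp
      have "norm (dflow ?s 0 ?x h - dflow ?t 0 ?y h) <= C * norm (dflow ?s ?t ?x h - h) + C * norm (?z - ?y) powr a * norm h"
        unfolding eq' by (intro order_trans[OF norm_triangle_ineq] add_mono C T)
      also have "\<dots> <= ?b p"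
      proof (intro add_mono mult_left_mono mult_right_mono C(4) T)
        have "norm (?z - ?y) <= norm (?z - ?x) + norm (?x - ?y)"
          using norm_triangle_ineq[of "?z - ?x" "?x - ?y"] by simp
        then have "norm (?z - ?y) <= aint m ?s ?t + norm (?x - ?y)"
          using flow_displacement[of ?s ?t ?x ?s] by simp
        then show "norm (?z - ?y) powr a <= (aint m ?s ?t + norm (?x - ?y)) powr a"
          using a by (intro powr_mono2) auto
      qed (use C(1) in auto)
      finally show ?case .
    qed
    have "((\<lambda>p. (aint m (fst p) (fst q) + norm (snd p - snd q)) powr a) \<longlongrightarrow> (0 + norm (snd q - snd q)) powr a) (at q)"
      by (intro tendsto_powr2 tendsto_intros aint_tendsto) (use a in \<open>auto simp: aint_nonneg m_nonneg\<close>)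
    then have p: "((\<lambda>p. (aint m (fst p) (fst q) + norm (snd p - snd q)) powr a) \<longlongrightarrow> 0) (at q)" using a by simp
    have "(?b \<longlongrightarrow> C * (C * norm h * 0) + C * 0 * norm h) (at q)"
      by (intro tendsto_intros aint_tendsto p)
    then show "(?b \<longlongrightarrow> 0) (at q)" by simp
  qed
  then show "isCont (\<lambda>(t, x). dflow t 0 x h) q"
    unfolding isCont_def case_prod_beta' by (rule LIM_zero_cancel)
qed

end

section \<open>Mollification\<close>

definition mollify :: "('a::euclidean_space => real) => nat => ('a => real) => 'a => real" where
  "mollify \<eta> n f z = (LBINT w. \<eta> w * f (z - (1 / real (Suc n)) *\<^sub>R w))"

locale mollifier =
  fixes \<eta> :: "'a::euclidean_space => real" and R :: real
  assumes smooth: "\<And>k. Ckon k UNIV \<eta>" and supp: "\<And>w. norm w > R ==> \<eta> w = 0"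
    and int1: "(LBINT w. \<eta> w) = 1"
begin

lemma \<eta>_continuous: "continuous_on UNIV \<eta>"
  using smooth[of 0] by simp

lemma \<eta>_measurable [measurable]: "borel_fun \<eta>"
  by (rule continuous_borel[OF \<eta>_continuous])

lemma \<eta>_integrable: "integrable lborel \<eta>"
proof -
  obtain a where a: "cball (0::'a) R \<subseteq> cbox (- a) a"
    using bounded_subset_cbox_symmetric[OF bounded_cball] by blast
  show ?thesis
    by (rule integrable_continuous_cbox_support[OF \<eta>_continuous, of "- a" a]) (use a supp in force)
qed

lemma \<eta>_bounded: obtains B where "B >= 0" "\<And>w. \<bar>\<eta> w\<bar> <= B"
proof -
  have "compact (\<eta> ` cball 0 R)"
    by (intro compact_continuous_image continuous_on_subset[OF \<eta>_continuous]) auto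
  then obtain B where B: "\<And>w. w \<in> cball 0 R ==> \<bar>\<eta> w\<bar> <= B"
    by (metis compact_imp_bounded bounded_iff image_eqI real_norm_def)
  have "\<bar>\<eta> w\<bar> <= max B 0" for w using B[of w] supp[of w] by (cases "norm w <= R") auto
  then show thesis using that[of "max B 0"] by simp
qed

text \<open>Moves the variable into \<eta>, so that its smoothness can be used while
  \<open>f\<close> is merely measurable.\<close>

lemma mollify_eq:
  assumes [measurable]: "borel_fun f"
  shows "mollify \<eta> n f z = (LBINT y. f y * (real (Suc n) ^ DIM('a) * \<eta> (real (Suc n) *\<^sub>R (z - y))))"
proof -
  let ?N = "real (Suc n)"
  let ?S = "LBINT y. f y * (?N ^ DIM('a) * \<eta> (?N *\<^sub>R (z - y)))"
  have 1: "(LBINT w. f (z + (- (1 / ?N)) *\<^sub>R w) * (?N ^ DIM('a) * \<eta> (?N *\<^sub>R (z - (z + (- (1 / ?N)) *\<^sub>R w)))))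
     = (LBINT y. f y * (?N ^ DIM('a) * \<eta> (?N *\<^sub>R (z - y)))) /\<^sub>R \<bar>- (1 / ?N)\<bar> ^ DIM('a)"
    by (intro lborel_affine_integral[of "\<lambda>y. f y * (?N ^ DIM('a) * \<eta> (?N *\<^sub>R (z - y)))"]) (auto simp del: of_nat_Suc)
  have 2: "f (z + (- (1 / ?N)) *\<^sub>R w) * (?N ^ DIM('a) * \<eta> (?N *\<^sub>R (z - (z + (- (1 / ?N)) *\<^sub>R w)))) = ?N ^ DIM('a) * (\<eta> w * f (z - (1 / ?N) *\<^sub>R w))" for w
    by (simp del: of_nat_Suc)
  have "?N ^ DIM('a) * mollify \<eta> n f z = ?S /\<^sub>R \<bar>- (1 / ?N)\<bar> ^ DIM('a)"
    unfolding 1[symmetric] 2 integral_mult_right_zero mollify_def ..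
  also have "\<dots> = ?N ^ DIM('a) * ?S" by (simp add: power_one_over del: of_nat_Suc)
  finally show ?thesis by (simp del: of_nat_Suc)
qed

lemma mollify_L1:
  assumes f: "integrable lborel f"
  shows "(\<lambda>n. LBINT z. \<bar>mollify \<eta> n f z - f z\<bar>) \<longlonglongrightarrow> 0"
  unfolding mollify_def
  by (rule approx_identity_L1_UNIV[OF f \<eta>_integrable int1]) (use LIMSEQ_inverse_real_of_nat in \<open>simp add: inverse_eq_divide\<close>)

lemma mollify_measurable [measurable]:
  assumes [measurable]: "borel_fun f" shows "borel_fun (mollify \<eta> n f)"
  unfolding mollify_def[abs_def] by measurable

lemma mollify_bound:
  assumes f: "borel_fun f" "\<And>z. \<bar>f z\<bar> <= M"
  shows "\<bar>mollify \<eta> n f z\<bar> <= M * (LBINT w. \<bar>\<eta> w\<bar>)"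
proof -
  note [measurable] = f(1)
  have b: "\<bar>\<eta> w * f (z - (1 / real (Suc n)) *\<^sub>R w)\<bar> <= M * \<bar>\<eta> w\<bar>" for w
    unfolding abs_mult mult.commute[of M] using f(2) by (intro mult_left_mono) auto
  have i: "integrable lborel (\<lambda>w. M * \<bar>\<eta> w\<bar>)" using \<eta>_integrable by simp
  have i': "integrable lborel (\<lambda>w. \<eta> w * f (z - (1 / real (Suc n)) *\<^sub>R w))"
    by (rule bochner_bound[OF i]) (use order_trans[OF b abs_ge_self] in auto)
  have "\<bar>mollify \<eta> n f z\<bar> <= (LBINT w. \<bar>\<eta> w * f (z - (1 / real (Suc n)) *\<^sub>R w)\<bar>)"
    unfolding mollify_def by (rule integral_abs_bound)
  also have "\<dots> <= (LBINT w. M * \<bar>\<eta> w\<bar>)"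
    by (rule integral_mono[OF integrable_abs[OF i'] i b])
  finally show ?thesis by simp
qed

lemma mollify_support:
  assumes "\<And>z. norm z > S ==> f z = 0" "norm z > S + R" "R >= 0"
  shows "mollify \<eta> n f z = 0"
proof -
  have "\<eta> w * f (z - (1 / real (Suc n)) *\<^sub>R w) = 0" for w
  proof (cases "norm w > R")
    case False
    have "norm ((1 / real (Suc n)) *\<^sub>R w) <= norm w" using mult_left_le_one_le[of "norm w" "1 / real (Suc n)"] by simp
    then have "norm (z - (1 / real (Suc n)) *\<^sub>R w) > S"
      using assms(2) False norm_triangle_ineq2[of z "(1 / real (Suc n)) *\<^sub>R w"] by linarith
    then show ?thesis using assms(1) by simp
  qed (use supp in simp)
  then show ?thesis unfolding mollify_def by (simp only: Bochner_Integration.integral_zero)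
qed

lemma mollify_tendsto:
  assumes f: "continuous_on UNIV f" "\<And>z. \<bar>f z\<bar> <= M"
  shows "(\<lambda>n. mollify \<eta> n f z) \<longlonglongrightarrow> f z"
proof -
  note [measurable] = continuous_borel[OF f(1)]
  have "(\<lambda>n. LBINT w. \<eta> w * f (z - (1 / real (Suc n)) *\<^sub>R w)) \<longlonglongrightarrow> (LBINT w. \<eta> w * f z)"
  proof (rule integral_dominated_convergence[where w="\<lambda>w. M * \<bar>\<eta> w\<bar>"])
    have "isCont f z" using f(1) by (simp add: continuous_on_eq_continuous_at)
    moreover have "(\<lambda>n. z - (1 / real (Suc n)) *\<^sub>R w) \<longlonglongrightarrow> z - 0 *\<^sub>R w" for w
      by (intro tendsto_intros) (use LIMSEQ_inverse_real_of_nat in \<open>simp add: inverse_eq_divide\<close>)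
    ultimately have "(\<lambda>n. f (z - (1 / real (Suc n)) *\<^sub>R w)) \<longlonglongrightarrow> f z" for w
      by (intro isCont_tendsto_compose[of z f]) simp_all
    then show "AE w in lborel. (\<lambda>n. \<eta> w * f (z - (1 / real (Suc n)) *\<^sub>R w)) \<longlonglongrightarrow> \<eta> w * f z"
      by (auto intro!: tendsto_intros)
    show "AE w in lborel. norm (\<eta> w * f (z - (1 / real (Suc n)) *\<^sub>R w)) <= M * \<bar>\<eta> w\<bar>" for n
      using f(2) by (auto simp: abs_mult mult.commute[of M] intro!: mult_left_mono)
  qed (use \<eta>_integrable in auto)
  then show ?thesis by (simp add: mollify_def int1)
qed

lemma scaled_\<eta>_smooth: "Ckon k UNIV (\<lambda>z. real (Suc n) ^ DIM('a) * \<eta> (real (Suc n) *\<^sub>R z))"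
proof -
  have "Ckon k UNIV (\<lambda>z. g (c *\<^sub>R z))" if "Ckon k UNIV g" for g :: "'a => real" and c
    using that
  proof (induction k arbitrary: g)
    case 0
    then show ?case by (auto intro!: continuous_on_compose2[of UNIV g] continuous_intros)
  next
    case (Suc k)
    have "((\<lambda>z. g (c *\<^sub>R z)) has_derivative (\<lambda>v. frechet_derivative g (at (c *\<^sub>R x)) (c *\<^sub>R v))) (at x)" for x
      by (rule has_derivative_compose[of "\<lambda>z. c *\<^sub>R z" "\<lambda>v. c *\<^sub>R v", OF _ Ckon_has_derivative[OF Suc.prems]])
        (auto intro!: derivative_eq_intros)
    then show ?case
    proof (rule Ckon_SucI[OF open_UNIV])
      show "Ckon k UNIV (\<lambda>x. frechet_derivative g (at (c *\<^sub>R x)) (c *\<^sub>R v))" for v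
        using Suc.IH[of "\<lambda>y. frechet_derivative g (at y) (c *\<^sub>R v)"] Suc.prems by simp
    qed
  qed
  from this[OF smooth] show ?thesis by (intro Ckon_cmult) auto
qed

lemma mollify_test_fun:
  assumes f: "continuous_on UNIV f" "\<And>z. norm z > S ==> f z = 0" and R: "R >= 0"
  shows "test_fun (mollify \<eta> n f)"
proof -
  let ?N = "real (Suc n)"
  obtain a where a: "cball (0::'a) S \<subseteq> cbox (- a) a"
    using bounded_subset_cbox_symmetric[OF bounded_cball] by blast
  have f0: "f y = 0" if "y \<notin> cbox (- a) a" for y using that a f(2) by force
  have s: "Ckon k UNIV (\<lambda>z. ?N ^ DIM('a) * \<eta> (?N *\<^sub>R z))" for k by (rule scaled_\<eta>_smooth)
  have c: "continuous_on UNIV (\<lambda>z. ?N ^ DIM('a) * \<eta> (?N *\<^sub>R z))" using s[of 0] by simp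
  have "mollify \<eta> n f z = integral (cbox (- a) a) (\<lambda>y. f y * (?N ^ DIM('a) * \<eta> (?N *\<^sub>R (z - y))))" for z
    unfolding mollify_eq[OF continuous_borel[OF f(1)]]
  proof (rule integral_eq_integral_cbox)
    show "continuous_on UNIV (\<lambda>y. f y * (?N ^ DIM('a) * \<eta> (?N *\<^sub>R (z - y))))"
      by (rule continuous_on_mult[OF f(1) continuous_on_compose2[OF c]]) (auto intro!: continuous_intros)
  qed (use f0 in simp)
  then have sm: "smooth_map (mollify \<eta> n f)"
    unfolding smooth_map_iff_Ckon using Ckon_convolution[OF f(1) s] by presburger
  obtain b where b: "cball (0::'a) (S + R) \<subseteq> cbox (- b) b"
    using bounded_subset_cbox_symmetric[OF bounded_cball] by blast
  have "compact (closure {z. mollify \<eta> n f z \<noteq> 0})"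
  proof (rule compact_closure_support)
    fix z assume "z \<notin> cbox (- b) b"
    then have "norm z > S + R" using b by force
    then show "mollify \<eta> n f z = 0" using f(2) R by (intro mollify_support[of S f z n]) auto
  qed
  with sm show ?thesis by (simp add: test_fun_def)
qed

lemma mollify_continuous:
  assumes f: "integrable lborel f" shows "continuous_on UNIV (mollify \<eta> n f)"
proof (rule continuous_at_imp_continuous_on, rule ballI, unfold continuous_at_sequentially, safe)
  note [measurable] = borel_measurable_integrable[OF f, simplified]
  let ?N = "real (Suc n)"
  obtain B where B: "B >= 0" "\<And>w. \<bar>\<eta> w\<bar> <= B" by (rule \<eta>_bounded) (rule that)
  fix z and X :: "nat => 'a" assume X: "X \<longlonglongrightarrow> z"
  have "(\<lambda>k. LBINT y. f y * (?N ^ DIM('a) * \<eta> (?N *\<^sub>R (X k - y)))) \<longlonglongrightarrow> (LBINT y. f y * (?N ^ DIM('a) * \<eta> (?N *\<^sub>R (z - y))))"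
  proof (rule integral_dominated_convergence[where w="\<lambda>y. (?N ^ DIM('a) * B) * \<bar>f y\<bar>"])
    have "isCont \<eta> w" for w using \<eta>_continuous by (simp add: continuous_on_eq_continuous_at)
    then have "(\<lambda>k. \<eta> (?N *\<^sub>R (X k - y))) \<longlonglongrightarrow> \<eta> (?N *\<^sub>R (z - y))" for y
      by (rule isCont_tendsto_compose) (intro tendsto_intros X)
    then show "AE y in lborel. (\<lambda>k. f y * (?N ^ DIM('a) * \<eta> (?N *\<^sub>R (X k - y)))) \<longlonglongrightarrow> f y * (?N ^ DIM('a) * \<eta> (?N *\<^sub>R (z - y)))"
      by (intro AE_I2 tendsto_intros)
    have "\<bar>f y\<bar> * (?N ^ DIM('a) * \<bar>\<eta> (?N *\<^sub>R (X k - y))\<bar>) <= \<bar>f y\<bar> * (?N ^ DIM('a) * B)" for k y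
      by (intro mult_left_mono B) auto
    then show "AE y in lborel. norm (f y * (?N ^ DIM('a) * \<eta> (?N *\<^sub>R (X k - y)))) <= ?N ^ DIM('a) * B * \<bar>f y\<bar>" for k
      by (intro AE_I2) (simp add: abs_mult mult_ac power_abs del: of_nat_Suc)
    show "integrable lborel (\<lambda>y. (?N ^ DIM('a) * B) * \<bar>f y\<bar>)" using f by simp
  qed (simp_all del: of_nat_Suc)
  then show "(mollify \<eta> n f \<circ> X) \<longlonglongrightarrow> mollify \<eta> n f z" by (simp add: mollify_eq o_def)
qed

text \<open>That increments along \<open>e\<close> are integrals of \<open>d\<close> is a relation
  which commutes with averaging, by Fubini; it makes sense even if \<open>f\<close> has no pointwise
  derivative along \<open>e\<close>.\<close>

lemma mollify_increment:
  assumes f: "integrable lborel f" and d: "integrable lborel d" and k: "k >= 0"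
    and inc: "\<And>y. f (y + k *\<^sub>R e) - f y = (LBINT r. indicator {0..k} r * d (y + r *\<^sub>R e))"
  shows "mollify \<eta> n f (z + k *\<^sub>R e) - mollify \<eta> n f z = (LBINT r. indicator {0..k} r * mollify \<eta> n d (z + r *\<^sub>R e))"
proof -
  note [measurable] = borel_measurable_integrable[OF f, simplified] borel_measurable_integrable[OF d, simplified]
  let ?c = "1 / real (Suc n)"
  obtain B where B: "B >= 0" "\<And>w. \<bar>\<eta> w\<bar> <= B" by (rule \<eta>_bounded) (rule that)
  have c: "- ?c \<noteq> 0" by simp
  have i: "integrable lborel (\<lambda>w. \<eta> w * g (z - ?c *\<^sub>R w))"
    "(LBINT w. \<bar>\<eta> w * g (z - ?c *\<^sub>R w)\<bar>) <= B * (real (Suc n) ^ DIM('a) * (LBINT w. \<bar>g w\<bar>))"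
    if g: "integrable lborel g" for g z
  proof -
    note [measurable] = borel_measurable_integrable[OF g, simplified]
    have gi: "integrable lborel (\<lambda>w. g (z - ?c *\<^sub>R w))"
      using lborel_affine_integrable_iff[of g "- ?c" z] g by (simp del: of_nat_Suc)
    have ge: "(LBINT w. \<bar>g (z - ?c *\<^sub>R w)\<bar>) = real (Suc n) ^ DIM('a) * (LBINT w. \<bar>g w\<bar>)"
      using lborel_affine_integral[of "\<lambda>w. \<bar>g w\<bar>" "- ?c" z] by (simp add: power_one_over del: of_nat_Suc)
    have b: "\<bar>\<eta> w * g (z - ?c *\<^sub>R w)\<bar> <= B * \<bar>g (z - ?c *\<^sub>R w)\<bar>" for w
      unfolding abs_mult by (intro mult_right_mono B) simp
    have gB: "integrable lborel (\<lambda>w. B * \<bar>g (z - ?c *\<^sub>R w)\<bar>)" using gi by (intro integrable_mult_right integrable_abs)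
    show 1: "integrable lborel (\<lambda>w. \<eta> w * g (z - ?c *\<^sub>R w))"
      by (rule bochner_bound[OF gB]) (use order_trans[OF b abs_ge_self] in auto)
    have "(LBINT w. \<bar>\<eta> w * g (z - ?c *\<^sub>R w)\<bar>) <= (LBINT w. B * \<bar>g (z - ?c *\<^sub>R w)\<bar>)"
      by (rule integral_mono[OF integrable_abs[OF 1] gB b])
    then show "(LBINT w. \<bar>\<eta> w * g (z - ?c *\<^sub>R w)\<bar>) <= B * (real (Suc n) ^ DIM('a) * (LBINT w. \<bar>g w\<bar>))"
      by (simp only: integral_mult_right_zero ge)
  qed
  define K where "K = B * (real (Suc n) ^ DIM('a) * (LBINT w. \<bar>d w\<bar>))"
  have H: "integrable (lborel \<Otimes>\<^sub>M lborel) (\<lambda>(r, w). indicator {0..k} r * (\<eta> w * d (z + r *\<^sub>R e - ?c *\<^sub>R w)))"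
  proof (rule lborel_pair.Fubini_integrable)
    have e: "(LBINT w. norm (case (r, w) of (r, w) => indicator {0..k} r * (\<eta> w * d (z + r *\<^sub>R e - ?c *\<^sub>R w))))
       = indicator {0..k} r * (LBINT w. \<bar>\<eta> w * d (z + r *\<^sub>R e - ?c *\<^sub>R w)\<bar>)" for r :: real
      by (simp add: abs_mult)
    show "integrable lborel (\<lambda>r. LBINT w. norm (case (r, w) of (r, w) => indicator {0..k} r * (\<eta> w * d (z + r *\<^sub>R e - ?c *\<^sub>R w))))"
      unfolding e
    proof (rule bochner_bound)
      show "integrable lborel (\<lambda>r. K * indicat_real {0..k} r)"
        by (intro integrable_mult_right integrable_real_indicator) (auto simp: emeasure_lborel_Icc_eq)
      show "AE r in lborel. norm (indicat_real {0..k} r * (LBINT w. \<bar>\<eta> w * d (z + r *\<^sub>R e - ?c *\<^sub>R w)\<bar>)) <= norm (K * indicat_real {0..k} r)"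
      proof (rule AE_I2)
        fix r :: real
        have "0 <= (LBINT w. \<bar>\<eta> w * d (z + r *\<^sub>R e - ?c *\<^sub>R w)\<bar>)" by simp
        then show "norm (indicat_real {0..k} r * (LBINT w. \<bar>\<eta> w * d (z + r *\<^sub>R e - ?c *\<^sub>R w)\<bar>)) <= norm (K * indicat_real {0..k} r)"
          using i(2)[OF d, of "z + r *\<^sub>R e"] unfolding K_def[symmetric] by (auto simp: indicator_def simp del: abs_mult of_nat_Suc)
      qed
    qed (simp del: of_nat_Suc)
    show "AE r in lborel. integrable lborel (\<lambda>w. case (r, w) of (r, w) => indicator {0..k} r * (\<eta> w * d (z + r *\<^sub>R e - ?c *\<^sub>R w)))"
      using i(1)[OF d] by (auto simp del: of_nat_Suc)
  qed (simp del: of_nat_Suc)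
  have "mollify \<eta> n f (z + k *\<^sub>R e) - mollify \<eta> n f z
      = (LBINT w. \<eta> w * f (z + k *\<^sub>R e - ?c *\<^sub>R w) - \<eta> w * f (z - ?c *\<^sub>R w))"
    unfolding mollify_def by (rule Bochner_Integration.integral_diff[symmetric]) (rule i(1)[OF f])+
  also have "\<dots> = (LBINT w. LBINT r. indicator {0..k} r * (\<eta> w * d (z + r *\<^sub>R e - ?c *\<^sub>R w)))"
  proof (rule Bochner_Integration.integral_cong[OF refl])
    fix w
    have "f (z + k *\<^sub>R e - ?c *\<^sub>R w) - f (z - ?c *\<^sub>R w) = (LBINT r. indicator {0..k} r * d (z + r *\<^sub>R e - ?c *\<^sub>R w))"
      using inc[of "z - ?c *\<^sub>R w"] by (simp add: algebra_simps del: of_nat_Suc)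
    then have "\<eta> w * f (z + k *\<^sub>R e - ?c *\<^sub>R w) - \<eta> w * f (z - ?c *\<^sub>R w) = \<eta> w * (LBINT r. indicator {0..k} r * d (z + r *\<^sub>R e - ?c *\<^sub>R w))"
      by (simp only: right_diff_distrib[symmetric])
    then show "\<eta> w * f (z + k *\<^sub>R e - ?c *\<^sub>R w) - \<eta> w * f (z - ?c *\<^sub>R w) = (LBINT r. indicator {0..k} r * (\<eta> w * d (z + r *\<^sub>R e - ?c *\<^sub>R w)))"
      by (simp only: integral_mult_right_zero[symmetric] mult.left_commute)
  qed
  also have "\<dots> = (LBINT r. LBINT w. indicator {0..k} r * (\<eta> w * d (z + r *\<^sub>R e - ?c *\<^sub>R w)))"
    by (rule lborel_pair.Fubini_integral[OF H])
  finally show ?thesis by (simp add: mollify_def del: of_nat_Suc)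
qed

text \<open>Although \<open>d\<close> is only integrable, its mollification is continuous, so the
  increment formula can be differentiated. The right-sided limit determines the derivative because
  the mollified function is already known to be smooth.\<close>

lemma mollify_derivative:
  assumes f: "integrable lborel f" and d: "integrable lborel d"
    and inc: "\<And>y k. k >= 0 ==> f (y + k *\<^sub>R e) - f y = (LBINT r. indicator {0..k} r * d (y + r *\<^sub>R e))"
    and t: "test_fun (mollify \<eta> n f)"
  shows "frechet_derivative (mollify \<eta> n f) (at z) e = mollify \<eta> n d z"
proof -
  have "Ckon (Suc 0) UNIV (mollify \<eta> n f)" using t by (simp only: test_fun_def smooth_map_iff_Ckon)
  from has_real_derivative_line[of "mollify \<eta> n f" _ z 0 e] Ckon_has_derivative[OF this, of z]
  have "((\<lambda>k. mollify \<eta> n f (z + k *\<^sub>R e)) has_real_derivative frechet_derivative (mollify \<eta> n f) (at z) e) (at 0)"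
    by simp
  then have 1: "((\<lambda>k. (mollify \<eta> n f (z + k *\<^sub>R e) - mollify \<eta> n f z) / k) \<longlongrightarrow> frechet_derivative (mollify \<eta> n f) (at z) e) (at_right 0)"
    by (auto simp: has_field_derivative_iff intro: tendsto_mono[OF at_le])
  let ?D = "\<lambda>r. mollify \<eta> n d (z + r *\<^sub>R e)"
  have Dc: "continuous_on UNIV ?D"
    by (intro continuous_on_compose2[OF mollify_continuous[OF d]] continuous_intros) auto
  have "((\<lambda>k. integral {0..k} ?D) has_real_derivative ?D 0) (at 0 within {0..1})"
    by (rule integral_has_real_derivative) (auto intro: continuous_on_subset[OF Dc])
  then have "((\<lambda>k. integral {0..k} ?D / k) \<longlongrightarrow> ?D 0) (at 0 within {0..1})"
    by (simp add: has_field_derivative_iff)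
  then have "((\<lambda>k. integral {0..k} ?D / k) \<longlongrightarrow> ?D 0) (at_right 0)"
    by (simp add: at_within_Icc_at_right)
  moreover have "\<forall>\<^sub>F k in at_right 0. integral {0..k} ?D / k = (mollify \<eta> n f (z + k *\<^sub>R e) - mollify \<eta> n f z) / k"
  proof (rule eventually_at_rightI[of 0 1])
    fix k :: real assume "k \<in> {0<..<1}"
    then have k: "k >= 0" by simp
    have "(LBINT r. indicator {0..k} r * ?D r) = integral {0..k} ?D"
      using set_borel_integral_eq_integral(2)[of "{0..k}" ?D]
        borel_integrable_atLeastAtMost'[of 0 k ?D, OF continuous_on_subset[OF Dc]]
      by (simp add: set_lebesgue_integral_def)
    then show "integral {0..k} ?D / k = (mollify \<eta> n f (z + k *\<^sub>R e) - mollify \<eta> n f z) / k"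
      using mollify_increment[OF f d k inc[OF k]] by simp
  qed simp
  ultimately have "((\<lambda>k. (mollify \<eta> n f (z + k *\<^sub>R e) - mollify \<eta> n f z) / k) \<longlongrightarrow> ?D 0) (at_right 0)"
    by (rule Lim_transform_eventually)
  from tendsto_unique[OF _ 1 this] show ?thesis by simp
qed

end

definition bump :: "real => real" where
  "bump r = flat_exp (1 + r) * flat_exp (1 - r)"

lemma Ckon_bump: "Ckon k UNIV bump"
  unfolding bump_def[abs_def]
proof (rule Ckon_mult[OF open_UNIV])
  have 1: "Ckon k UNIV (\<lambda>r::real. 1 + r)" "Ckon k UNIV (\<lambda>r::real. 1 - r)"
    by (intro Ckon_add Ckon_diff Ckon_const Ckon_linear bounded_linear_ident open_UNIV)+
  show "Ckon k UNIV (\<lambda>r. flat_exp (1 + r))" "Ckon k UNIV (\<lambda>r. flat_exp (1 - r))"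
    by (rule Ckon_compose[OF open_UNIV open_UNIV _ 1(1) Ckon_flat_exp], simp)
      (rule Ckon_compose[OF open_UNIV open_UNIV _ 1(2) Ckon_flat_exp], simp)
qed

lemma bump_nonneg: "0 <= bump r" and bump_0: "\<bar>r\<bar> > 1 ==> bump r = 0" and bump_pos: "0 < bump 0"
  using flat_exp_pos[of 1] by (auto simp: bump_def flat_exp_nonneg flat_exp_0 abs_if split: if_splits)

lemma mollifier_exists:
  obtains \<eta> :: "'a::euclidean_space => real" and R where "R >= 0" "mollifier \<eta> R"
proof -
  define h where "h = (\<lambda>w::'a. \<Prod>b\<in>Basis. bump (w \<bullet> b))"
  have hs: "Ckon k UNIV h" for k
    unfolding h_def by (intro Ckon_prod open_UNIV Ckon_compose[OF open_UNIV open_UNIV _ _ Ckon_bump] Ckon_linear bounded_linear_inner_left) auto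
  have hc: "continuous_on UNIV h" using hs[of 0] by simp
  have h0: "h w = 0" if "w \<notin> cbox (- One) One" for w :: 'a
    using that bump_0 by (force simp: h_def mem_box intro!: prod_zero)
  obtain R where R: "\<And>w::'a. w \<in> cbox (- One) One ==> norm w <= R"
    using bounded_cbox[of "- One :: 'a" One] unfolding bounded_iff by blast
  have hi: "integrable lborel h" by (rule integrable_continuous_cbox_support[OF hc h0])
  have hn: "0 <= h w" for w by (simp add: h_def bump_nonneg prod_nonneg)
  have hp: "0 < h 0" using bump_pos by (simp add: h_def)
  define c where "c = (LBINT w. h w)"
  have "c \<noteq> 0"
  proof
    assume "c = 0"
    then have ae: "AE w in lborel. h w = 0"
      using integral_nonneg_eq_0_iff_AE[OF hi] hn by (simp add: c_def)
    have "open {w. 0 < h w}" by (rule open_Collect_less) (auto intro: hc continuous_intros)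
    moreover have "(0::'a) \<in> {w. 0 < h w}" using hp by simp
    ultimately obtain r where r: "r > 0" "ball 0 r \<subseteq> {w. 0 < h w}" using open_contains_ball by blast
    have "AE w in lborel. w \<notin> ball (0::'a) r" using ae by eventually_elim (use r(2) in force)
    then have "ball (0::'a) r \<in> null_sets lborel" using AE_iff_null_sets[of "ball (0::'a) r" lborel] by simp
    then have "emeasure lborel (ball (0::'a) r) = 0" by (rule null_setsD1)
    then show False using r(1) by (simp add: emeasure_ball unit_ball_vol_pos less_imp_neq[symmetric])
  qed
  have "mollifier (\<lambda>w. (1 / c) * h w) (max R 0)"
  proof
    show "Ckon k UNIV (\<lambda>w. (1 / c) * h w)" for k by (intro Ckon_cmult hs open_UNIV)
    show "(1 / c) * h w = 0" if "norm w > max R 0" for w using that R[of w] h0[of w] by force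
    show "(LBINT w. (1 / c) * h w) = 1" using \<open>c \<noteq> 0\<close> by (simp add: c_def)
  qed
  then show thesis using that[of "max R 0"] by simp
qed

section \<open>Transport along the flow\<close>

text \<open>The weak equation with initial datum for Borel functions of one space-time variable. For
  \<theta> and \<theta>0 equal to 1 it expresses that the velocity is divergence free, since the
  time derivative then cancels the initial term.\<close>

abbreviation weak_transport_eq ::
    "(real \<times> plane => real) => (real \<times> plane => plane) => (plane => real) => (real \<times> plane => real) => bool" where
  "weak_transport_eq \<theta> u \<theta>0 \<phi> \<equiv> (LBINT z. indicator spacetime z * (\<theta> z * (frechet_derivative \<phi> (at z) (1, 0)
      + (\<Sum>i\<in>UNIV. u z $ i * frechet_derivative \<phi> (at z) (0, axis i 1))))) + (LBINT x. \<theta>0 x * \<phi> (0, x)) = 0"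

text \<open>The test functions composed with the backward flow are only absolutely continuous in time; \<open>d\<close> plays
  the part of the time derivative.\<close>

lemma weak_transport_extend:
  fixes \<theta> :: "real \<times> plane => real" and u :: "real \<times> plane => plane" and \<theta>0 :: "plane => real"
    and \<psi> d :: "real \<times> plane => real" and G :: "2 => real \<times> plane => real"
  assumes \<theta>[measurable]: "borel_fun \<theta>" and \<theta>b: "\<And>S. \<exists>M. \<forall>z. norm z <= S --> \<bar>\<theta> z\<bar> <= M"
    and u[measurable]: "borel_fun u"
    and ui: "\<And>S. integrable lborel (\<lambda>z. indicator (cball 0 S \<inter> spacetime) z * norm (u z))"
    and \<theta>0[measurable]: "borel_fun \<theta>0" and \<theta>0b: "\<And>x. \<bar>\<theta>0 x\<bar> <= M0"
    and weak: "\<And>\<phi>. test_fun \<phi> ==> weak_transport_eq \<theta> u \<theta>0 \<phi>"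
    and \<psi>c: "continuous_on UNIV \<psi>" and \<psi>s: "\<And>z. norm z > S ==> \<psi> z = 0"
    and d: "integrable lborel d" and ds: "\<And>z. norm z > S ==> d z = 0"
    and dinc: "\<And>t x k. k >= 0 ==> \<psi> (t + k, x) - \<psi> (t, x) = (LBINT r. indicator {0..k} r * d (t + r, x))"
    and Gc: "\<And>i. continuous_on UNIV (G i)"
    and Gd: "\<And>t x. ((\<lambda>x. \<psi> (t, x)) has_derivative (\<lambda>h. \<Sum>i\<in>UNIV. h $ i * G i (t, x))) (at x)"
  shows "(LBINT z. indicator spacetime z * (\<theta> z * (d z + (\<Sum>i\<in>UNIV. u z $ i * G i z)))) + (LBINT x. \<theta>0 x * \<psi> (0, x)) = 0"
proof -
  obtain \<eta> :: "real \<times> plane => real" and R where R: "R >= 0" and "mollifier \<eta> R" by (rule mollifier_exists)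
  interpret mollifier \<eta> R by fact
  let ?I = "\<lambda>f z. indicat_real spacetime z * (\<theta> z * f z)"
  let ?J = "\<lambda>f. LBINT z. ?I f z" and ?un = "\<lambda>n i z. u z $ i * mollify \<eta> n (G i) z" and ?ug = "\<lambda>i z. u z $ i * G i z"
  have Gs: "G i z = 0" if "norm z > S" for i z
  proof -
    obtain t x where z: "z = (t, x)" by (cases z)
    have "((\<lambda>x. \<psi> (t, x)) has_derivative (\<lambda>h. 0)) (at x)"
    proof (rule has_derivative_transform_within_open[of "\<lambda>x. 0" _ _ UNIV "{y. S < norm (t, y)}"])
      show "open {y. S < norm (t, y)}" by (intro open_Collect_less continuous_intros)
    qed (use that z \<psi>s in auto)
    then have "(\<lambda>h. \<Sum>i\<in>UNIV. h $ i * G i (t, x)) = (\<lambda>h. 0)" using has_derivative_unique[OF Gd] by blast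
    from fun_cong[OF this, of "axis i 1"] show ?thesis
      using exhaust_2[of i] by (auto simp: sum_2 axis_def z)
  qed
  have \<psi>i: "integrable lborel \<psi>" by (rule integrable_continuous_support[OF \<psi>c \<psi>s])
  have Gi: "integrable lborel (G i)" for i by (rule integrable_continuous_support[OF Gc Gs])
  note [measurable] = continuous_borel[OF \<psi>c] continuous_borel[OF Gc] borel_measurable_integrable[OF d, simplified]
  have test: "test_fun (mollify \<eta> n \<psi>)" for n by (rule mollify_test_fun[OF \<psi>c \<psi>s R])
  have Dt: "frechet_derivative (mollify \<eta> n \<psi>) (at z) (1, 0) = mollify \<eta> n d z" for n z
  proof (rule mollify_derivative[OF \<psi>i d _ test])
    fix y :: "real \<times> plane" and k :: real assume "k >= 0"
    from dinc[OF this, of "fst y" "snd y"]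
    show "\<psi> (y + k *\<^sub>R (1, 0)) - \<psi> y = (LBINT r. indicator {0..k} r * d (y + r *\<^sub>R (1, 0)))"
      by (cases y) simp
  qed
  have Dx: "frechet_derivative (mollify \<eta> n \<psi>) (at z) (0, axis i 1) = mollify \<eta> n (G i) z" for n z i
  proof (rule mollify_derivative[OF \<psi>i Gi _ test])
    fix y :: "real \<times> plane" and k :: real assume k: "k >= 0"
    obtain t x where y: "y = (t, x)" by (cases y)
    let ?g = "\<lambda>r. G i (t, x + r *\<^sub>R axis i 1)"
    have gc: "continuous_on A ?g" for A
      by (rule continuous_on_compose2[OF Gc[of i]]) (auto intro!: continuous_intros)
    have "((\<lambda>r. \<psi> (t, x + r *\<^sub>R axis i 1)) has_real_derivative (\<Sum>j\<in>UNIV. axis i 1 $ j * G j (t, x + r *\<^sub>R axis i 1))) (at r)" for r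
      by (rule has_real_derivative_line[of "\<lambda>x. \<psi> (t, x)", OF Gd])
    moreover have "(\<Sum>j\<in>UNIV. axis i 1 $ j * G j (t, x + r *\<^sub>R axis i 1)) = ?g r" for r
      using exhaust_2[of i] by (auto simp: sum_2 axis_def)
    ultimately have "(?g has_integral \<psi> (t, x + k *\<^sub>R axis i 1) - \<psi> (t, x + 0 *\<^sub>R axis i 1)) {0..k}"
      by (intro fundamental_theorem_of_calculus k) (auto simp: has_real_derivative_iff_has_vector_derivative[symmetric] intro: has_field_derivative_at_within)
    then have "\<psi> (t, x + k *\<^sub>R axis i 1) - \<psi> (t, x) = integral {0..k} ?g" by (simp add: integral_unique)
    also have "\<dots> = (LBINT r. indicator {0..k} r * ?g r)"
      using set_borel_integral_eq_integral(2)[OF borel_integrable_atLeastAtMost'[of 0 k ?g, OF gc]]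
      by (simp add: set_lebesgue_integral_def)
    finally show "\<psi> (y + k *\<^sub>R (0, axis i 1)) - \<psi> y = (LBINT r. indicator {0..k} r * G i (y + r *\<^sub>R (0, axis i 1)))"
      by (simp add: y)
  qed
  obtain M where M: "\<And>z. norm z <= S + R ==> \<bar>\<theta> z\<bar> <= M" using \<theta>b by blast
  have ms: "\<forall>z. norm z > S + R --> mollify \<eta> n f z = 0" if "\<forall>z. norm z > S --> f z = 0" for f n
    using that R by (intro allI impI mollify_support[of S f]) auto
  have ds': "\<forall>z. norm z > S --> d z = 0" and Gs': "\<forall>z. norm z > S --> G i z = 0" and \<psi>s': "\<forall>z. norm z > S --> \<psi> z = 0" for i
    using ds Gs \<psi>s by blast+
  let ?M = "max M 0"
  have \<theta>f: "\<bar>\<theta> z * f z\<bar> <= ?M * \<bar>f z\<bar>" if "\<forall>z. norm z > S + R --> f z = 0" for f :: "real \<times> plane => real" and z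
    using that[rule_format, of z] M[of z] by (cases "norm z <= S + R") (auto simp: abs_mult intro!: mult_right_mono)
  have stm[measurable]: "spacetime \<in> sets (borel :: (real \<times> plane) measure)" by (intro borel_closed closed_Times) auto
  have z1: "\<forall>z. norm z > S + R --> f z = 0" if "\<forall>z. norm z > S --> f z = (0::real)" for f :: "real \<times> plane => real"
    using that R by auto
  have Ai: "integrable lborel (?I f)"
    if f: "integrable lborel f" and s: "\<forall>z. norm z > S + R --> f z = 0" for f
  proof (rule bochner_bound)
    show "integrable lborel (\<lambda>z. ?M * f z)" using f by simp
    note [measurable] = borel_measurable_integrable[OF f, simplified]
    show "(?I f) \<in> borel_measurable lborel" by measurable
    show "AE z in lborel. norm (?I f z) <= norm (?M * f z)"
      using \<theta>f[OF s] by (intro AE_I2) (auto simp: indicator_def abs_mult)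
  qed
  have mi: "integrable lborel (mollify \<eta> n d)" for n
    by (rule integrable_continuous_support[OF mollify_continuous[OF d] ms[OF ds', rule_format]])
  \<comment> \<open>In the time term \<open>d\<close> is integrable and \<theta> is bounded on the
    common support, so \<open>L^1\<close> convergence of the mollifications is enough.\<close>
  have Al: "(\<lambda>n. ?J (mollify \<eta> n d)) \<longlonglongrightarrow> ?J d"
  proof (rule LIM_zero_cancel, rule Lim_null_comparison)
    show "(\<lambda>n. ?M * (LBINT z. \<bar>mollify \<eta> n d z - d z\<bar>)) \<longlonglongrightarrow> 0"
      by (intro tendsto_mult_right_zero mollify_L1 d)
    have "norm (?J (mollify \<eta> n d) - ?J d)
        <= ?M * (LBINT z. \<bar>mollify \<eta> n d z - d z\<bar>)" for n
    proof -
      have s: "\<forall>z. norm z > S + R --> mollify \<eta> n d z - d z = 0" using ms[OF ds'] z1[OF ds'] by simp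
      have "?J (mollify \<eta> n d) - ?J d
         = ?J (\<lambda>z. mollify \<eta> n d z - d z)"
        by (subst Bochner_Integration.integral_diff[symmetric, OF Ai[OF mi ms[OF ds']] Ai[OF d z1[OF ds']]]) (simp_all add: right_diff_distrib)
      also have "\<bar>\<dots>\<bar> <= (LBINT z. \<bar>?I (\<lambda>z. mollify \<eta> n d z - d z) z\<bar>)"
        by (rule integral_abs_bound)
      also have "\<dots> <= (LBINT z. ?M * \<bar>mollify \<eta> n d z - d z\<bar>)"
      proof (rule integral_mono)
        show "integrable lborel (\<lambda>z. \<bar>?I (\<lambda>z. mollify \<eta> n d z - d z) z\<bar>)"
          by (intro integrable_abs Ai Bochner_Integration.integrable_diff mi d s)
        show "integrable lborel (\<lambda>z. ?M * \<bar>mollify \<eta> n d z - d z\<bar>)"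
          by (intro integrable_mult_right integrable_abs Bochner_Integration.integrable_diff mi d)
        show "\<bar>?I (\<lambda>z. mollify \<eta> n d z - d z) z\<bar> <= ?M * \<bar>mollify \<eta> n d z - d z\<bar>" for z
          using \<theta>f[OF s, of z] by (auto simp: indicator_def)
      qed
      finally show ?thesis by simp
    qed
    then show "\<forall>\<^sub>F n in sequentially. norm (?J (mollify \<eta> n d) - ?J d)
        <= ?M * (LBINT z. \<bar>mollify \<eta> n d z - d z\<bar>)" by simp
  qed
  \<comment> \<open>In the space terms the roles are reversed: \<open>u\<close> is only locally
    integrable, but \<open>G i\<close> is continuous, so its mollifications converge pointwise with
    a uniform bound, and a multiple of \<open>norm (u z)\<close> is the majorant.\<close>
  have Bl: "(\<lambda>n. ?J (?un n i)) \<longlonglongrightarrow> ?J (?ug i)"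
    and Bi: "integrable lborel (?I (?un n i))"
    and Bi': "integrable lborel (?I (?ug i))" for i n
  proof -
    obtain K where K: "K >= 0" "\<And>z. \<bar>G i z\<bar> <= K" by (rule bounded_continuous_support[OF Gc Gs], assumption, rule that)
    define E where "E = (LBINT w. \<bar>\<eta> w\<bar>)"
    have mb: "\<bar>mollify \<eta> n (G i) z\<bar> <= K * E" for n z unfolding E_def by (rule mollify_bound[OF _ K(2)]) simp
    have E: "E >= 0" by (simp add: E_def)
    let ?w = "\<lambda>z. ?M * (K * (E + 1)) * (indicat_real (cball 0 (S + R) \<inter> spacetime) z * norm (u z))"
    have b: "\<bar>indicat_real spacetime z * (\<theta> z * (u z $ i * f z))\<bar> <= ?w z"
      if "\<forall>z. norm z > S + R --> f z = 0" "\<And>z. \<bar>f z\<bar> <= K * (E + 1)" for f :: "real \<times> plane => real" and z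
    proof (cases "norm z <= S + R \<and> z \<in> spacetime")
      case True
      have "\<bar>\<theta> z\<bar> * (\<bar>u z $ i\<bar> * \<bar>f z\<bar>) <= ?M * (norm (u z) * (K * (E + 1)))"
        using M[of z] True that(2)[of z] by (intro mult_mono component_le_norm_cart) auto
      then show ?thesis using True by (simp add: abs_mult mult_ac)
    qed (use that(1)[rule_format, of z] in \<open>auto simp: indicator_def\<close>)
    have wi: "integrable lborel ?w" by (intro integrable_mult_right ui)
    have m1: "\<bar>mollify \<eta> n (G i) z\<bar> <= K * (E + 1)" for n z using mb[of n z] K(1) by (simp add: ring_distribs)
    have m2: "\<bar>G i z\<bar> <= K * (E + 1)" for z using K(2)[of z] K(1) E by (simp add: ring_distribs add_increasing)
    show "(\<lambda>n. ?J (?un n i)) \<longlonglongrightarrow> ?J (?ug i)"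
    proof (rule integral_dominated_convergence[OF _ _ wi])
      show "AE z in lborel. (\<lambda>n. ?I (?un n i) z) \<longlonglongrightarrow> ?I (?ug i) z"
        by (intro AE_I2 tendsto_intros mollify_tendsto[OF Gc K(2)])
      show "AE z in lborel. norm (?I (?un n i) z) <= ?w z" for n
        using b[OF ms[OF Gs'] m1] by (intro AE_I2) (simp only: real_norm_def)
    qed measurable
    show "integrable lborel (?I (?un n i))"
    proof (rule bochner_bound[OF wi])
      show "AE z in lborel. norm (?I (?un n i) z) <= norm (?w z)"
        using order_trans[OF b[OF ms[OF Gs'] m1] abs_ge_self] by (intro AE_I2) (simp only: real_norm_def)
    qed measurable
    show "integrable lborel (?I (?ug i))"
    proof (rule bochner_bound[OF wi])
      show "AE z in lborel. norm (?I (?ug i) z) <= norm (?w z)"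
        using order_trans[OF b[OF z1[OF Gs'] m2] abs_ge_self] by (intro AE_I2) (simp only: real_norm_def)
    qed measurable
  qed
  have Cl: "(\<lambda>n. LBINT x. \<theta>0 x * mollify \<eta> n \<psi> (0, x)) \<longlonglongrightarrow> (LBINT x. \<theta>0 x * \<psi> (0, x))"
  proof -
    obtain K where K: "K >= 0" "\<And>z. \<bar>\<psi> z\<bar> <= K" by (rule bounded_continuous_support[OF \<psi>c \<psi>s], assumption, rule that)
    define E where "E = (LBINT w. \<bar>\<eta> w\<bar>)"
    have mb: "\<bar>mollify \<eta> n \<psi> z\<bar> <= K * E" for n z unfolding E_def by (rule mollify_bound[OF _ K(2)]) simp
    have wi: "integrable lborel (\<lambda>x. M0 * (K * E) * indicat_real (cball (0::plane) (S + R)) x)" by simp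
    show ?thesis
    proof (rule integral_dominated_convergence[OF _ _ wi])
      show "AE x in lborel. (\<lambda>n. \<theta>0 x * mollify \<eta> n \<psi> (0, x)) \<longlonglongrightarrow> \<theta>0 x * \<psi> (0, x)"
        by (intro AE_I2 tendsto_intros mollify_tendsto[OF \<psi>c K(2)])
      show "AE x in lborel. norm (\<theta>0 x * mollify \<eta> n \<psi> (0, x)) <= M0 * (K * E) * indicat_real (cball (0::plane) (S + R)) x" for n
      proof (rule AE_I2)
        fix x :: plane
        show "norm (\<theta>0 x * mollify \<eta> n \<psi> (0, x)) <= M0 * (K * E) * indicat_real (cball (0::plane) (S + R)) x"
        proof (cases "norm x <= S + R")
          case True
          have "\<bar>\<theta>0 x\<bar> * \<bar>mollify \<eta> n \<psi> (0, x)\<bar> <= M0 * (K * E)"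
            by (intro mult_mono \<theta>0b mb order_trans[OF abs_ge_zero \<theta>0b]) simp
          then show ?thesis using True by (simp add: abs_mult)
        next
          case False
          then have "norm (0::real, x) > S + R" by (simp add: norm_Pair)
          then show ?thesis using ms[OF \<psi>s', of n] False by simp
        qed
      qed
      have "borel_fun (\<lambda>x. f (0, x))" if [measurable]: "borel_fun f" for f :: "real \<times> plane => real"
        by (rule measurable_compose[OF _ that]) (intro continuous_borel continuous_intros)
      then show "(\<lambda>x. \<theta>0 x * \<psi> (0, x)) \<in> borel_measurable lborel" "(\<lambda>x. \<theta>0 x * mollify \<eta> n \<psi> (0, x)) \<in> borel_measurable lborel" for n
        by simp_all
    qed
  qed
  have sumn: "?J (mollify \<eta> n d)
      + (\<Sum>i\<in>UNIV. ?J (?un n i))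
      + (LBINT x. \<theta>0 x * mollify \<eta> n \<psi> (0, x)) = 0" for n
    using weak[OF test[of n]] Ai[OF mi ms[OF ds'], of n] Bi[where n=n]
    unfolding Dt Dx sum_2 distrib_left by simp
  have "(\<lambda>n. ?J (mollify \<eta> n d)
      + (\<Sum>i\<in>UNIV. ?J (?un n i))
      + (LBINT x. \<theta>0 x * mollify \<eta> n \<psi> (0, x))) \<longlonglongrightarrow> ?J d
      + (\<Sum>i\<in>UNIV. ?J (?ug i)) + (LBINT x. \<theta>0 x * \<psi> (0, x))"
    by (intro tendsto_intros Al Bl Cl)
  then have "?J d
      + (\<Sum>i\<in>UNIV. ?J (?ug i)) + (LBINT x. \<theta>0 x * \<psi> (0, x)) = 0"
    unfolding sumn by (simp add: LIMSEQ_const_iff)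
  then show ?thesis using Ai[OF d z1[OF ds']] Bi' unfolding sum_2 distrib_left by simp
qed

section \<open>Products and cutoffs in time\<close>

text \<open>Uniform continuity lets each factor be frozen over a short interval up to an error
  \<open>e\<close>; \<open>null_increment\<close> with the majorant
  \<open>\<bar>f' r\<bar> + \<bar>k' r\<bar>\<close> then gives the product rule without pointwise
  derivatives.\<close>

lemma itg_product:
  fixes f k f' k' :: "real => real"
  assumes fc: "continuous_on UNIV f" and kc: "continuous_on UNIV k" and f': "loc_int f'" and k': "loc_int k'"
    and f: "\<And>s t. s <= t ==> f t - f s = itg f' s t" and k: "\<And>s t. s <= t ==> k t - k s = itg k' s t"
    and st: "s <= t"
  shows "f t * k t - f s * k s = itg (\<lambda>r. f' r * k r + f r * k' r) s t"
    and "loc_int (\<lambda>r. f' r * k r + f r * k' r)"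
proof -
  have lm: "loc_int (\<lambda>r. p r * q r)" if p: "loc_int p" and q: "continuous_on UNIV q" for p q :: "real => real"
  proof -
    note [measurable] = loc_int_measurable[OF p] continuous_borel[OF q]
    have ap: "loc_int (\<lambda>r. \<bar>p r\<bar>)" using p by (auto simp: loc_int_def intro: set_integrable_abs)
    have "loc_int (\<lambda>r. \<bar>p r\<bar> * \<bar>q r\<bar>)" by (rule loc_int_mult_continuous[OF ap]) (auto intro!: continuous_intros q)
    then show ?thesis by (rule loc_int_bound) (auto simp: abs_mult)
  qed
  have a: "loc_int (\<lambda>r. \<bar>f' r\<bar>)" "loc_int (\<lambda>r. \<bar>k' r\<bar>)" using f' k' by (auto simp: loc_int_def intro: set_integrable_abs)
  have l1: "loc_int (\<lambda>r. f' r * k r)" and l2: "loc_int (\<lambda>r. f r * k' r)"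
    using lm[OF f' kc] lm[OF k' fc] by (simp_all add: mult.commute)
  show l: "loc_int (\<lambda>r. f' r * k r + f r * k' r)" by (intro loc_int_add l1 l2)
  let ?G = "\<lambda>w. f w * k w - itg (\<lambda>r. f' r * k r + f r * k' r) s w"
  have "?G t = ?G s"
  proof (rule null_increment[OF loc_int_add[OF a] st])
    fix e :: real assume e: "e > 0"
    have "uniformly_continuous_on {s..t} f" "uniformly_continuous_on {s..t} k"
      using fc kc by (auto intro!: compact_uniformly_continuous intro: continuous_on_subset)
    then obtain d1 d2 where d1: "d1 > 0" "\<And>x y. x \<in> {s..t} ==> y \<in> {s..t} ==> \<bar>y - x\<bar> < d1 ==> \<bar>f y - f x\<bar> < e"
      and d2: "d2 > 0" "\<And>x y. x \<in> {s..t} ==> y \<in> {s..t} ==> \<bar>y - x\<bar> < d2 ==> \<bar>k y - k x\<bar> < e"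
      unfolding uniformly_continuous_on_def dist_real_def using e by metis
    show "\<exists>d>0. \<forall>u w. s <= u \<and> u <= w \<and> w <= t \<and> w - u < d --> \<bar>?G w - ?G u\<bar> <= e * itg (\<lambda>r. \<bar>f' r\<bar> + \<bar>k' r\<bar>) u w"
    proof (intro exI[of _ "min d1 d2"] conjI allI impI)
      fix u w assume uw: "s <= u \<and> u <= w \<and> w <= t \<and> w - u < min d1 d2"
      have "?G w - ?G u = k w * (f w - f u) + f u * (k w - k u) - itg (\<lambda>r. f' r * k r + f r * k' r) u w"
        using itg_combine[OF l, of s u w] uw by (simp add: algebra_simps)
      also have "\<dots> = itg (\<lambda>r. (k w * f' r + f u * k' r) - (f' r * k r + f r * k' r)) u w"
        using uw by (simp add: f k itg_diff[OF loc_int_add[OF loc_int_cmult[OF f'] loc_int_cmult[OF k']] l]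
          itg_add[OF loc_int_cmult[OF f'] loc_int_cmult[OF k']] itg_cmult)
      also have "\<bar>\<dots>\<bar> <= itg (\<lambda>r. e * (\<bar>f' r\<bar> + \<bar>k' r\<bar>)) u w"
      proof (rule itg_norm_le[where 'a=real, unfolded real_norm_def])
        fix r assume r: "u <= r" "r <= w"
        have 1: "\<bar>k w - k r\<bar> <= e" using d2(2)[of r w] r uw by auto
        have 2: "\<bar>f u - f r\<bar> <= e" using d1(2)[of r u] r uw by auto
        have "(k w * f' r + f u * k' r) - (f' r * k r + f r * k' r) = (k w - k r) * f' r + (f u - f r) * k' r" by (simp add: algebra_simps)
        also have "\<bar>\<dots>\<bar> <= e * \<bar>f' r\<bar> + e * \<bar>k' r\<bar>"
          by (intro order_trans[OF abs_triangle_ineq] add_mono) (auto simp: abs_mult intro!: mult_right_mono 1 2)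
        finally show "\<bar>(k w * f' r + f u * k' r) - (f' r * k r + f r * k' r)\<bar> <= e * (\<bar>f' r\<bar> + \<bar>k' r\<bar>)" by (simp add: ring_distribs)
      qed (intro loc_int_diff loc_int_add loc_int_cmult f' k' l a)+
      finally show "\<bar>?G w - ?G u\<bar> <= e * itg (\<lambda>r. \<bar>f' r\<bar> + \<bar>k' r\<bar>) u w" by (simp add: itg_cmult)
    qed (use d1 d2 in simp)
  qed
  then show "f t * k t - f s * k s = itg (\<lambda>r. f' r * k r + f r * k' r) s t" using itg_le[OF order_refl l, of s] by simp
qed

lemma itg_indicator: "itg (indicat_real {c..d}) s t = max 0 (min t d - max s c)"
proof -
  have "itg (indicat_real {c..d}) s t = (LBINT r. indicat_real {max s c..min t d} r)"
    unfolding itg_def set_lebesgue_integral_def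
    by (rule Bochner_Integration.integral_cong) (auto simp: indicator_def)
  also have "\<dots> = max 0 (min t d - max s c)"
    by (cases "max s c <= min t d") (auto simp: measure_lborel_Icc)
  finally show ?thesis .
qed

lemma loc_int_indicator: "loc_int (indicat_real {c..d})"
  by (rule loc_int_bound[OF loc_int_continuous[of "\<lambda>r. 1::real"]]) (auto simp: indicator_def)

text \<open>The density of a piecewise linear cutoff that rises on \<open>{-1..0}\<close>, equals 1
  up to \<open>a\<close> and falls to 0 on \<open>{a..b}\<close>. The rise lies at negative times,
  which integrals over \<open>spacetime\<close> do not see; the fall turns a tested equation into an
  average over \<open>{a..b}\<close>.\<close>

definition ramp' :: "real => real => real => real" where
  "ramp' a b r = indicat_real {-1..0} r - (1 / (b - a)) * indicat_real {a..b} r"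

definition ramp :: "real => real => real => real" where
  "ramp a b t = oint (ramp' a b) (-1) t"

lemma ramp'_loc_int: "loc_int (ramp' a b)"
  unfolding ramp'_def[abs_def] by (intro loc_int_diff loc_int_cmult loc_int_indicator)

lemma ramp_props:
  assumes "0 <= a" "a < b"
  shows "continuous_on UNIV (ramp a b)" "\<And>s t. s <= t ==> ramp a b t - ramp a b s = itg (ramp' a b) s t"
    "\<And>t. t <= -1 ==> ramp a b t = 0" "\<And>t. b <= t ==> ramp a b t = 0" "ramp a b 0 = 1"
proof -
  note l = ramp'_loc_int[of a b]
  have i: "itg (ramp' a b) s t = itg (indicat_real {-1..0}) s t - 1 / (b - a) * itg (indicat_real {a..b}) s t" for s t
    unfolding ramp'_def[abs_def] by (simp only: itg_diff[OF loc_int_indicator loc_int_cmult[OF loc_int_indicator]] itg_cmult)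
  show "continuous_on UNIV (ramp a b)" unfolding ramp_def[abs_def] by (rule continuous_on_oint[OF l])
  show "ramp a b t - ramp a b s = itg (ramp' a b) s t" if "s <= t" for s t
    using oint_combine[OF l, of "-1" s t] oint_simps(1)[OF l that] by (simp add: ramp_def)
  show "ramp a b t = 0" if "t <= -1" for t
    using that assms by (simp add: ramp_def oint_simps(2)[OF l] i itg_indicator)
  show "ramp a b t = 0" if "b <= t" for t
    using that assms by (simp add: ramp_def oint_simps(1)[OF l] i itg_indicator)
  show "ramp a b 0 = 1"
    using assms by (simp add: ramp_def oint_simps(1)[OF l] i itg_indicator)
qed

lemma integrable_prod_real_plane:
  fixes k :: "real => real" and l :: "plane => real"
  assumes k: "integrable lborel k" and l: "integrable lborel l"
  shows "integrable lborel (\<lambda>z. k (fst z) * l (snd z))"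
proof -
  note [measurable] = borel_measurable_integrable[OF k, simplified] borel_measurable_integrable[OF l, simplified]
  have "integrable (lborel \<Otimes>\<^sub>M lborel) (\<lambda>z. k (fst z) * l (snd z))"
    by (rule lborel_pair.Fubini_integrable) (use k l in \<open>auto simp: abs_mult\<close>)
  then show ?thesis by (simp add: lborel_prod)
qed

lemma itg_shift:
  fixes f :: "real => real"
  assumes "borel_fun f"
  shows "itg f t (t + k) = (LBINT r. indicator {0..k} r * f (t + r))"
proof -
  have [measurable]: "borel_fun f" by fact
  have "(LBINT r. indicat_real {t..t + k} (t + r) * f (t + r)) = (LBINT r. indicat_real {t..t + k} r * f r)"
    by (rule lborel_integral_shift(1)) measurable
  moreover have "indicat_real {t..t + k} (t + r) = indicat_real {0..k} r" for r by (auto simp: indicator_def)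
  ultimately show ?thesis by (simp add: itg_def set_lebesgue_integral_def)
qed

text \<open>Lets time 0 be ignored, where the rising part of \<open>ramp'\<close> meets
  \<open>spacetime\<close>.\<close>

lemma AE_fst_nonzero: "AE z in (lborel :: (real \<times> plane) measure). fst z \<noteq> 0"
proof -
  have "emeasure (lborel \<Otimes>\<^sub>M lborel) ({0::real} \<times> (UNIV :: plane set)) = 0"
    by (subst lborel.emeasure_pair_measure_Times) auto
  then have n: "{0::real} \<times> (UNIV :: plane set) \<in> null_sets (lborel :: (real \<times> plane) measure)"
    by (auto simp: null_sets_def lborel_prod intro!: borel_closed closed_Times)
  show ?thesis using AE_not_in[OF n] by eventually_elim auto
qed

section \<open>Test functions carried by the flow\<close>

context c1a_field
begin

text \<open>The gradient of \<open>g \<circ> flow t 0\<close> when \<open>Dg\<close> is that of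
  \<open>g\<close>: the transposed Jacobian of the flow applied to \<open>Dg\<close> at the image
  point, in coordinates.\<close>

definition tgrad :: "(plane => plane) => real => plane => plane" where
  "tgrad Dg t x = (\<chi> i. Dg (flow t 0 x) \<bullet> dflow t 0 x (axis i 1))"

lemma tgrad_inner: "tgrad Dg t x \<bullet> h = Dg (flow t 0 x) \<bullet> dflow t 0 x h"
proof -
  have h: "h = h $ 1 *\<^sub>R axis 1 1 + h $ 2 *\<^sub>R axis 2 1" by (simp add: vec_eq_iff forall_2 axis_def)
  have "dflow t 0 x h = h $ 1 *\<^sub>R dflow t 0 x (axis 1 1) + h $ 2 *\<^sub>R dflow t 0 x (axis 2 1)"
    by (subst h) (simp only: linear_add[OF dflow_linear] linear_cmul[OF dflow_linear])
  then show ?thesis by (simp add: tgrad_def inner_vec_def[of _ h] sum_2 inner_add_right mult.commute)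
qed

lemma tgrad_continuous:
  assumes "continuous_on UNIV Dg"
  shows "continuous_on UNIV (\<lambda>z. tgrad Dg (fst z) (snd z))"
  unfolding tgrad_def
proof (rule continuous_on_vec_lambda)
  fix i :: 2
  show "continuous_on UNIV (\<lambda>z. Dg (flow (fst z) 0 (snd z)) \<bullet> dflow (fst z) 0 (snd z) (axis i 1))"
    using backward_flow_continuous backward_dflow_continuous[of "axis i 1"]
    by (intro continuous_on_inner continuous_on_compose2[OF assms]) (simp_all add: case_prod_beta')
qed

lemma tgrad_derivative:
  assumes "\<And>x. (g has_derivative (\<lambda>h. Dg x \<bullet> h)) (at x)"
  shows "((\<lambda>x. g (flow t 0 x)) has_derivative (\<lambda>h. tgrad Dg t x \<bullet> h)) (at x)"
  unfolding tgrad_inner by (rule has_derivative_compose[OF flow_has_derivative assms])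

lemma loc_int_inner:
  assumes c: "continuous_on UNIV c" and y: "continuous_on UNIV y"
  shows "loc_int (\<lambda>r. c r \<bullet> v r (y r))"
proof (rule loc_int_bound)
  show "loc_int (\<lambda>r. m r * norm (c r))"
    by (intro loc_int_mult_continuous m_loc_int m_nonneg continuous_intros c)
  note [measurable] = continuous_borel[OF c] loc_int_measurable[OF loc_int_F_continuous[OF y]]
  show "borel_fun (\<lambda>r. c r \<bullet> v r (y r))" by measurable
  show "norm (c r \<bullet> v r (y r)) <= m r * norm (c r)" for r
    using order_trans[OF Cauchy_Schwarz_ineq2[of "c r" "v r (y r)"] mult_left_mono[OF v_bound[of r "y r"] norm_ge_zero[of "c r"]]]
    by (simp add: mult.commute)
qed

text \<open>Since \<open>flow u 0 x\<close> equals \<open>flow w 0 (flow u w x)\<close>, a change of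
  time from \<open>u\<close> to \<open>w\<close> is a spatial increment at time \<open>w\<close>,
  which replaces a time derivative of the backward flow. The mean value theorem in space and
  \<open>null_increment\<close> with majorant \<open>m\<close> finish.\<close>

lemma transported_increment:
  assumes g: "\<And>x. (g has_derivative (\<lambda>h. Dg x \<bullet> h)) (at x)" and Dg: "continuous_on UNIV Dg" and st: "s <= t"
  shows "g (flow t 0 x) - g (flow s 0 x) = itg (\<lambda>r. - (tgrad Dg r x \<bullet> v r x)) s t"
    and "loc_int (\<lambda>r. - (tgrad Dg r x \<bullet> v r x))"
proof -
  let ?P = "\<lambda>r y. tgrad Dg r y"
  have Pc: "continuous_on UNIV (\<lambda>r. ?P r y)" for y
    using continuous_on_compose2[OF tgrad_continuous[OF Dg] continuous_on_Pair[OF continuous_on_id continuous_on_const[of _ y]]] by simp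
  have l: "loc_int (\<lambda>r. ?P r x \<bullet> v r x)" by (rule loc_int_inner[OF Pc]) simp
  show l': "loc_int (\<lambda>r. - (?P r x \<bullet> v r x))" using loc_int_cmult[OF l, of "-1"] by simp
  let ?G = "\<lambda>w. g (flow w 0 x) + itg (\<lambda>r. ?P r x \<bullet> v r x) s w"
  have "?G t = ?G s"
  proof (rule null_increment[OF m_loc_int st])
    fix e :: real assume e: "e > 0"
    let ?Q = "{s..t} \<times> cball x 1"
    have Qc: "continuous_on ?Q (\<lambda>z. ?P (fst z) (snd z))" by (rule continuous_on_subset[OF tgrad_continuous[OF Dg]]) simp
    have Qk: "compact ?Q" by (intro compact_Times) auto
    obtain B where B: "\<And>z. z \<in> ?Q ==> norm (?P (fst z) (snd z)) <= B"
      using compact_imp_bounded[OF compact_continuous_image[OF Qc Qk]] unfolding bounded_iff by (meson image_eqI)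
    define B' where "B' = max B 0"
    have B': "B' >= 0" "\<And>z. z \<in> ?Q ==> norm (?P (fst z) (snd z)) <= B'" using B by (auto simp: B'_def le_max_iff_disj)
    have "uniformly_continuous_on ?Q (\<lambda>z. ?P (fst z) (snd z))" by (rule compact_uniformly_continuous[OF Qc Qk])
    then obtain \<delta> where \<delta>: "\<delta> > 0" "\<And>p q. p \<in> ?Q ==> q \<in> ?Q ==> dist q p < \<delta> ==> dist (?P (fst q) (snd q)) (?P (fst p) (snd p)) < e / 2"
      using e unfolding uniformly_continuous_on_def by (metis half_gt_zero)
    \<comment> \<open>\<open>c\<close> bounds the displacement over a short interval: at most 1 to
      stay in the compact set \<open>?Q\<close>, at most \<open>\<delta> / 2\<close> for uniform
      continuity of the gradient, and such that \<open>B' * c <= e / 2\<close> in the term that uses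
      \<open>v_lipschitz\<close>.\<close>
    define c where "c = min (min 1 (\<delta> / 2)) (e / (2 * (B' + 1)))"
    have c: "c > 0" "c <= 1" "c <= \<delta> / 2" "c <= e / (2 * (B' + 1))"
      using \<delta>(1) e B'(1) unfolding c_def by (simp_all only: min.coboundedI1 min.coboundedI2 order_refl) (auto intro!: divide_pos_pos)
    have Bc: "B' * c <= e / 2"
    proof -
      have "B' * c <= (B' + 1) * (e / (2 * (B' + 1)))" using c B' by (intro mult_mono) auto
      also have "\<dots> = e / 2"
        using nonzero_mult_divide_mult_cancel_left[of "B' + 1" e 2] B'(1) by (simp only: times_divide_eq_right mult.commute[of 2])
      finally show ?thesis .
    qed
    have "uniformly_continuous_on {s..t} (\<lambda>w. oint m s w)"
      by (intro compact_uniformly_continuous continuous_on_subset[OF continuous_on_oint[OF m_loc_int]]) auto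
    then obtain d where d: "d > 0" "\<And>u w. u \<in> {s..t} ==> w \<in> {s..t} ==> \<bar>w - u\<bar> < d ==> \<bar>oint m s w - oint m s u\<bar> < c"
      using c(1) unfolding uniformly_continuous_on_def dist_real_def by metis
    show "\<exists>d>0. \<forall>u w. s <= u \<and> u <= w \<and> w <= t \<and> w - u < d --> \<bar>?G w - ?G u\<bar> <= e * itg m u w"
    proof (intro exI[of _ "min d (\<delta> / 2)"] conjI allI impI)
      fix u w assume uw: "s <= u \<and> u <= w \<and> w <= t \<and> w - u < min d (\<delta> / 2)"
      have mc: "itg m u w < c"
        using d(2)[of u w] uw oint_combine[OF m_loc_int, of s u w] oint_simps(1)[OF m_loc_int, of u w] by auto
      define y where "y = flow u w x"
      have near: "norm (flow u r x - x) < c" if "u <= r" "r <= w" for r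
      proof -
        have "norm (flow u r x - x) <= aint m u r" using flow_displacement[of u r x u] by simp
        also have "\<dots> <= itg m u w" using that by (intro aint_le_itg m_loc_int m_nonneg) auto
        finally show ?thesis using mc by simp
      qed
      have yx: "norm (y - x) < c" unfolding y_def by (rule near) (use uw in auto)
      have "((\<lambda>\<tau>. g (flow w 0 (x + \<tau> *\<^sub>R (y - x)))) has_real_derivative ?P w (x + \<tau> *\<^sub>R (y - x)) \<bullet> (y - x)) (at \<tau>)" for \<tau>
        by (rule has_real_derivative_line[of "\<lambda>x. g (flow w 0 x)", OF tgrad_derivative[OF g]])
      from MVT2[of 0 1, OF zero_less_one this] obtain \<tau> where \<tau>: "0 < \<tau>" "\<tau> < 1"
        "g (flow w 0 y) - g (flow w 0 x) = ?P w (x + \<tau> *\<^sub>R (y - x)) \<bullet> (y - x)" by auto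
      define \<zeta> where "\<zeta> = x + \<tau> *\<^sub>R (y - x)"
      have \<zeta>: "norm (\<zeta> - x) < c" using \<tau> yx mult_left_le_one_le[of "norm (y - x)" \<tau>] by (simp add: \<zeta>_def)
      have P\<zeta>: "norm (?P w \<zeta>) <= B'"
        using B'(2)[of "(w, \<zeta>)"] \<zeta> c uw by (simp add: dist_norm norm_minus_commute)
      have lv: "loc_int (\<lambda>r. v r (flow u r x))" by (rule flow_loc_int)
      have yxi: "y - x = itg (\<lambda>r. v r (flow u r x)) u w"
        using flow_eq[of u w x u] oint_simps(1)[OF lv, of u w] uw by (simp add: y_def)
      have lz: "loc_int (\<lambda>r. ?P w \<zeta> \<bullet> v r (flow u r x))" by (rule loc_int_inner[OF _ flow_continuous]) simp
      have "?G w - ?G u = itg (\<lambda>r. ?P r x \<bullet> v r x) u w - ?P w \<zeta> \<bullet> (y - x)"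
        using \<tau>(3) itg_combine[OF l, of s u w] uw flow_comp[of w 0 u x] by (simp add: y_def \<zeta>_def)
      also have "?P w \<zeta> \<bullet> (y - x) = itg (\<lambda>r. ?P w \<zeta> \<bullet> v r (flow u r x)) u w"
        unfolding yxi by (rule itg_linear[OF lv bounded_linear_inner_right, symmetric])
      also have "itg (\<lambda>r. ?P r x \<bullet> v r x) u w - itg (\<lambda>r. ?P w \<zeta> \<bullet> v r (flow u r x)) u w
          = itg (\<lambda>r. ?P r x \<bullet> v r x - ?P w \<zeta> \<bullet> v r (flow u r x)) u w"
        by (rule itg_diff[OF l lz, symmetric])
      also have "\<bar>\<dots>\<bar> <= itg (\<lambda>r. e * m r) u w"
      proof (rule itg_norm_le[where 'a=real, unfolded real_norm_def])
        fix r assume r: "u <= r" "r <= w"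
        have "dist (r, x) (w, \<zeta>) <= \<bar>r - w\<bar> + norm (\<zeta> - x)"
          using norm_Pair_le[of "r - w" "x - \<zeta>"] by (simp add: dist_norm norm_minus_commute)
        also have "\<dots> < \<delta>" using r uw \<zeta> c(3) by simp
        finally have "dist (?P r x) (?P w \<zeta>) < e / 2"
          using \<delta>(2)[of "(w, \<zeta>)" "(r, x)"] r uw \<zeta> c by (simp add: dist_norm norm_minus_commute)
        then have 1: "norm (?P r x - ?P w \<zeta>) <= e / 2" by (simp add: dist_norm)
        have "norm (v r x - v r (flow u r x)) <= m r * norm (x - flow u r x)" by (rule v_lipschitz)
        also have "\<dots> <= m r * c"
          using near[OF r] by (intro mult_left_mono m_nonneg) (simp add: norm_minus_commute)
        finally have 2: "norm (?P w \<zeta>) * norm (v r x - v r (flow u r x)) <= B' * (m r * c)"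
          by (intro mult_mono P\<zeta> B' norm_ge_zero)
        have 3: "norm (?P r x - ?P w \<zeta>) * norm (v r x) <= e / 2 * m r"
          using e by (intro mult_mono 1 v_bound) simp_all
        have 4: "B' * (m r * c) <= e / 2 * m r"
          using mult_right_mono[OF Bc m_nonneg[of r]] by (simp only: mult_ac)
        have 5: "\<bar>(?P r x - ?P w \<zeta>) \<bullet> v r x\<bar> <= norm (?P r x - ?P w \<zeta>) * norm (v r x)"
          "\<bar>?P w \<zeta> \<bullet> (v r x - v r (flow u r x))\<bar> <= norm (?P w \<zeta>) * norm (v r x - v r (flow u r x))"
          by (rule Cauchy_Schwarz_ineq2)+
        have 6: "?P r x \<bullet> v r x - ?P w \<zeta> \<bullet> v r (flow u r x) = (?P r x - ?P w \<zeta>) \<bullet> v r x + ?P w \<zeta> \<bullet> (v r x - v r (flow u r x))"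
          by (simp add: inner_diff_left inner_diff_right)
        have 7: "e * m r = e / 2 * m r + e / 2 * m r" by simp
        show "\<bar>?P r x \<bullet> v r x - ?P w \<zeta> \<bullet> v r (flow u r x)\<bar> <= e * m r"
          unfolding 6 7 using 2 3 4 5 abs_triangle_ineq[of "(?P r x - ?P w \<zeta>) \<bullet> v r x" "?P w \<zeta> \<bullet> (v r x - v r (flow u r x))"] by linarith
      qed (intro loc_int_diff l lz loc_int_cmult m_loc_int)+
      finally show "\<bar>?G w - ?G u\<bar> <= e * itg m u w" by (simp add: itg_cmult)
    qed (use d \<delta> in simp)
  qed
  then show "g (flow t 0 x) - g (flow s 0 x) = itg (\<lambda>r. - (?P r x \<bullet> v r x)) s t"
    using itg_le[OF order_refl l, of s] itg_cmult[of "-1" "\<lambda>r. ?P r x \<bullet> v r x" s t] by simp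
qed

text \<open>The test function is \<open>ramp t1 t2\<close> times \<open>g \<circ> flow t 0\<close>.
  Its derivative along the field reduces to that of the ramp, which at positive times is
  \<open>- 1 / (t2 - t1)\<close> on \<open>{t1..t2}\<close> and 0 elsewhere. At time 0 the ramp is 1
  and the flow is the identity, which produces the right-hand side.\<close>

lemma transport_average:
  fixes \<theta> :: "real \<times> plane => real" and u :: "real \<times> plane => plane" and \<theta>0 g :: "plane => real"
  assumes \<theta>[measurable]: "borel_fun \<theta>" and \<theta>b: "\<And>S. \<exists>M. \<forall>z. norm z <= S --> \<bar>\<theta> z\<bar> <= M"
    and u[measurable]: "borel_fun u"
    and ui: "\<And>S. integrable lborel (\<lambda>z. indicator (cball 0 S \<inter> spacetime) z * norm (u z))"
    and uv: "AE z in lborel. z \<in> spacetime --> u z = v (fst z) (snd z)"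
    and \<theta>0[measurable]: "borel_fun \<theta>0" and \<theta>0b: "\<And>x. \<bar>\<theta>0 x\<bar> <= M0"
    and weak: "\<And>\<phi>. test_fun \<phi> ==> weak_transport_eq \<theta> u \<theta>0 \<phi>"
    and g: "\<And>x. (g has_derivative (\<lambda>h. Dg x \<bullet> h)) (at x)" and Dg: "continuous_on UNIV Dg"
    and gs: "\<And>x. norm x > \<rho> ==> g x = 0" and t12: "0 <= t1" "t1 < t2"
  shows "(LBINT z. indicator ({t1..t2} \<times> UNIV) z * (\<theta> z * g (flow (fst z) 0 (snd z)))) = (t2 - t1) * (LBINT x. \<theta>0 x * g x)"
proof -
  let ?\<kappa> = "ramp t1 t2" and ?\<kappa>' = "ramp' t1 t2"
  note \<kappa> = ramp_props[OF t12]
  let ?g = "\<lambda>z. g (flow (fst z) 0 (snd z))" and ?P = "\<lambda>z. tgrad Dg (fst z) (snd z)"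
  define \<psi> where "\<psi> = (\<lambda>z. ?\<kappa> (fst z) * ?g z)"
  define d where "d = (\<lambda>z. ?\<kappa>' (fst z) * ?g z + ?\<kappa> (fst z) * (- (?P z \<bullet> v (fst z) (snd z))))"
  define G where "G = (\<lambda>(i::2) z. ?\<kappa> (fst z) * (?P z $ i))"
  have gc: "continuous_on UNIV g"
    by (rule continuous_at_imp_continuous_on) (use g has_derivative_continuous in blast)
  have bf: "continuous_on UNIV (\<lambda>z. flow (fst z) 0 (snd z))" using backward_flow_continuous by (simp add: case_prod_beta')
  have ggc: "continuous_on UNIV ?g" by (rule continuous_on_compose2[OF gc bf]) simp
  have \<kappa>c: "continuous_on UNIV (\<lambda>z::real \<times> plane. ?\<kappa> (fst z))" by (rule continuous_on_compose2[OF \<kappa>(1)]) (auto intro!: continuous_intros)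
  have Pc: "continuous_on UNIV ?P" by (rule tgrad_continuous[OF Dg])
  have \<psi>c: "continuous_on UNIV \<psi>" unfolding \<psi>_def by (intro continuous_intros \<kappa>c ggc)
  have Gc: "continuous_on UNIV (G i)" for i unfolding G_def by (intro continuous_intros \<kappa>c Pc)
  have D0: "Dg x = 0" if "norm x > \<rho>" for x
  proof -
    have "(g has_derivative (\<lambda>h. 0)) (at x)"
      by (rule has_derivative_transform_within_open[of "\<lambda>x. 0" _ _ UNIV "{y. \<rho> < norm y}"])
        (use that gs in \<open>auto intro!: open_Collect_less continuous_intros\<close>)
    then have "(\<lambda>h. Dg x \<bullet> h) = (\<lambda>h. 0)" using has_derivative_unique[OF g] by blast
    from fun_cong[OF this, of "Dg x"] show ?thesis by simp
  qed
  define T where "T = max 1 t2"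
  obtain C where C: "C >= 1" "\<And>s t x. s \<in> {-T..T} ==> t \<in> {-T..T} ==> norm (flow s t x - x) <= C"
    by (rule flow_bounds[of T]) (rule that)
  define S where "S = T + \<rho> + C"
  \<comment> \<open>Gives compact support: outside \<open>{-T..T}\<close> the ramp vanishes, and
    within it the flow moves points by at most \<open>C\<close>.\<close>
  have far: "(?\<kappa> (fst z) = 0 \<and> ?\<kappa>' (fst z) = 0) \<or> norm (flow (fst z) 0 (snd z)) > \<rho>" if "norm z > S" for z
  proof (cases "\<bar>fst z\<bar> <= T")
    case False
    then have "fst z < -1 \<or> fst z > t2" by (auto simp: T_def)
    then show ?thesis using \<kappa>(3,4) t12 by (auto simp: ramp'_def indicator_def)
  next
    case True
    have "norm z <= \<bar>fst z\<bar> + norm (snd z)" using norm_Pair_le[of "fst z" "snd z"] by simp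
    then have "norm (snd z) > \<rho> + C" using that True by (simp add: S_def)
    moreover have "norm (flow (fst z) 0 (snd z) - snd z) <= C" using True by (intro C) (auto simp: T_def)
    ultimately show ?thesis
      using norm_triangle_ineq3[of "flow (fst z) 0 (snd z)" "snd z"] by linarith
  qed
  have P0: "?P z = 0" if "norm (flow (fst z) 0 (snd z)) > \<rho>" for z
    unfolding tgrad_def D0[OF that] by (simp add: vec_eq_iff)
  have \<psi>s: "\<psi> z = 0" and ds: "d z = 0" if "norm z > S" for z
    using far[OF that] gs P0[of z] by (auto simp: \<psi>_def d_def)
  have [measurable]: "borel_fun (\<lambda>z. v (fst z) (snd z))"
    using v_measurable by (simp add: case_prod_beta')
  have [measurable]: "borel_fun ?\<kappa>'" by (rule loc_int_measurable[OF ramp'_loc_int])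
  have fm: "borel_fun (\<lambda>z::real \<times> plane. f (fst z))" if "borel_fun f" for f :: "real => real"
    by (rule measurable_compose[OF _ that]) (intro continuous_borel continuous_intros)
  note [measurable] = continuous_borel[OF ggc] continuous_borel[OF \<kappa>c]
    continuous_borel[OF Pc] fm[OF loc_int_measurable[OF ramp'_loc_int]]
  have dm[measurable]: "borel_fun d" unfolding d_def by measurable
  have d: "integrable lborel d"
  proof -
    have bd: "\<exists>B\<ge>0. \<forall>z\<in>cball 0 S. norm (f z) <= B" if "continuous_on UNIV f" for f :: "real \<times> plane => 'b::real_normed_vector"
    proof -
      have "compact (f ` cball 0 S)" by (intro compact_continuous_image continuous_on_subset[OF that]) auto
      then obtain B where "\<And>z. z \<in> cball 0 S ==> norm (f z) <= B"
        by (metis compact_imp_bounded bounded_iff image_eqI)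
      then show ?thesis by (intro exI[of _ "max B 0"]) (auto simp: le_max_iff_disj)
    qed
    obtain B1 where B1: "B1 >= 0" "\<And>z. z \<in> cball 0 S ==> norm (?g z) <= B1" using bd[OF ggc] by blast
    obtain B2 where B2: "B2 >= 0" "\<And>z. z \<in> cball 0 S ==> norm (?\<kappa> (fst z) *\<^sub>R ?P z) <= B2"
      using bd[OF continuous_on_scaleR[OF \<kappa>c Pc]] by blast
    have i1: "integrable lborel (\<lambda>t. indicat_real {-S..S} t * (B1 * \<bar>?\<kappa>' t\<bar> + B2 * m t))"
    proof -
      have "loc_int (\<lambda>t. \<bar>?\<kappa>' t\<bar>)" using ramp'_loc_int by (auto simp: loc_int_def intro: set_integrable_abs)
      then have "loc_int (\<lambda>t. B1 * \<bar>?\<kappa>' t\<bar> + B2 * m t)" by (intro loc_int_add loc_int_cmult m_loc_int)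
      then show ?thesis by (simp add: loc_int_def set_integrable_def)
    qed
    have i2: "integrable lborel (indicat_real (cball (0::plane) S))" by (rule integrable_indicator_cball)
    show ?thesis
    proof (rule bochner_bound[OF integrable_prod_real_plane[OF i1 i2]])
      show "AE z in lborel. norm (d z) <= norm (indicat_real {-S..S} (fst z) * (B1 * \<bar>?\<kappa>' (fst z)\<bar> + B2 * m (fst z)) * indicat_real (cball 0 S) (snd z))"
      proof (rule AE_I2)
        fix z :: "real \<times> plane"
        show "norm (d z) <= norm (indicat_real {-S..S} (fst z) * (B1 * \<bar>?\<kappa>' (fst z)\<bar> + B2 * m (fst z)) * indicat_real (cball 0 S) (snd z))"
        proof (cases "norm z <= S")
          case True
          then have z: "fst z \<in> {-S..S}" "snd z \<in> cball 0 S" using norm_fst_le[of "fst z" "snd z"] norm_snd_le[of "snd z" "fst z"] by auto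
          have "\<bar>?\<kappa>' (fst z) * ?g z\<bar> <= B1 * \<bar>?\<kappa>' (fst z)\<bar>"
            unfolding abs_mult mult.commute[of B1] using B1(2)[of z] True by (intro mult_left_mono) auto
          moreover have "\<bar>?\<kappa> (fst z) * (- (?P z \<bullet> v (fst z) (snd z)))\<bar> <= B2 * m (fst z)"
          proof -
            have "\<bar>?\<kappa> (fst z) * (- (?P z \<bullet> v (fst z) (snd z)))\<bar> = \<bar>(?\<kappa> (fst z) *\<^sub>R ?P z) \<bullet> v (fst z) (snd z)\<bar>" by (simp add: abs_mult)
            also have "\<dots> <= norm (?\<kappa> (fst z) *\<^sub>R ?P z) * norm (v (fst z) (snd z))" by (rule Cauchy_Schwarz_ineq2)
            also have "\<dots> <= B2 * m (fst z)" using B2 True by (intro mult_mono v_bound) auto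
            finally show ?thesis .
          qed
          ultimately have "\<bar>d z\<bar> <= B1 * \<bar>?\<kappa>' (fst z)\<bar> + B2 * m (fst z)" unfolding d_def by linarith
          then show ?thesis using z by simp
        qed (use ds[of z] in simp)
      qed
    qed measurable
  qed
  have dinc: "\<psi> (t + k, x) - \<psi> (t, x) = (LBINT r. indicator {0..k} r * d (t + r, x))" if "k >= 0" for t x k
  proof -
    have fc: "continuous_on UNIV (\<lambda>r. g (flow r 0 x))"
      using continuous_on_compose2[OF ggc continuous_on_Pair[OF continuous_on_id continuous_on_const[of _ x]]] by simp
    note l = transported_increment(2)[OF g Dg order_refl, of x]
    note i = transported_increment(1)[OF g Dg]
    have "\<psi> (t + k, x) - \<psi> (t, x) = itg (\<lambda>r. d (r, x)) t (t + k)"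
      unfolding \<psi>_def d_def fst_conv snd_conv by (rule itg_product(1)[OF \<kappa>(1) fc ramp'_loc_int l \<kappa>(2) i]) (use that in auto)
    also have "\<dots> = (LBINT r. indicator {0..k} r * d (t + r, x))"
    proof (rule itg_shift)
      have "loc_int (\<lambda>r. d (r, x))"
        unfolding d_def fst_conv snd_conv by (rule itg_product(2)[OF \<kappa>(1) fc ramp'_loc_int l \<kappa>(2) i order_refl])
      then show "borel_fun (\<lambda>r. d (r, x))" by (rule loc_int_measurable)
    qed
    finally show ?thesis .
  qed
  have Gd: "((\<lambda>x. \<psi> (t, x)) has_derivative (\<lambda>h. \<Sum>i\<in>UNIV. h $ i * G i (t, x))) (at x)" for t x
  proof -
    have "((\<lambda>x. ?\<kappa> t * g (flow t 0 x)) has_derivative (\<lambda>h. ?\<kappa> t * (tgrad Dg t x \<bullet> h))) (at x)"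
      by (intro has_derivative_mult_right tgrad_derivative g)
    moreover have "?\<kappa> t * (tgrad Dg t x \<bullet> h) = (\<Sum>i\<in>UNIV. h $ i * G i (t, x))" for h
      by (simp add: G_def inner_vec_def sum_2 algebra_simps)
    ultimately show ?thesis by (simp add: \<psi>_def)
  qed
  have E: "(LBINT z. indicator spacetime z * (\<theta> z * (d z + (\<Sum>i\<in>UNIV. u z $ i * G i z)))) + (LBINT x. \<theta>0 x * \<psi> (0, x)) = 0"
    by (rule weak_transport_extend[OF \<theta> \<theta>b u ui \<theta>0 \<theta>0b weak \<psi>c \<psi>s d ds dinc Gc Gd])
  have "(LBINT z. indicator spacetime z * (\<theta> z * (d z + (\<Sum>i\<in>UNIV. u z $ i * G i z))))
      = (LBINT z. (- (1 / (t2 - t1))) * (indicator ({t1..t2} \<times> UNIV) z * (\<theta> z * ?g z)))"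
  proof (rule integral_cong_AE)
    have stm[measurable]: "spacetime \<in> sets (borel :: (real \<times> plane) measure)" by (intro borel_closed closed_Times) auto
    have stm'[measurable]: "{t1..t2} \<times> UNIV \<in> sets (borel :: (real \<times> plane) measure)" by (intro borel_closed closed_Times) auto
    note [measurable] = continuous_borel[OF Gc]
    show "(\<lambda>z. indicator spacetime z * (\<theta> z * (d z + (\<Sum>i\<in>UNIV. u z $ i * G i z)))) \<in> borel_measurable lborel" by measurable
    show "(\<lambda>z. (- (1 / (t2 - t1))) * (indicator ({t1..t2} \<times> UNIV) z * (\<theta> z * ?g z))) \<in> borel_measurable lborel" by measurable
    show "AE z in lborel. indicator spacetime z * (\<theta> z * (d z + (\<Sum>i\<in>UNIV. u z $ i * G i z))) = (- (1 / (t2 - t1))) * (indicator ({t1..t2} \<times> UNIV) z * (\<theta> z * ?g z))"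
      using uv AE_fst_nonzero
    proof eventually_elim
      case (elim z)
      show ?case
      proof (cases "fst z > 0")
        case True
        then have uz: "u z = v (fst z) (snd z)" using elim by (cases z) auto
        have "(\<Sum>i\<in>UNIV. u z $ i * G i z) = ?\<kappa> (fst z) * (?P z \<bullet> v (fst z) (snd z))"
          by (simp add: uz G_def inner_vec_def sum_2 algebra_simps)
        then have "d z + (\<Sum>i\<in>UNIV. u z $ i * G i z) = ?\<kappa>' (fst z) * ?g z" by (simp add: d_def)
        then show ?thesis using True by (cases z) (auto simp: ramp'_def indicator_def)
      next
        case False
        then show ?thesis using elim(2) t12 by (cases z) (auto simp: indicator_def)
      qed
    qed
  qed
  also have "\<dots> = (- (1 / (t2 - t1))) * (LBINT z. indicator ({t1..t2} \<times> UNIV) z * (\<theta> z * ?g z))"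
    by (rule integral_mult_right_zero)
  finally have "(- (1 / (t2 - t1))) * (LBINT z. indicator ({t1..t2} \<times> UNIV) z * (\<theta> z * ?g z)) + (LBINT x. \<theta>0 x * g x) = 0"
    using E by (simp add: \<psi>_def \<kappa>(5))
  then show ?thesis using t12 by (simp add: field_simps)
qed

end

section \<open>Area preservation\<close>

lemma Ckon_gradient:
  fixes g :: "plane => real"
  assumes g: "\<And>k. Ckon k UNIV g"
  obtains Dg where "continuous_on UNIV Dg" "\<And>x. (g has_derivative (\<lambda>h. Dg x \<bullet> h)) (at x)"
proof (rule that)
  let ?D = "\<lambda>x. (\<chi> i. frechet_derivative g (at x) (axis i 1)) :: plane"
  show "continuous_on UNIV ?D"
    using g[of "Suc 0"] by (intro continuous_on_vec_lambda) simp
  fix x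
  have d: "(g has_derivative frechet_derivative g (at x)) (at x)" by (rule Ckon_has_derivative[OF g]) simp
  have "frechet_derivative g (at x) h = ?D x \<bullet> h" for h
  proof -
    have h: "h = h $ 1 *\<^sub>R axis 1 1 + h $ 2 *\<^sub>R axis 2 1" by (simp add: vec_eq_iff forall_2 axis_def)
    have l: "linear (frechet_derivative g (at x))" by (rule has_derivative_linear[OF d])
    have "frechet_derivative g (at x) h = h $ 1 * frechet_derivative g (at x) (axis 1 1) + h $ 2 * frechet_derivative g (at x) (axis 2 1)"
      by (subst h) (simp only: linear_add[OF l] linear_cmul[OF l] real_scaleR_def)
    then show ?thesis by (simp add: inner_vec_def sum_2 mult.commute)
  qed
  then have "frechet_derivative g (at x) = (\<lambda>h. ?D x \<bullet> h)" by (rule ext)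
  then show "(g has_derivative (\<lambda>h. ?D x \<bullet> h)) (at x)" using d by (simp only:)
qed

text \<open>Approximates the indicator of \<open>box l u\<close> from inside: all members vanish off
  the box.\<close>

definition soft_box :: "plane => plane => nat => plane => real" where
  "soft_box l u n x = (\<Prod>i\<in>UNIV. smooth_step (real n * (x $ i - l $ i)) * smooth_step (real n * (u $ i - x $ i)))"

lemma Ckon_soft_box: "Ckon k UNIV (soft_box l u n)"
proof -
  have c: "Ckon k UNIV (\<lambda>x::plane. x $ i)" for i by (rule Ckon_linear[OF bounded_linear_vec_nth open_UNIV])
  have "Ckon k UNIV (\<lambda>x::plane. smooth_step (real n * (x $ i - l $ i)))" "Ckon k UNIV (\<lambda>x::plane. smooth_step (real n * (u $ i - x $ i)))" for i
    by (rule Ckon_compose[OF open_UNIV open_UNIV subset_UNIV _ Ckon_smooth_step], intro Ckon_cmult Ckon_diff Ckon_const c open_UNIV)+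
  then show ?thesis unfolding soft_box_def by (intro Ckon_prod Ckon_mult open_UNIV)
qed

lemma soft_box_range: "0 <= soft_box l u n x" "soft_box l u n x <= 1"
  unfolding soft_box_def
  by (intro prod_nonneg mult_nonneg_nonneg ballI smooth_step_nonneg,
      intro prod_le_1 conjI mult_nonneg_nonneg mult_le_one smooth_step_nonneg smooth_step_le1)

lemma soft_box_outside: "x \<notin> box l u ==> soft_box l u n x = 0"
  by (force simp: soft_box_def mem_box_cart not_less intro: smooth_step_0 mult_nonneg_nonpos)

lemma soft_box_tendsto: "(\<lambda>n. soft_box l u n x) \<longlonglongrightarrow> indicator (box l u) x"
proof (cases "x \<in> box l u")
  case True
  have s: "(\<lambda>n. smooth_step (real n * c)) \<longlonglongrightarrow> 1" if "c > 0" for c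
  proof (rule tendsto_eventually)
    have "filterlim (\<lambda>n. real n * c) at_top sequentially" using that by real_asymp
    then have "eventually (\<lambda>n. real n * c >= 1) sequentially" by (simp add: filterlim_at_top)
    then show "eventually (\<lambda>n. smooth_step (real n * c) = 1) sequentially" by eventually_elim (rule smooth_step_1)
  qed
  have "(\<lambda>n. soft_box l u n x) \<longlonglongrightarrow> (\<Prod>i\<in>(UNIV :: 2 set). 1 * 1)"
    unfolding soft_box_def using True by (intro tendsto_prod tendsto_mult s) (simp_all add: mem_box_cart)
  then show ?thesis using True by simp
qed (simp add: soft_box_outside)

lemma borel_fst_real: "f \<in> borel_measurable borel ==> borel_fun (\<lambda>z :: real \<times> plane. f (fst z))"
  and borel_snd_plane: "g \<in> borel_measurable borel ==> borel_fun (\<lambda>z :: real \<times> plane. g (snd z))"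
  by (rule measurable_compose, rule continuous_borel, intro continuous_intros, assumption)+

lemma integral_spacetime:
  fixes f :: "real \<times> plane => real"
  assumes "integrable lborel f"
  shows "(LBINT z. f z) = (LBINT t. (LBINT x. f (t, x)))"
    and "integrable lborel (\<lambda>t. LBINT x. f (t, x))"
  using lborel_pair.integral_fst'[of f] lborel_pair.integrable_fst'[of f] assms by (simp_all add: lborel_prod)

text \<open>\<open>w\<close> is a Borel version of the given velocity, for which the weak equations
  are known; \<open>v\<close> is the regular version, for which the flow exists. They agree almost
  everywhere at nonnegative times.\<close>

locale incompressible_field = c1a_field +
  fixes w :: "real \<times> plane => plane"
  assumes w_measurable: "borel_fun w"
    and w_integrable: "\<And>S. integrable lborel (\<lambda>z. indicator (cball 0 S \<inter> spacetime) z * norm (w z))"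
    and w_eq_v: "AE z in lborel. z \<in> spacetime --> w z = v (fst z) (snd z)"
    and weak_one: "\<And>\<phi>. test_fun \<phi> ==> weak_transport_eq (\<lambda>_. 1) w (\<lambda>_. 1) \<phi>"
begin

lemma flow_measurable [measurable]: "borel_fun (flow s t)"
proof (rule continuous_borel, rule lipschitz_on_continuous_on)
  show "(2 * weight m s t)-lipschitz_on UNIV (flow s t)"
  proof (rule lipschitz_onI)
    show "dist (flow s t x) (flow s t y) <= 2 * weight m s t * dist x y" for x y
      using flow_lipschitz[of s t x y] by (simp only: dist_norm mult_ac)
    show "0 <= 2 * weight m s t" by (simp add: weight_def)
  qed
qed

lemma flow_slice_continuous: "continuous_on UNIV (\<lambda>t. flow t 0 x)"
  using continuous_on_compose2[OF backward_flow_continuous continuous_on_Pair[OF continuous_on_id continuous_on_const[of _ x]]] by simp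

lemma flow_support:
  assumes "T >= 0"
  obtains C where "C >= 0" "\<And>s t x. s \<in> {-T..T} ==> t \<in> {-T..T} ==> norm x <= norm (flow s t x) + C"
    "\<And>s t x. s \<in> {-T..T} ==> t \<in> {-T..T} ==> norm (flow s t x) <= norm x + C"
proof -
  obtain C where C: "C >= 1" "\<And>s t x. s \<in> {-T..T} ==> t \<in> {-T..T} ==> norm (flow s t x - x) <= C"
    by (rule flow_bounds[of T]) (rule that)
  show thesis
  proof (rule that)
    fix s t x assume st: "s \<in> {-T..T}" "t \<in> {-T..T}"
    show "norm x <= norm (flow s t x) + C" "norm (flow s t x) <= norm x + C"
      using C(2)[OF st, of x] norm_triangle_ineq3[of "flow s t x" x] by linarith+
  qed (use C in simp)
qed

text \<open>With the constant 1 for \<theta>, \<open>transport_average\<close> says that the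
  integral of \<open>F\<close> over \<open>{0..r}\<close> is \<open>r\<close> times the integral of
  \<open>g\<close>. As \<open>F\<close> is continuous, differentiating in \<open>r\<close> at
  \<open>t\<close> gives the value of \<open>F\<close> there.\<close>

lemma integral_flow_test:
  fixes g :: "plane => real"
  assumes g: "\<And>x. (g has_derivative (\<lambda>h. Dg x \<bullet> h)) (at x)" and Dg: "continuous_on UNIV Dg"
    and gs: "\<And>x. norm x > \<rho> ==> g x = 0" and gb: "\<And>x. \<bar>g x\<bar> <= B" and t: "t >= 0"
  shows "(LBINT x. g (flow t 0 x)) = (LBINT x. g x)"
proof (cases "t = 0")
  case False
  \<comment> \<open>Room beyond \<open>t\<close>, so that \<open>t\<close> is an interior point and
    two-sided derivatives can be compared.\<close>
  define T where "T = t + 1"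
  have T: "0 < t" "t < T" using False t by (auto simp: T_def)
  obtain C where C: "C >= 0" "\<And>s t x. s \<in> {-T..T} ==> t \<in> {-T..T} ==> norm x <= norm (flow s t x) + C"
    by (rule flow_support[of T]) (use T in \<open>auto intro: that\<close>)
  have gc: "continuous_on UNIV g"
    by (rule continuous_at_imp_continuous_on) (use g has_derivative_continuous in blast)
  have gm[measurable]: "borel_fun g" by (rule continuous_borel[OF gc])
  define F where "F = (\<lambda>r. LBINT x. g (flow r 0 x))"
  have z: "g (flow r 0 x) = 0" if "r \<in> {-T..T}" "norm x > \<rho> + C" for r x
    using C(2)[OF that(1), of 0 x] that(2) T by (intro gs) auto
  have B: "B >= 0" using gb[of 0] by simp
  have Fc: "continuous_on {0..T} F"
    unfolding continuous_on_sequentially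
  proof (intro allI ballI impI, elim conjE)
    fix r and \<tau> :: "nat => real" assume r: "r \<in> {0..T}" "\<forall>n. \<tau> n \<in> {0..T}" "\<tau> \<longlonglongrightarrow> r"
    show "(F \<circ> \<tau>) \<longlonglongrightarrow> F r" unfolding F_def o_def
    proof (rule integral_dominated_convergence)
      show "integrable lborel (\<lambda>x::plane. B * indicat_real (cball 0 (\<rho> + C)) x)"
        by (intro integrable_mult_right integrable_indicator_cball)
      show "AE x in lborel. (\<lambda>n. g (flow (\<tau> n) 0 x)) \<longlonglongrightarrow> g (flow r 0 x)"
        using r(3) gc flow_slice_continuous
        by (intro AE_I2 continuous_on_tendsto_compose[OF gc] continuous_on_tendsto_compose[OF flow_slice_continuous]) auto
      show "AE x in lborel. norm (g (flow (\<tau> n) 0 x)) <= B * indicat_real (cball 0 (\<rho> + C)) x" for n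
        using z[of "\<tau> n"] r(2)[rule_format, of n] gb B by (auto simp: indicator_def)
    qed measurable
  qed
  have ggc: "continuous_on UNIV (\<lambda>z. g (flow (fst z) 0 (snd z)))"
    by (rule continuous_on_compose2[OF gc]) (use backward_flow_continuous in \<open>simp_all add: case_prod_beta'\<close>)
  note [measurable] = continuous_borel[OF ggc]
  have avg: "integral {0..r} F = r * (LBINT x. g x)" if r: "0 < r" "r <= T" for r
  proof -
    let ?I = "\<lambda>z. indicat_real ({0..r} \<times> UNIV) z * (1 * g (flow (fst z) 0 (snd z)))"
    have [measurable]: "{0..r} \<times> (UNIV :: plane set) \<in> sets borel" by (intro borel_closed closed_Times) auto
    have i: "integrable lborel ?I"
    proof (rule integrable_bounded_support[where S="T + \<rho> + C" and M=B])
      fix z :: "real \<times> plane" assume n: "norm z > T + \<rho> + C"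
      show "?I z = 0"
      proof (cases "fst z \<in> {0..r}")
        case True
        then have "norm (snd z) > \<rho> + C" using n r norm_Pair_le[of "fst z" "snd z"] by auto
        then show ?thesis using z[of "fst z" "snd z"] True r by auto
      qed (auto simp: indicator_def)
    qed (use gb B in \<open>auto simp: indicator_def\<close>)
    have "(LBINT z. ?I z) = (r - 0) * (LBINT x. 1 * g x)"
      by (rule transport_average[where \<theta>="\<lambda>_. 1" and \<theta>0="\<lambda>_. 1" and ?M0.0=1, OF _ _ w_measurable w_integrable w_eq_v _ _ weak_one g Dg gs order_refl r(1)])
        auto
    then have "r * (LBINT x. g x) = (LBINT z. ?I z)" by simp
    also have "\<dots> = (LBINT s. indicator {0..r} s * F s)"
      by (subst integral_spacetime(1)[OF i]) (simp add: F_def indicator_times)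
    also have "\<dots> = integral {0..r} F"
    proof -
      have "set_integrable lborel {0..r} F"
        unfolding set_integrable_def by (rule borel_integrable_compact) (use r in \<open>auto intro: continuous_on_subset[OF Fc]\<close>)
      from set_borel_integral_eq_integral(2)[OF this] show ?thesis by (simp add: set_lebesgue_integral_def)
    qed
    finally show ?thesis ..
  qed
  have "((\<lambda>r. integral {0..r} F) has_real_derivative F t) (at t within {0..T})"
    by (rule integral_has_real_derivative[OF Fc]) (use T in auto)
  then have "((\<lambda>r. integral {0..r} F) has_real_derivative F t) (at t)"
    using T by (simp add: at_within_Icc_at)
  moreover have "((\<lambda>r. integral {0..r} F) has_real_derivative (LBINT x. g x)) (at t)"
  proof (rule has_field_derivative_transform_within_open[of "\<lambda>r. r * (LBINT x. g x)" _ _ "{0<..<T}"])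
    show "((\<lambda>r. r * (LBINT x. g x)) has_real_derivative (LBINT x. g x)) (at t)"
      by (auto intro!: derivative_eq_intros)
  qed (use T avg in auto)
  ultimately show ?thesis unfolding F_def by (rule DERIV_unique)
qed simp

text \<open>Passage to the limit in \<open>integral_flow_test\<close> along \<open>soft_box\<close>;
  the bounded displacement by the flow provides an integrable majorant for the compositions.\<close>

lemma emeasure_flow_box:
  assumes t: "t >= 0"
  shows "emeasure lborel (flow t 0 -` box l u) = emeasure lborel (box l u)"
proof -
  obtain C where C: "C >= 0" "\<And>s r x. s \<in> {-t..t} ==> r \<in> {-t..t} ==> norm x <= norm (flow s r x) + C"
    by (rule flow_support[OF t]) (rule that)
  obtain \<rho> where \<rho>: "\<And>x. x \<in> box l u ==> norm x <= \<rho>" using bounded_box[of l u] by (auto simp: bounded_iff)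
  have out: "flow t 0 x \<notin> box l u" if "norm x > \<rho> + C" for x
    using \<rho> C(2)[of t 0 x] that t by force
  have [measurable]: "borel_fun (soft_box l u n)" for n
    using Ckon_continuous[OF Ckon_soft_box] by (rule continuous_borel)
  have dom: "integrable lborel (\<lambda>x::plane. indicat_real (cball 0 (\<rho> + C)) x)"
    by (rule integrable_indicator_cball)
  have le: "norm (soft_box l u n y) <= 1" for n y using soft_box_range[of l u n y] by simp
  have "(\<lambda>n. LBINT x. soft_box l u n (flow t 0 x)) \<longlonglongrightarrow> (LBINT x. indicator (box l u) (flow t 0 x))"
  proof (rule integral_dominated_convergence[OF _ _ dom])
    show "AE x in lborel. norm (soft_box l u n (flow t 0 x)) <= indicat_real (cball 0 (\<rho> + C)) x" for n
      using out soft_box_outside le by (auto simp: indicator_def not_le)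
  qed (auto intro: soft_box_tendsto)
  moreover have "(\<lambda>n. LBINT x. soft_box l u n x) \<longlonglongrightarrow> (LBINT x. indicator (box l u) x)"
  proof (rule integral_dominated_convergence[OF _ _ dom])
    have "norm (soft_box l u n x) <= indicat_real (cball 0 (\<rho> + C)) x" for n x
    proof (cases "x \<in> box l u")
      case True
      then show ?thesis using \<rho>[OF True] C(1) le[of n x] by (simp add: indicator_def)
    qed (simp add: soft_box_outside)
    then show "AE x in lborel. norm (soft_box l u n x) <= indicat_real (cball 0 (\<rho> + C)) x" for n by simp
  qed (auto intro: soft_box_tendsto)
  moreover have "(LBINT x. soft_box l u n (flow t 0 x)) = (LBINT x. soft_box l u n x)" for n
  proof -
    obtain Dg where Dg: "continuous_on UNIV Dg" "\<And>x. (soft_box l u n has_derivative (\<lambda>h. Dg x \<bullet> h)) (at x)"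
      by (rule Ckon_gradient[OF Ckon_soft_box]) (rule that)
    show ?thesis
    proof (rule integral_flow_test[OF Dg(2,1) _ _ t])
      show "soft_box l u n x = 0" if "norm x > \<rho>" for x using \<rho>[of x] that by (intro soft_box_outside) auto
      show "\<bar>soft_box l u n x\<bar> <= 1" for x using le by simp
    qed
  qed
  ultimately have "(LBINT x. indicat_real (box l u) (flow t 0 x)) = (LBINT x. indicat_real (box l u) x)"
    by (simp add: LIMSEQ_unique)
  moreover have "(\<lambda>x. indicat_real (box l u) (flow t 0 x)) = indicator (flow t 0 -` box l u)" by (auto simp: indicator_def)
  ultimately have eq: "measure lborel (flow t 0 -` box l u) = measure lborel (box l u)" by simp
  have "flow t 0 -` box l u \<subseteq> cball 0 (\<rho> + C)" using out by (auto simp: not_less[symmetric])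
  then have "emeasure lborel (flow t 0 -` box l u) <= emeasure lborel (cball 0 (\<rho> + C) :: plane set)" by (intro emeasure_mono) auto
  then have "emeasure lborel (flow t 0 -` box l u) < \<infinity>" using emeasure_lborel_cball_finite order.strict_trans1 by blast
  then show ?thesis using eq emeasure_lborel_box_finite[of l u] by (simp add: emeasure_eq_ennreal_measure)
qed

text \<open>Boxes determine Lebesgue measure; the forward flow follows because it inverts the
  backward one.\<close>

lemma distr_flow:
  assumes t: "t >= 0"
  shows "distr lborel borel (flow t 0) = lborel" "distr lborel borel (flow 0 t) = lborel"
proof -
  show 1: "distr lborel borel (flow t 0) = lborel"
  proof (rule lborel_eqI[symmetric])
    fix l u :: plane assume lu: "\<And>b. b \<in> Basis ==> l \<bullet> b <= u \<bullet> b"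
    have "emeasure (distr lborel borel (flow t 0)) (box l u) = emeasure lborel (box l u)"
      by (subst emeasure_distr) (simp_all add: emeasure_flow_box[OF t])
    then show "emeasure (distr lborel borel (flow t 0)) (box l u) = ennreal (\<Prod>b\<in>Basis. (u - l) \<bullet> b)"
      using lu by simp
  qed simp
  have "distr lborel borel (flow 0 t) = distr (distr lborel borel (flow t 0)) borel (flow 0 t)" by (simp only: 1)
  also have "\<dots> = distr lborel borel (flow 0 t \<circ> flow t 0)" by (rule distr_distr) auto
  also have "\<dots> = distr lborel lborel (\<lambda>x. x)" by (intro distr_cong) (auto simp: flow_inverse)
  finally show "distr lborel borel (flow 0 t) = lborel" by (simp add: distr_id)
qed

lemma integral_flow:
  fixes f :: "plane => real"
  assumes t: "t >= 0" and f: "borel_fun f"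
  shows "(LBINT x. f (flow t 0 x)) = (LBINT x. f x)"
  using integral_distr[of "flow t 0" lborel borel f] f distr_flow(1)[OF t] by simp

lemma AE_flow:
  assumes t: "t >= 0" and P: "AE x in lborel. P x"
  shows "AE x in lborel. P (flow t 0 x)" "AE x in lborel. P (flow 0 t x)"
proof -
  show "AE x in lborel. P (flow t 0 x)"
    by (rule AE_distrD[of "flow t 0" lborel borel, unfolded distr_flow[OF t], OF _ P]) simp
  show "AE x in lborel. P (flow 0 t x)"
    by (rule AE_distrD[of "flow 0 t" lborel borel, unfolded distr_flow[OF t], OF _ P]) simp
qed

lemma forward_flow_continuous: "continuous_on UNIV (\<lambda>z. flow 0 (fst z) (snd z))"
proof (rule continuous_at_imp_continuous_on, rule ballI)
  fix q :: "real \<times> plane"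
  define T where "T = \<bar>fst q\<bar> + 1"
  obtain C where C: "C >= 1" "\<And>s t x y. s \<in> {-T..T} ==> t \<in> {-T..T} ==> norm (flow s t x - flow s t y) <= C * norm (x - y)"
    by (rule flow_bounds[of T]) (rule that)
  have "((\<lambda>p. flow 0 (fst p) (snd p) - flow 0 (fst q) (snd q)) \<longlongrightarrow> 0) (at q)"
  proof (rule Lim_null_comparison)
    show "\<forall>\<^sub>F p in at q. norm (flow 0 (fst p) (snd p) - flow 0 (fst q) (snd q)) <= C * norm (snd p - snd q) + aint m (fst p) (fst q)"
      using eventually_fst_in[of q]
    proof eventually_elim
      case (elim p)
      have "norm (flow 0 (fst p) (snd p) - flow 0 (fst p) (snd q)) <= C * norm (snd p - snd q)"
        using elim by (intro C) (auto simp: T_def)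
      moreover have "norm (flow 0 (fst p) (snd q) - flow 0 (fst q) (snd q)) <= aint m (fst p) (fst q)"
        using flow_displacement[of 0 "fst p" "snd q" "fst q"] by (simp add: aint_commute)
      ultimately show ?case
        using norm_triangle_ineq[of "flow 0 (fst p) (snd p) - flow 0 (fst p) (snd q)" "flow 0 (fst p) (snd q) - flow 0 (fst q) (snd q)"]
        by simp
    qed
    have "((\<lambda>p. C * norm (snd p - snd q) + aint m (fst p) (fst q)) \<longlongrightarrow> C * norm (snd q - snd q) + 0) (at q)"
      by (intro tendsto_intros aint_tendsto)
    then show "((\<lambda>p. C * norm (snd p - snd q) + aint m (fst p) (fst q)) \<longlongrightarrow> 0) (at q)" by simp
  qed
  then show "isCont (\<lambda>z. flow 0 (fst z) (snd z)) q" unfolding isCont_def by (rule LIM_zero_cancel)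
qed

end

section \<open>The scalar along trajectories\<close>

locale transported_scalar = incompressible_field +
  fixes \<theta> :: "real \<times> plane => real" and \<theta>0 :: "plane => real" and M0 :: real
  assumes \<theta>_measurable [measurable]: "borel_fun \<theta>"
    and \<theta>_bounded: "\<And>S. \<exists>M. \<forall>z. norm z <= S --> \<bar>\<theta> z\<bar> <= M"
    and \<theta>0_measurable [measurable]: "borel_fun \<theta>0"
    and \<theta>0_bounded: "\<And>x. \<bar>\<theta>0 x\<bar> <= M0"
    and weak_transport: "\<And>\<phi>. test_fun \<phi> ==> weak_transport_eq \<theta> w \<theta>0 \<phi>"
begin

text \<open>In terms of the labels at time 0 the transport formula reads \<open>defect = 0\<close>,
  and the averaged identities become orthogonality to products of a time indicator and a function of
  the label.\<close>

definition defect :: "real \<times> plane => real" where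
  "defect z = \<theta> (fst z, flow 0 (fst z) (snd z)) - \<theta>0 (snd z)"

lemma defect_measurable [measurable]: "borel_fun defect"
proof -
  have "continuous_on UNIV (\<lambda>z :: real \<times> plane. (fst z, flow 0 (fst z) (snd z)))"
    by (intro continuous_intros forward_flow_continuous)
  from measurable_compose[OF continuous_borel[OF this] \<theta>_measurable] borel_snd_plane[OF \<theta>0_measurable]
  show ?thesis unfolding defect_def by measurable
qed

lemma defect_bounded: "\<exists>M\<ge>0. \<forall>z. norm z <= S --> \<bar>defect z\<bar> <= M"
proof -
  define T where "T = max S 0"
  have T: "T >= 0" by (simp add: T_def)
  obtain C where C: "C >= 0" "\<And>s t x. s \<in> {-T..T} ==> t \<in> {-T..T} ==> norm (flow s t x) <= norm x + C"
    by (rule flow_support[OF T]) (rule that)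
  obtain M where M: "\<And>z. norm z <= 2 * T + C ==> \<bar>\<theta> z\<bar> <= M" using \<theta>_bounded by blast
  have "\<bar>defect z\<bar> <= max 0 M + M0" if z: "norm z <= S" for z
  proof -
    have f: "\<bar>fst z\<bar> <= T" "norm (snd z) <= T"
      using z norm_fst_le[of "fst z" "snd z"] norm_snd_le[of "snd z" "fst z"] by (auto simp: T_def)
    then have "norm (flow 0 (fst z) (snd z)) <= T + C" using C(2)[of 0 "fst z" "snd z"] T by (auto simp: abs_le_iff)
    then have "norm (fst z, flow 0 (fst z) (snd z)) <= 2 * T + C"
      using norm_Pair_le[of "fst z" "flow 0 (fst z) (snd z)"] f by simp
    from M[OF this] \<theta>0_bounded[of "snd z"] show ?thesis by (simp add: defect_def)
  qed
  moreover have "0 <= max 0 M + M0" using \<theta>0_bounded[of 0] by simp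
  ultimately show ?thesis by blast
qed

text \<open>Area preservation allows the change of variables by \<open>flow 0 t\<close> in every
  time slice, after which \<open>g\<close> is evaluated at the label;
  \<open>transport_average\<close> then says that the parts with \<theta> and with \<theta>0 have
  the same integral.\<close>

lemma defect_orthogonal:
  fixes g :: "plane => real"
  assumes g: "\<And>x. (g has_derivative (\<lambda>h. Dg x \<bullet> h)) (at x)" and Dg: "continuous_on UNIV Dg"
    and gs: "\<And>x. norm x > \<rho> ==> g x = 0" and gb: "\<And>x. \<bar>g x\<bar> <= B" and t12: "0 <= t1" "t1 < t2"
  shows "(LBINT z. indicator {t1..t2} (fst z) * (defect z * g (snd z))) = 0"
proof -
  define T where "T = t2"
  have T: "T >= 0" using t12 by (simp add: T_def)
  have B: "B >= 0" using gb[of 0] by simp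
  obtain C where C: "C >= 0" "\<And>s t x. s \<in> {-T..T} ==> t \<in> {-T..T} ==> norm x <= norm (flow s t x) + C"
    by (rule flow_support[OF T]) (rule that)
  have gc: "continuous_on UNIV g"
    by (rule continuous_at_imp_continuous_on) (use g has_derivative_continuous in blast)
  have gm[measurable]: "borel_fun g" by (rule continuous_borel[OF gc])
  have ggc: "continuous_on UNIV (\<lambda>z. g (flow (fst z) 0 (snd z)))"
    by (rule continuous_on_compose2[OF gc]) (use backward_flow_continuous in \<open>simp_all add: case_prod_beta'\<close>)
  note [measurable] = continuous_borel[OF ggc] borel_snd_plane[OF gm] borel_snd_plane[OF \<theta>0_measurable]
    borel_fst_real[OF borel_measurable_indicator[of "{t1..t2}" borel], simplified]
  define S where "S = T + \<rho> + C"
  obtain M where M: "M >= 0" "\<And>z. norm z <= S ==> \<bar>defect z\<bar> <= M" using defect_bounded by blast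
  obtain M1 where M1: "\<And>z. norm z <= S ==> \<bar>\<theta> z\<bar> <= M1" using \<theta>_bounded by blast
  let ?D = "\<lambda>z. indicat_real {t1..t2} (fst z) * (defect z * g (snd z))"
  let ?E = "\<lambda>z. indicat_real {t1..t2} (fst z) * (\<theta> z * g (flow (fst z) 0 (snd z)))"
  let ?F = "\<lambda>z. indicat_real {t1..t2} (fst z) * (\<theta>0 (snd z) * g (snd z))"
  have z: "g (snd z) = 0 \<and> g (flow (fst z) 0 (snd z)) = 0" if "norm z > S" "fst z \<in> {t1..t2}" for z
  proof -
    have "norm (snd z) > \<rho> + C" using that t12 norm_Pair_le[of "fst z" "snd z"] by (auto simp: S_def T_def)
    moreover have "norm (snd z) <= norm (flow (fst z) 0 (snd z)) + C" using that t12 by (intro C) (auto simp: T_def)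
    ultimately show ?thesis using C(1) gs by auto
  qed
  have bd: "\<bar>indicat_real {t1..t2} s * (x * y)\<bar> <= K * B" if "\<bar>x\<bar> <= K" "\<bar>y\<bar> <= B" for s x y K
  proof -
    have "\<bar>x * y\<bar> <= K * B" unfolding abs_mult using that by (intro mult_mono) auto
    then show ?thesis by (auto simp: indicator_def)
  qed
  have iD: "integrable lborel ?D"
  proof (rule integrable_bounded_support[where S=S and M="M * B"])
    show "\<bar>?D x\<bar> <= M * B" for x
    proof (cases "norm x > S")
      case False
      then show ?thesis using M(2)[of x] gb by (intro bd) auto
    qed (use z[of x] M(1) B in \<open>auto simp: indicator_def\<close>)
    show "?D x = 0" if "norm x > S" for x using z[OF that] by (auto simp: indicator_def)
  qed measurable
  have iE: "integrable lborel ?E"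
  proof (rule integrable_bounded_support[where S=S and M="max 0 M1 * B"])
    show "\<bar>?E x\<bar> <= max 0 M1 * B" for x
    proof (cases "norm x > S")
      case False
      then show ?thesis using M1[of x] gb by (intro bd) auto
    qed (use z[of x] B in \<open>auto simp: indicator_def\<close>)
    show "?E x = 0" if "norm x > S" for x using z[OF that] by (auto simp: indicator_def)
  qed measurable
  have iF: "integrable lborel ?F"
  proof (rule integrable_bounded_support[where S=S and M="M0 * B"])
    show "?F x = 0" if "norm x > S" for x using z[OF that] by (auto simp: indicator_def)
    show "\<bar>?F x\<bar> <= M0 * B" for x by (rule bd) (rule \<theta>0_bounded gb)+
  qed measurable
  have E: "(LBINT z. ?E z) = (t2 - t1) * (LBINT x. \<theta>0 x * g x)"
    using transport_average[OF \<theta>_measurable \<theta>_bounded w_measurable w_integrable w_eq_v \<theta>0_measurable \<theta>0_bounded weak_transport g Dg gs t12]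
    by (simp add: indicator_times)
  have F: "(LBINT z. ?F z) = (t2 - t1) * (LBINT x. \<theta>0 x * g x)"
    using t12 by (subst integral_spacetime(1)[OF iF]) simp
  have DF: "(LBINT z. ?D z + ?F z) = (LBINT z. ?E z)"
  proof -
    have "(LBINT x. ?D (t, x) + ?F (t, x)) = (LBINT x. ?E (t, x))" for t
    proof (cases "t \<in> {t1..t2}")
      case True
      then have t: "t >= 0" using t12 by simp
      have [measurable]: "borel_fun (\<lambda>x. \<theta> (t, x))"
        by (rule measurable_compose[OF _ \<theta>_measurable]) (intro continuous_borel continuous_intros)
      have "(LBINT x. ?E (t, x)) = (LBINT x. (\<lambda>y. \<theta> (t, flow 0 t y) * g y) (flow t 0 x))"
        using True by (simp add: flow_inverse)
      also have "\<dots> = (LBINT y. \<theta> (t, flow 0 t y) * g y)"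
        by (rule integral_flow[OF t]) measurable
      also have "\<dots> = (LBINT x. ?D (t, x) + ?F (t, x))"
        using True by (intro Bochner_Integration.integral_cong) (simp_all add: defect_def algebra_simps)
      finally show ?thesis ..
    qed simp
    then show ?thesis
      using integral_spacetime(1)[OF iE] integral_spacetime(1)[OF Bochner_Integration.integrable_add[OF iD iF]] by simp
  qed
  show ?thesis using DF E F iD iF by (simp add: Bochner_Integration.integral_add)
qed

text \<open>Convolution with a product of a time indicator and a mollifier tests the defect against
  exactly the functions of \<open>defect_orthogonal\<close>, hence vanishes at small scales; but it
  also converges to the defect in \<open>L^1\<close> on bounded sets.\<close>

lemma defect_zero: "AE z in lborel. 0 < fst z --> defect z = 0"
proof -
  obtain \<eta> :: "plane => real" and R where R: "R >= 0" "mollifier \<eta> R" by (rule mollifier_exists)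
  interpret mollifier \<eta> R by (rule R)
  \<comment> \<open>The time factor is the indicator of \<open>{0..1}\<close>, so that the rescaled
    kernel averages over an interval that ends at the time of evaluation, the form that
    \<open>defect_orthogonal\<close> covers.\<close>
  define k where "k = (\<lambda>z :: real \<times> plane. indicat_real {0..1} (fst z) * \<eta> (snd z))"
  have ki: "integrable lborel k" unfolding k_def by (rule integrable_prod_real_plane) (auto simp: \<eta>_integrable)
  have k1: "(LBINT z. k z) = 1"
    by (subst integral_spacetime(1)[OF ki]) (simp add: k_def int1)
  obtain B where B: "\<And>w. \<bar>\<eta> w\<bar> <= B" using \<eta>_bounded by blast
  \<comment> \<open>The margin \<open>d\<close> keeps the averaging window within positive times and
    within the larger set in \<open>f\<close>, so that this truncation is invisible from
    \<open>S\<close>.\<close>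
  have local: "AE z in lborel. fst z \<in> {d<..<T} \<and> norm (snd z) < T --> defect z = 0" if d: "0 < d" "d < T" for d T
  proof -
    define S where "S = {d<..<T} \<times> ball (0 :: plane) T"
    define f where "f = (\<lambda>z. indicat_real ({0..T} \<times> ball (0 :: plane) (T + d)) z * defect z)"
    have Sm[measurable]: "S \<in> sets borel" unfolding S_def by (intro borel_open open_Times) auto
    have [measurable]: "{0..T} \<times> ball (0 :: plane) (T + d) \<in> sets borel"
      unfolding borel_prod[symmetric] by (intro pair_measureI) auto
    have [measurable]: "borel_fun f" unfolding f_def by measurable
    obtain M where M: "M >= 0" "\<And>z. norm z <= T + (T + d) ==> \<bar>defect z\<bar> <= M" using defect_bounded by blast
    have fi: "integrable lborel f"
    proof (rule integrable_bounded_support[where S="T + (T + d)" and M=M])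
      show "f x = 0" if "norm x > T + (T + d)" for x
        using that norm_Pair_le[of "fst x" "snd x"] by (cases x) (auto simp: f_def indicator_def)
      then show "\<bar>f x\<bar> <= M" for x using M(2)[of x] M(1) by (cases "norm x > T + (T + d)") (auto simp: f_def indicator_def)
    qed measurable
    define \<epsilon> where "\<epsilon> = (\<lambda>n :: nat. 1 / real (Suc n))"
    have \<epsilon>: "\<epsilon> \<longlonglongrightarrow> 0" unfolding \<epsilon>_def by (rule LIMSEQ_Suc) (rule lim_1_over_n)
    have "(\<lambda>n. LBINT x. indicator S x * \<bar>(LBINT z. k z * f (x - \<epsilon> n *\<^sub>R z)) - f x\<bar>) \<longlonglongrightarrow> 0"
    proof (rule approx_identity_L1[OF _ Sm ki k1 _ _ _ _ _ \<epsilon>, where B'=UNIV and C="LBINT x. \<bar>f x\<bar>"])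
      fix z :: "real \<times> plane"
      have i: "integrable lborel (\<lambda>x. f (x - z))" using lborel_integral_shift(2)[of f "- z"] fi by simp
      show "integrable lborel (\<lambda>x. indicator S x * f (x - z))"
        using integrable_real_mult_indicator[OF _ i, of S] by (simp add: mult.commute)
      have "(LBINT x. indicator S x * \<bar>f (x - z)\<bar>) <= (LBINT x. \<bar>f (x - z)\<bar>)"
        using integrable_real_mult_indicator[OF _ integrable_abs[OF i], of S] i
        by (intro integral_mono) (auto simp: mult.commute indicator_def)
      also have "\<dots> = (LBINT x. \<bar>f x\<bar>)" using lborel_integral_shift(1)[of "\<lambda>x. \<bar>f x\<bar>" "- z"] by simp
      finally show "(LBINT x. indicator S x * \<bar>f (x - z)\<bar>) <= (LBINT x. \<bar>f x\<bar>)" .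
    qed (use fi in auto)
    moreover have "\<forall>\<^sub>F n in sequentially. (LBINT x. indicator S x * \<bar>(LBINT z. k z * f (x - \<epsilon> n *\<^sub>R z)) - f x\<bar>) = (LBINT x. indicator S x * \<bar>f x\<bar>)"
    proof -
      have "\<forall>\<^sub>F n in sequentially. \<epsilon> n < d / (R + 1)"
        using \<epsilon> d R(1) by (intro order_tendstoD) auto
      then show ?thesis
      proof eventually_elim
        case (elim n)
        have e: "\<epsilon> n > 0" by (simp add: \<epsilon>_def)
        have eR: "\<epsilon> n * (R + 1) < d" using elim R(1) by (simp add: field_simps)
        have "0 <= \<epsilon> n * R" using e R(1) by simp
        then have e2: "\<epsilon> n < d" "\<epsilon> n * R < d" using eR e by (simp_all add: algebra_simps)
        have "(LBINT z. k z * f (x - \<epsilon> n *\<^sub>R z)) = 0" if x: "x \<in> S" for x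
        proof -
          define g where "g = (\<lambda>y. \<eta> ((1 / \<epsilon> n) *\<^sub>R (snd x - y)))"
          define F where "F = (\<lambda>w. indicat_real {fst x - \<epsilon> n..fst x} (fst w) * (defect w * g (snd w)))"
          have "k z * f (x - \<epsilon> n *\<^sub>R z) = F (x + (- \<epsilon> n) *\<^sub>R z)" for z
          proof (cases "fst z \<in> {0..1} \<and> norm (snd z) <= R")
            case True
            have 1: "0 <= \<epsilon> n * fst z" "\<epsilon> n * fst z <= \<epsilon> n" using True e by (auto simp: mult_left_le)
            have "\<epsilon> n * norm (snd z) <= \<epsilon> n * R" using True e by (intro mult_left_mono) auto
            moreover have "norm (\<epsilon> n *\<^sub>R snd z) = \<epsilon> n * norm (snd z)" using e by simp
            moreover have "norm (snd x) < T" using x by (auto simp: S_def)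
            ultimately have "norm (snd x - \<epsilon> n *\<^sub>R snd z) < T + d"
              using norm_triangle_ineq4[of "snd x" "\<epsilon> n *\<^sub>R snd z"] e2(2) by linarith
            then have "x - \<epsilon> n *\<^sub>R z \<in> {0..T} \<times> ball 0 (T + d)"
              using x 1 e2 by (cases x; cases z) (auto simp: S_def)
            moreover have "g (snd (x - \<epsilon> n *\<^sub>R z)) = \<eta> (snd z)" using e by (simp add: g_def)
            ultimately show ?thesis using 1 True by (simp add: f_def F_def k_def indicator_def)
          next
            case False
            have "fst z \<notin> {0..1} ==> fst (x - \<epsilon> n *\<^sub>R z) \<notin> {fst x - \<epsilon> n..fst x}"
              using e by (auto simp: zero_le_mult_iff)
            moreover have "g (snd (x - \<epsilon> n *\<^sub>R z)) = \<eta> (snd z)" using e by (simp add: g_def)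
            ultimately show ?thesis using False supp[of "snd z"] by (auto simp: F_def k_def)
          qed
          then have "(LBINT z. k z * f (x - \<epsilon> n *\<^sub>R z)) = (LBINT z. F (x + (- \<epsilon> n) *\<^sub>R z))" by simp
          also have "\<dots> = (LBINT z. F z) /\<^sub>R \<bar>- \<epsilon> n\<bar> ^ DIM(real \<times> plane)"
          proof (rule lborel_affine_integral)
            have "continuous_on UNIV g" unfolding g_def
              by (intro continuous_on_compose2[OF \<eta>_continuous] continuous_intros) auto
            note [measurable] = borel_snd_plane[OF continuous_borel[OF this]]
              borel_fst_real[OF borel_measurable_indicator[of "{fst x - \<epsilon> n..fst x}" borel], simplified]
            show "borel_fun F" unfolding F_def by measurable
          qed (use e in simp)
          also have "(LBINT z. F z) = 0"
          proof -
            obtain D where D: "continuous_on UNIV D" "\<And>y. (\<eta> has_derivative (\<lambda>h. D y \<bullet> h)) (at y)"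
              by (rule Ckon_gradient[OF smooth]) (rule that)
            define Dg where "Dg = (\<lambda>y. (- (1 / \<epsilon> n)) *\<^sub>R D ((1 / \<epsilon> n) *\<^sub>R (snd x - y)))"
            have Dgc: "continuous_on UNIV Dg"
              unfolding Dg_def by (intro continuous_on_scaleR continuous_on_compose2[OF D(1)] continuous_intros) auto
            have Dg: "(g has_derivative (\<lambda>h. Dg y \<bullet> h)) (at y)" for y
            proof -
              have "((\<lambda>y. (1 / \<epsilon> n) *\<^sub>R (snd x - y)) has_derivative (\<lambda>h. (1 / \<epsilon> n) *\<^sub>R (- h))) (at y)"
                by (auto intro!: derivative_eq_intros)
              from has_derivative_compose[OF this D(2)]
              show ?thesis by (simp add: g_def Dg_def)
            qed
            show ?thesis unfolding F_def
            proof (rule defect_orthogonal[OF Dg Dgc])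
              fix y :: plane assume "norm y > norm (snd x) + \<epsilon> n * R"
              then have "\<epsilon> n * R < norm (snd x - y)" using norm_triangle_ineq3[of "snd x" y] by linarith
              then have "R < norm (snd x - y) / \<epsilon> n" using e by (simp add: field_simps)
              also have "\<dots> = norm ((1 / \<epsilon> n) *\<^sub>R (snd x - y))" unfolding norm_scaleR using e by simp
              finally have "R < norm ((1 / \<epsilon> n) *\<^sub>R (snd x - y))" .
              then show "g y = 0" unfolding g_def by (rule supp)
            qed (use x e e2 B in \<open>auto simp: S_def g_def\<close>)
          qed
          finally show ?thesis by simp
        qed
        then show ?case by (intro Bochner_Integration.integral_cong) (auto simp: indicator_def)
      qed
    qed
    ultimately have "(\<lambda>n. LBINT x. indicator S x * \<bar>f x\<bar>) \<longlonglongrightarrow> 0"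
      by (rule Lim_transform_eventually)
    then have "(LBINT x. indicator S x * \<bar>f x\<bar>) = 0" by (simp add: LIMSEQ_const_iff)
    moreover have "integrable lborel (\<lambda>x. indicator S x * \<bar>f x\<bar>)"
      using integrable_real_mult_indicator[OF _ integrable_abs[OF fi], of S] by (simp add: mult.commute)
    ultimately have "AE x in lborel. indicator S x * \<bar>f x\<bar> = 0"
      using integral_nonneg_eq_0_iff_AE[of lborel "\<lambda>x. indicator S x * \<bar>f x\<bar>"] by simp
    then show ?thesis
    proof eventually_elim
      case (elim x)
      show ?case
      proof (intro impI, elim conjE)
        assume "fst x \<in> {d<..<T}" "norm (snd x) < T"
        then have "x \<in> S" "x \<in> {0..T} \<times> ball 0 (T + d)" using d by (simp_all add: S_def mem_Times_iff)
        then show "defect x = 0" using elim by (simp add: f_def)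
      qed
    qed
  qed
  have "AE z in lborel. \<forall>n::nat. fst z \<in> {1 / real (n + 2)<..<real (n + 2)} \<and> norm (snd z) < real (n + 2) --> defect z = 0"
    unfolding AE_all_countable
  proof (intro allI local)
    fix n :: nat
    have "1 / real (n + 2) < 1" by simp
    also have "1 < real (n + 2)" by simp
    finally show "1 / real (n + 2) < real (n + 2)" .
  qed simp
  then show ?thesis
  proof eventually_elim
    case (elim z)
    show ?case
    proof
      assume z: "0 < fst z"
      obtain n :: nat where n: "max (1 / fst z) (max (fst z) (norm (snd z))) < real n" by (rule exE[OF reals_Archimedean2])
      then have "1 / fst z < real (n + 2)" by simp
      then have "1 / real (n + 2) < fst z" using z by (simp add: field_simps)
      then show "defect z = 0" using elim[rule_format, of n] n by simp
    qed
  qed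
qed

text \<open>Fubini gives the time slices, and area preservation carries the null set of exceptional
  labels to a null set of points.\<close>

lemma transported_along_flow: "AE t in lborel. 0 < t --> (AE x in lborel. \<theta> (t, x) = \<theta>0 (flow t 0 x))"
proof -
  have "AE t in lborel. AE x in lborel. 0 < fst (t, x) --> defect (t, x) = 0"
    using defect_zero by (intro lborel_pair.AE_pair) (simp only: lborel_prod)
  then show ?thesis
  proof eventually_elim
    case (elim t)
    show ?case
    proof
      assume t: "0 < t"
      have "AE x in lborel. defect (t, flow t 0 x) = 0"
        using AE_flow(1)[OF less_imp_le[OF t], of "\<lambda>x. defect (t, x) = 0"] elim t by simp
      then show "AE x in lborel. \<theta> (t, x) = \<theta>0 (flow t 0 x)"
        by eventually_elim (simp add: defect_def flow_inverse)
    qed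
  qed
qed

text \<open>\<theta>0 is only measurable, so the integrand need not be continuous in
  \<open>t\<close>. Area preservation moves the flow onto \<open>g\<close>; for continuous
  \<open>g\<close> dominated convergence applies, and \<open>L^1\<close> approximation of
  \<open>g\<close> is uniform in \<open>t\<close> since \<theta>0 is bounded.\<close>

lemma transported_weakly_continuous:
  fixes g :: "plane => real"
  assumes \<theta>0s: "\<And>x. norm x > \<rho> ==> \<theta>0 x = 0"
    and g: "borel_fun g" "\<And>S. integrable lborel (\<lambda>x. indicator (cball 0 S) x * g x)"
  shows "continuous_on {0..} (\<lambda>t. LBINT x. \<theta>0 (flow t 0 x) * g x)"
proof -
  have "continuous_on {0..T} (\<lambda>t. LBINT x. \<theta>0 (flow t 0 x) * g x)" if T: "T >= 0" for T
  proof -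
    obtain C where C: "C >= 0" "\<And>s t x. s \<in> {-T..T} ==> t \<in> {-T..T} ==> norm x <= norm (flow s t x) + C"
      "\<And>s t x. s \<in> {-T..T} ==> t \<in> {-T..T} ==> norm (flow s t x) <= norm x + C"
      by (rule flow_support[OF T]) (rule that)
    have z: "\<theta>0 (flow t 0 x) = 0" if "t \<in> {0..T}" "norm x > \<rho> + C" for t x
      using C(2)[of t 0 x] that T by (intro \<theta>0s) auto
    \<comment> \<open>On \<open>{0..T}\<close> the transported scalar is supported in this ball, so
      only the integrable function \<open>G\<close> matters.\<close>
    define G where "G = (\<lambda>x. indicat_real (cball 0 (\<rho> + C)) x * g x)"
    have Gi: "integrable lborel G" unfolding G_def by (rule g)
    have [measurable]: "borel_fun G" using borel_measurable_integrable[OF Gi] by simp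
    have eq: "\<theta>0 (flow t 0 x) * g x = \<theta>0 (flow t 0 x) * G x" if "t \<in> {0..T}" for t x
      using z[OF that, of x] by (auto simp: G_def indicator_def)
    have "\<forall>n. \<exists>h. continuous_on UNIV h \<and> (\<exists>a b. \<forall>x. x \<notin> cbox a b --> h x = 0) \<and> integrable lborel h
        \<and> (LBINT x. \<bar>G x - h x\<bar>) < 1 / real (Suc n)"
    proof
      fix n
      obtain h a b where "continuous_on UNIV h" "\<And>x. x \<notin> cbox a b ==> h x = 0" "integrable lborel h" "(LBINT x. \<bar>G x - h x\<bar>) < 1 / real (Suc n)"
        by (rule L1_dense_continuous[OF Gi, of "1 / real (Suc n)"]) (simp, rule that)
      then show "\<exists>h. continuous_on UNIV h \<and> (\<exists>a b. \<forall>x. x \<notin> cbox a b --> h x = 0) \<and> integrable lborel h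
        \<and> (LBINT x. \<bar>G x - h x\<bar>) < 1 / real (Suc n)" by (intro exI[of _ h] conjI exI[of _ a] exI[of _ b]) auto
    qed
    from choice[OF this] obtain h where h: "\<forall>n. continuous_on UNIV (h n) \<and> (\<exists>a b. \<forall>x. x \<notin> cbox a b --> h n x = 0) \<and> integrable lborel (h n)
        \<and> (LBINT x. \<bar>G x - h n x\<bar>) < 1 / real (Suc n)" by (rule exE)
    have hc: "continuous_on UNIV (h n)" and hs: "\<exists>a b. \<forall>x. x \<notin> cbox a b --> h n x = 0"
      and hi: "integrable lborel (h n)" and hG: "(LBINT x. \<bar>G x - h n x\<bar>) < 1 / real (Suc n)" for n
      by (simp_all only: h)
    have [measurable]: "borel_fun (h n)" for n by (rule continuous_borel[OF hc])
    have M0: "M0 >= 0" using \<theta>0_bounded[of 0] by simp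
    have ti: "integrable lborel (\<lambda>x. \<theta>0 (flow t 0 x) * f x)" if "integrable lborel f" "borel_fun f" for f t
    proof (rule bochner_bound[OF integrable_mult_right[OF integrable_abs[OF that(1)], of M0]])
      show "AE x in lborel. norm (\<theta>0 (flow t 0 x) * f x) <= norm (M0 * \<bar>f x\<bar>)"
        using \<theta>0_bounded M0 by (intro AE_I2) (auto simp: abs_mult intro: mult_right_mono)
    qed (use that in measurable)
    have cont: "continuous_on {0..T} (\<lambda>t. LBINT x. \<theta>0 (flow t 0 x) * h n x)" for n
    proof -
      obtain a b where ab: "\<And>x. x \<notin> cbox a b ==> h n x = 0" using hs by blast
      have "compact (h n ` cbox a b)" by (intro compact_continuous_image continuous_on_subset[OF hc]) auto
      then obtain B' where B': "\<And>x. x \<in> cbox a b ==> norm (h n x) <= B'" by (metis compact_imp_bounded bounded_iff image_eqI)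
      have B: "norm (h n x) <= max 0 B'" for x using B'[of x] ab[of x] by (cases "x \<in> cbox a b") auto
      have "continuous_on {0..T} (\<lambda>t. LBINT x. \<theta>0 x * h n (flow 0 t x))"
        unfolding continuous_on_sequentially
      proof (intro allI ballI impI, elim conjE)
        fix r and \<tau> :: "nat => real" assume r: "r \<in> {0..T}" "\<forall>n. \<tau> n \<in> {0..T}" "\<tau> \<longlonglongrightarrow> r"
        show "((\<lambda>t. LBINT x. \<theta>0 x * h n (flow 0 t x)) \<circ> \<tau>) \<longlonglongrightarrow> (LBINT x. \<theta>0 x * h n (flow 0 r x))" unfolding o_def
        proof (rule integral_dominated_convergence)
          show "integrable lborel (\<lambda>x::plane. (M0 * max 0 B') * indicat_real (cball 0 \<rho>) x)"
            by (intro integrable_mult_right integrable_indicator_cball)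
          show "AE x in lborel. (\<lambda>k. \<theta>0 x * h n (flow 0 (\<tau> k) x)) \<longlonglongrightarrow> \<theta>0 x * h n (flow 0 r x)"
            using r(3)
            by (intro AE_I2 tendsto_intros continuous_on_tendsto_compose[OF hc] continuous_on_tendsto_compose[OF flow_continuous]) auto
          show "AE x in lborel. norm (\<theta>0 x * h n (flow 0 (\<tau> k) x)) <= (M0 * max 0 B') * indicat_real (cball 0 \<rho>) x" for k
          proof (rule AE_I2)
            fix x
            show "norm (\<theta>0 x * h n (flow 0 (\<tau> k) x)) <= (M0 * max 0 B') * indicat_real (cball 0 \<rho>) x"
            proof (cases "norm x > \<rho>")
              case False
              then show ?thesis using mult_mono[OF \<theta>0_bounded B M0 norm_ge_zero] by (simp add: abs_mult)
            qed (simp add: \<theta>0s)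
          qed
        qed measurable
      qed
      moreover have "(LBINT x. \<theta>0 (flow t 0 x) * h n x) = (LBINT x. \<theta>0 x * h n (flow 0 t x))" if "t \<in> {0..T}" for t
        using integral_flow[of t "\<lambda>x. \<theta>0 x * h n (flow 0 t x)"] that by (simp add: flow_inverse)
      ultimately show ?thesis by (subst continuous_on_cong[OF refl]) auto
    qed
    have "uniform_limit {0..T} (\<lambda>n t. LBINT x. \<theta>0 (flow t 0 x) * h n x) (\<lambda>t. LBINT x. \<theta>0 (flow t 0 x) * G x) sequentially"
    proof (rule uniform_limitI)
      fix e :: real assume e: "e > 0"
      have "(\<lambda>n. M0 * (1 / real (Suc n))) \<longlonglongrightarrow> M0 * 0" by (intro tendsto_intros LIMSEQ_Suc[OF lim_1_over_n])
      then have "\<forall>\<^sub>F n in sequentially. M0 * (1 / real (Suc n)) < e" using e by (intro order_tendstoD) auto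
      then show "\<forall>\<^sub>F n in sequentially. \<forall>t\<in>{0..T}. dist (LBINT x. \<theta>0 (flow t 0 x) * h n x) (LBINT x. \<theta>0 (flow t 0 x) * G x) < e"
      proof eventually_elim
        case (elim n)
        show ?case
        proof
          fix t
          have "dist (LBINT x. \<theta>0 (flow t 0 x) * h n x) (LBINT x. \<theta>0 (flow t 0 x) * G x)
              = \<bar>LBINT x. \<theta>0 (flow t 0 x) * (G x - h n x)\<bar>"
            using ti[OF Gi] ti[OF hi[of n]] by (simp add: dist_real_def abs_minus_commute right_diff_distrib Bochner_Integration.integral_diff)
          also have "\<dots> <= (LBINT x. \<bar>\<theta>0 (flow t 0 x) * (G x - h n x)\<bar>)" by (rule integral_abs_bound)
          also have "\<dots> <= (LBINT x. M0 * \<bar>G x - h n x\<bar>)"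
            using Gi hi[of n] \<theta>0_bounded
            by (intro integral_mono integrable_abs ti) (auto simp: abs_mult intro!: mult_right_mono)
          also have "\<dots> <= M0 * (1 / real (Suc n))" using mult_left_mono[OF less_imp_le[OF hG[of n]] M0] by simp
          finally show "dist (LBINT x. \<theta>0 (flow t 0 x) * h n x) (LBINT x. \<theta>0 (flow t 0 x) * G x) < e" using elim by simp
        qed
      qed
    qed
    from uniform_limit_theorem[OF _ this] cont have "continuous_on {0..T} (\<lambda>t. LBINT x. \<theta>0 (flow t 0 x) * G x)" by simp
    moreover have "(LBINT x. \<theta>0 (flow t 0 x) * g x) = (LBINT x. \<theta>0 (flow t 0 x) * G x)" if "t \<in> {0..T}" for t
      by (simp only: eq[OF that])
    ultimately show ?thesis by (subst continuous_on_cong[OF refl]) auto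
  qed
  note main = this
  show ?thesis
    unfolding continuous_on_sequentially
  proof (intro allI ballI impI, elim conjE)
    fix r and \<tau> :: "nat => real" assume r: "r \<in> {0..}" "\<forall>n. \<tau> n \<in> {0..}" "\<tau> \<longlonglongrightarrow> r"
    obtain K where K: "\<And>n. \<tau> n <= K" using Bseq_bdd_above'[OF convergent_imp_Bseq] r(3)
      by (metis bdd_above.unfold convergentI convergent_imp_Bseq Bseq_bdd_above rangeI)
    have "r <= K" using LIMSEQ_le_const2[OF r(3)] K by blast
    then have "K >= 0" using r by auto
    from main[OF this, unfolded continuous_on_sequentially] r K \<open>r <= K\<close>
    show "((\<lambda>t. LBINT x. \<theta>0 (flow t 0 x) * g x) \<circ> \<tau>) \<longlonglongrightarrow> (LBINT x. \<theta>0 (flow r 0 x) * g x)" by auto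
  qed
qed

end

section \<open>Evolution of the boundary\<close>

lemma SUP_ennreal_finite_D:
  assumes "(SUP x\<in>A. ennreal (f x)) < \<infinity>" "\<And>x. x \<in> A ==> 0 <= f x"
  obtains K where "0 <= K" "\<And>x. x \<in> A ==> f x <= K"
proof (rule that[of "enn2real (SUP x\<in>A. ennreal (f x))"])
  fix x assume x: "x \<in> A"
  have "ennreal (f x) <= (SUP x\<in>A. ennreal (f x))" using x by (rule SUP_upper)
  from enn2real_mono[OF this] show "f x <= enn2real (SUP x\<in>A. ennreal (f x))" using assms x by simp
qed simp

lemma Holder_quotient_le:
  assumes "x \<noteq> (y::real)" "0 <= (n::real)"
  shows "n / \<bar>x - y\<bar> powr r <= K \<longleftrightarrow> n <= K * \<bar>x - y\<bar> powr r"
  using assms by (simp add: divide_le_eq)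

lemma Holder_norm_lt_1:
  assumes s: "0 <= s" "s < 1"
  shows "Holder_norm s \<gamma> < \<infinity> ==> \<exists>K\<ge>0. continuous_on {0..1} \<gamma> \<and> (\<forall>x\<in>{0..1}. norm (\<gamma> x) <= K)
      \<and> (\<forall>x\<in>{0..1}. \<forall>y\<in>{0..1}. norm (\<gamma> x - \<gamma> y) <= K * \<bar>x - y\<bar> powr s)"
    and "continuous_on {0..1} \<gamma> ==> (\<And>x. x \<in> {0..1} ==> norm (\<gamma> x) <= K) ==>
      (\<And>x y. x \<in> {0..1} ==> y \<in> {0..1} ==> norm (\<gamma> x - \<gamma> y) <= K * \<bar>x - y\<bar> powr s) ==> Holder_norm s \<gamma> <= ennreal K + ennreal K"
proof -
  let ?P = "{(x, y). x \<in> {0..1::real} \<and> y \<in> {0..1} \<and> x \<noteq> y}"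
  have k: "nat \<lfloor>s\<rfloor> = 0" using s by (simp add: floor_eq_iff)
  have H: "Holder_norm s \<gamma> = (if continuous_on {0..1} \<gamma> then (SUP x\<in>{0..1}. ennreal (norm (\<gamma> x)))
      + (SUP p\<in>?P. ennreal (norm (\<gamma> (fst p) - \<gamma> (snd p)) / \<bar>fst p - snd p\<bar> powr s)) else \<infinity>)"
    unfolding Holder_norm_def Let_def k by (simp add: case_prod_beta' del: Collect_case_prod)
  {
    assume "Holder_norm s \<gamma> < \<infinity>"
    then have c: "continuous_on {0..1} \<gamma>" and f: "(SUP x\<in>{0..1}. ennreal (norm (\<gamma> x))) < \<infinity>"
      "(SUP p\<in>?P. ennreal (norm (\<gamma> (fst p) - \<gamma> (snd p)) / \<bar>fst p - snd p\<bar> powr s)) < \<infinity>"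
      unfolding H by (auto split: if_splits)
    obtain K1 where K1: "0 <= K1" "\<And>x. x \<in> {0..1} ==> norm (\<gamma> x) <= K1"
      by (rule SUP_ennreal_finite_D[OF f(1)]) (auto intro: that)
    obtain K2 where K2: "0 <= K2" "\<And>p. p \<in> ?P ==> norm (\<gamma> (fst p) - \<gamma> (snd p)) / \<bar>fst p - snd p\<bar> powr s <= K2"
      by (rule SUP_ennreal_finite_D[OF f(2)]) (auto intro: that)
    have "norm (\<gamma> x - \<gamma> y) <= (K1 + K2) * \<bar>x - y\<bar> powr s" if "x \<in> {0..1}" "y \<in> {0..1}" for x y
    proof (cases "x = y")
      case False
      then have "norm (\<gamma> x - \<gamma> y) <= K2 * \<bar>x - y\<bar> powr s"
        using K2(2)[of "(x, y)"] that Holder_quotient_le[of x y "norm (\<gamma> x - \<gamma> y)" s K2] by simp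
      also have "\<dots> <= (K1 + K2) * \<bar>x - y\<bar> powr s" using K1(1) by (intro mult_right_mono) auto
      finally show ?thesis .
    qed simp
    moreover have "norm (\<gamma> x) <= K1 + K2" if "x \<in> {0..1}" for x using K1(2)[OF that] K2(1) by simp
    ultimately show "\<exists>K\<ge>0. continuous_on {0..1} \<gamma> \<and> (\<forall>x\<in>{0..1}. norm (\<gamma> x) <= K)
      \<and> (\<forall>x\<in>{0..1}. \<forall>y\<in>{0..1}. norm (\<gamma> x - \<gamma> y) <= K * \<bar>x - y\<bar> powr s)"
      using K1(1) K2(1) c by (intro exI[of _ "K1 + K2"]) simp
  }
  {
    assume c: "continuous_on {0..1} \<gamma>" and K: "\<And>x. x \<in> {0..1} ==> norm (\<gamma> x) <= K"
      "\<And>x y. x \<in> {0..1} ==> y \<in> {0..1} ==> norm (\<gamma> x - \<gamma> y) <= K * \<bar>x - y\<bar> powr s"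
    have "(SUP x\<in>{0..1}. ennreal (norm (\<gamma> x))) <= ennreal K" by (intro SUP_least ennreal_leI K)
    moreover have "(SUP p\<in>?P. ennreal (norm (\<gamma> (fst p) - \<gamma> (snd p)) / \<bar>fst p - snd p\<bar> powr s)) <= ennreal K"
      by (intro SUP_least ennreal_leI) (auto simp: Holder_quotient_le K)
    ultimately show "Holder_norm s \<gamma> <= ennreal K + ennreal K" unfolding H using c by (simp add: add_mono)
  }
qed

lemma Holder_norm_ge_1:
  assumes s: "1 <= s" "s < 2"
  shows "Holder_norm s \<gamma> < \<infinity> ==> \<exists>K\<ge>0. \<gamma> differentiable_on {0..1} \<and> continuous_on {0..1} (curve_deriv \<gamma>)
      \<and> (\<forall>x\<in>{0..1}. norm (\<gamma> x) <= K) \<and> (\<forall>x\<in>{0..1}. norm (curve_deriv \<gamma> x) <= K)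
      \<and> (\<forall>x\<in>{0..1}. \<forall>y\<in>{0..1}. norm (curve_deriv \<gamma> x - curve_deriv \<gamma> y) <= K * \<bar>x - y\<bar> powr (s - 1))"
    and "\<gamma> differentiable_on {0..1} ==> continuous_on {0..1} (curve_deriv \<gamma>) ==> (\<And>x. x \<in> {0..1} ==> norm (\<gamma> x) <= K) ==>
      (\<And>x. x \<in> {0..1} ==> norm (curve_deriv \<gamma> x) <= K) ==>
      (\<And>x y. x \<in> {0..1} ==> y \<in> {0..1} ==> norm (curve_deriv \<gamma> x - curve_deriv \<gamma> y) <= K * \<bar>x - y\<bar> powr (s - 1)) ==>
      Holder_norm s \<gamma> <= ennreal K + ennreal K + ennreal K"
proof -
  let ?P = "{(x, y). x \<in> {0..1::real} \<and> y \<in> {0..1} \<and> x \<noteq> y}" and ?d = "curve_deriv \<gamma>"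
  have "\<lfloor>s\<rfloor> = 1" using s by (simp add: floor_eq_iff)
  then have k: "nat \<lfloor>s\<rfloor> = Suc 0" by simp
  have H: "Holder_norm s \<gamma> = (if \<gamma> differentiable_on {0..1} \<and> continuous_on {0..1} ?d
      then (SUP x\<in>{0..1}. ennreal (norm (\<gamma> x))) + (SUP x\<in>{0..1}. ennreal (norm (?d x)))
      + (SUP p\<in>?P. ennreal (norm (?d (fst p) - ?d (snd p)) / \<bar>fst p - snd p\<bar> powr (s - 1))) else \<infinity>)"
    unfolding Holder_norm_def Let_def k by (simp add: case_prod_beta' del: Collect_case_prod)
  {
    assume "Holder_norm s \<gamma> < \<infinity>"
    then have c: "\<gamma> differentiable_on {0..1}" "continuous_on {0..1} ?d" and f: "(SUP x\<in>{0..1}. ennreal (norm (\<gamma> x))) < \<infinity>"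
      "(SUP x\<in>{0..1}. ennreal (norm (?d x))) < \<infinity>"
      "(SUP p\<in>?P. ennreal (norm (?d (fst p) - ?d (snd p)) / \<bar>fst p - snd p\<bar> powr (s - 1))) < \<infinity>"
      unfolding H by (auto split: if_splits)
    obtain K1 where K1: "0 <= K1" "\<And>x. x \<in> {0..1} ==> norm (\<gamma> x) <= K1"
      by (rule SUP_ennreal_finite_D[OF f(1)]) (auto intro: that)
    obtain K3 where K3: "0 <= K3" "\<And>x. x \<in> {0..1} ==> norm (?d x) <= K3"
      by (rule SUP_ennreal_finite_D[OF f(2)]) (auto intro: that)
    obtain K2 where K2: "0 <= K2" "\<And>p. p \<in> ?P ==> norm (?d (fst p) - ?d (snd p)) / \<bar>fst p - snd p\<bar> powr (s - 1) <= K2"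
      by (rule SUP_ennreal_finite_D[OF f(3)]) (auto intro: that)
    have "norm (?d x - ?d y) <= (K1 + K2 + K3) * \<bar>x - y\<bar> powr (s - 1)" if "x \<in> {0..1}" "y \<in> {0..1}" for x y
    proof (cases "x = y")
      case False
      then have "norm (?d x - ?d y) <= K2 * \<bar>x - y\<bar> powr (s - 1)"
        using K2(2)[of "(x, y)"] that Holder_quotient_le[of x y "norm (?d x - ?d y)" "s - 1" K2] by simp
      also have "\<dots> <= (K1 + K2 + K3) * \<bar>x - y\<bar> powr (s - 1)" using K1(1) K3(1) by (intro mult_right_mono) auto
      finally show ?thesis .
    qed simp
    moreover have "norm (\<gamma> x) <= K1 + K2 + K3" "norm (?d x) <= K1 + K2 + K3" if "x \<in> {0..1}" for x
      using K1(2)[OF that] K1(1) K2(1) K3(1) K3(2)[OF that] by simp_all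
    ultimately show "\<exists>K\<ge>0. \<gamma> differentiable_on {0..1} \<and> continuous_on {0..1} ?d
      \<and> (\<forall>x\<in>{0..1}. norm (\<gamma> x) <= K) \<and> (\<forall>x\<in>{0..1}. norm (?d x) <= K)
      \<and> (\<forall>x\<in>{0..1}. \<forall>y\<in>{0..1}. norm (?d x - ?d y) <= K * \<bar>x - y\<bar> powr (s - 1))"
      using K1(1) K2(1) K3(1) c by (intro exI[of _ "K1 + K2 + K3"]) simp
  }
  {
    assume c: "\<gamma> differentiable_on {0..1}" "continuous_on {0..1} ?d" and K: "\<And>x. x \<in> {0..1} ==> norm (\<gamma> x) <= K"
      "\<And>x. x \<in> {0..1} ==> norm (?d x) <= K"
      "\<And>x y. x \<in> {0..1} ==> y \<in> {0..1} ==> norm (?d x - ?d y) <= K * \<bar>x - y\<bar> powr (s - 1)"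
    have "(SUP x\<in>{0..1}. ennreal (norm (\<gamma> x))) <= ennreal K" "(SUP x\<in>{0..1}. ennreal (norm (?d x))) <= ennreal K"
      by (intro SUP_least ennreal_leI K, assumption)+
    moreover have "(SUP p\<in>?P. ennreal (norm (?d (fst p) - ?d (snd p)) / \<bar>fst p - snd p\<bar> powr (s - 1))) <= ennreal K"
      by (intro SUP_least ennreal_leI) (auto simp: Holder_quotient_le K)
    ultimately show "Holder_norm s \<gamma> <= ennreal K + ennreal K + ennreal K" unfolding H using c by (simp add: add_mono)
  }
qed

lemma closure_image_inverse:
  assumes f: "continuous_on UNIV f" and g: "continuous_on UNIV g" and fg: "\<And>x. f (g x) = x" and gf: "\<And>x. g (f x) = x"
  shows "closure (f ` A) = f ` closure A"
proof
  have "g ` closure (f ` A) \<subseteq> closure A"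
    by (rule image_closure_subset[OF continuous_on_subset[OF g]]) (auto simp: gf image_image intro: closure_subset[THEN subsetD])
  then have "f ` (g ` closure (f ` A)) \<subseteq> f ` closure A" by (rule image_mono)
  then show "closure (f ` A) \<subseteq> f ` closure A" by (simp add: image_image fg)
  show "f ` closure A \<subseteq> closure (f ` A)"
    by (rule image_closure_subset[OF continuous_on_subset[OF f]]) (auto intro: closure_subset[THEN subsetD])
qed

lemma frontier_image_inverse:
  assumes f: "continuous_on UNIV f" and g: "continuous_on UNIV g" and fg: "\<And>x. f (g x) = x" and gf: "\<And>x. g (f x) = x"
  shows "frontier (f ` A) = f ` frontier A"
proof -
  have "bij f" using fg gf by (rule o_bij[OF ext ext, unfolded o_def id_def, rotated])
  then have "- (f ` A) = f ` (- A)" by (simp add: bij_image_Compl_eq)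
  then show ?thesis
    using closure_image_inverse[OF assms] \<open>bij f\<close>
    by (simp add: frontier_closures image_Int bij_is_inj)
qed

context c1a_field
begin

lemma flow_continuous_space: "continuous_on UNIV (flow s t)"
  by (rule continuous_at_imp_continuous_on) (use flow_has_derivative has_derivative_continuous in blast)

lemma dflow_inverse: "dflow t s (flow s t x) (dflow s t x h) = h"
  by (simp only: dflow_comp dflow_refl)

lemma curve_deriv_flow:
  assumes "\<gamma> differentiable_on {0..1}" "x \<in> {0..1}"
  shows "((flow s t \<circ> \<gamma>) has_vector_derivative dflow s t (\<gamma> x) (curve_deriv \<gamma> x)) (at x within {0..1})"
    and "curve_deriv (flow s t \<circ> \<gamma>) x = dflow s t (\<gamma> x) (curve_deriv \<gamma> x)"
proof -
  have "(\<gamma> has_vector_derivative curve_deriv \<gamma> x) (at x within {0..1})"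
    unfolding curve_deriv_def using assms by (simp add: differentiable_on_def vector_derivative_works)
  then have "((\<lambda>r. flow s t (\<gamma> r)) has_derivative (\<lambda>h. dflow s t (\<gamma> x) (h *\<^sub>R curve_deriv \<gamma> x))) (at x within {0..1})"
    unfolding has_vector_derivative_def by (rule has_derivative_compose[OF _ flow_has_derivative])
  then show d: "((flow s t \<circ> \<gamma>) has_vector_derivative dflow s t (\<gamma> x) (curve_deriv \<gamma> x)) (at x within {0..1})"
    by (simp add: has_vector_derivative_def o_def linear_cmul[OF dflow_linear])
  show "curve_deriv (flow s t \<circ> \<gamma>) x = dflow s t (\<gamma> x) (curve_deriv \<gamma> x)"
    unfolding curve_deriv_def by (rule vector_derivative_within_cbox[of 0 1, unfolded cbox_interval]) (use d assms in \<open>auto simp: curve_deriv_def\<close>)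
qed

text \<open>The curve is composed with the flow. If \<sigma> is at least 1, its derivative is
  \<open>dflow\<close> along \<open>\<gamma>0\<close> applied to the derivative of
  \<open>\<gamma>0\<close>: the first factor is Hoelder of order \<open>a\<close> because
  \<open>\<gamma>0\<close> is Lipschitz, the second of order \<open>\<sigma> - 1 <= a\<close>. If
  \<sigma> is below 1, the Lipschitz bound on the flow is enough.\<close>

theorem boundary_transport:
  assumes \<gamma>0: "boundary_param \<sigma> D0 \<gamma>0" and \<sigma>: "0 <= \<sigma>" "\<sigma> <= 1 + a" "\<sigma> < 2" and T: "0 <= T"
  shows "boundary_bounded_in_time \<sigma> T (\<lambda>t. flow 0 t ` D0)"
proof -
  obtain C where C: "C >= 1"
    "\<And>s t x y. s \<in> {-T..T} ==> t \<in> {-T..T} ==> norm (flow s t x - flow s t y) <= C * norm (x - y)"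
    "\<And>s t x h. s \<in> {-T..T} ==> t \<in> {-T..T} ==> norm (dflow s t x h) <= C * norm h"
    "\<And>s t x y h. s \<in> {-T..T} ==> t \<in> {-T..T} ==> norm (dflow s t x h - dflow s t y h) <= C * norm (x - y) powr a * norm h"
    "\<And>s t x. s \<in> {-T..T} ==> t \<in> {-T..T} ==> norm (flow s t x - x) <= C"
    by (rule flow_bounds[of T]) (rule that)
  have simple: "simple_path \<gamma>0" "pathfinish \<gamma>0 = pathstart \<gamma>0" "path_image \<gamma>0 = frontier D0"
    and fin: "Holder_norm \<sigma> \<gamma>0 < \<infinity>" and nz: "\<sigma> >= 1 ==> x \<in> {0..1} ==> curve_deriv \<gamma>0 x \<noteq> 0" for x
    using \<gamma>0 by (auto simp: boundary_param_def)
  let ?\<gamma> = "\<lambda>t. flow 0 t \<circ> \<gamma>0"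
  have bound: "norm (?\<gamma> t x) <= C + K" if "t \<in> {0..T}" "norm (\<gamma>0 x) <= K" for t x K
  proof -
    have "norm (flow 0 t (\<gamma>0 x) - \<gamma>0 x) <= C" using that by (intro C) auto
    then show ?thesis using that norm_triangle_ineq2[of "flow 0 t (\<gamma>0 x)" "\<gamma>0 x"] by simp
  qed
  have "\<exists>N. \<forall>t\<in>{0..T}. Holder_norm \<sigma> (?\<gamma> t) <= ennreal N + ennreal N + ennreal N"
  proof (cases "\<sigma> < 1")
    case True
    obtain K where K: "K >= 0" "continuous_on {0..1} \<gamma>0" "\<And>x. x \<in> {0..1} ==> norm (\<gamma>0 x) <= K"
      "\<And>x y. x \<in> {0..1} ==> y \<in> {0..1} ==> norm (\<gamma>0 x - \<gamma>0 y) <= K * \<bar>x - y\<bar> powr \<sigma>"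
      using Holder_norm_lt_1(1)[OF \<sigma>(1) True fin] by blast
    have "Holder_norm \<sigma> (?\<gamma> t) <= ennreal (C + C * K) + ennreal (C + C * K)" if t: "t \<in> {0..T}" for t
    proof (rule Holder_norm_lt_1(2)[OF \<sigma>(1) True])
      show "continuous_on {0..1} (?\<gamma> t)"
        by (intro continuous_on_compose K continuous_on_subset[OF flow_continuous_space] subset_UNIV)
      have CK: "K <= C * K" "0 <= C * K" using C(1) K(1) by (simp_all add: mult_le_cancel_right1)
      show "norm (?\<gamma> t x) <= C + C * K" if "x \<in> {0..1}" for x
        using bound[OF t K(3)[OF that]] CK by simp
      fix x y :: real assume xy: "x \<in> {0..1}" "y \<in> {0..1}"
      have "norm (?\<gamma> t x - ?\<gamma> t y) <= C * norm (\<gamma>0 x - \<gamma>0 y)" using C(2)[of 0 t] t by simp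
      also have "\<dots> <= C * (K * \<bar>x - y\<bar> powr \<sigma>)" using C(1) K(4)[OF xy] by (intro mult_left_mono) auto
      also have "\<dots> <= (C + C * K) * \<bar>x - y\<bar> powr \<sigma>" using C(1) by (simp add: algebra_simps)
      finally show "norm (?\<gamma> t x - ?\<gamma> t y) <= (C + C * K) * \<bar>x - y\<bar> powr \<sigma>" .
    qed
    then show ?thesis by (intro exI[of _ "C + C * K"] ballI) (rule add_increasing2[OF zero_le], simp)
  next
    case False
    then have \<sigma>1: "1 <= \<sigma>" by simp
    obtain K where K: "K >= 0" "\<gamma>0 differentiable_on {0..1}" "continuous_on {0..1} (curve_deriv \<gamma>0)"
      "\<And>x. x \<in> {0..1} ==> norm (\<gamma>0 x) <= K" "\<And>x. x \<in> {0..1} ==> norm (curve_deriv \<gamma>0 x) <= K"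
      "\<And>x y. x \<in> {0..1} ==> y \<in> {0..1} ==> norm (curve_deriv \<gamma>0 x - curve_deriv \<gamma>0 y) <= K * \<bar>x - y\<bar> powr (\<sigma> - 1)"
      using Holder_norm_ge_1(1)[OF \<sigma>1 \<sigma>(3) fin] by blast
    have lip: "norm (\<gamma>0 x - \<gamma>0 y) <= K * \<bar>x - y\<bar>" if "x \<in> {0..1}" "y \<in> {0..1}" for x y
    proof -
      have "norm (\<gamma>0 x - \<gamma>0 y) <= K * norm (x - y)"
      proof (rule differentiable_bound[of "{0..1}" \<gamma>0 "\<lambda>x h. h *\<^sub>R curve_deriv \<gamma>0 x"])
        show "(\<gamma>0 has_derivative (\<lambda>h. h *\<^sub>R curve_deriv \<gamma>0 x)) (at x within {0..1})" if "x \<in> {0..1}" for x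
          using K(2) that unfolding curve_deriv_def
          by (simp add: differentiable_on_def vector_derivative_works has_vector_derivative_def)
        show "onorm (\<lambda>h. h *\<^sub>R curve_deriv \<gamma>0 x) <= K" if "x \<in> {0..1}" for x
          using K(1) K(5)[OF that] by (intro onorm_bound) (auto simp: mult.commute[of K] intro: mult_left_mono)
      qed (use that in auto)
      then show ?thesis by simp
    qed
    define N where "N = C + C * K + C * K powr a * K"
    have pos: "0 <= C * K" "0 <= C * K powr a * K" using C(1) K(1) by simp_all
    have "Holder_norm \<sigma> (?\<gamma> t) <= ennreal N + ennreal N + ennreal N" if t: "t \<in> {0..T}" for t
    proof (rule Holder_norm_ge_1(2)[OF \<sigma>1 \<sigma>(3)])
      show "?\<gamma> t differentiable_on {0..1}"
        using curve_deriv_flow(1)[OF K(2), of _ 0 t] unfolding differentiable_on_def has_vector_derivative_def differentiable_def by blast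
      have CK: "K <= C * K" using C(1) K(1) by (simp add: mult_le_cancel_right1)
      have t': "0 \<in> {-T..T}" "t \<in> {-T..T}" using t by auto
      show "norm (?\<gamma> t x) <= N" if "x \<in> {0..1}" for x
        using bound[OF t K(4)[OF that]] CK pos by (simp add: N_def)
      have dle: "norm (curve_deriv (?\<gamma> t) x) <= C * K" if "x \<in> {0..1}" for x
      proof -
        have "norm (curve_deriv (?\<gamma> t) x) <= C * norm (curve_deriv \<gamma>0 x)"
          unfolding curve_deriv_flow(2)[OF K(2) that] by (rule C(3)[OF t'])
        also have "\<dots> <= C * K" using C(1) K(5)[OF that] by (intro mult_left_mono) auto
        finally show ?thesis .
      qed
      show "norm (curve_deriv (?\<gamma> t) x) <= N" if "x \<in> {0..1}" for x
        using dle[OF that] C(1) pos by (simp add: N_def)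
      have diff: "norm (curve_deriv (?\<gamma> t) x - curve_deriv (?\<gamma> t) y)
          <= C * norm (curve_deriv \<gamma>0 x - curve_deriv \<gamma>0 y) + C * K powr a * K * \<bar>x - y\<bar> powr a"
        if xy: "x \<in> {0..1}" "y \<in> {0..1}" for x y
      proof -
        let ?dx = "curve_deriv \<gamma>0 x" and ?dy = "curve_deriv \<gamma>0 y"
        have 1: "norm (dflow 0 t (\<gamma>0 x) (?dx - ?dy)) <= C * norm (?dx - ?dy)" by (rule C(3)[OF t'])
        have "norm (dflow 0 t (\<gamma>0 x) ?dy - dflow 0 t (\<gamma>0 y) ?dy) <= C * norm (\<gamma>0 x - \<gamma>0 y) powr a * norm ?dy"
          by (rule C(4)[OF t'])
        also have "\<dots> <= C * (K * \<bar>x - y\<bar>) powr a * K"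
          using C(1) K(1) a lip[OF xy] K(5)[OF xy(2)] by (intro mult_mono powr_mono2) auto
        also have "\<dots> = C * K powr a * K * \<bar>x - y\<bar> powr a" using K(1) by (simp add: powr_mult)
        finally have 2: "norm (dflow 0 t (\<gamma>0 x) ?dy - dflow 0 t (\<gamma>0 y) ?dy) <= C * K powr a * K * \<bar>x - y\<bar> powr a" .
        have "curve_deriv (?\<gamma> t) x - curve_deriv (?\<gamma> t) y
            = dflow 0 t (\<gamma>0 x) (?dx - ?dy) + (dflow 0 t (\<gamma>0 x) ?dy - dflow 0 t (\<gamma>0 y) ?dy)"
          using xy by (simp add: curve_deriv_flow(2)[OF K(2)] linear_diff[OF dflow_linear])
        then show ?thesis using norm_triangle_le[OF add_mono[OF 1 2]] by (simp only:)
      qed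
      show "norm (curve_deriv (?\<gamma> t) x - curve_deriv (?\<gamma> t) y) <= N * \<bar>x - y\<bar> powr (\<sigma> - 1)"
        if xy: "x \<in> {0..1}" "y \<in> {0..1}" for x y
      proof -
        have "C * norm (curve_deriv \<gamma>0 x - curve_deriv \<gamma>0 y) <= C * (K * \<bar>x - y\<bar> powr (\<sigma> - 1))"
          using C(1) K(6)[OF xy] by (intro mult_left_mono) auto
        \<comment> \<open>Here \<open>\<bar>x - y\<bar> <= 1\<close> lets the exponent drop from
          \<open>a\<close> to \<open>\<sigma> - 1\<close>.\<close>
        moreover have "C * K powr a * K * \<bar>x - y\<bar> powr a <= C * K powr a * K * \<bar>x - y\<bar> powr (\<sigma> - 1)"
        proof (cases "x = y")
          case False
          then show ?thesis using pos(2) \<sigma> xy by (intro mult_left_mono powr_mono') auto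
        qed (use a in simp)
        ultimately have "norm (curve_deriv (?\<gamma> t) x - curve_deriv (?\<gamma> t) y) <= (C * K + C * K powr a * K) * \<bar>x - y\<bar> powr (\<sigma> - 1)"
          using diff[OF xy] by (simp add: algebra_simps)
        also have "\<dots> <= N * \<bar>x - y\<bar> powr (\<sigma> - 1)" using C(1) by (intro mult_right_mono) (auto simp: N_def)
        finally show ?thesis .
      qed
      \<comment> \<open>Derived from \<open>diff\<close> and not from the previous estimate: for
        \<sigma> = 1 that one has exponent 0 and carries no continuity.\<close>
      show "continuous_on {0..1} (curve_deriv (?\<gamma> t))"
        unfolding continuous_on_def
      proof
        fix y :: real assume y: "y \<in> {0..1}"
        let ?b = "\<lambda>x. C * norm (curve_deriv \<gamma>0 x - curve_deriv \<gamma>0 y) + C * K powr a * K * \<bar>x - y\<bar> powr a"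
        have "(?b \<longlongrightarrow> ?b y) (at y within {0..1})"
          using K(3) y a by (intro tendsto_intros tendsto_powr2) (auto simp: continuous_on_def)
        moreover have "?b y = 0" using a by simp
        ultimately have b: "(?b \<longlongrightarrow> 0) (at y within {0..1})" by (simp only:)
        have "\<forall>\<^sub>F x in at y within {0..1}. norm (curve_deriv (?\<gamma> t) x - curve_deriv (?\<gamma> t) y) <= ?b x"
          unfolding eventually_at_filter by (intro always_eventually allI impI diff y)
        then have "((\<lambda>x. curve_deriv (?\<gamma> t) x - curve_deriv (?\<gamma> t) y) \<longlongrightarrow> 0) (at y within {0..1})"
          by (rule Lim_null_comparison[OF _ b])
        then show "(curve_deriv (?\<gamma> t) \<longlongrightarrow> curve_deriv (?\<gamma> t) y) (at y within {0..1})" by (rule LIM_zero_cancel)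
      qed
    qed
    then show ?thesis by blast
  qed
  then obtain N where N: "\<And>t. t \<in> {0..T} ==> Holder_norm \<sigma> (?\<gamma> t) <= ennreal N + ennreal N + ennreal N" by blast
  have fin': "ennreal N + ennreal N + ennreal N < \<infinity>" by simp
  show ?thesis unfolding boundary_bounded_in_time_def
  proof (intro exI[of _ ?\<gamma>] conjI ballI)
    show "(SUP \<tau>\<in>{0..T}. Holder_norm \<sigma> (?\<gamma> \<tau>)) < \<infinity>"
      by (rule order.strict_trans1[OF SUP_least[OF N] fin'])
    fix t assume t: "t \<in> {0..T}"
    show "boundary_param \<sigma> (flow 0 t ` D0) (?\<gamma> t)" unfolding boundary_param_def
    proof (intro conjI impI ballI)
      show "simple_path (?\<gamma> t)"
        by (rule simple_path_continuous_image[OF simple(1) continuous_on_subset[OF flow_continuous_space subset_UNIV]])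
          (rule inj_on_inverseI[of _ "flow t 0"], rule flow_inverse)
      show "pathfinish (?\<gamma> t) = pathstart (?\<gamma> t)" using simple(2) by (simp add: pathfinish_compose pathstart_compose)
      show "path_image (?\<gamma> t) = frontier (flow 0 t ` D0)"
        by (simp add: path_image_compose simple(3) frontier_image_inverse[OF flow_continuous_space flow_continuous_space flow_inverse flow_inverse])
      show "Holder_norm \<sigma> (?\<gamma> t) < \<infinity>" by (rule order.strict_trans1[OF N[OF t] fin'])
      fix x :: real assume \<sigma>1: "1 <= \<sigma>" and x: "x \<in> {0..1}"
      have d: "\<gamma>0 differentiable_on {0..1}" using Holder_norm_ge_1(1)[OF \<sigma>1 \<sigma>(3) fin] by blast
      show "curve_deriv (?\<gamma> t) x \<noteq> 0"
      proof
        assume "curve_deriv (?\<gamma> t) x = 0"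
        then have "dflow 0 t (\<gamma>0 x) (curve_deriv \<gamma>0 x) = 0" by (simp only: curve_deriv_flow(2)[OF d x])
        \<comment> \<open>The Jacobian of the flow is invertible, with that of the reverse flow as
          its inverse, so the velocity of the curve cannot vanish.\<close>
        then have "curve_deriv \<gamma>0 x = dflow t 0 (flow 0 t (\<gamma>0 x)) 0" using dflow_inverse[of t 0 "\<gamma>0 x" "curve_deriv \<gamma>0 x"] by simp
        then show False using nz[OF \<sigma>1 x] linear_0[OF dflow_linear] by simp
      qed
    qed
  qed
qed

end

section \<open>The velocity field of the solution\<close>

lemma measurable_vec_lambda2:
  assumes [measurable]: "\<And>i. f i \<in> borel_measurable M"
  shows "(\<lambda>x. (\<chi> i. f i x) :: plane) \<in> borel_measurable M"
proof -
  have "(\<lambda>x. (\<chi> i. f i x) :: plane) = (\<lambda>x. f 1 x *\<^sub>R axis 1 1 + f 2 x *\<^sub>R axis 2 1)"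
    by (auto simp: vec_eq_iff forall_2 axis_def)
  then show ?thesis by simp
qed

lemma lebesgue_borel_version:
  fixes f :: "'a::euclidean_space => real"
  assumes "f \<in> borel_measurable lebesgue"
  obtains g where "borel_fun g" "AE x in lborel. f x = g x"
  using completion_ex_borel_measurable_real[OF assms] by auto

lemma lebesgue_borel_version_plane:
  fixes f :: "'a::euclidean_space => plane"
  assumes f: "f \<in> borel_measurable lebesgue"
  obtains g where "borel_fun g" "AE x in lborel. f x = g x"
proof -
  have "(\<lambda>x. f x $ i) \<in> borel_measurable lebesgue" for i
    by (rule measurable_vec_nth[OF f])
  then have "\<forall>i. \<exists>g. g \<in> borel_measurable borel \<and> (AE x in lborel. f x $ i = g x)"
    by (metis lebesgue_borel_version)
  from choice[OF this] obtain g where g: "\<forall>i. g i \<in> borel_measurable borel \<and> (AE x in lborel. f x $ i = g i x)" by (rule exE)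
  show thesis
  proof (rule that)
    show "borel_fun (\<lambda>x. \<chi> i. g i x)" using g by (intro measurable_vec_lambda2) simp
    have "AE x in lborel. f x $ 1 = g 1 x" "AE x in lborel. f x $ 2 = g 2 x" using g by simp_all
    then show "AE x in lborel. f x = (\<chi> i. g i x)" by eventually_elim (simp add: vec_eq_iff forall_2)
  qed
qed

lemma AE_lebesgue: "(AE x in lebesgue. P x) \<longleftrightarrow> (AE x in lborel. P x)"
  by (rule AE_completion_iff)

text \<open>Fubini and composition with the flow call for Borel functions, while the solution
  concept is formulated with the completed measure. Functions are replaced by Borel versions, and
  this lemma carries the integrals over.\<close>

lemma integral_lebesgue_version:
  fixes f :: "'a::euclidean_space => 'b::euclidean_space"
  assumes fg: "AE x in lborel. f x = g x" and g: "borel_fun g"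
  shows "f \<in> borel_measurable lebesgue" "(LINT x|lebesgue. f x) = (LBINT x. g x)"
    "integrable lebesgue f \<longleftrightarrow> integrable lborel g"
proof -
  have gl: "g \<in> borel_measurable lborel" using g by simp
  have gf: "AE x in lebesgue. g x = f x" using fg by (simp add: AE_lebesgue eq_commute)
  show f: "f \<in> borel_measurable lebesgue" by (rule borel_measurable_AE[OF measurable_completion[OF gl] gf])
  have fg': "AE x in lebesgue. f x = g x" using fg by (simp add: AE_lebesgue)
  show "(LINT x|lebesgue. f x) = (LBINT x. g x)"
    by (subst integral_completion[OF gl, symmetric]) (rule integral_cong_AE[OF f measurable_completion[OF gl] fg'])
  show "integrable lebesgue f \<longleftrightarrow> integrable lborel g"
    by (subst integrable_completion[OF gl, symmetric]) (rule integrable_cong_AE[OF f measurable_completion[OF gl] fg'])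
qed

lemma AE_slices: "AE z in (lborel :: (real \<times> plane) measure). P z ==> AE t in lborel. AE x in lborel. P (t, x)"
  by (rule lborel_pair.AE_pair) (simp only: lborel_prod)

lemma AE_spacetimeI:
  assumes "Measurable.pred borel P" "AE t in lborel. AE x in lborel. P (t, x)"
  shows "AE z in (lborel :: (real \<times> plane) measure). P z"
  unfolding lborel_prod[symmetric]
proof (rule lborel_pair.AE_pair_measure[OF _ assms(2)])
  show "{x \<in> space (lborel \<Otimes>\<^sub>M lborel). P x} \<in> sets (lborel \<Otimes>\<^sub>M lborel)"
    using assms(1) unfolding lborel_prod by (simp add: pred_def)
qed

lemma ennpowr_ennreal: "0 <= x ==> ennpowr (ennreal x) a = ennreal (x powr a)"
  by (simp add: ennpowr_def)

lemma ennpowr_less_top: "ennpowr x a < top \<longleftrightarrow> x < top"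
  by (auto simp: ennpowr_def less_top)

lemma Lp_norm_finite:
  fixes f :: "plane => 'b::euclidean_space"
  assumes q: "1 <= q"
  shows "Lp_norm (ennreal q) f < \<infinity> \<longleftrightarrow> f \<in> borel_measurable lebesgue \<and> (\<integral>\<^sup>+ x. ennreal (norm (f x) powr q) \<partial>lborel) < \<infinity>"
  using q by (auto simp: Lp_norm_def Lp_ennorm_def ennpowr_ennreal ennpowr_less_top nn_integral_completion)

lemma Lp_norm_imp_lq:
  fixes f g :: "plane => plane"
  assumes "1 <= q" "Lp_norm (ennreal q) f < \<infinity>" "AE x in lborel. f x = g x" and g: "borel_fun g"
  shows "lq q (\<lambda>x. g x $ i)"
proof -
  have m[measurable]: "borel_fun (\<lambda>x. g x $ i)"
    by (rule measurable_vec_nth[OF g])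
  have "(\<integral>\<^sup>+ x. ennreal (\<bar>g x $ i\<bar> powr q) \<partial>lborel) <= (\<integral>\<^sup>+ x. ennreal (norm (f x) powr q) \<partial>lborel)"
  proof (rule nn_integral_mono_AE)
    show "AE x in lborel. ennreal (\<bar>g x $ i\<bar> powr q) <= ennreal (norm (f x) powr q)"
      using assms(3)
    proof eventually_elim
      case (elim x)
      then show ?case using component_le_norm_cart[of "g x" i] assms(1) by (intro ennreal_leI powr_mono2) auto
    qed
  qed
  also have "\<dots> < \<infinity>" using assms(2) unfolding Lp_norm_finite[OF assms(1)] by (rule conjunct2)
  finally show ?thesis unfolding lq_def by (intro conjI m integrableI_bounded) auto
qed

lemma Lp_norm_top_AE:
  fixes f :: "plane => 'b::euclidean_space"
  shows "AE x in lborel. ennreal (norm (f x)) <= Lp_norm \<infinity> f"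
proof (cases "f \<in> borel_measurable lebesgue")
  case True
  then have "Lp_norm \<infinity> f = esssup lebesgue (\<lambda>x. ennreal (norm (f x)))" by (simp add: Lp_norm_def Lp_ennorm_def)
  then show ?thesis using esssup_AE[of "\<lambda>x. ennreal (norm (f x))" lebesgue] by (simp add: AE_lebesgue)
qed (simp add: Lp_norm_def)

lemma Besov_norm_imp_block:
  fixes f g :: "plane => plane"
  assumes N: "Besov_norm s f < \<infinity>" and fg: "AE x in lborel. f x = g x" and g: "borel_fun g"
  shows "AE x in lborel. \<bar>block n (\<lambda>y. g y $ i) x\<bar> <= enn2real (Besov_norm s f) * 2 powr (- s * (real n - 1))"
proof -
  have int: "integrable lebesgue (\<lambda>y. lp_kernel n (x - y) *\<^sub>R f y)" for x
    using N by (auto simp: Besov_norm_def split: if_splits)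
  have B: "Besov_norm s f = (SUP n. ennreal (2 powr (s * (real n - 1))) * Lp_norm \<infinity> (lp_block n f))"
    using N by (auto simp: Besov_norm_def split: if_splits)
  let ?c = "2 powr (s * (real n - 1))"
  have le: "ennreal ?c * Lp_norm \<infinity> (lp_block n f) <= Besov_norm s f" unfolding B by (rule SUP_upper) simp
  have bl: "block n (\<lambda>y. g y $ i) x = lp_block n f x $ i" for x
  proof -
    have [measurable]: "borel_fun g" by (rule g)
    have m: "borel_fun (\<lambda>y. lp_kernel n (x - y) *\<^sub>R g y)" by measurable
    have e: "AE y in lborel. lp_kernel n (x - y) *\<^sub>R f y = lp_kernel n (x - y) *\<^sub>R g y" using fg by eventually_elim simp
    have "lp_block n f x = (LBINT y. lp_kernel n (x - y) *\<^sub>R g y)"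
      unfolding lp_block_def by (rule integral_lebesgue_version(2)[OF e m])
    then have "lp_block n f x $ i = (LBINT y. (lp_kernel n (x - y) *\<^sub>R g y) $ i)"
      using integral_bounded_linear[OF bounded_linear_vec_nth, of lborel "\<lambda>y. lp_kernel n (x - y) *\<^sub>R g y" i]
        int[of x] integral_lebesgue_version(3)[OF e m] by simp
    then show ?thesis by (simp add: block_def)
  qed
  show ?thesis using Lp_norm_top_AE[of "lp_block n f"]
  proof eventually_elim
    case (elim x)
    have "ennreal (?c * norm (lp_block n f x)) = ennreal ?c * ennreal (norm (lp_block n f x))" by (simp add: ennreal_mult)
    also have "\<dots> <= Besov_norm s f" by (rule order_trans[OF mult_left_mono[OF elim] le]) simp
    finally have "?c * norm (lp_block n f x) <= enn2real (Besov_norm s f)"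
      using enn2real_mono[OF _ N[unfolded infinity_ennreal_def]] by fastforce
    then have "norm (lp_block n f x) <= enn2real (Besov_norm s f) / ?c" by (simp add: field_simps)
    also have "\<dots> = enn2real (Besov_norm s f) * 2 powr (- s * (real n - 1))" by (simp add: powr_minus divide_inverse)
    finally show ?case unfolding bl using component_le_norm_cart[of "lp_block n f x" i] by linarith
  qed
qed

definition vec_rep :: "(plane => plane) => plane => plane" where
  "vec_rep f x = (\<chi> i. besov_rep (\<lambda>y. f y $ i) x)"

lemma norm_plane_le: "norm (x :: plane) <= \<bar>x $ 1\<bar> + \<bar>x $ 2\<bar>"
  using norm_le_l1_cart[of x] by (simp add: sum_2)

text \<open>The conditions of \<open>c1a_field\<close> at one fixed time, with the value of its
  majorant there as the constant.\<close>

definition c1a_bounded :: "real => real => (plane => plane) => (plane => plane => plane) => bool" where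
  "c1a_bounded a m V L \<longleftrightarrow> (\<forall>x. norm (V x) <= m) \<and> (\<forall>x y. norm (V x - V y) <= m * norm (x - y)) \<and> (\<forall>x. linear (L x))
    \<and> (\<forall>x h. norm (L x h) <= m * norm h) \<and> (\<forall>x h. norm (V (x + h) - V x - L x h) <= m * norm h powr (1 + a))"

lemma vec_rep_regular:
  assumes a: "0 < a" "a <= 1" "1 + a < s"
  obtains K where "K >= 0"
    "\<And>q f M. 1 <= q ==> 0 <= M ==> (\<And>i. lq q (\<lambda>x. f x $ i)) ==>
      (\<And>n i. AE x in lborel. \<bar>block n (\<lambda>y. f y $ i) x\<bar> <= M * 2 powr (- s * (real n - 1))) ==>
      (AE x in lborel. vec_rep f x = f x) \<and> (\<exists>L. c1a_bounded a (K * M) (vec_rep f) L)"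
proof (rule besov_rep_regular[OF a])
  fix C :: real
  assume C: "C >= 0"
    "\<And>q g M. lq q g ==> 1 <= q ==> M >= 0 ==> (\<And>n. AE x in lborel. \<bar>block n g x\<bar> <= M * 2 powr (- s * (real n - 1))) ==>
      (AE x in lborel. besov_rep g x = g x) \<and> (\<forall>x. \<bar>besov_rep g x\<bar> <= C * M) \<and>
      (\<exists>L. \<forall>x. linear (L x) \<and> (\<forall>h. \<bar>L x h\<bar> <= C * M * norm h) \<and>
        (\<forall>h. \<bar>besov_rep g (x + h) - besov_rep g x - L x h\<bar> <= C * M * norm h powr (1 + a)))"
  show thesis
  \<comment> \<open>One factor 2 is for the two components, the other for the Lipschitz bound, which
    comes from the expansion for \<open>norm h <= 1\<close> and from boundedness otherwise.\<close>
  proof (rule that[of "4 * C"])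
    fix q M and f :: "plane => plane"
    assume q: "1 <= q" and M: "0 <= M" and f: "\<And>i. lq q (\<lambda>x. f x $ i)"
      and bl: "\<And>n i. AE x in lborel. \<bar>block n (\<lambda>y. f y $ i) x\<bar> <= M * 2 powr (- s * (real n - 1))"
    note R = C(2)[OF f q M bl]
    define P where "P = (\<lambda>i L. \<forall>x. linear (L x) \<and> (\<forall>h. \<bar>L x h\<bar> <= C * M * norm h) \<and>
        (\<forall>h. \<bar>besov_rep (\<lambda>y. f y $ i) (x + h) - besov_rep (\<lambda>y. f y $ i) x - L x h\<bar> <= C * M * norm h powr (1 + a)))"
    have "\<forall>i. \<exists>L. P i L" using R unfolding P_def by blast
    from choice[OF this] obtain L where L: "\<forall>i. P i (L i)" by (rule exE)
    have Ll: "linear (L i x)" and Lb: "\<bar>L i x h\<bar> <= C * M * norm h"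
      and Le: "\<bar>besov_rep (\<lambda>y. f y $ i) (x + h) - besov_rep (\<lambda>y. f y $ i) x - L i x h\<bar> <= C * M * norm h powr (1 + a)" for i x h
      using L by (simp_all add: P_def)
    have CM: "0 <= C * M" using C(1) M by simp
    let ?V = "vec_rep f" and ?L = "\<lambda>x h. (\<chi> i. L i x h) :: plane"
    have b: "norm (?V x) <= 2 * (C * M)" for x
    proof -
      have "\<bar>?V x $ i\<bar> <= C * M" for i using R[of i] by (simp add: vec_rep_def)
      from add_mono[OF this[of 1] this[of 2]] show ?thesis using norm_plane_le[of "?V x"] by linarith
    qed
    have lb: "norm (?L x h) <= 2 * (C * M) * norm h" for x h
      using norm_plane_le[of "?L x h"] Lb[of 1 x h] Lb[of 2 x h] by simp
    have e: "norm (?V (x + h) - ?V x - ?L x h) <= 2 * (C * M) * norm h powr (1 + a)" for x h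
      using norm_plane_le[of "?V (x + h) - ?V x - ?L x h"] Le[of 1 x h] Le[of 2 x h] by (simp add: vec_rep_def)
    have lip: "norm (?V (x + h) - ?V x) <= 4 * (C * M) * norm h" for x h
    proof (cases "norm h <= 1")
      case True
      have "norm h powr (1 + a) <= norm h powr 1" using powr_mono'[of 1 "1 + a" "norm h"] True a by (cases "h = 0") auto
      then have "2 * (C * M) * norm h powr (1 + a) <= 2 * (C * M) * norm h" using CM by (intro mult_left_mono) auto
      then show ?thesis using norm_triangle_le[OF add_mono[OF e[of x h] lb[of x h]]] by (simp add: algebra_simps)
    next
      case False
      then have "4 * (C * M) * 1 <= 4 * (C * M) * norm h" using CM by (intro mult_left_mono) auto
      then show ?thesis using norm_triangle_ineq4[of "?V (x + h)" "?V x"] b[of "x + h"] b[of x] by simp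
    qed
    have w: "2 * (C * M) * r <= 4 * C * M * r" "2 * (C * M) <= 4 * C * M" if "0 <= r" for r
      using CM mult_nonneg_nonneg[OF CM that] by simp_all
    have "c1a_bounded a (4 * C * M) ?V ?L" unfolding c1a_bounded_def
    proof (intro conjI allI)
      fix x y h
      show "norm (?V x) <= 4 * C * M" using b[of x] w(2)[of 0] by simp
      show "norm (?V x - ?V y) <= 4 * C * M * norm (x - y)" using lip[of y "x - y"] by (simp add: mult.assoc)
      show "linear (?L x)" using Ll by (intro linearI) (simp_all add: vec_eq_iff linear_add linear_cmul)
      show "norm (?L x h) <= 4 * C * M * norm h" using lb[of x h] w(1)[of "norm h"] by simp
      show "norm (?V (x + h) - ?V x - ?L x h) <= 4 * C * M * norm h powr (1 + a)"
        using e[of x h] w(1)[of "norm h powr (1 + a)"] by simp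
    qed
    moreover have "AE x in lborel. ?V x = f x"
    proof -
      have "AE x in lborel. besov_rep (\<lambda>y. f y $ i) x = f x $ i" for i using R[of i] by simp
      from this[of 1] this[of 2] show ?thesis by eventually_elim (simp add: vec_rep_def vec_eq_iff forall_2)
    qed
    ultimately show "(AE x in lborel. ?V x = f x) \<and> (\<exists>L. c1a_bounded a (4 * C * M) ?V L)" by blast
  qed (use C(1) in simp)
qed

lemma vec_rep_measurable:
  fixes w :: "real \<times> plane => plane"
  assumes [measurable]: "borel_fun w"
  shows "borel_fun (\<lambda>z. vec_rep (\<lambda>x. w (fst z, x)) (snd z))"
proof -
  have K[measurable]: "borel_fun (scaled_kernel r)" for r by (rule scaled_kernel_measurable)
  have c: "borel_fun (\<lambda>z. besov_rep (\<lambda>y. w (fst z, y) $ i) (snd z))" for i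
  proof -
    have "(\<lambda>z :: real \<times> plane. LBINT y. scaled_kernel (2 ^ n) (snd z - y) * w (fst z, y) $ i) \<in> borel_measurable (borel \<Otimes>\<^sub>M borel)" for n
      by (rule lborel.borel_measurable_lebesgue_integral) measurable
    then show ?thesis unfolding besov_rep_def partial_sum_def borel_prod
      by (intro borel_measurable_lim_metric)
  qed
  show ?thesis unfolding vec_rep_def by (intro measurable_vec_lambda2 c)
qed

lemma in_Lr_time_top_AE:
  assumes "in_Lr_time \<infinity> T N f"
  obtains B where "B < \<infinity>" "AE \<tau> in lborel. \<tau> \<in> {0<..<T} --> N (f \<tau>) <= B"
proof (rule that)
  let ?e = "esssup (lebesgue_on {0<..<T}) (\<lambda>\<tau>. N (f \<tau>))"
  show "?e < \<infinity>" using assms by (auto simp: in_Lr_time_def Lp_ennorm_def split: if_splits)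
  have "AE \<tau> in lebesgue_on {0<..<T}. N (f \<tau>) <= ?e" by (rule esssup_AE)
  then show "AE \<tau> in lborel. \<tau> \<in> {0<..<T} --> N (f \<tau>) <= ?e"
    by (simp add: AE_restrict_space_iff AE_lebesgue)
qed

lemma AE_positive_time:
  assumes "\<And>T. 0 < T ==> AE \<tau> in lborel. \<tau> \<in> {0<..<T} --> P \<tau>"
  shows "AE \<tau> in lborel. 0 < \<tau> --> P (\<tau> :: real)"
proof -
  have "AE \<tau> in lborel. \<forall>n. \<tau> \<in> {0<..<real (Suc n)} --> P \<tau>"
    unfolding AE_all_countable by (intro allI assms) simp
  then show ?thesis
  proof eventually_elim
    case (elim \<tau>)
    obtain n where "\<tau> < real n" by (rule exE[OF reals_Archimedean2])
    then show ?case using elim[rule_format, of n] by simp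
  qed
qed

lemma ennpowr_1: "ennpowr x 1 = x"
  by (cases x) (auto simp: ennpowr_def)

text \<open>The norm is measurable only in the Lebesgue sense, on each \<open>{0<..<T}\<close>
  separately, and may be infinite on a null set. \<open>M\<close> is a finite Borel version, set to
  0 at nonpositive times so that it lives on the whole axis.\<close>

lemma in_Lr_time_1_loc_int:
  assumes "\<And>T. 0 < T ==> in_Lr_time 1 T N f"
  obtains M where "loc_int M" "\<And>\<tau>. 0 <= M \<tau>" "AE \<tau> in lborel. 0 < \<tau> --> N (f \<tau>) < \<infinity> \<and> enn2real (N (f \<tau>)) = M \<tau>"
proof -
  define F where "F = (\<lambda>\<tau>. N (f \<tau>))"
  have F: "F \<in> borel_measurable (lebesgue_on {0<..<T})" "(\<integral>\<^sup>+ \<tau>. F \<tau> \<partial>lebesgue_on {0<..<T}) < \<infinity>" if "0 < T" for T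
    using assms[OF that] by (auto simp: in_Lr_time_def Lp_ennorm_def ennpowr_1 F_def split: if_splits)
  \<comment> \<open>The supremum glues the restrictions to bounded intervals into one measurable
    function.\<close>
  define G where "G = (\<lambda>\<tau>. SUP n. F \<tau> * indicator {0<..<real (Suc n)} \<tau>)"
  have "G \<in> borel_measurable lebesgue" unfolding G_def
    by (intro borel_measurable_SUP) (use F(1) in \<open>simp_all add: borel_measurable_restrict_space_iff_ennreal\<close>)
  then obtain H where H[measurable]: "borel_fun H" and GH: "AE \<tau> in lborel. G \<tau> = H \<tau>"
    using completion_ex_borel_measurable by (metis measurable_lborel2)
  have GF: "G \<tau> = F \<tau>" if "0 < \<tau>" for \<tau>
  proof (rule antisym)
    show "G \<tau> <= F \<tau>" unfolding G_def by (rule SUP_least) (auto simp: indicator_def)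
    obtain n where "\<tau> < real n" by (rule exE[OF reals_Archimedean2])
    then have "F \<tau> = F \<tau> * indicator {0<..<real (Suc n)} \<tau>" using that by simp
    also have "\<dots> <= G \<tau>" unfolding G_def by (rule SUP_upper) simp
    finally show "F \<tau> <= G \<tau>" .
  qed
  have int: "(\<integral>\<^sup>+ \<tau>. H \<tau> * indicator {0<..<T} \<tau> \<partial>lborel) < \<infinity>" if T: "0 < T" for T
  proof -
    have "(\<integral>\<^sup>+ \<tau>. H \<tau> * indicator {0<..<T} \<tau> \<partial>lborel) = (\<integral>\<^sup>+ \<tau>. F \<tau> * indicator {0<..<T} \<tau> \<partial>lborel)"
    proof (rule nn_integral_cong_AE)
      show "AE \<tau> in lborel. H \<tau> * indicator {0<..<T} \<tau> = F \<tau> * indicator {0<..<T} \<tau>"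
        using GH by eventually_elim (auto simp: indicator_def GF[symmetric])
    qed
    also have "\<dots> = (\<integral>\<^sup>+ \<tau>. F \<tau> \<partial>lebesgue_on {0<..<T})"
      by (subst nn_integral_restrict_space) (simp_all add: nn_integral_completion)
    finally show ?thesis using F(2)[OF T] by simp
  qed
  define M where "M = (\<lambda>\<tau>. enn2real (H \<tau>) * indicator {0<..} \<tau>)"
  have Mm[measurable]: "borel_fun M" unfolding M_def by measurable
  show thesis
  proof (rule that)
    show M0: "0 <= M \<tau>" for \<tau> by (simp add: M_def)
    show "loc_int M" unfolding loc_int_def set_integrable_def
    proof (intro conjI allI Mm integrableI_bounded)
      fix a b :: real
      show "(\<lambda>x. indicator {a..b} x *\<^sub>R M x) \<in> borel_measurable lborel" by measurable
      have "(\<integral>\<^sup>+ x. ennreal (norm (indicator {a..b} x *\<^sub>R M x)) \<partial>lborel) <= (\<integral>\<^sup>+ \<tau>. H \<tau> * indicator {0<..<max 0 b + 1} \<tau> \<partial>lborel)"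
      proof (rule nn_integral_mono)
        fix x
        show "ennreal (norm (indicator {a..b} x *\<^sub>R M x)) <= H x * indicator {0<..<max 0 b + 1} x"
        proof (cases "0 < x \<and> x <= b")
          case True
          have "ennreal (norm (indicator {a..b} x *\<^sub>R M x)) <= ennreal (enn2real (H x))"
            using True by (intro ennreal_leI) (simp add: M_def indicator_def)
          also have "\<dots> <= H x" by (cases "H x") auto
          finally show ?thesis using True by simp
        qed (auto simp: M_def indicator_def)
      qed
      also have "\<dots> < \<infinity>" by (rule int) simp
      finally show "(\<integral>\<^sup>+ x. ennreal (norm (indicator {a..b} x *\<^sub>R M x)) \<partial>lborel) < \<infinity>" .
    qed
    have "AE \<tau> in lborel. 0 < \<tau> --> F \<tau> < \<infinity>"
    proof (rule AE_positive_time)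
      fix T :: real assume T: "0 < T"
      have "AE \<tau> in lborel. H \<tau> * indicator {0<..<T} \<tau> \<noteq> \<infinity>"
        by (rule nn_integral_PInf_AE) (use int[OF T] in auto)
      then show "AE \<tau> in lborel. \<tau> \<in> {0<..<T} --> F \<tau> < \<infinity>"
        using GH by eventually_elim (auto simp: GF less_top)
    qed
    then show "AE \<tau> in lborel. 0 < \<tau> --> N (f \<tau>) < \<infinity> \<and> enn2real (N (f \<tau>)) = M \<tau>"
      using GH by eventually_elim (auto simp: GF M_def F_def)
  qed
qed

lemma spacetime_closed: "closed spacetime"
  by (intro closed_Times) auto

lemma L2_loc_version:
  fixes f :: "real => plane => 'b::euclidean_space"
  assumes "L2_loc f"
  shows "(\<lambda>z. indicator spacetime z *\<^sub>R f (fst z) (snd z)) \<in> borel_measurable lebesgue"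
  using assms spacetime_closed
  by (simp add: L2_loc_def case_prod_beta' borel_measurable_restrict_space_iff lborelD borel_closed)

lemma L2_loc_imp_locally_integrable:
  fixes f :: "real => plane => plane"
  assumes f: "L2_loc f" and [measurable]: "borel_fun w"
    and fw: "AE z in lborel. z \<in> spacetime --> f (fst z) (snd z) = w z"
  shows "integrable lborel (\<lambda>z. indicator (cball 0 S \<inter> spacetime) z * norm (w z))"
proof -
  let ?K = "cball (0 :: real \<times> plane) S \<inter> spacetime"
  have K: "compact ?K" by (intro compact_Int_closed compact_cball spacetime_closed)
  have Km[measurable]: "?K \<in> sets borel" using K by (intro borel_closed compact_imp_closed)
  have "set_integrable lebesgue ?K (\<lambda>(t, x). (norm (f t x))\<^sup>2)" using f K by (simp add: L2_loc_def)
  then have i: "integrable lebesgue (\<lambda>z. indicator ?K z * (norm (f (fst z) (snd z)))\<^sup>2)"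
    by (simp add: set_integrable_def case_prod_beta')
  have ae: "AE z in lborel. indicat_real ?K z * (norm (f (fst z) (snd z)))\<^sup>2 = indicat_real ?K z * (norm (w z))\<^sup>2"
    using fw by eventually_elim (auto simp: indicator_def)
  have i1: "integrable lborel (\<lambda>z. indicat_real ?K z * (norm (w z))\<^sup>2)"
    using integral_lebesgue_version(3)[OF ae] i by simp
  have i2: "integrable lborel (indicat_real ?K)"
    by (rule integrable_real_indicator[OF _ emeasure_compact_finite[OF K]]) simp
  show ?thesis
  proof (rule bochner_bound[OF Bochner_Integration.integrable_add[OF i1 i2]])
    show "AE z in lborel. norm (indicat_real ?K z * norm (w z)) <= norm (indicat_real ?K z * (norm (w z))\<^sup>2 + indicat_real ?K z)"
    proof (rule AE_I2)
      fix z
      have "norm (w z) <= (norm (w z))\<^sup>2 + 1" using sum_squares_ge_zero[of "norm (w z) - 1" 0] by (simp add: power2_eq_square algebra_simps) (smt (verit) norm_ge_zero)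
      then show "norm (indicat_real ?K z * norm (w z)) <= norm (indicat_real ?K z * (norm (w z))\<^sup>2 + indicat_real ?K z)"
        by (auto simp: indicator_def)
    qed
  qed measurable
qed

text \<open>The locale \<open>c1a_field\<close> asks for its bounds at every time, but the norms are
  finite only almost everywhere. At exceptional and at nonpositive times \<open>v\<close> is set to
  0, which satisfies the bounds trivially.\<close>

lemma velocity_field:
  fixes u :: "real => plane => plane"
  assumes a: "0 < a" "a <= 1" "1 + a < s" and q: "1 <= q" and u: "L2_loc u"
    and W: "\<And>T. 0 < T ==> in_Lr_time \<infinity> T (W1_norm (ennreal q)) u"
    and B: "\<And>T. 0 < T ==> in_Lr_time 1 T (Besov_norm s) u"
  obtains w v L m where "borel_fun w" "AE z in lborel. z \<in> spacetime --> u (fst z) (snd z) = w z"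
    "c1a_field v L m a" "AE z in lborel. z \<in> spacetime --> w z = v (fst z) (snd z)"
proof -
  obtain w where w[measurable]: "borel_fun w" and uw0: "AE z in lborel. indicator spacetime z *\<^sub>R u (fst z) (snd z) = w z"
    by (rule lebesgue_borel_version_plane[OF L2_loc_version[OF u]])
  have uw: "AE z in lborel. z \<in> spacetime --> u (fst z) (snd z) = w z"
    using uw0 by eventually_elim (auto simp: indicator_def)
  have slice: "AE t in lborel. AE x in lborel. (t, x) \<in> spacetime --> u t x = w (t, x)"
    using AE_slices[OF uw] by simp
  have wm[measurable]: "borel_fun (\<lambda>x. w (t, x))" for t
    by (rule measurable_compose[OF _ w]) (intro continuous_borel continuous_intros)
  obtain M where M: "loc_int M" "\<And>\<tau>. 0 <= M \<tau>" "AE \<tau> in lborel. 0 < \<tau> --> Besov_norm s (u \<tau>) < \<infinity> \<and> enn2real (Besov_norm s (u \<tau>)) = M \<tau>"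
    by (rule in_Lr_time_1_loc_int[OF B], assumption, rule that)
  have Lq: "AE \<tau> in lborel. 0 < \<tau> --> Lp_norm (ennreal q) (u \<tau>) < \<infinity>"
  proof (rule AE_positive_time)
    fix T :: real assume "0 < T"
    from in_Lr_time_top_AE[OF W[OF this]] obtain K where K: "K < \<infinity>" "AE \<tau> in lborel. \<tau> \<in> {0<..<T} --> W1_norm (ennreal q) (u \<tau>) <= K" .
    from K(2) show "AE \<tau> in lborel. \<tau> \<in> {0<..<T} --> Lp_norm (ennreal q) (u \<tau>) < \<infinity>"
    proof eventually_elim
      case (elim \<tau>)
      have "Lp_norm (ennreal q) (u \<tau>) <= W1_norm (ennreal q) (u \<tau>)" by (simp add: W1_norm_def)
      then show ?case using elim K(1) by (auto intro: order.strict_trans1)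
    qed
  qed
  define P where "P = (\<lambda>t. (\<forall>i. lq q (\<lambda>x. w (t, x) $ i)) \<and> (\<forall>n i. AE x in lborel. \<bar>block n (\<lambda>y. w (t, y) $ i) x\<bar> <= M t * 2 powr (- s * (real n - 1))))"
  have P: "AE t in lborel. 0 < t --> P t"
    using slice M(3) Lq
  proof eventually_elim
    case (elim t)
    show ?case
    proof
      assume t: "0 < t"
      have ae: "AE x in lborel. u t x = w (t, x)" using elim(1) t by simp
      show "P t" unfolding P_def
      proof (intro conjI allI)
        show "lq q (\<lambda>x. w (t, x) $ i)" for i
          by (rule Lp_norm_imp_lq[OF q _ ae wm]) (use elim t in simp)
        show "AE x in lborel. \<bar>block n (\<lambda>y. w (t, y) $ i) x\<bar> <= M t * 2 powr (- s * (real n - 1))" for n i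
          using Besov_norm_imp_block[OF _ ae wm, of s n i] elim t by simp
      qed
    qed
  qed
  \<comment> \<open>A Borel null set that contains all exceptional times, since these need not form
    a measurable set themselves.\<close>
  obtain Z where Z: "{t \<in> space lborel. \<not> (0 < t --> P t)} \<subseteq> Z" "emeasure lborel Z = 0" "Z \<in> sets lborel"
    by (rule AE_E[OF P])
  define E where "E = {0<..} - Z"
  have Em[measurable]: "E \<in> sets borel" using Z(3) by (simp add: E_def)
  have EP: "P t" if "t \<in> E" for t using that Z(1) by (auto simp: E_def)
  have "Z \<in> null_sets lborel" using Z by auto
  from AE_not_in[OF this] have EAE: "AE t in lborel. 0 < t --> t \<in> E" by eventually_elim (simp add: E_def)
  obtain K where K: "K >= 0"
    "\<And>q f M. 1 <= q ==> 0 <= M ==> (\<And>i. lq q (\<lambda>x. f x $ i)) ==>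
      (\<And>n i. AE x in lborel. \<bar>block n (\<lambda>y. f y $ i) x\<bar> <= M * 2 powr (- s * (real n - 1))) ==>
      (AE x in lborel. vec_rep f x = f x) \<and> (\<exists>L. c1a_bounded a (K * M) (vec_rep f) L)"
    by (erule vec_rep_regular[OF a])
  let ?V = "\<lambda>t. vec_rep (\<lambda>x. w (t, x))"
  have R: "(AE x in lborel. ?V t x = w (t, x)) \<and> (\<exists>L. c1a_bounded a (K * M t) (?V t) L)" if "t \<in> E" for t
    using EP[OF that] unfolding P_def by (intro K(2)[OF q M(2)]) simp_all
  have "\<forall>t. \<exists>L. t \<in> E --> c1a_bounded a (K * M t) (?V t) L" using R by blast
  from choice[OF this] obtain L where L: "\<forall>t. t \<in> E --> c1a_bounded a (K * M t) (?V t) (L t)" by (rule exE)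
  define v where "v = (\<lambda>t x. if t \<in> E then ?V t x else 0)"
  define L' where "L' = (\<lambda>t. if t \<in> E then L t else (\<lambda>x h. 0))"
  have KM: "0 <= K * M t" for t using K(1) M(2) by simp
  have cb: "c1a_bounded a (K * M t) (v t) (L' t)" for t
  proof (cases "t \<in> E")
    case False
    then show ?thesis using KM[of t] by (simp add: c1a_bounded_def v_def L'_def module_hom_zero)
  qed (use L in \<open>simp add: v_def[abs_def] L'_def\<close>)
  have vm: "borel_fun (\<lambda>z. v (fst z) (snd z))"
  proof -
    have "borel_fun (\<lambda>z :: real \<times> plane. indicat_real E (fst z))" by (rule borel_fst_real) measurable
    then have "borel_fun (\<lambda>z. indicat_real E (fst z) *\<^sub>R ?V (fst z) (snd z))"
      using vec_rep_measurable[OF w] by measurable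
    moreover have "indicat_real E (fst z) *\<^sub>R ?V (fst z) (snd z) = v (fst z) (snd z)" for z by (simp add: v_def indicator_def)
    ultimately show ?thesis by simp
  qed
  show thesis
  proof (rule that[OF w uw])
    show "c1a_field v L' (\<lambda>t. K * M t) a"
      using cb a vm loc_int_cmult[OF M(1)] KM unfolding c1a_field_def c1a_bounded_def case_prod_beta' by blast
    have "AE z in lborel. fst z > 0 --> w z = v (fst z) (snd z)"
    proof (rule AE_spacetimeI)
      note [measurable] = vm borel_fst_real[of "\<lambda>x. x"]
      show "Measurable.pred borel (\<lambda>z :: real \<times> plane. fst z > 0 --> w z = v (fst z) (snd z))" by measurable
      show "AE t in lborel. AE x in lborel. fst (t, x) > 0 --> w (t, x) = v (fst (t, x)) (snd (t, x))"
        using EAE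
      proof eventually_elim
        case (elim t)
        show ?case
        proof (cases "0 < t")
          case True
          then have t: "t \<in> E" using elim by simp
          have "AE x in lborel. ?V t x = w (t, x)" using R[OF t] by simp
          then show ?thesis by eventually_elim (simp add: v_def t)
        qed simp
      qed
    qed
    with AE_fst_nonzero show "AE z in lborel. z \<in> spacetime --> w z = v (fst z) (snd z)"
      by eventually_elim auto
  qed
qed

section \<open>Weak equations for Borel versions\<close>

lemma test_fun_derivative:
  fixes \<phi> :: "'a::euclidean_space => real"
  assumes "test_fun \<phi>"
  shows "(\<phi> has_derivative frechet_derivative \<phi> (at z)) (at z)" "continuous_on UNIV (\<lambda>z. frechet_derivative \<phi> (at z) h)"
    "continuous_on UNIV \<phi>"
proof -
  have c: "Ckon k UNIV \<phi>" for k using assms by (simp add: test_fun_def smooth_map_iff_Ckon)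
  show "(\<phi> has_derivative frechet_derivative \<phi> (at z)) (at z)" by (rule Ckon_has_derivative[OF c]) simp
  show "continuous_on UNIV (\<lambda>z. frechet_derivative \<phi> (at z) h)" using c[of "Suc 0"] by simp
  show "continuous_on UNIV \<phi>" by (rule Ckon_continuous[OF c])
qed

lemma test_fun_support:
  fixes \<phi> :: "'a::euclidean_space => real"
  assumes \<phi>: "test_fun \<phi>"
  obtains S where "0 <= S" "\<And>z. norm z > S ==> \<phi> z = 0" "\<And>z h. norm z > S ==> frechet_derivative \<phi> (at z) h = 0"
proof -
  have "bounded (closure {z. \<phi> z \<noteq> 0})" using \<phi> by (simp add: test_fun_def compact_imp_bounded)
  then have "bounded {z. \<phi> z \<noteq> 0}" by (rule bounded_subset) (rule closure_subset)
  then obtain S where S: "0 < S" "\<forall>z\<in>{z. \<phi> z \<noteq> 0}. norm z <= S" unfolding bounded_pos by blast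
  have z: "\<phi> z = 0" if "norm z > S" for z using S(2) that by force
  show thesis
  proof (rule that[OF less_imp_le[OF S(1)] z])
    fix z h :: 'a assume n: "norm z > S"
    have "(\<phi> has_derivative (\<lambda>h. 0)) (at z)"
      by (rule has_derivative_transform_within_open[of "\<lambda>x. 0" _ _ UNIV "{y. S < norm y}"])
        (use n z in \<open>auto intro!: open_Collect_less continuous_intros\<close>)
    from has_derivative_unique[OF test_fun_derivative(1)[OF \<phi>] this]
    show "frechet_derivative \<phi> (at z) h = 0" by (rule fun_cong)
  qed
qed

text \<open>At fixed \<open>x\<close> this is the fundamental theorem of calculus up to time
  \<open>S + 1\<close>, which lies beyond the support.\<close>

lemma integral_time_derivative:
  assumes \<phi>: "test_fun \<phi>"
  shows "(LBINT z. indicator spacetime z * frechet_derivative \<phi> (at z) (1, 0)) = - (LBINT x. \<phi> (0, x))"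
    and "integrable lborel (\<lambda>z. indicator spacetime z * frechet_derivative \<phi> (at z) (1, 0) :: real)"
proof -
  let ?d = "\<lambda>z. frechet_derivative \<phi> (at z) (1, 0)"
  obtain S where S: "0 <= S" "\<And>z. norm z > S ==> \<phi> z = 0" "\<And>z h. norm z > S ==> frechet_derivative \<phi> (at z) h = 0"
    by (rule test_fun_support[OF \<phi>]) (rule that)
  have dc: "continuous_on UNIV ?d" by (rule test_fun_derivative(2)[OF \<phi>])
  obtain B where B: "0 <= B" "\<And>z. \<bar>?d z\<bar> <= B" by (rule bounded_continuous_support[OF dc S(3)], assumption, rule that)
  note [measurable] = continuous_borel[OF dc] borel_closed[OF spacetime_closed]
  show i: "integrable lborel (\<lambda>z. indicator spacetime z * ?d z)"
    by (rule integrable_bounded_support[of _ S B]) (use S B in \<open>auto simp: indicator_def\<close>)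
  have "(LBINT t. indicator spacetime (t, x) * ?d (t, x)) = - \<phi> (0, x)" for x
  proof -
    have D: "((\<lambda>t. \<phi> (t, x)) has_real_derivative ?d (t, x)) (at t)" for t
      using has_real_derivative_line[of \<phi> _ "(0, x)" t "(1, 0)", OF test_fun_derivative(1)[OF \<phi>]] by simp
    have "continuous_on UNIV (\<lambda>t. ?d (t, x))"
      using continuous_on_compose2[OF dc continuous_on_Pair[OF continuous_on_id continuous_on_const[of _ x]]] by simp
    then have "isCont (\<lambda>t. ?d (t, x)) t" for t by (simp add: continuous_on_eq_continuous_at)
    then have "(LBINT t. ?d (t, x) * indicator {0..S + 1} t) = \<phi> (S + 1, x) - \<phi> (0, x)"
      using S(1) by (intro integral_FTC_Icc_real D) auto
    moreover have far: "norm (t, x) > S" if "t > S" for t using that S(1) norm_fst_le[of t x] by simp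
    moreover have "(\<lambda>t. indicator spacetime (t, x) * ?d (t, x)) = (\<lambda>t. ?d (t, x) * indicator {0..S + 1} t)"
    proof
      show "indicator spacetime (t, x) * ?d (t, x) = ?d (t, x) * indicator {0..S + 1} t" for t
        using S(3)[OF far, of t] by (cases "t > S") (auto simp: indicator_def)
    qed
    moreover have "\<phi> (S + 1, x) = 0" by (intro S(2) far) simp
    ultimately show ?thesis by (simp only: diff_0)
  qed
  then show "(LBINT z. indicator spacetime z * ?d z) = - (LBINT x. \<phi> (0, x))"
    using lborel_pair.integral_snd[of "\<lambda>t x. indicator spacetime (t, x) * ?d (t, x)"] i
    by (simp add: lborel_prod case_prod_beta')
qed

text \<open>The bound on \<theta> depends on the time horizon and holds almost everywhere in time
  and space. Replacing larger values by 0 changes nothing almost everywhere at nonnegative times,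
  and yields the bound at every point of a bounded set that \<open>transported_scalar\<close> asks
  for.\<close>

lemma bounded_version:
  fixes \<theta> :: "real => plane => real"
  assumes \<theta>: "L2_loc \<theta>" and B: "\<And>T. 0 < T ==> in_Lr_time \<infinity> T (\<lambda>f. Lp_norm 1 f + Lp_norm \<infinity> f) \<theta>"
  obtains \<Theta> where "borel_fun \<Theta>" "AE z in lborel. z \<in> spacetime --> \<theta> (fst z) (snd z) = \<Theta> z"
    "\<And>S. \<exists>M. \<forall>z. norm z <= S --> \<bar>\<Theta> z\<bar> <= M"
proof -
  obtain g where g[measurable]: "borel_fun g" and \<theta>g0: "AE z in lborel. indicator spacetime z *\<^sub>R \<theta> (fst z) (snd z) = g z"
    by (rule lebesgue_borel_version[OF L2_loc_version[OF \<theta>]])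
  have \<theta>g: "AE z in lborel. z \<in> spacetime --> \<theta> (fst z) (snd z) = g z"
    using \<theta>g0 by eventually_elim (auto simp: indicator_def)
  have slice: "AE t in lborel. AE x in lborel. (t, x) \<in> spacetime --> \<theta> t x = g (t, x)"
    using AE_slices[OF \<theta>g] by simp
  have "\<exists>b. AE t in lborel. t \<in> {0<..<real (Suc n)} --> (AE x in lborel. \<bar>\<theta> t x\<bar> <= b)" for n
  proof -
    have "0 < real (Suc n)" by simp
    from in_Lr_time_top_AE[OF B[OF this]] obtain K where K: "K < \<infinity>"
      "AE t in lborel. t \<in> {0<..<real (Suc n)} --> Lp_norm 1 (\<theta> t) + Lp_norm \<infinity> (\<theta> t) <= K" .
    from K(2) have "AE t in lborel. t \<in> {0<..<real (Suc n)} --> (AE x in lborel. \<bar>\<theta> t x\<bar> <= enn2real K)"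
    proof eventually_elim
      case (elim t)
      show ?case
      proof
        assume "t \<in> {0<..<real (Suc n)}"
        moreover have "Lp_norm \<infinity> (\<theta> t) <= Lp_norm 1 (\<theta> t) + Lp_norm \<infinity> (\<theta> t)" by simp
        ultimately have le: "Lp_norm \<infinity> (\<theta> t) <= K" using elim by (meson order_trans)
        show "AE x in lborel. \<bar>\<theta> t x\<bar> <= enn2real K"
          using Lp_norm_top_AE[of "\<theta> t"]
        proof eventually_elim
          case (elim x)
          then have "ennreal \<bar>\<theta> t x\<bar> <= K" using le by simp
          from enn2real_mono[OF this] show ?case using K(1) by simp
        qed
      qed
    qed
    then show ?thesis by (rule exI)
  qed
  then have "\<forall>n. \<exists>b. AE t in lborel. t \<in> {0<..<real (Suc n)} --> (AE x in lborel. \<bar>\<theta> t x\<bar> <= b)" by (rule allI)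
  from choice[OF this] obtain b where b: "\<forall>n. AE t in lborel. t \<in> {0<..<real (Suc n)} --> (AE x in lborel. \<bar>\<theta> t x\<bar> <= b n)"
    by (rule exE)
  \<comment> \<open>Absolute values and partial sums make the bounds nonnegative and monotone, so
    that the bound at a rounded-up time is valid for all earlier times.\<close>
  define c where "c = (\<lambda>n :: nat. \<Sum>k\<le>n. \<bar>b k\<bar>)"
  have c: "b n <= c n" "0 <= c n" for n
  proof -
    have "\<bar>b n\<bar> <= c n" unfolding c_def by (rule member_le_sum) auto
    then show "b n <= c n" "0 <= c n" by auto
  qed
  have c_mono: "c k <= c n" if "k <= n" for k n unfolding c_def using that by (intro sum_mono2) auto
  let ?c = "\<lambda>z :: real \<times> plane. c (nat \<lceil>fst z\<rceil>)"
  have [measurable]: "borel_fun ?c"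
    by (rule borel_fst_real) measurable
  define \<Theta> where "\<Theta> = (\<lambda>z. if \<bar>g z\<bar> <= ?c z then g z else 0)"
  have \<Theta>m: "borel_fun \<Theta>" unfolding \<Theta>_def by measurable
  have "AE z in lborel. fst z > 0 --> \<bar>g z\<bar> <= ?c z"
  proof (rule AE_spacetimeI)
    note [measurable] = borel_fst_real[of "\<lambda>x. x"]
    show "Measurable.pred borel (\<lambda>z. fst z > 0 --> \<bar>g z\<bar> <= ?c z)" by measurable
    have "AE t in lborel. \<forall>n. t \<in> {0<..<real (Suc n)} --> (AE x in lborel. \<bar>\<theta> t x\<bar> <= b n)"
      unfolding AE_all_countable by (rule b)
    then show "AE t in lborel. AE x in lborel. fst (t, x) > 0 --> \<bar>g (t, x)\<bar> <= ?c (t, x)"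
      using slice
    proof eventually_elim
      case (elim t)
      show ?case
      proof (cases "0 < t")
        case True
        define n where "n = nat \<lceil>t\<rceil>"
        have "t <= real n" using True unfolding n_def by linarith
        then have "t \<in> {0<..<real (Suc n)}" using True by simp
        then have "AE x in lborel. \<bar>\<theta> t x\<bar> <= b n" by (rule elim(1)[rule_format])
        then show ?thesis using elim(2)
        proof eventually_elim
          case (elim x)
          then show ?case using True c(1)[of n] by (simp add: n_def)
        qed
      qed simp
    qed
  qed
  then have \<theta>\<Theta>: "AE z in lborel. z \<in> spacetime --> \<theta> (fst z) (snd z) = \<Theta> z"
    using \<theta>g AE_fst_nonzero by eventually_elim (auto simp: \<Theta>_def)
  show thesis
  proof (rule that[OF \<Theta>m \<theta>\<Theta>], intro exI allI impI)
    fix S and z :: "real \<times> plane" assume z: "norm z <= S"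
    have "nat \<lceil>fst z\<rceil> <= nat \<lceil>S\<rceil>" using z norm_fst_le[of "fst z" "snd z"] by (intro nat_mono ceiling_mono) auto
    then have "?c z <= c (nat \<lceil>S\<rceil>)" by (rule c_mono)
    then show "\<bar>\<Theta> z\<bar> <= c (nat \<lceil>S\<rceil>)" using c(2)[of "nat \<lceil>S\<rceil>"] by (auto simp: \<Theta>_def)
  qed
qed

text \<open>Measurability of \<open>D0\<close> is extracted from local integrability on a ball that
  contains it; the Borel version is then truncated so that bound and support hold at every
  point.\<close>

lemma indicator_version:
  assumes l: "locally_integrable (indicat_real D0)" and b: "bounded D0"
  obtains \<theta>0 \<rho> where "borel_fun \<theta>0" "AE x in lborel. indicat_real D0 x = \<theta>0 x"
    "\<And>x. \<bar>\<theta>0 x\<bar> <= 1" "\<And>x. norm x > \<rho> ==> \<theta>0 x = 0"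
proof -
  obtain \<rho> where \<rho>: "\<And>x. x \<in> D0 ==> norm x <= \<rho>" using b by (auto simp: bounded_iff)
  have "set_integrable lebesgue (cball 0 \<rho>) (indicat_real D0)" using l by (simp add: locally_integrable_def)
  then have "(\<lambda>x. indicator (cball 0 \<rho>) x *\<^sub>R indicat_real D0 x) \<in> borel_measurable lebesgue"
    unfolding set_integrable_def by (rule borel_measurable_integrable)
  moreover have "(\<lambda>x. indicator (cball 0 \<rho>) x *\<^sub>R indicat_real D0 x) = indicat_real D0"
    using \<rho> by (auto simp: indicator_def)
  ultimately have "indicat_real D0 \<in> borel_measurable lebesgue" by (simp only:)
  then obtain g where g[measurable]: "borel_fun g" and ae: "AE x in lborel. indicat_real D0 x = g x"
    by (rule lebesgue_borel_version)
  show thesis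
  proof (rule that[of _ \<rho>])
    show "(\<lambda>x. if \<bar>g x\<bar> <= 1 \<and> norm x <= \<rho> then g x else 0) \<in> borel_measurable borel" by measurable
    show "AE x in lborel. indicat_real D0 x = (if \<bar>g x\<bar> <= 1 \<and> norm x <= \<rho> then g x else 0)"
      using ae
    proof eventually_elim
      case (elim x)
      then show ?case using \<rho>[of x] by (cases "x \<in> D0") auto
    qed
  qed auto
qed

text \<open>The identity for the time derivative is added to the weak divergence condition; its
  right-hand side is the negative of the initial term, so the constant 1 solves the transport
  equation.\<close>

lemma weak_divergence_version:
  fixes \<phi> :: "real \<times> plane => real"
  assumes \<phi>: "test_fun \<phi>" and w[measurable]: "borel_fun w"
    and wi: "\<And>S. integrable lborel (\<lambda>z. indicator (cball 0 S \<inter> spacetime) z * norm (w z))"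
    and uw: "AE z in lborel. z \<in> spacetime --> u (fst z) (snd z) = w z"
    and div: "(LINT z:spacetime|lebesgue. (\<lambda>(t, x). \<Sum>i\<in>UNIV. u t x $ i * dx i \<phi> (t, x)) z) = 0"
  shows "weak_transport_eq (\<lambda>_. 1) w (\<lambda>_. 1) \<phi>"
proof -
  let ?d = "\<lambda>i z. frechet_derivative \<phi> (at z) (0, axis i 1)"
  obtain S where S: "0 <= S" "\<And>z. norm z > S ==> \<phi> z = 0" "\<And>z h. norm z > S ==> frechet_derivative \<phi> (at z) h = 0"
    by (rule test_fun_support[OF \<phi>]) (rule that)
  have dc: "continuous_on UNIV (?d i)" for i by (rule test_fun_derivative(2)[OF \<phi>])
  have "\<exists>B. \<forall>z. \<bar>?d i z\<bar> <= B" for i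
    by (rule bounded_continuous_support[OF dc[of i] S(3)], assumption) blast
  then obtain B where B: "\<And>i z. \<bar>?d i z\<bar> <= B i" by metis
  note [measurable] = continuous_borel[OF dc] borel_closed[OF spacetime_closed]
  define J where "J = (\<lambda>z. indicat_real spacetime z * (\<Sum>i\<in>UNIV. w z $ i * ?d i z))"
  have Jm: "borel_fun J" unfolding J_def by measurable
  have Ji: "integrable lborel J"
  proof (rule bochner_bound[OF integrable_mult_right[OF wi[of S], of "B 1 + B 2"]])
    show "AE z in lborel. norm (J z) <= norm ((B 1 + B 2) * (indicat_real (cball 0 S \<inter> spacetime) z * norm (w z)))"
    proof (rule AE_I2)
      fix z
      have B0: "0 <= B i" for i using B[of z i] by linarith
      show "norm (J z) <= norm ((B 1 + B 2) * (indicat_real (cball 0 S \<inter> spacetime) z * norm (w z)))"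
      proof (cases "norm z <= S \<and> z \<in> spacetime")
        case True
        have "\<bar>w z $ i * ?d i z\<bar> <= norm (w z) * B i" for i
          unfolding abs_mult by (intro mult_mono component_le_norm_cart B) auto
        from abs_triangle_ineq[of "w z $ 1 * ?d 1 z" "w z $ 2 * ?d 2 z"] this[of 1] this[of 2]
        have "\<bar>w z $ 1 * ?d 1 z + w z $ 2 * ?d 2 z\<bar> <= (B 1 + B 2) * norm (w z)" by (simp add: algebra_simps)
        then show ?thesis using True B0[of 1] B0[of 2] by (simp add: J_def sum_2 abs_mult)
      next
        case False
        then have "J z = 0" using S(3)[of z] by (cases "z \<in> spacetime") (auto simp: J_def)
        then show ?thesis by simp
      qed
    qed
  qed (use Jm in simp)
  have "AE z in lborel. indicat_real spacetime z *\<^sub>R (\<lambda>(t, x). \<Sum>i\<in>UNIV. u t x $ i * dx i \<phi> (t, x)) z = J z"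
    using uw by eventually_elim (auto simp: J_def indicator_def dx_def)
  from integral_lebesgue_version(2)[OF this Jm] have J0: "(LBINT z. J z) = 0"
    using div by (simp add: set_lebesgue_integral_def)
  have "(LBINT z. indicator spacetime z * (1 * (frechet_derivative \<phi> (at z) (1, 0) + (\<Sum>i\<in>UNIV. w z $ i * ?d i z))))
      = (LBINT z. indicator spacetime z * frechet_derivative \<phi> (at z) (1, 0) + J z)"
    by (intro Bochner_Integration.integral_cong) (simp_all add: J_def algebra_simps)
  also have "\<dots> = - (LBINT x. \<phi> (0, x))"
    using integral_time_derivative[OF \<phi>] Ji J0 by (simp add: Bochner_Integration.integral_add)
  finally show ?thesis by simp
qed

lemma weak_transport_version:
  fixes \<phi> :: "real \<times> plane => real"
  assumes \<phi>: "test_fun \<phi>" and w[measurable]: "borel_fun w" and \<Theta>[measurable]: "borel_fun \<Theta>"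
    and \<theta>0[measurable]: "borel_fun \<theta>0"
    and uw: "AE z in lborel. z \<in> spacetime --> u (fst z) (snd z) = w z"
    and \<theta>\<Theta>: "AE z in lborel. z \<in> spacetime --> \<theta> (fst z) (snd z) = \<Theta> z"
    and i0: "AE x in lborel. i0 x = \<theta>0 x"
    and weak: "(LINT z:spacetime|lebesgue. transport_integrand u \<theta> \<phi> z) + (LINT x|lebesgue. i0 x * \<phi> (0, x)) = 0"
  shows "weak_transport_eq \<Theta> w \<theta>0 \<phi>"
proof -
  have dc: "continuous_on UNIV (\<lambda>z. frechet_derivative \<phi> (at z) h)" for h by (rule test_fun_derivative(2)[OF \<phi>])
  have "continuous_on UNIV (\<lambda>x. \<phi> (0, x))"
    using continuous_on_compose2[OF test_fun_derivative(3)[OF \<phi>] continuous_on_Pair[OF continuous_on_const[of _ 0] continuous_on_id]] by simp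
  note [measurable] = continuous_borel[OF this]
  note [measurable] = continuous_borel[OF dc] borel_closed[OF spacetime_closed]
  let ?g = "\<lambda>z. indicat_real spacetime z * (\<Theta> z * (frechet_derivative \<phi> (at z) (1, 0)
        + (\<Sum>i\<in>UNIV. w z $ i * frechet_derivative \<phi> (at z) (0, axis i 1))))"
  have "AE z in lborel. indicat_real spacetime z *\<^sub>R transport_integrand u \<theta> \<phi> z = ?g z"
    using uw \<theta>\<Theta> by eventually_elim (auto simp: transport_integrand_def indicator_def dx_def dt_def algebra_simps)
  then have 1: "(LINT z:spacetime|lebesgue. transport_integrand u \<theta> \<phi> z) = (LBINT z. ?g z)"
    unfolding set_lebesgue_integral_def by (rule integral_lebesgue_version(2)) measurable
  have "AE x in lborel. i0 x * \<phi> (0, x) = \<theta>0 x * \<phi> (0, x)" using i0 by eventually_elim simp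
  then have 2: "(LINT x|lebesgue. i0 x * \<phi> (0, x)) = (LBINT x. \<theta>0 x * \<phi> (0, x))"
    by (rule integral_lebesgue_version(2)) measurable
  show ?thesis using weak unfolding 1 2 .
qed

lemma L2_imp_locally_integrable:
  fixes g :: "plane => real"
  assumes g: "Lp_norm 2 g < \<infinity>"
  obtains h where "borel_fun h" "AE x in lborel. g x = h x" "\<And>S. integrable lborel (\<lambda>x. indicator (cball 0 S) x * h x)"
proof -
  have "Lp_norm (ennreal 2) g < \<infinity>" using g by simp
  then have gm: "g \<in> borel_measurable lebesgue" and gi: "(\<integral>\<^sup>+ x. ennreal (norm (g x) powr 2) \<partial>lborel) < \<infinity>"
    by (simp_all only: Lp_norm_finite[of 2] one_le_numeral)
  obtain h where h[measurable]: "borel_fun h" and gh: "AE x in lborel. g x = h x"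
    by (rule lebesgue_borel_version[OF gm])
  have "(\<integral>\<^sup>+ x. ennreal (\<bar>h x\<bar> powr 2) \<partial>lborel) = (\<integral>\<^sup>+ x. ennreal (norm (g x) powr 2) \<partial>lborel)"
    by (rule nn_integral_cong_AE) (use gh in eventually_elim, simp)
  then have i2: "integrable lborel (\<lambda>x. \<bar>h x\<bar> powr 2)"
    by (intro integrableI_bounded) (use gi in auto)
  show thesis
  proof (rule that[OF h gh])
    fix S
    note [measurable] = borel_closed[OF closed_cball[of "0 :: plane" S]]
    have i1: "integrable lborel (indicat_real (cball (0 :: plane) S))" by (rule integrable_indicator_cball)
    show "integrable lborel (\<lambda>x. indicator (cball 0 S) x * h x)"
    proof (rule bochner_bound[OF Bochner_Integration.integrable_add[OF i1 i2]])
      show "AE x in lborel. norm (indicator (cball 0 S) x * h x) <= norm (indicat_real (cball 0 S) x + \<bar>h x\<bar> powr 2)"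
      proof (rule AE_I2)
        fix x
        show "norm (indicator (cball 0 S) x * h x) <= norm (indicat_real (cball 0 S) x + \<bar>h x\<bar> powr 2)"
          using abs_le_1_plus_powr[of 2 "h x"] by (simp add: indicator_def)
      qed
    qed measurable
  qed
qed

section \<open>The transported set\<close>

context transported_scalar
begin

text \<open>The representative is an exact indicator function at every time; its integrability and
  weak continuity are read off from \<theta>0 along the flow, with which it agrees almost
  everywhere.\<close>

lemma transported_set:
  assumes i0: "AE x in lborel. indicat_real D0 x = \<theta>0 x" and s: "\<And>x. norm x > \<rho> ==> \<theta>0 x = 0"
    and \<theta>': "AE z in lborel. z \<in> spacetime --> \<theta>' (fst z) (snd z) = \<theta> z"
  shows "weakly_continuous_rep \<theta>' (\<lambda>t. indicat_real (flow 0 t ` D0))"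
proof -
  have ind: "indicat_real (flow 0 t ` D0) x = indicat_real D0 (flow t 0 x)" for t x
    by (auto simp: indicator_def flow_inverse intro!: image_eqI[of _ _ "flow t 0 x"])
  have ae: "AE x in lborel. indicat_real (flow 0 t ` D0) x = \<theta>0 (flow t 0 x)" if "0 <= t" for t
    unfolding ind by (rule AE_flow(1)[OF that i0])
  have m[measurable]: "borel_fun (\<lambda>x. \<theta>0 (flow t 0 x))" for t by measurable
  show ?thesis unfolding weakly_continuous_rep_def
  proof (intro conjI allI impI)
    have "AE t in lborel. t \<in> {0..} --> (AE x in lborel. indicat_real (flow 0 t ` D0) x = \<theta>' t x)"
      using transported_along_flow AE_slices[OF \<theta>'] AE_lborel_singleton[of 0]
    proof eventually_elim
      case (elim t)
      show ?case
      proof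
        assume "t \<in> {0..}"
        then have t: "0 < t" using elim(3) by simp
        have "AE x in lborel. \<theta> (t, x) = \<theta>0 (flow t 0 x)" using elim(1) t by simp
        then show "AE x in lborel. indicat_real (flow 0 t ` D0) x = \<theta>' t x"
          using elim(2) ae[OF less_imp_le[OF t]] by eventually_elim (use t in simp)
      qed
    qed
    then show "AE t in lebesgue_on {0..}. AE x in lebesgue. indicat_real (flow 0 t ` D0) x = \<theta>' t x"
      by (simp add: AE_restrict_space_iff AE_lebesgue)
  next
    fix t :: real assume t: "0 <= t"
    obtain C where C: "C >= 0" "\<And>s r x. s \<in> {-t..t} ==> r \<in> {-t..t} ==> norm x <= norm (flow s r x) + C"
      by (rule flow_support[OF t]) (rule that)
    have z: "\<theta>0 (flow t 0 x) = 0" if "norm x > \<rho> + C" for x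
      using C(2)[of t 0 x] that t by (intro s) auto
    let ?f = "indicat_real (flow 0 t ` D0)"
    have "(\<integral>\<^sup>+ x. ennreal (norm (?f x) powr 2) \<partial>lborel) <= (\<integral>\<^sup>+ x. indicator (cball (0 :: plane) (\<rho> + C)) x \<partial>lborel)"
    proof (rule nn_integral_mono_AE)
      show "AE x in lborel. ennreal (norm (?f x) powr 2) <= indicator (cball 0 (\<rho> + C)) x"
        using ae[OF t]
      proof eventually_elim
        case (elim x)
        show ?case
        proof (cases "norm x > \<rho> + C")
          case True
          then show ?thesis using elim z[of x] by simp
        qed (simp add: indicator_def)
      qed
    qed
    also have "\<dots> < \<infinity>" by (simp add: emeasure_lborel_cball_finite[unfolded infinity_ennreal_def])
    finally have "(\<integral>\<^sup>+ x. ennreal (norm (?f x) powr 2) \<partial>lborel) < \<infinity>" .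
    then have "Lp_norm (ennreal 2) ?f < \<infinity>"
      using integral_lebesgue_version(1)[OF ae[OF t] m] by (simp only: Lp_norm_finite[of 2] one_le_numeral)
    then show "Lp_norm 2 ?f < \<infinity>" by simp
  next
    fix g :: "plane => real" assume "Lp_norm 2 g < \<infinity>"
    then obtain h where h[measurable]: "borel_fun h" and gh: "AE x in lborel. g x = h x"
      and hi: "\<And>S. integrable lborel (\<lambda>x. indicator (cball 0 S) x * h x)"
      by (rule L2_imp_locally_integrable) (rule that)
    have "(LINT x|lebesgue. indicat_real (flow 0 t ` D0) x * g x) = (LBINT x. \<theta>0 (flow t 0 x) * h x)" if "t \<in> {0..}" for t
    proof (rule integral_lebesgue_version(2))
      have "0 <= t" using that by simp
      from ae[OF this] gh show "AE x in lborel. indicat_real (flow 0 t ` D0) x * g x = \<theta>0 (flow t 0 x) * h x"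
        by eventually_elim simp
    qed measurable
    then show "continuous_on {0..} (\<lambda>t. LINT x|lebesgue. indicat_real (flow 0 t ` D0) x * g x)"
      using transported_weakly_continuous[OF s h hi] by (subst continuous_on_cong[OF refl]) auto
  qed
qed

end

theorem theorem1p3:
  fixes \<alpha> \<alpha>' q :: real and p :: ennreal
    and u0 :: "real^2 \<Rightarrow> real^2" and D0 :: "(real^2) set"
    and u :: "real \<Rightarrow> real^2 \<Rightarrow> real^2" and \<theta> :: "real \<Rightarrow> real^2 \<Rightarrow> real"
  assumes "1 / 2 < \<alpha>" "\<alpha> < 1"
    and "2 < p"
    and "W1_norm 2 u0 < \<infinity>" "W1_seminorm p u0 < \<infinity>" "div_free u0"
    and "bounded D0" "simply_connected D0"
    and "0 \<le> \<alpha>'" "\<alpha>' < \<alpha>"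
    and "\<exists>\<gamma>0. boundary_param (2 * \<alpha>') D0 \<gamma>0"
    and "2 < q" "p < \<infinity> \<longrightarrow> ennreal q = p"
    and "global_solution \<alpha> q u0 (indicat_real D0) u \<theta>"
  shows "\<exists>\<theta>' D. weakly_continuous_rep \<theta> \<theta>' \<and>
           (\<forall>t\<ge>0. AE x in lebesgue. \<theta>' t x = indicat_real (D t) x) \<and>
           (\<forall>t\<ge>0. boundary_bounded_in_time (2 * \<alpha>') t D)"
proof -
  \<comment> \<open>\<open>2 * \<alpha>' - 1\<close> is what the boundary requires;
    \<open>\<alpha> - 1 / 2\<close> keeps \<open>a\<close> positive when
    \<open>\<alpha>' <= 1 / 2\<close>. Both are less than \<open>2 * \<alpha> - 1\<close>, so
    \<open>s\<close> can be the midpoint of \<open>1 + a\<close> and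
    \<open>2 * \<alpha>\<close>.\<close>
  define a where "a = max (2 * \<alpha>' - 1) (\<alpha> - 1 / 2)"
  define s where "s = (1 + a + 2 * \<alpha>) / 2"
  have exps: "0 < a" "a <= 1" "1 + a < s" "2 * \<alpha>' <= 1 + a" "s < 2 * \<alpha>"
    using assms(1,2,10) by (auto simp: a_def s_def)
  have sol: "weak_solution \<alpha> u0 (indicat_real D0) u \<theta>"
    and gs: "\<And>T \<rho> \<beta>. 0 < T ==> \<rho> \<in> {1..<min 2 (q / 2)} ==> \<beta> \<in> {0..<\<alpha>} ==>
        in_Lr_time \<infinity> T (W1_norm (ennreal q)) u \<and> in_Lr_time (ennreal \<rho>) T (Besov_norm (2 * \<beta>)) u \<and>
        in_Lr_time \<infinity> T (\<lambda>f. Lp_norm 1 f + Lp_norm \<infinity> f) \<theta>"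
    using assms(14) unfolding global_solution_def by blast+
  \<comment> \<open>The exponent \<rho> = 1 is admissible because \<open>q > 2\<close>, and plain
    integrability in time is what the flow uses.\<close>
  have 1: "(1 :: real) \<in> {1..<min 2 (q / 2)}" using assms(12) by simp
  have s2: "s / 2 \<in> {0..<\<alpha>}" using exps by simp
  have spaces: "in_Lr_time \<infinity> T (W1_norm (ennreal q)) u" "in_Lr_time 1 T (Besov_norm s) u"
    "in_Lr_time \<infinity> T (\<lambda>f. Lp_norm 1 f + Lp_norm \<infinity> f) \<theta>" if "0 < T" for T
    using gs[OF that 1 s2] by simp_all
  have L2: "locally_integrable (indicat_real D0)" "L2_loc u" "L2_loc \<theta>"
    and div: "\<And>\<psi>. test_fun \<psi> ==> (LINT z:spacetime|lebesgue. (\<lambda>(t, x). \<Sum>i\<in>UNIV. u t x $ i * dx i \<psi> (t, x)) z) = 0"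
    and weak: "\<And>\<psi>. test_fun \<psi> ==> (LINT z:spacetime|lebesgue. transport_integrand u \<theta> \<psi> z) + (LINT x|lebesgue. indicat_real D0 x * \<psi> (0, x)) = 0"
    using sol unfolding weak_solution_def by blast+
  have q: "1 <= q" using assms(12) by simp
  obtain w v L m where w: "borel_fun w" and uw: "AE z in lborel. z \<in> spacetime --> u (fst z) (snd z) = w z"
    and field: "c1a_field v L m a" and wv: "AE z in lborel. z \<in> spacetime --> w z = v (fst z) (snd z)"
    by (rule velocity_field[OF exps(1-3) q L2(2) spaces(1,2)], assumption, assumption, rule that)
  obtain \<Theta> where \<Theta>: "borel_fun \<Theta>" "AE z in lborel. z \<in> spacetime --> \<theta> (fst z) (snd z) = \<Theta> z"
    "\<And>S. \<exists>M. \<forall>z. norm z <= S --> \<bar>\<Theta> z\<bar> <= M"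
    by (rule bounded_version[OF L2(3) spaces(3)], assumption, rule that)
  obtain \<theta>0 \<rho> where \<theta>0: "borel_fun \<theta>0" "AE x in lborel. indicat_real D0 x = \<theta>0 x"
    "\<And>x. \<bar>\<theta>0 x\<bar> <= 1" "\<And>x. norm x > \<rho> ==> \<theta>0 x = 0"
    by (rule indicator_version[OF L2(1) assms(7)]) (rule that)
  have wi: "integrable lborel (\<lambda>z. indicator (cball 0 S \<inter> spacetime) z * norm (w z))" for S
    by (rule L2_loc_imp_locally_integrable[OF L2(2) w uw])
  interpret c1a_field v L m a by (rule field)
  interpret transported_scalar v L m a w \<Theta> \<theta>0 1
  proof
    show "weak_transport_eq (\<lambda>_. 1) w (\<lambda>_. 1) \<phi>"
      if "test_fun \<phi>" for \<phi>
      by (rule weak_divergence_version[OF that w wi uw div[OF that]])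
    show "weak_transport_eq \<Theta> w \<theta>0 \<phi>"
      if "test_fun \<phi>" for \<phi>
      by (rule weak_transport_version[OF that w \<Theta>(1) \<theta>0(1) uw \<Theta>(2) \<theta>0(2) weak[OF that]])
  qed (fact w wi wv \<Theta> \<theta>0)+
  obtain \<gamma>0 where \<gamma>0: "boundary_param (2 * \<alpha>') D0 \<gamma>0" using assms(11) by blast
  show ?thesis
  proof (intro exI conjI allI impI)
    show "weakly_continuous_rep \<theta> (\<lambda>t. indicat_real (flow 0 t ` D0))"
      by (rule transported_set[OF \<theta>0(2,4) \<Theta>(2)])
    show "AE x in lebesgue. indicat_real (flow 0 t ` D0) x = indicat_real (flow 0 t ` D0) x" for t by simp
    show "boundary_bounded_in_time (2 * \<alpha>') t (\<lambda>t. flow 0 t ` D0)" if "0 <= t" for t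
      using boundary_transport[OF \<gamma>0 _ exps(4) _ that] assms by simp
  qed
qed

end
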